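(* Let $\Bbbk$ be a field (of arbitrary characteristic), $(A,\Delta)$ a cocommutative $\Bbbk$-algebra, and $V$ an $A$-module. Let $\lambda:A\otimes V\to A$ and $\kappa=\kappa_V\oplus\kappa_A:V\wedge V\to V\oplus A$ be $\Bbbk$-linear. Consider the following two statements. (1) $\mathscr{H}_{\lambda,\kappa}$ has the PBW property. (2) There exists a graded $\Bbbk[t]$-deformation $B_t$ of $B:=\mathscr{H}_{0,0}=\mathrm{Sym}(V)\rtimes A$ whose multiplication maps $\mu_1,\mu_2$ satisfy, for all $v,v'\in V$ and $a\in A$: $$\lambda(a,v)=\mu_1(a\otimes v)-\sum\mu_1(a_{(1)}(v)\otimes a_{(2)}),$$ $$\kappa_V(v,v')=\mu_1(v\otimes v')-\mu_1(v'\otimes v),$$ $$\kappa_A(v,v')=\mu_2(v\otimes v')-\mu_2(v'\otimes v).$$ Then $(1)\Rightarrow(2)$, and the converse $(2)\Rightarrow(1)$ holds if $\dim_\Bbbk A$ and $\dim_\Bbbk V$ are both finite. Moreover, if these statements hold, then $\mathscr{H}_{\lambda,\kappa}\cong B_t|_{t=1}$.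
   Context: A cocommutative $\Bbbk$-algebra $(A,\Delta)$ is a unital associative $\Bbbk$-algebra $A$ with a $\Bbbk$-algebra map $\Delta:A\to A\otimes A$ satisfying $\Delta(1)=1\otimes1$, coassociativity, and $\Delta=\Delta^{op}$ (no counit or antipode is assumed). Sweedler notation: $\Delta(a)=\sum a_{(1)}\otimes a_{(2)}$. The action of $a$ on $v\in V$ is written $a(v)$. $V\wedge V\subset V\otimes V$ is the span of the $v\wedge v'=v\otimes v'-v'\otimes v$; $\kappa(v,v')=\kappa(v\wedge v')$. $\mathscr{H}_{\lambda,\kappa}$ is the quotient of the tensor algebra $T(V\oplus A)$ by the multiplication in $A$ (with $1_A$ the unit) and by the relations $av-\sum a_{(1)}(v)a_{(2)}=\lambda(a,v)$ and $vv'-v'v=\kappa(v,v')$ for $a\in A$, $v,v'\in V$. It is filtered by $\deg A=0$, $\deg V=1$. $\mathscr{H}_{0,0}=\mathrm{Sym}(V)\rtimes A$ is the smash product: the space $\mathrm{Sym}(V)\otimes A$ with $(f'\otimes a')(f\otimes a)=\sum f'a'_{(1)}(f)\otimes a'_{(2)}a$ for $f\in\mathrm{Sym}^{\ge1}(V)$ (where $A$ acts on $\mathrm{Sym}^n(V)$, $n\geq 1$, via iterated coproducts) and $(f'\otimes a')(1\otimes a)=f'\otimes a'a$; it is $\mathbb{Z}^{\ge0}$-graded with $\deg A=0$, $\deg V=1$. $\mathscr{H}_{\lambda,\kappa}$ has the PBW property if the natural surjection from $\mathscr{H}_{0,0}$ onto its associated graded algebra is an isomorphism. A deformation of an associative $\Bbbk$-algebra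 $B$ over $\Bbbk[t]$ is an associative $\Bbbk[t]$-algebra $(B_t,* )$ identified with $B[t]$ as a vector space, such that $B_t/tB_t\cong B$ as $\Bbbk$-algebras; so for $b_1,b_2\in B$, $$b_1*b_2=b_1b_2+\sum_{j>0}\mu_j(b_1\otimes b_2)t^j$$ (a finite sum), with $\mu_j:B\otimes B\to B$ $\Bbbk$-linear, called the $j$th multiplication map. If $B$ is $\mathbb{Z}^{\ge0}$-graded, a graded $\Bbbk[t]$-deformation is one that is graded with $\deg t=1$, i.e. each $\mu_j$ is homogeneous of degree $-j$. $B_t|_{t=1}$ denotes $B_t/(t-1)B_t$. *)

theory Defs
  imports
    "HOL-Algebra.Algebra"
    "HOL-Algebra.Algebraic_Closure_Type"
    "HOL-Library.Poly_Mapping"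
begin

section \<open>Linear algebra over a field\<close>

text \<open>
  Vector spaces and algebras over a field \<open>'k\<close> are records of type \<open>('k, 'm) module\<close> with an explicit
  carrier. For a bare vector space the fields \<open>mult\<close> and \<open>one\<close> carry no information.
\<close>

definition assoc_algebra :: "'r ring \<Rightarrow> ('r, 'm) module \<Rightarrow> bool" where
  "assoc_algebra R M \<longleftrightarrow> module R M \<and> ring M \<and>
     (\<forall>c \<in> carrier R. \<forall>x \<in> carrier M. \<forall>y \<in> carrier M.
        (c \<odot>\<^bsub>M\<^esub> x) \<otimes>\<^bsub>M\<^esub> y = c \<odot>\<^bsub>M\<^esub> (x \<otimes>\<^bsub>M\<^esub> y) \<and>
        x \<otimes>\<^bsub>M\<^esub> (c \<odot>\<^bsub>M\<^esub> y) = c \<odot>\<^bsub>M\<^esub> (x \<otimes>\<^bsub>M\<^esub> y))"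

abbreviation kvs :: "('k::field, 'm) module \<Rightarrow> bool" where
  "kvs M \<equiv> module ring_of_type_algebra M"

abbreviation kalg :: "('k::field, 'm) module \<Rightarrow> bool" where
  "kalg M \<equiv> assoc_algebra ring_of_type_algebra M"

definition klinear :: "('k::field, 'm) module \<Rightarrow> ('k, 'n) module \<Rightarrow> ('m \<Rightarrow> 'n) \<Rightarrow> bool" where
  "klinear M N f \<longleftrightarrow> f \<in> carrier M \<rightarrow> carrier N \<and>
     (\<forall>x \<in> carrier M. \<forall>y \<in> carrier M. f (x \<oplus>\<^bsub>M\<^esub> y) = f x \<oplus>\<^bsub>N\<^esub> f y) \<and>
     (\<forall>c. \<forall>x \<in> carrier M. f (c \<odot>\<^bsub>M\<^esub> x) = c \<odot>\<^bsub>N\<^esub> f x)"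

definition alg_hom :: "('k::field, 'm) module \<Rightarrow> ('k, 'n) module \<Rightarrow> ('m \<Rightarrow> 'n) set" where
  "alg_hom M N = {f \<in> ring_hom M N. klinear M N f}"

definition alg_iso :: "('k::field, 'm) module \<Rightarrow> ('k, 'n) module \<Rightarrow> ('m \<Rightarrow> 'n) set" where
  "alg_iso M N = {f \<in> alg_hom M N. bij_betw f (carrier M) (carrier N)}"

definition kspan :: "('k::field, 'm) module \<Rightarrow> 'm set \<Rightarrow> 'm set" where
  "kspan M S = \<Inter>{U. submodule U ring_of_type_algebra M \<and> S \<subseteq> U}"

definition fin_dim :: "('k::field, 'm) module \<Rightarrow> bool" where
  "fin_dim M \<longleftrightarrow> (\<exists>S. finite S \<and> S \<subseteq> carrier M \<and> kspan M S = carrier M)"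

text \<open>\<^term>\<open>M Quot I\<close> together with the induced scalar multiplication.\<close>

definition quot :: "('r, 'm) module \<Rightarrow> 'm set \<Rightarrow> ('r, 'm set) module" where
  "quot M I = ring.extend (M Quot I) \<lparr>module.smult = (\<lambda>c P. \<Union>x\<in>P. I +>\<^bsub>M\<^esub> (c \<odot>\<^bsub>M\<^esub> x))\<rparr>"

definition dirsum :: "('k, 'm) module \<Rightarrow> ('k, 'n) module \<Rightarrow> ('k, 'm \<times> 'n) module" where
  "dirsum M N = ring.extend (RDirProd M N) \<lparr>module.smult = (\<lambda>c (x, y). (c \<odot>\<^bsub>M\<^esub> x, c \<odot>\<^bsub>N\<^esub> y))\<rparr>"

text \<open>The monoid algebra \<open>k[G]\<close>; as a vector space it is free on the set \<^term>\<open>carrier G\<close>.\<close>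

definition monoid_algebra :: "'x monoid \<Rightarrow> ('k::field, 'x \<Rightarrow>\<^sub>0 'k) module" where
  "monoid_algebra G =
     \<lparr>carrier = {p. Poly_Mapping.keys p \<subseteq> carrier G},
      monoid.mult = (\<lambda>p q. \<Sum>x \<in> Poly_Mapping.keys p. \<Sum>y \<in> Poly_Mapping.keys q.
        Poly_Mapping.single (x \<otimes>\<^bsub>G\<^esub> y) (Poly_Mapping.lookup p x * Poly_Mapping.lookup q y)),
      one = Poly_Mapping.single \<one>\<^bsub>G\<^esub> 1,
      ring.zero = 0,
      ring.add = (+),
      module.smult = (\<lambda>c. Poly_Mapping.map ((*) c))\<rparr>"

abbreviation pt :: "'x \<Rightarrow> 'x \<Rightarrow>\<^sub>0 'k::field" where
  "pt x \<equiv> Poly_Mapping.single x 1"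

definition free_ext :: "('k::field, 'n) module \<Rightarrow> ('x \<Rightarrow> 'n) \<Rightarrow> ('x \<Rightarrow>\<^sub>0 'k) \<Rightarrow> 'n" where
  "free_ext N g p = (\<Oplus>\<^bsub>N\<^esub>x \<in> Poly_Mapping.keys p. Poly_Mapping.lookup p x \<odot>\<^bsub>N\<^esub> g x)"


section \<open>Tensor products\<close>

definition tensor_rel ::
  "('k::field, 'm) module \<Rightarrow> ('k, 'n) module \<Rightarrow> ('m \<times> 'n \<Rightarrow>\<^sub>0 'k) set" where
  "tensor_rel M N = kspan (monoid_algebra (M \<times>\<times> N))
     ({pt (x \<oplus>\<^bsub>M\<^esub> x', y) - pt (x, y) - pt (x', y) | x x' y.
         x \<in> carrier M \<and> x' \<in> carrier M \<and> y \<in> carrier N} \<union>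
      {pt (x, y \<oplus>\<^bsub>N\<^esub> y') - pt (x, y) - pt (x, y') | x y y'.
         x \<in> carrier M \<and> y \<in> carrier N \<and> y' \<in> carrier N} \<union>
      {pt (c \<odot>\<^bsub>M\<^esub> x, y) - Poly_Mapping.single (x, y) c | c x y.
         x \<in> carrier M \<and> y \<in> carrier N} \<union>
      {pt (x, c \<odot>\<^bsub>N\<^esub> y) - Poly_Mapping.single (x, y) c | c x y.
         x \<in> carrier M \<and> y \<in> carrier N})"

text \<open>
  The tensor product over \<open>'k\<close>. If \<open>M\<close> and \<open>N\<close> are algebras, the multiplication inherited from
  \<open>k[M \<times> N]\<close> is the usual one, \<open>(x \<otimes> y)(x' \<otimes> y') = xx' \<otimes> yy'\<close>.
\<close>

definition tensor ::
  "('k::field, 'm) module \<Rightarrow> ('k, 'n) module \<Rightarrow> ('k, ('m \<times> 'n \<Rightarrow>\<^sub>0 'k) set) module" where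
  "tensor M N = quot (monoid_algebra (M \<times>\<times> N)) (tensor_rel M N)"

definition tens ::
  "('k::field, 'm) module \<Rightarrow> ('k, 'n) module \<Rightarrow> 'm \<Rightarrow> 'n \<Rightarrow> ('m \<times> 'n \<Rightarrow>\<^sub>0 'k) set" where
  "tens M N x y = tensor_rel M N +>\<^bsub>monoid_algebra (M \<times>\<times> N)\<^esub> pt (x, y)"

text \<open>
  Value at the tensor \<open>t\<close> of the linear map into \<open>P\<close> induced by a bilinear map \<open>f\<close>, computed on some
  representative of \<open>t\<close>; for \<open>t = \<Delta>(a)\<close> this is the Sweedler sum of \<open>f a\<^sub>(\<^sub>1\<^sub>) a\<^sub>(\<^sub>2\<^sub>)\<close>.
\<close>

definition tens_ext ::
  "('k::field, 'p) module \<Rightarrow> ('m \<Rightarrow> 'n \<Rightarrow> 'p) \<Rightarrow> ('m \<times> 'n \<Rightarrow>\<^sub>0 'k) set \<Rightarrow> 'p" where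
  "tens_ext P f t = free_ext P (\<lambda>(x, y). f x y) (SOME p. p \<in> t)"

definition wedge ::
  "('k::field, 'v) module \<Rightarrow> 'v \<Rightarrow> 'v \<Rightarrow> ('v \<times> 'v \<Rightarrow>\<^sub>0 'k) set" where
  "wedge V v v' = tens V V v v' \<ominus>\<^bsub>tensor V V\<^esub> tens V V v' v"

definition wedge_space ::
  "('k::field, 'v) module \<Rightarrow> ('k, ('v \<times> 'v \<Rightarrow>\<^sub>0 'k) set) module" where
  "wedge_space V = (tensor V V)
     \<lparr>carrier := kspan (tensor V V) {wedge V v v' | v v'. v \<in> carrier V \<and> v' \<in> carrier V}\<rparr>"


section \<open>Tensor algebra and symmetric algebra\<close>

abbreviation word_monoid :: "'w set \<Rightarrow> 'w list monoid" where
  "word_monoid W \<equiv> \<lparr>carrier = lists W, monoid.mult = (@), one = []\<rparr>"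

definition talg_rel :: "('k::field, 'w) module \<Rightarrow> ('w list \<Rightarrow>\<^sub>0 'k) set" where
  "talg_rel W = Idl\<^bsub>monoid_algebra (word_monoid (carrier W))\<^esub>
     ({pt [x \<oplus>\<^bsub>W\<^esub> y] - pt [x] - pt [y] | x y. x \<in> carrier W \<and> y \<in> carrier W} \<union>
      {pt [c \<odot>\<^bsub>W\<^esub> x] - Poly_Mapping.single [x] c | c x. x \<in> carrier W})"

definition talg :: "('k::field, 'w) module \<Rightarrow> ('k, ('w list \<Rightarrow>\<^sub>0 'k) set) module" where
  "talg W = quot (monoid_algebra (word_monoid (carrier W))) (talg_rel W)"

definition talg_in :: "('k::field, 'w) module \<Rightarrow> 'w \<Rightarrow> ('w list \<Rightarrow>\<^sub>0 'k) set" where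
  "talg_in W x = talg_rel W +>\<^bsub>monoid_algebra (word_monoid (carrier W))\<^esub> pt [x]"

definition sym_rel :: "('k::field, 'v) module \<Rightarrow> ('v list \<Rightarrow>\<^sub>0 'k) set set" where
  "sym_rel V = Idl\<^bsub>talg V\<^esub>
     {(talg_in V v \<otimes>\<^bsub>talg V\<^esub> talg_in V v') \<ominus>\<^bsub>talg V\<^esub> (talg_in V v' \<otimes>\<^bsub>talg V\<^esub> talg_in V v) | v v'.
        v \<in> carrier V \<and> v' \<in> carrier V}"

definition symalg :: "('k::field, 'v) module \<Rightarrow> ('k, ('v list \<Rightarrow>\<^sub>0 'k) set set) module" where
  "symalg V = quot (talg V) (sym_rel V)"

definition sym_in :: "('k::field, 'v) module \<Rightarrow> 'v \<Rightarrow> ('v list \<Rightarrow>\<^sub>0 'k) set set" where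
  "sym_in V v = sym_rel V +>\<^bsub>talg V\<^esub> talg_in V v"

definition sym_deg :: "('k::field, 'v) module \<Rightarrow> nat \<Rightarrow> ('v list \<Rightarrow>\<^sub>0 'k) set set set" where
  "sym_deg V n = kspan (symalg V)
     {foldr (\<lambda>v f. sym_in V v \<otimes>\<^bsub>symalg V\<^esub> f) vs \<one>\<^bsub>symalg V\<^esub> | vs. vs \<in> lists (carrier V) \<and> length vs = n}"

text \<open>
  Value at \<open>f\<close> of the linear map on \<open>Sym(V)\<close> sending \<open>v\<^sub>1 \<dots> v\<^sub>n\<close> to \<open>g [v\<^sub>1, \<dots>, v\<^sub>n]\<close>, for \<open>g\<close> multilinear
  and symmetric. An element of \<open>Sym(V)\<close> is a coset of cosets, so \<^term>\<open>\<Union>f\<close> consists of the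
  noncommutative polynomials in the vectors of \<open>V\<close> that represent \<open>f\<close>.
\<close>

definition sym_ext ::
  "('k::field, 'n) module \<Rightarrow> ('v list \<Rightarrow> 'n) \<Rightarrow> ('v list \<Rightarrow>\<^sub>0 'k) set set \<Rightarrow> 'n" where
  "sym_ext N g f = free_ext N g (SOME p. p \<in> \<Union>f)"


section \<open>Cocommutative algebras and their modules\<close>

definition cocomm_algebra ::
  "('k::field, 'a) module \<Rightarrow> ('a \<Rightarrow> ('a \<times> 'a \<Rightarrow>\<^sub>0 'k) set) \<Rightarrow> bool" where
  "cocomm_algebra A \<Delta> \<longleftrightarrow> kalg A \<and>
     \<comment> \<open>this includes \<open>\<Delta>(1) = 1 \<otimes> 1\<close>\<close>
     \<Delta> \<in> alg_hom A (tensor A A) \<and>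
     \<comment> \<open>coassociativity; the left-hand side is rebracketed by \<open>(A \<otimes> A) \<otimes> A \<rightarrow> A \<otimes> (A \<otimes> A)\<close>\<close>
     (\<forall>a \<in> carrier A.
        tens_ext (tensor A (tensor A A))
          (\<lambda>u z. tens_ext (tensor A (tensor A A)) (\<lambda>x y. tens A (tensor A A) x (tens A A y z)) u)
          (tens_ext (tensor (tensor A A) A) (\<lambda>x y. tens (tensor A A) A (\<Delta> x) y) (\<Delta> a)) =
        tens_ext (tensor A (tensor A A)) (\<lambda>x y. tens A (tensor A A) x (\<Delta> y)) (\<Delta> a)) \<and>
     (\<forall>a \<in> carrier A. tens_ext (tensor A A) (\<lambda>x y. tens A A y x) (\<Delta> a) = \<Delta> a)"

definition alg_module ::
  "('k::field, 'a) module \<Rightarrow> ('k, 'v) module \<Rightarrow> ('a \<Rightarrow> 'v \<Rightarrow> 'v) \<Rightarrow> bool" where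
  "alg_module A V act \<longleftrightarrow> kvs V \<and>
     (\<forall>a \<in> carrier A. klinear V V (act a)) \<and>
     (\<forall>v \<in> carrier V. klinear A V (\<lambda>a. act a v)) \<and>
     (\<forall>a \<in> carrier A. \<forall>b \<in> carrier A. \<forall>v \<in> carrier V. act (a \<otimes>\<^bsub>A\<^esub> b) v = act a (act b v)) \<and>
     (\<forall>v \<in> carrier V. act \<one>\<^bsub>A\<^esub> v = v)"


section \<open>The smash product\<close>

text \<open>
  \<open>a(v\<^sub>1 \<dots> v\<^sub>n) = \<Sum> a\<^sub>(\<^sub>1\<^sub>)(v\<^sub>1) \<dots> a\<^sub>(\<^sub>n\<^sub>)(v\<^sub>n)\<close> in \<open>Sym\<^sup>n(V)\<close> for \<open>n \<ge> 1\<close>. In the absence of a counit there is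
  no action on \<open>Sym\<^sup>0(V)\<close>, and the value at the empty word is never used.
\<close>

primrec word_act ::
  "('k::field, 'a) module \<Rightarrow> ('a \<Rightarrow> ('a \<times> 'a \<Rightarrow>\<^sub>0 'k) set) \<Rightarrow> ('k, 'v) module \<Rightarrow> ('a \<Rightarrow> 'v \<Rightarrow> 'v) \<Rightarrow>
   'v list \<Rightarrow> 'a \<Rightarrow> ('v list \<Rightarrow>\<^sub>0 'k) set set" where
  "word_act A \<Delta> V act [] = (\<lambda>a. undefined)"
| "word_act A \<Delta> V act (v # vs) =
     (\<lambda>a. if vs = [] then sym_in V (act a v)
          else tens_ext (symalg V) (\<lambda>x y. sym_in V (act x v) \<otimes>\<^bsub>symalg V\<^esub> word_act A \<Delta> V act vs y) (\<Delta> a))"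

text \<open>
  \<open>(f' \<otimes> a')(f \<otimes> a)\<close> for a monomial \<open>f = v\<^sub>1 \<dots> v\<^sub>n\<close>: this is \<open>\<Sum> f' a'\<^sub>(\<^sub>1\<^sub>)(f) \<otimes> a'\<^sub>(\<^sub>2\<^sub>) a\<close> if \<open>n \<ge> 1\<close> and
  \<open>f' \<otimes> a' a\<close> if \<open>f = 1\<close>. The product of \<open>Sym(V) \<rtimes> A\<close> is its multilinear extension.
\<close>

definition smash_word ::
  "('k::field, 'a) module \<Rightarrow> ('a \<Rightarrow> ('a \<times> 'a \<Rightarrow>\<^sub>0 'k) set) \<Rightarrow> ('k, 'v) module \<Rightarrow> ('a \<Rightarrow> 'v \<Rightarrow> 'v) \<Rightarrow>
   ('v list \<Rightarrow>\<^sub>0 'k) set set \<Rightarrow> 'a \<Rightarrow> 'v list \<Rightarrow> 'a \<Rightarrow>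
   (('v list \<Rightarrow>\<^sub>0 'k) set set \<times> 'a \<Rightarrow>\<^sub>0 'k) set" where
  "smash_word A \<Delta> V act f' a' vs a =
     (if vs = [] then tens (symalg V) A f' (a' \<otimes>\<^bsub>A\<^esub> a)
      else tens_ext (tensor (symalg V) A)
             (\<lambda>x y. tens (symalg V) A (f' \<otimes>\<^bsub>symalg V\<^esub> word_act A \<Delta> V act vs x) (y \<otimes>\<^bsub>A\<^esub> a)) (\<Delta> a'))"

definition smash_mult ::
  "('k::field, 'a) module \<Rightarrow> ('a \<Rightarrow> ('a \<times> 'a \<Rightarrow>\<^sub>0 'k) set) \<Rightarrow> ('k, 'v) module \<Rightarrow> ('a \<Rightarrow> 'v \<Rightarrow> 'v) \<Rightarrow>
   (('v list \<Rightarrow>\<^sub>0 'k) set set \<times> 'a \<Rightarrow>\<^sub>0 'k) set \<Rightarrow> (('v list \<Rightarrow>\<^sub>0 'k) set set \<times> 'a \<Rightarrow>\<^sub>0 'k) set \<Rightarrow>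
   (('v list \<Rightarrow>\<^sub>0 'k) set set \<times> 'a \<Rightarrow>\<^sub>0 'k) set" where
  "smash_mult A \<Delta> V act t' t =
     tens_ext (tensor (symalg V) A)
       (\<lambda>f' a'. tens_ext (tensor (symalg V) A)
          (\<lambda>f a. sym_ext (tensor (symalg V) A) (\<lambda>vs. smash_word A \<Delta> V act f' a' vs a) f) t) t'"

definition smash ::
  "('k::field, 'a) module \<Rightarrow> ('a \<Rightarrow> ('a \<times> 'a \<Rightarrow>\<^sub>0 'k) set) \<Rightarrow> ('k, 'v) module \<Rightarrow> ('a \<Rightarrow> 'v \<Rightarrow> 'v) \<Rightarrow>
   ('k, (('v list \<Rightarrow>\<^sub>0 'k) set set \<times> 'a \<Rightarrow>\<^sub>0 'k) set) module" where
  "smash A \<Delta> V act = (tensor (symalg V) A)\<lparr>monoid.mult := smash_mult A \<Delta> V act\<rparr>"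

definition smash_deg ::
  "('k::field, 'a) module \<Rightarrow> ('a \<Rightarrow> ('a \<times> 'a \<Rightarrow>\<^sub>0 'k) set) \<Rightarrow> ('k, 'v) module \<Rightarrow> ('a \<Rightarrow> 'v \<Rightarrow> 'v) \<Rightarrow>
   nat \<Rightarrow> (('v list \<Rightarrow>\<^sub>0 'k) set set \<times> 'a \<Rightarrow>\<^sub>0 'k) set set" where
  "smash_deg A \<Delta> V act n = kspan (smash A \<Delta> V act)
     {tens (symalg V) A f a | f a. f \<in> sym_deg V n \<and> a \<in> carrier A}"

definition smashV ::
  "('k::field, 'a) module \<Rightarrow> ('k, 'v) module \<Rightarrow> 'v \<Rightarrow> (('v list \<Rightarrow>\<^sub>0 'k) set set \<times> 'a \<Rightarrow>\<^sub>0 'k) set" where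
  "smashV A V v = tens (symalg V) A (sym_in V v) \<one>\<^bsub>A\<^esub>"

definition smashA ::
  "('k::field, 'a) module \<Rightarrow> ('k, 'v) module \<Rightarrow> 'a \<Rightarrow> (('v list \<Rightarrow>\<^sub>0 'k) set set \<times> 'a \<Rightarrow>\<^sub>0 'k) set" where
  "smashA A V a = tens (symalg V) A \<one>\<^bsub>symalg V\<^esub> a"


section \<open>The algebras \<open>H\<^bsub>\<lambda>,\<kappa>\<^esub>\<close>\<close>

text \<open>
  \<open>\<lambda> : A \<otimes> V \<rightarrow> A\<close> and \<open>\<kappa> : V \<and> V \<rightarrow> V \<oplus> A\<close> are linear maps on the tensor product and on
  \<^const>\<open>wedge_space\<close>; they only matter on those carriers.
\<close>

definition Hlk_rel ::
  "('k::field, 'a) module \<Rightarrow> ('a \<Rightarrow> ('a \<times> 'a \<Rightarrow>\<^sub>0 'k) set) \<Rightarrow> ('k, 'v) module \<Rightarrow> ('a \<Rightarrow> 'v \<Rightarrow> 'v) \<Rightarrow>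
   (('a \<times> 'v \<Rightarrow>\<^sub>0 'k) set \<Rightarrow> 'a) \<Rightarrow> (('v \<times> 'v \<Rightarrow>\<^sub>0 'k) set \<Rightarrow> 'v \<times> 'a) \<Rightarrow>
   (('v \<times> 'a) list \<Rightarrow>\<^sub>0 'k) set set" where
  "Hlk_rel A \<Delta> V act lam kap =
     (let T = talg (dirsum V A);
          iV = (\<lambda>v. talg_in (dirsum V A) (v, \<zero>\<^bsub>A\<^esub>));
          iA = (\<lambda>a. talg_in (dirsum V A) (\<zero>\<^bsub>V\<^esub>, a))
      in Idl\<^bsub>T\<^esub>
        ({iA \<one>\<^bsub>A\<^esub> \<ominus>\<^bsub>T\<^esub> \<one>\<^bsub>T\<^esub>} \<union>
         {(iA a \<otimes>\<^bsub>T\<^esub> iA b) \<ominus>\<^bsub>T\<^esub> iA (a \<otimes>\<^bsub>A\<^esub> b) | a b. a \<in> carrier A \<and> b \<in> carrier A} \<union>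
         {((iA a \<otimes>\<^bsub>T\<^esub> iV v) \<ominus>\<^bsub>T\<^esub> tens_ext T (\<lambda>x y. iV (act x v) \<otimes>\<^bsub>T\<^esub> iA y) (\<Delta> a))
            \<ominus>\<^bsub>T\<^esub> iA (lam (tens A V a v)) | a v. a \<in> carrier A \<and> v \<in> carrier V} \<union>
         {((iV v \<otimes>\<^bsub>T\<^esub> iV v') \<ominus>\<^bsub>T\<^esub> (iV v' \<otimes>\<^bsub>T\<^esub> iV v))
            \<ominus>\<^bsub>T\<^esub> talg_in (dirsum V A) (kap (wedge V v v')) | v v'.
            v \<in> carrier V \<and> v' \<in> carrier V}))"

definition Hlk ::
  "('k::field, 'a) module \<Rightarrow> ('a \<Rightarrow> ('a \<times> 'a \<Rightarrow>\<^sub>0 'k) set) \<Rightarrow> ('k, 'v) module \<Rightarrow> ('a \<Rightarrow> 'v \<Rightarrow> 'v) \<Rightarrow>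
   (('a \<times> 'v \<Rightarrow>\<^sub>0 'k) set \<Rightarrow> 'a) \<Rightarrow> (('v \<times> 'v \<Rightarrow>\<^sub>0 'k) set \<Rightarrow> 'v \<times> 'a) \<Rightarrow>
   ('k, (('v \<times> 'a) list \<Rightarrow>\<^sub>0 'k) set set) module" where
  "Hlk A \<Delta> V act lam kap = quot (talg (dirsum V A)) (Hlk_rel A \<Delta> V act lam kap)"

definition Hlk_in ::
  "('k::field, 'a) module \<Rightarrow> ('a \<Rightarrow> ('a \<times> 'a \<Rightarrow>\<^sub>0 'k) set) \<Rightarrow> ('k, 'v) module \<Rightarrow> ('a \<Rightarrow> 'v \<Rightarrow> 'v) \<Rightarrow>
   (('a \<times> 'v \<Rightarrow>\<^sub>0 'k) set \<Rightarrow> 'a) \<Rightarrow> (('v \<times> 'v \<Rightarrow>\<^sub>0 'k) set \<Rightarrow> 'v \<times> 'a) \<Rightarrow>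
   'v + 'a \<Rightarrow> (('v \<times> 'a) list \<Rightarrow>\<^sub>0 'k) set set" where
  "Hlk_in A \<Delta> V act lam kap g = Hlk_rel A \<Delta> V act lam kap +>\<^bsub>talg (dirsum V A)\<^esub>
     talg_in (dirsum V A) (case g of Inl v \<Rightarrow> (v, \<zero>\<^bsub>A\<^esub>) | Inr a \<Rightarrow> (\<zero>\<^bsub>V\<^esub>, a))"

text \<open>The span of the products of generators with at most \<open>n\<close> factors from \<open>V\<close>.\<close>

definition Hlk_filt ::
  "('k::field, 'a) module \<Rightarrow> ('a \<Rightarrow> ('a \<times> 'a \<Rightarrow>\<^sub>0 'k) set) \<Rightarrow> ('k, 'v) module \<Rightarrow> ('a \<Rightarrow> 'v \<Rightarrow> 'v) \<Rightarrow>
   (('a \<times> 'v \<Rightarrow>\<^sub>0 'k) set \<Rightarrow> 'a) \<Rightarrow> (('v \<times> 'v \<Rightarrow>\<^sub>0 'k) set \<Rightarrow> 'v \<times> 'a) \<Rightarrow>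
   nat \<Rightarrow> (('v \<times> 'a) list \<Rightarrow>\<^sub>0 'k) set set set" where
  "Hlk_filt A \<Delta> V act lam kap n = kspan (Hlk A \<Delta> V act lam kap)
     {foldr (\<lambda>g h. Hlk_in A \<Delta> V act lam kap g \<otimes>\<^bsub>Hlk A \<Delta> V act lam kap\<^esub> h) gs \<one>\<^bsub>Hlk A \<Delta> V act lam kap\<^esub> | gs.
        gs \<in> lists (carrier V <+> carrier A) \<and> length (filter isl gs) \<le> n}"


section \<open>Associated graded algebra and the PBW property\<close>

definition filt_below :: "('k, 'm) module \<Rightarrow> (nat \<Rightarrow> 'm set) \<Rightarrow> nat \<Rightarrow> 'm set" where
  "filt_below M F n = (case n of 0 \<Rightarrow> {\<zero>\<^bsub>M\<^esub>} | Suc m \<Rightarrow> F m)"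

text \<open>
  Elements of \<open>\<Oplus>\<^sub>n F\<^sub>n / F\<^sub>n\<^sub>-\<^sub>1\<close> are sequences of cosets, almost all of which are zero.
\<close>

definition gr :: "('k, 'm) module \<Rightarrow> (nat \<Rightarrow> 'm set) \<Rightarrow> ('k, nat \<Rightarrow> 'm set) module" where
  "gr M F =
     \<lparr>carrier = {P. (\<forall>n. \<exists>x \<in> F n. P n = filt_below M F n +>\<^bsub>M\<^esub> x) \<and>
                    finite {n. P n \<noteq> filt_below M F n}},
      monoid.mult = (\<lambda>P Q n. filt_below M F n +>\<^bsub>M\<^esub>
        (\<Oplus>\<^bsub>M\<^esub>i \<in> {..n}. (SOME x. x \<in> P i) \<otimes>\<^bsub>M\<^esub> (SOME y. y \<in> Q (n - i)))),
      one = (\<lambda>n. filt_below M F n +>\<^bsub>M\<^esub> (if n = 0 then \<one>\<^bsub>M\<^esub> else \<zero>\<^bsub>M\<^esub>)),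
      ring.zero = filt_below M F,
      ring.add = (\<lambda>P Q n. P n <+>\<^bsub>M\<^esub> Q n),
      module.smult = (\<lambda>c P n. filt_below M F n +>\<^bsub>M\<^esub> (c \<odot>\<^bsub>M\<^esub> (SOME x. x \<in> P n)))\<rparr>"

definition gr_in :: "('k, 'm) module \<Rightarrow> (nat \<Rightarrow> 'm set) \<Rightarrow> nat \<Rightarrow> 'm \<Rightarrow> nat \<Rightarrow> 'm set" where
  "gr_in M F n x = (\<lambda>m. if m = n then filt_below M F n +>\<^bsub>M\<^esub> x else filt_below M F m)"

text \<open>
  The smash product is generated by \<open>V\<close> and \<open>A\<close>, so the natural surjection onto the associated graded
  algebra is the only algebra homomorphism with the prescribed values on \<open>V\<close> and \<open>A\<close>.
\<close>

definition natural_gr_map ::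
  "('k::field, 'a) module \<Rightarrow> ('a \<Rightarrow> ('a \<times> 'a \<Rightarrow>\<^sub>0 'k) set) \<Rightarrow> ('k, 'v) module \<Rightarrow> ('a \<Rightarrow> 'v \<Rightarrow> 'v) \<Rightarrow>
   (('a \<times> 'v \<Rightarrow>\<^sub>0 'k) set \<Rightarrow> 'a) \<Rightarrow> (('v \<times> 'v \<Rightarrow>\<^sub>0 'k) set \<Rightarrow> 'v \<times> 'a) \<Rightarrow>
   ((('v list \<Rightarrow>\<^sub>0 'k) set set \<times> 'a \<Rightarrow>\<^sub>0 'k) set \<Rightarrow> nat \<Rightarrow> (('v \<times> 'a) list \<Rightarrow>\<^sub>0 'k) set set set) \<Rightarrow> bool"
  where
  "natural_gr_map A \<Delta> V act lam kap nu \<longleftrightarrow>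
     (let HH = Hlk A \<Delta> V act lam kap; F = Hlk_filt A \<Delta> V act lam kap; i = Hlk_in A \<Delta> V act lam kap
      in nu \<in> alg_hom (smash A \<Delta> V act) (gr HH F) \<and>
         (\<forall>v \<in> carrier V. nu (smashV A V v) = gr_in HH F 1 (i (Inl v))) \<and>
         (\<forall>a \<in> carrier A. nu (smashA A V a) = gr_in HH F 0 (i (Inr a))))"

definition PBW ::
  "('k::field, 'a) module \<Rightarrow> ('a \<Rightarrow> ('a \<times> 'a \<Rightarrow>\<^sub>0 'k) set) \<Rightarrow> ('k, 'v) module \<Rightarrow> ('a \<Rightarrow> 'v \<Rightarrow> 'v) \<Rightarrow>
   (('a \<times> 'v \<Rightarrow>\<^sub>0 'k) set \<Rightarrow> 'a) \<Rightarrow> (('v \<times> 'v \<Rightarrow>\<^sub>0 'k) set \<Rightarrow> 'v \<times> 'a) \<Rightarrow> bool" where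
  "PBW A \<Delta> V act lam kap \<longleftrightarrow>
     (\<exists>nu. natural_gr_map A \<Delta> V act lam kap nu \<and>
        bij_betw nu (carrier (smash A \<Delta> V act))
          (carrier (gr (Hlk A \<Delta> V act lam kap) (Hlk_filt A \<Delta> V act lam kap))))"


section \<open>Deformations over \<open>k[t]\<close>\<close>

text \<open>\<open>B\<^sub>t / (t - c) B\<^sub>t\<close> as an algebra over \<open>'k\<close>.\<close>

definition specialize :: "('k::field poly, 'm) module \<Rightarrow> 'k \<Rightarrow> ('k, 'm set) module" where
  "specialize Bt c =
     (let Q = quot Bt ((\<lambda>p. [:- c, 1:] \<odot>\<^bsub>Bt\<^esub> p) ` carrier Bt)
      in ring.extend (ring.truncate Q) \<lparr>module.smult = (\<lambda>a. module.smult Q [:a:])\<rparr>)"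

text \<open>
  The underlying \<open>k[t]\<close>-module of \<open>B\<^sub>t\<close> is \<open>B[t]\<close>, whose elements are coefficient sequences; the
  multiplication and the unit of \<open>B\<^sub>t\<close> are arbitrary subject to the axioms. The isomorphism
  \<open>B\<^sub>t / t B\<^sub>t \<cong> B\<close> is the one induced by taking constant coefficients.
\<close>

definition deformation ::
  "('k::field, 'b) module \<Rightarrow> ('k poly, nat \<Rightarrow> 'b) module \<Rightarrow> bool" where
  "deformation B Bt \<longleftrightarrow>
     assoc_algebra ring_of_type_algebra Bt \<and>
     carrier Bt = up B \<and>
     (\<forall>p \<in> up B. \<forall>q \<in> up B. p \<oplus>\<^bsub>Bt\<^esub> q = (\<lambda>n. p n \<oplus>\<^bsub>B\<^esub> q n)) \<and>
     (\<forall>f. \<forall>p \<in> up B. f \<odot>\<^bsub>Bt\<^esub> p = (\<lambda>n. \<Oplus>\<^bsub>B\<^esub>i \<in> {..n}. poly.coeff f i \<odot>\<^bsub>B\<^esub> p (n - i))) \<and>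
     (\<lambda>P. the_elem ((\<lambda>p. p 0) ` P)) \<in> alg_iso (specialize Bt 0) B"

definition const_seq :: "('k, 'b) module \<Rightarrow> 'b \<Rightarrow> nat \<Rightarrow> 'b" where
  "const_seq B b = (\<lambda>n. if n = 0 then b else \<zero>\<^bsub>B\<^esub>)"

text \<open>The multiplication maps \<open>\<mu>\<^sub>j\<close>, as bilinear maps.\<close>

definition mu ::
  "('k, 'b) module \<Rightarrow> ('k poly, nat \<Rightarrow> 'b) module \<Rightarrow> nat \<Rightarrow> 'b \<Rightarrow> 'b \<Rightarrow> 'b" where
  "mu B Bt j b b' = (const_seq B b \<otimes>\<^bsub>Bt\<^esub> const_seq B b') j"

definition graded_deformation ::
  "('k::field, 'b) module \<Rightarrow> (nat \<Rightarrow> 'b set) \<Rightarrow> ('k poly, nat \<Rightarrow> 'b) module \<Rightarrow> bool" where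
  "graded_deformation B G Bt \<longleftrightarrow> deformation B Bt \<and>
     (\<forall>j \<ge> 1. \<forall>m n. \<forall>b \<in> G m. \<forall>b' \<in> G n.
        mu B Bt j b b' \<in> (if j \<le> m + n then G (m + n - j) else {\<zero>\<^bsub>B\<^esub>}))"

text \<open>
  The conditions on \<open>\<mu>\<^sub>1\<close> and \<open>\<mu>\<^sub>2\<close>, which are equations in \<open>B = Sym(V) \<rtimes> A\<close>; \<open>V\<close> and \<open>A\<close> are regarded
  as subspaces of \<open>B\<close> via \<^const>\<open>smashV\<close> and \<^const>\<open>smashA\<close>.
\<close>

definition mu_compatible ::
  "('k::field, 'a) module \<Rightarrow> ('a \<Rightarrow> ('a \<times> 'a \<Rightarrow>\<^sub>0 'k) set) \<Rightarrow> ('k, 'v) module \<Rightarrow> ('a \<Rightarrow> 'v \<Rightarrow> 'v) \<Rightarrow>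
   (('a \<times> 'v \<Rightarrow>\<^sub>0 'k) set \<Rightarrow> 'a) \<Rightarrow> (('v \<times> 'v \<Rightarrow>\<^sub>0 'k) set \<Rightarrow> 'v \<times> 'a) \<Rightarrow>
   ('k poly, nat \<Rightarrow> (('v list \<Rightarrow>\<^sub>0 'k) set set \<times> 'a \<Rightarrow>\<^sub>0 'k) set) module \<Rightarrow> bool" where
  "mu_compatible A \<Delta> V act lam kap Bt \<longleftrightarrow>
     (let B = smash A \<Delta> V act; iV = smashV A V; iA = smashA A V; m = mu B Bt in
      (\<forall>a \<in> carrier A. \<forall>v \<in> carrier V.
         iA (lam (tens A V a v)) =
           m 1 (iA a) (iV v) \<ominus>\<^bsub>B\<^esub> tens_ext B (\<lambda>x y. m 1 (iV (act x v)) (iA y)) (\<Delta> a)) \<and>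
      (\<forall>v \<in> carrier V. \<forall>v' \<in> carrier V.
         iV (fst (kap (wedge V v v'))) = m 1 (iV v) (iV v') \<ominus>\<^bsub>B\<^esub> m 1 (iV v') (iV v) \<and>
         iA (snd (kap (wedge V v v'))) = m 2 (iV v) (iV v') \<ominus>\<^bsub>B\<^esub> m 2 (iV v') (iV v)))"

end

theory Submission
  imports Defs
begin

text \<open>
  Write \<open>H\<close> for the algebra with the deformed relations, \<open>F\<close> for its filtration and \<open>B = Sym(V) \<rtimes>
  A\<close>.

  Every natural map \<open>B \<rightarrow> gr H\<close> is surjective (\<open>natural_surj\<close>), since \<open>gr H\<close> is generated by the
  classes of \<open>V\<close> and \<open>A\<close>, and a natural map exists (\<open>natural_nu\<close>): in \<open>gr H\<close> the terms \<open>\<lambda>\<close> and \<open>\<kappa>\<close>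
  vanish because they have lower degree. The PBW property thus says that a natural map is
  injective.

  From the PBW property to a deformation: the Rees algebra \<open>R = \<Oplus>\<^sub>n F\<^sub>n t\<^sup>n\<close> is an algebra
  over \<open>k[t]\<close> on which \<open>t\<close> is not a zero divisor, and \<open>R / t R = gr H\<close>. If \<open>gr H\<close> is \<open>B\<close>, then a
  homogeneous linear lift \<open>\<sigma> : B \<rightarrow> R\<close> of the isomorphism extends to an isomorphism \<open>B[t] \<rightarrow> R\<close> of
  graded \<open>k[t]\<close>-modules (\<open>Phi_inj\<close>, \<open>Phi_surj\<close>), and the product of \<open>R\<close>, transported to \<open>B[t]\<close>, is
  a graded deformation of \<open>B\<close> (\<open>graded_Bt\<close>). Its maps \<open>\<mu>\<^sub>1\<close> and \<open>\<mu>\<^sub>2\<close> depend on the lift. When \<open>\<sigma>\<close>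
  sends \<open>a\<close> to \<open>a\<close> and \<open>v a\<close> to \<open>v a t\<close>, the defining relations of \<open>H\<close>, made homogeneous with \<open>t\<close>,
  are the required equations (\<open>compatible_Bt\<close>). Such a lift exists because the products \<open>v a\<close> span
  a subspace of \<open>F\<^sub>1\<close> that meets \<open>F\<^sub>0\<close> trivially (\<open>rees_lift_exists\<close>).

  From a deformation to the PBW property: in a graded deformation \<open>B\<^sub>t\<close> the product of two
  generators has at most the coefficients \<open>\<mu>\<^sub>0, \<mu>\<^sub>1, \<mu>\<^sub>2\<close>, so the equations for \<open>\<mu>\<^sub>1\<close> and \<open>\<mu>\<^sub>2\<close>
  say that the relations of \<open>H\<close>, made homogeneous with \<open>t\<close>, hold in \<open>B\<^sub>t\<close> (\<open>act_relation\<close>,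
  \<open>comm_relation\<close>). At \<open>t = 1\<close> this yields a homomorphism \<open>phi : H \<rightarrow> B\<^sub>t / (t - 1) B\<^sub>t\<close>.
  Evaluation at \<open>t = 1\<close> identifies the target with \<open>B\<close> as a vector space. A product of generators
  with \<open>n\<close> factors from \<open>V\<close> is homogeneous of degree \<open>n\<close> in \<open>B\<^sub>t\<close>, hence goes to its product in
  \<open>B\<close> plus terms of degree below \<open>n\<close>. Therefore taking the component of degree \<open>n\<close> gives a map \<open>gr
  H \<rightarrow> B\<close> that is left inverse to the natural map (\<open>symb_natural\<close>), which proves the PBW property.
  By induction on the degree \<open>phi\<close> is then bijective as well (\<open>specialization_iso\<close>).

  The elements of the tensor products and of \<open>Sym(V)\<close> are cosets, and linear maps on them are
  computed on chosen representatives; the first sections provide the universal properties that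
  make these values independent of the choice.
\<close>

section \<open>Vector spaces and algebras\<close>

lemma rta_simps [simp]:
  "carrier ring_of_type_algebra = UNIV"
  "a \<otimes>\<^bsub>ring_of_type_algebra\<^esub> b = a * b"
  "a \<oplus>\<^bsub>ring_of_type_algebra\<^esub> b = a + b"
  "\<one>\<^bsub>ring_of_type_algebra\<^esub> = 1"
  "\<zero>\<^bsub>ring_of_type_algebra\<^esub> = 0"
  by (simp_all add: ring_of_type_algebra_def)

locale vspace =
  fixes M :: "('k::field, 'm) module" (structure)
  assumes kvs: "kvs M"

sublocale vspace \<subseteq> abelian_group M
  using kvs by (simp add: module_def)

context vspace
begin

lemma smult_closed [simp, intro]: "x \<in> carrier M \<Longrightarrow> c \<odot> x \<in> carrier M"
  using module.smult_closed[OF kvs] by simp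

lemma smult_add_left: "x \<in> carrier M \<Longrightarrow> (c + d) \<odot> x = c \<odot> x \<oplus> d \<odot> x"
  using module.smult_l_distr[OF kvs, of c d] by simp

lemma smult_add_right:
  "x \<in> carrier M \<Longrightarrow> y \<in> carrier M \<Longrightarrow> c \<odot> (x \<oplus> y) = c \<odot> x \<oplus> c \<odot> y"
  using module.smult_r_distr[OF kvs, of c] by simp

lemma smult_smult: "x \<in> carrier M \<Longrightarrow> c \<odot> (d \<odot> x) = (c * d) \<odot> x"
  using module.smult_assoc1[OF kvs, of c d] by simp

lemma smult_1 [simp]: "x \<in> carrier M \<Longrightarrow> 1 \<odot> x = x"
  using module.smult_one[OF kvs] by simp

lemma smult_0_left [simp]: "x \<in> carrier M \<Longrightarrow> 0 \<odot> x = \<zero>"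
  using module.smult_l_null[OF kvs] by simp

lemma smult_0_right [simp]: "c \<odot> \<zero> = \<zero>"
  using module.smult_r_null[OF kvs, of c] by simp

lemma smult_uminus_1: "x \<in> carrier M \<Longrightarrow> (-1) \<odot> x = \<ominus> x"
proof -
  assume x: "x \<in> carrier M"
  have "(-1) \<odot> x \<oplus> x = ((-1) + 1) \<odot> x"
    using x by (simp only: smult_add_left smult_1)
  then have "(-1) \<odot> x \<oplus> x = \<zero>" using x by simp
  then show ?thesis using x by (simp add: minus_equality)
qed

lemma minus_eq_smult: "x \<in> carrier M \<Longrightarrow> y \<in> carrier M \<Longrightarrow> x \<ominus> y = x \<oplus> (-1) \<odot> y"
  by (simp add: smult_uminus_1 a_minus_def)

lemma diff_add_cancel: "x \<in> carrier M \<Longrightarrow> y \<in> carrier M \<Longrightarrow> (x \<ominus> y) \<oplus> y = x"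
  by (simp add: a_minus_def a_assoc l_neg)

lemma diff_eq_zero_iff:
  assumes "x \<in> carrier M" "y \<in> carrier M" shows "x \<ominus> y = \<zero> \<longleftrightarrow> x = y"
proof
  assume "x \<ominus> y = \<zero>"
  with diff_add_cancel[OF assms] show "x = y" using assms by simp
qed (use assms in \<open>simp add: a_minus_def r_neg\<close>)

lemma diff_diff_diff:
  "x \<in> carrier M \<Longrightarrow> y \<in> carrier M \<Longrightarrow> z \<in> carrier M \<Longrightarrow> (z \<ominus> x) \<oplus> (x \<ominus> y) = z \<ominus> y"
  by (simp add: a_minus_def a_assoc r_neg1)

lemma add_diff_cancel: "x \<in> carrier M \<Longrightarrow> y \<in> carrier M \<Longrightarrow> (x \<oplus> y) \<ominus> y = x"
  by (simp add: a_minus_def a_assoc r_neg)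

lemma subspaceI:
  assumes "U \<subseteq> carrier M" "\<zero> \<in> U"
    and "\<And>x y. x \<in> U \<Longrightarrow> y \<in> U \<Longrightarrow> x \<oplus> y \<in> U"
    and "\<And>c x. x \<in> U \<Longrightarrow> c \<odot> x \<in> U"
  shows "submodule U ring_of_type_algebra M"
proof (rule module.submoduleI[OF kvs])
  fix a assume "a \<in> U"
  with assms(4)[of a "-1"] assms(1) show "\<ominus> a \<in> U" by (simp add: smult_uminus_1 subset_iff)
qed (use assms in auto)

lemma subspaceD:
  assumes "submodule U ring_of_type_algebra M"
  shows "U \<subseteq> carrier M" "\<zero> \<in> U"
    "\<And>x y. x \<in> U \<Longrightarrow> y \<in> U \<Longrightarrow> x \<oplus> y \<in> U"
    "\<And>c x. x \<in> U \<Longrightarrow> c \<odot> x \<in> U"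
    "\<And>x y. x \<in> U \<Longrightarrow> y \<in> U \<Longrightarrow> x \<ominus> y \<in> U"
proof -
  note E = module.submoduleE[OF kvs assms]
  show a: "U \<subseteq> carrier M" "\<And>x y. x \<in> U \<Longrightarrow> y \<in> U \<Longrightarrow> x \<oplus> y \<in> U" 
    "\<And>c x. x \<in> U \<Longrightarrow> c \<odot> x \<in> U"
    using E by simp_all
  show "\<And>x y. x \<in> U \<Longrightarrow> y \<in> U \<Longrightarrow> x \<ominus> y \<in> U" using E by (simp add: a_minus_def)
  from E(2) obtain x where "x \<in> U" by blast
  with E(5)[OF this E(3)[OF this]] E(1) show "\<zero> \<in> U" by (auto simp: r_neg)
qed

lemma subspace_kspan:
  assumes "S \<subseteq> carrier M"
  shows "submodule (kspan M S) ring_of_type_algebra M"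
proof (rule subspaceI)
  have "submodule (carrier M) ring_of_type_algebra M"
    by (rule module.carrier_is_submodule[OF kvs])
  with assms show "kspan M S \<subseteq> carrier M" unfolding kspan_def by blast
qed (auto simp: kspan_def subspaceD)

lemma kspan_subset: "S \<subseteq> carrier M \<Longrightarrow> kspan M S \<subseteq> carrier M"
  using subspaceD(1)[OF subspace_kspan] .

lemma kspan_least: "submodule U ring_of_type_algebra M \<Longrightarrow> S \<subseteq> U \<Longrightarrow> kspan M S \<subseteq> U"
  unfolding kspan_def by blast

lemma kspan_induct [consumes 2, case_names base zero add smult]:
  assumes "x \<in> kspan M S" "S \<subseteq> carrier M"
    and "\<And>x. x \<in> S \<Longrightarrow> P x"
    and "P \<zero>"
    and "\<And>x y. x \<in> carrier M \<Longrightarrow> y \<in> carrier M \<Longrightarrow> P x \<Longrightarrow> P y \<Longrightarrow> P (x \<oplus> y)"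
    and "\<And>c x. x \<in> carrier M \<Longrightarrow> P x \<Longrightarrow> P (c \<odot> x)"
  shows "P x"
proof -
  have "submodule {x \<in> carrier M. P x} ring_of_type_algebra M"
    by (rule subspaceI) (use assms in auto)
  from kspan_least[OF this, of S] assms show ?thesis by blast
qed

end

lemma kspan_base: "x \<in> S \<Longrightarrow> x \<in> kspan M S"
  unfolding kspan_def by blast

text \<open>Quotients and associated graded algebras inherit their axioms along the projection, which is why
  the zero and the operations of the image are only assumed to be compatible with \<open>f\<close>.\<close>

lemma kvs_image:
  assumes "kvs M" and c: "carrier N = f ` carrier M"
    and add: "\<And>x y. x \<in> carrier M \<Longrightarrow> y \<in> carrier M \<Longrightarrow> f (x \<oplus>\<^bsub>M\<^esub> y) = f x \<oplus>\<^bsub>N\<^esub> f y"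
    and smult: "\<And>c x. x \<in> carrier M \<Longrightarrow> f (c \<odot>\<^bsub>M\<^esub> x) = c \<odot>\<^bsub>N\<^esub> f x"
    and zero: "f \<zero>\<^bsub>M\<^esub> = \<zero>\<^bsub>N\<^esub>"
  shows "kvs N"
proof -
  interpret M: vspace M by (rule vspace.intro[OF assms(1)])
  have "abelian_group N"
  proof (rule abelian_groupI; (unfold c)?)
    fix x assume "x \<in> f ` carrier M"
    then obtain u where u: "u \<in> carrier M" "x = f u" by blast
    then have "f (\<ominus>\<^bsub>M\<^esub> u) \<oplus>\<^bsub>N\<^esub> x = \<zero>\<^bsub>N\<^esub>"
      by (simp add: add[symmetric] M.l_neg zero)
    with u show "\<exists>y\<in>f ` carrier M. y \<oplus>\<^bsub>N\<^esub> x = \<zero>\<^bsub>N\<^esub>" by blast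
  qed (auto simp: add[symmetric] zero[symmetric] M.a_ac)
  then show ?thesis
    by (intro moduleI cring_from_type_algebra)
      (auto simp: c add[symmetric] smult[symmetric] M.smult_add_left M.smult_add_right M.smult_smult)
qed

locale kalgebra =
  fixes M :: "('k::field, 'm) module" (structure)
  assumes kalg: "kalg M"

sublocale kalgebra \<subseteq> vspace M
  by (rule vspace.intro) (use kalg in \<open>simp add: assoc_algebra_def\<close>)

sublocale kalgebra \<subseteq> ring M
  using kalg by (simp add: assoc_algebra_def)

context kalgebra
begin

lemma mult_smult_left: "x \<in> carrier M \<Longrightarrow> y \<in> carrier M \<Longrightarrow> (c \<odot> x) \<otimes> y = c \<odot> (x \<otimes> y)"
  and mult_smult_right: "x \<in> carrier M \<Longrightarrow> y \<in> carrier M \<Longrightarrow> x \<otimes> (c \<odot> y) = c \<odot> (x \<otimes> y)"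
  using kalg by (auto simp: assoc_algebra_def)

lemma ideal_subspace:
  assumes "ideal I M" shows "submodule I ring_of_type_algebra M"
proof -
  interpret ideal I M by fact
  show ?thesis
  proof (rule subspaceI)
    fix c x assume x: "x \<in> I"
    then have "(c \<odot> \<one>) \<otimes> x \<in> I" by (simp add: I_l_closed)
    with x show "c \<odot> x \<in> I" by (simp add: mult_smult_left Icarr)
  qed (auto simp: Icarr)
qed

lemma idealI_subspace:
  assumes "submodule I ring_of_type_algebra M"
    and "\<And>x a. a \<in> I \<Longrightarrow> x \<in> carrier M \<Longrightarrow> x \<otimes> a \<in> I"
    and "\<And>x a. a \<in> I \<Longrightarrow> x \<in> carrier M \<Longrightarrow> a \<otimes> x \<in> I"
  shows "ideal I M"
  by (rule idealI[OF ring_axioms]) (use assms submodule.axioms(1) in auto)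

end

lemma kalgI:
  assumes "kvs M"
    and "\<And>x y. x \<in> carrier M \<Longrightarrow> y \<in> carrier M \<Longrightarrow> x \<otimes>\<^bsub>M\<^esub> y \<in> carrier M"
    and "\<one>\<^bsub>M\<^esub> \<in> carrier M"
    and "\<And>x y z. x \<in> carrier M \<Longrightarrow> y \<in> carrier M \<Longrightarrow> z \<in> carrier M \<Longrightarrow>
      (x \<otimes>\<^bsub>M\<^esub> y) \<otimes>\<^bsub>M\<^esub> z = x \<otimes>\<^bsub>M\<^esub> (y \<otimes>\<^bsub>M\<^esub> z)"
    and "\<And>x. x \<in> carrier M \<Longrightarrow> \<one>\<^bsub>M\<^esub> \<otimes>\<^bsub>M\<^esub> x = x"
    and "\<And>x. x \<in> carrier M \<Longrightarrow> x \<otimes>\<^bsub>M\<^esub> \<one>\<^bsub>M\<^esub> = x"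
    and "\<And>x y z. x \<in> carrier M \<Longrightarrow> y \<in> carrier M \<Longrightarrow> z \<in> carrier M \<Longrightarrow>
      (x \<oplus>\<^bsub>M\<^esub> y) \<otimes>\<^bsub>M\<^esub> z = x \<otimes>\<^bsub>M\<^esub> z \<oplus>\<^bsub>M\<^esub> y \<otimes>\<^bsub>M\<^esub> z"
    and "\<And>x y z. x \<in> carrier M \<Longrightarrow> y \<in> carrier M \<Longrightarrow> z \<in> carrier M \<Longrightarrow>
      z \<otimes>\<^bsub>M\<^esub> (x \<oplus>\<^bsub>M\<^esub> y) = z \<otimes>\<^bsub>M\<^esub> x \<oplus>\<^bsub>M\<^esub> z \<otimes>\<^bsub>M\<^esub> y"
    and "\<And>c x y. x \<in> carrier M \<Longrightarrow> y \<in> carrier M \<Longrightarrow> (c \<odot>\<^bsub>M\<^esub> x) \<otimes>\<^bsub>M\<^esub> y = c \<odot>\<^bsub>M\<^esub> (x \<otimes>\<^bsub>M\<^esub> y)"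
    and "\<And>c x y. x \<in> carrier M \<Longrightarrow> y \<in> carrier M \<Longrightarrow> x \<otimes>\<^bsub>M\<^esub> (c \<odot>\<^bsub>M\<^esub> y) = c \<odot>\<^bsub>M\<^esub> (x \<otimes>\<^bsub>M\<^esub> y)"
  shows "kalg M"
proof -
  interpret M: vspace M by (rule vspace.intro[OF assms(1)])
  have "ring M"
    by (intro ringI monoidI M.abelian_group_axioms) (use assms in auto)
  then show ?thesis using assms by (simp add: assoc_algebra_def)
qed

lemma kalg_image:
  assumes "kalg M" and c: "carrier N = f ` carrier M"
    and add: "\<And>x y. x \<in> carrier M \<Longrightarrow> y \<in> carrier M \<Longrightarrow> f (x \<oplus>\<^bsub>M\<^esub> y) = f x \<oplus>\<^bsub>N\<^esub> f y"
    and smult: "\<And>c x. x \<in> carrier M \<Longrightarrow> f (c \<odot>\<^bsub>M\<^esub> x) = c \<odot>\<^bsub>N\<^esub> f x"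
    and zero: "f \<zero>\<^bsub>M\<^esub> = \<zero>\<^bsub>N\<^esub>"
    and mult: "\<And>x y. x \<in> carrier M \<Longrightarrow> y \<in> carrier M \<Longrightarrow> f (x \<otimes>\<^bsub>M\<^esub> y) = f x \<otimes>\<^bsub>N\<^esub> f y"
    and one: "f \<one>\<^bsub>M\<^esub> = \<one>\<^bsub>N\<^esub>"
  shows "kalg N"
proof -
  interpret M: kalgebra M by (rule kalgebra.intro[OF assms(1)])
  have "kvs N" by (rule kvs_image[OF M.kvs c add smult zero])
  then show ?thesis
    by (rule kalgI)
      (auto simp: c add[symmetric] smult[symmetric] mult[symmetric] one[symmetric] M.m_assoc
        M.l_distr M.r_distr M.mult_smult_left M.mult_smult_right)
qed

subsection \<open>Linear maps\<close>

lemma klinearI: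
  assumes "\<And>x. x \<in> carrier M \<Longrightarrow> f x \<in> carrier N"
    and "\<And>x y. x \<in> carrier M \<Longrightarrow> y \<in> carrier M \<Longrightarrow> f (x \<oplus>\<^bsub>M\<^esub> y) = f x \<oplus>\<^bsub>N\<^esub> f y"
    and "\<And>c x. x \<in> carrier M \<Longrightarrow> f (c \<odot>\<^bsub>M\<^esub> x) = c \<odot>\<^bsub>N\<^esub> f x"
  shows "klinear M N f"
  using assms by (auto simp: klinear_def)

lemma klinear_closed: "klinear M N f \<Longrightarrow> x \<in> carrier M \<Longrightarrow> f x \<in> carrier N"
  and klinear_add: "klinear M N f \<Longrightarrow> x \<in> carrier M \<Longrightarrow> y \<in> carrier M \<Longrightarrow>
    f (x \<oplus>\<^bsub>M\<^esub> y) = f x \<oplus>\<^bsub>N\<^esub> f y"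
  and klinear_smult: "klinear M N f \<Longrightarrow> x \<in> carrier M \<Longrightarrow> f (c \<odot>\<^bsub>M\<^esub> x) = c \<odot>\<^bsub>N\<^esub> f x"
  by (auto simp: klinear_def)

lemma klinear_comp: "klinear M N f \<Longrightarrow> klinear N P g \<Longrightarrow> klinear M P (\<lambda>x. g (f x))"
  by (simp add: klinear_def Pi_iff)

lemma klinear_zero:
  assumes "kvs M" "kvs N" "klinear M N f" shows "f \<zero>\<^bsub>M\<^esub> = \<zero>\<^bsub>N\<^esub>"
proof -
  interpret M: vspace M by (rule vspace.intro[OF assms(1)])
  interpret N: vspace N by (rule vspace.intro[OF assms(2)])
  have "f (0 \<odot>\<^bsub>M\<^esub> \<zero>\<^bsub>M\<^esub>) = 0 \<odot>\<^bsub>N\<^esub> f \<zero>\<^bsub>M\<^esub>"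
    using klinear_smult[OF assms(3), of "\<zero>\<^bsub>M\<^esub>" 0] by (simp del: M.smult_0_left M.smult_0_right)
  then show ?thesis using klinear_closed[OF assms(3), of "\<zero>\<^bsub>M\<^esub>"] by simp
qed

lemma klinear_diff:
  assumes "kvs M" "kvs N" "klinear M N f" "x \<in> carrier M" "y \<in> carrier M"
  shows "f (x \<ominus>\<^bsub>M\<^esub> y) = f x \<ominus>\<^bsub>N\<^esub> f y"
proof -
  interpret M: vspace M by (rule vspace.intro[OF assms(1)])
  interpret N: vspace N by (rule vspace.intro[OF assms(2)])
  show ?thesis using assms(4,5)
    by (simp add: M.minus_eq_smult N.minus_eq_smult klinear_closed[OF assms(3)]
        klinear_add[OF assms(3)] klinear_smult[OF assms(3)])
qed

lemma klinear_add_fun: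
  assumes "kvs N" "klinear M N f" "klinear M N g" shows "klinear M N (\<lambda>x. f x \<oplus>\<^bsub>N\<^esub> g x)"
proof -
  interpret N: vspace N by (rule vspace.intro[OF assms(1)])
  show ?thesis
    using assms(2,3) by (auto intro!: klinearI simp: klinear_closed klinear_add klinear_smult
      N.smult_add_right N.a_ac)
qed

lemma klinear_smult_fun:
  assumes "kvs N" "klinear M N f" shows "klinear M N (\<lambda>x. c \<odot>\<^bsub>N\<^esub> f x)"
proof -
  interpret N: vspace N by (rule vspace.intro[OF assms(1)])
  show ?thesis
    using assms(2) by (auto intro!: klinearI simp: klinear_closed klinear_add klinear_smult
      N.smult_add_right N.smult_smult mult.commute)
qed

lemma subspace_kernel:
  assumes "kvs M" "kvs N" "klinear M N f" "submodule U ring_of_type_algebra N"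
  shows "submodule {x \<in> carrier M. f x \<in> U} ring_of_type_algebra M"
proof -
  interpret M: vspace M by (rule vspace.intro[OF assms(1)])
  interpret N: vspace N by (rule vspace.intro[OF assms(2)])
  show ?thesis
    by (rule M.subspaceI) (auto simp: klinear_zero[OF assms(1-3)] klinear_add[OF assms(3)]
      klinear_smult[OF assms(3)] N.subspaceD[OF assms(4)])
qed

lemma (in vspace) subspace_zero: "submodule {\<zero>} ring_of_type_algebra M"
  by (rule subspaceI) auto

lemma klinear_eq_on_span:
  assumes "kvs M" "kvs N" "klinear M N f" "klinear M N g" "S \<subseteq> carrier M"
    and "\<And>x. x \<in> S \<Longrightarrow> f x = g x" "x \<in> kspan M S"
  shows "f x = g x"
proof -
  interpret M: vspace M by (rule vspace.intro[OF assms(1)])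
  interpret N: vspace N by (rule vspace.intro[OF assms(2)])
  from assms(7,5) show ?thesis
    by (induction rule: M.kspan_induct)
      (simp_all add: assms(6) klinear_zero[OF assms(1,2)] assms(3,4) klinear_add[OF assms(3)]
        klinear_smult[OF assms(3)] klinear_add[OF assms(4)] klinear_smult[OF assms(4)])
qed

lemma alg_homI:
  assumes "klinear M N f"
    and "\<And>x y. x \<in> carrier M \<Longrightarrow> y \<in> carrier M \<Longrightarrow> f (x \<otimes>\<^bsub>M\<^esub> y) = f x \<otimes>\<^bsub>N\<^esub> f y"
    and "f \<one>\<^bsub>M\<^esub> = \<one>\<^bsub>N\<^esub>"
  shows "f \<in> alg_hom M N"
  using assms by (auto simp: alg_hom_def klinear_def intro!: ring_hom_memI)

lemma alg_homD:
  assumes "f \<in> alg_hom M N"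
  shows "klinear M N f" "f \<in> ring_hom M N"
    "\<And>x. x \<in> carrier M \<Longrightarrow> f x \<in> carrier N"
    "\<And>x y. x \<in> carrier M \<Longrightarrow> y \<in> carrier M \<Longrightarrow> f (x \<oplus>\<^bsub>M\<^esub> y) = f x \<oplus>\<^bsub>N\<^esub> f y"
    "\<And>c x. x \<in> carrier M \<Longrightarrow> f (c \<odot>\<^bsub>M\<^esub> x) = c \<odot>\<^bsub>N\<^esub> f x"
    "\<And>x y. x \<in> carrier M \<Longrightarrow> y \<in> carrier M \<Longrightarrow> f (x \<otimes>\<^bsub>M\<^esub> y) = f x \<otimes>\<^bsub>N\<^esub> f y"
    "f \<one>\<^bsub>M\<^esub> = \<one>\<^bsub>N\<^esub>"
  using assms by (auto simp: alg_hom_def klinear_def ring_hom_def)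

lemma alg_hom_comp: "f \<in> alg_hom M N \<Longrightarrow> g \<in> alg_hom N P \<Longrightarrow> (\<lambda>x. g (f x)) \<in> alg_hom M P"
  by (simp add: alg_hom_def klinear_def ring_hom_def Pi_iff)

subsection \<open>Quotients\<close>

lemma quot_sel [simp]:
  "\<zero>\<^bsub>quot M I\<^esub> = I" "\<one>\<^bsub>quot M I\<^esub> = I +>\<^bsub>M\<^esub> \<one>\<^bsub>M\<^esub>"
  by (simp_all add: quot_def ring.defs FactRing_def)

lemma carrier_quot: "carrier (quot M I) = (\<lambda>x. I +>\<^bsub>M\<^esub> x) ` carrier M"
  by (auto simp: quot_def ring.defs FactRing_def A_RCOSETS_defs a_r_coset_defs)

context vspace
begin

context
  fixes I assumes I: "submodule I ring_of_type_algebra M"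
begin

lemma subspace_abelian_subgroup: "abelian_subgroup I M"
  by (rule abelian_subgroupI3)
    (use I abelian_group_axioms in \<open>auto simp: submodule_def additive_subgroup_def\<close>)

interpretation I: abelian_subgroup I M by (rule subspace_abelian_subgroup)

lemma mem_coset_iff_diff:
  assumes x: "x \<in> carrier M" shows "y \<in> I +> x \<longleftrightarrow> y \<in> carrier M \<and> y \<ominus> x \<in> I"
proof
  assume "y \<in> I +> x"
  then obtain h where "h \<in> I" "y = h \<oplus> x" by (auto simp: a_r_coset_def')
  with x subspaceD(1)[OF I] show "y \<in> carrier M \<and> y \<ominus> x \<in> I"
    by (auto simp: add_diff_cancel subset_iff)
next
  assume "y \<in> carrier M \<and> y \<ominus> x \<in> I"
  with x have "y = (y \<ominus> x) \<oplus> x" "y \<ominus> x \<in> I" by (auto simp: diff_add_cancel)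
  then show "y \<in> I +> x" unfolding a_r_coset_def' by blast
qed

lemma coset_eq_iff:
  assumes "x \<in> carrier M" "y \<in> carrier M" shows "I +> x = I +> y \<longleftrightarrow> x \<ominus> y \<in> I"
proof
  assume "I +> x = I +> y"
  moreover have "x \<in> I +> x"
    using assms subspaceD(2)[OF I] by (simp add: mem_coset_iff_diff a_minus_def r_neg)
  ultimately show "x \<ominus> y \<in> I" using assms by (simp add: mem_coset_iff_diff)
next
  assume "x \<ominus> y \<in> I"
  then have "z \<ominus> y \<in> I \<longleftrightarrow> z \<ominus> x \<in> I" if "z \<in> carrier M" for z
    using diff_diff_diff[OF assms that] subspaceD(3)[OF I, of "z \<ominus> x" "x \<ominus> y"]
      subspaceD(5)[OF I, of "z \<ominus> y" "x \<ominus> y"] add_diff_cancel[of "z \<ominus> x" "x \<ominus> y"] assms that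
    by auto
  then show "I +> x = I +> y" using assms by (auto simp: mem_coset_iff_diff)
qed

lemma mem_coset_iff: "x \<in> carrier M \<Longrightarrow> y \<in> I +> x \<longleftrightarrow> y \<in> carrier M \<and> I +> y = I +> x"
  using mem_coset_iff_diff coset_eq_iff by blast

lemma coset_zero: "I +> \<zero> = I"
  by (rule a_coset_add_zero) (rule subspaceD(1)[OF I])

lemma coset_eq_zero_iff: "x \<in> carrier M \<Longrightarrow> I +> x = I \<longleftrightarrow> x \<in> I"
  using coset_eq_iff[of x \<zero>] by (simp add: coset_zero minus_eq_smult)

lemma quot_add: "x \<in> carrier M \<Longrightarrow> y \<in> carrier M \<Longrightarrow> (I +> x) \<oplus>\<^bsub>quot M I\<^esub> (I +> y) = I +> (x \<oplus> y)"
  by (simp add: quot_def ring.defs FactRing_def I.a_rcos_sum)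

lemma quot_smult: "x \<in> carrier M \<Longrightarrow> c \<odot>\<^bsub>quot M I\<^esub> (I +> x) = I +> (c \<odot> x)"
proof -
  assume x: "x \<in> carrier M"
  have "I +> (c \<odot> y) = I +> (c \<odot> x)" if "y \<in> I +> x" for y
  proof -
    have y: "y \<in> carrier M" "y \<ominus> x \<in> I"
      using that x by (auto simp: mem_coset_iff coset_eq_iff)
    have "c \<odot> y \<ominus> c \<odot> x = c \<odot> (y \<ominus> x)"
      using x y by (simp add: minus_eq_smult smult_add_right smult_smult)
    then show ?thesis using x y by (simp add: coset_eq_iff subspaceD(4)[OF I])
  qed
  note same = this
  have "x \<in> I +> x" using x by (simp add: mem_coset_iff)
  then have "(\<Union>y\<in>I +> x. I +> (c \<odot> y)) = I +> (c \<odot> x)"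
    by (intro SUP_eq_const same) auto
  then show ?thesis by (simp only: quot_def ring.defs module.simps)
qed

lemma kvs_quot: "kvs (quot M I)"
  by (rule kvs_image[OF kvs carrier_quot])
    (simp_all add: quot_add quot_smult coset_eq_zero_iff subspaceD(2)[OF I])

lemma klinear_coset: "klinear M (quot M I) (\<lambda>x. I +> x)"
  by (rule klinearI) (auto simp: carrier_quot quot_add quot_smult)

end

end

lemma (in kalgebra) quot_mult:
  assumes "ideal I M" "x \<in> carrier M" "y \<in> carrier M"
  shows "(I +> x) \<otimes>\<^bsub>quot M I\<^esub> (I +> y) = I +> (x \<otimes> y)"
  using ideal.rcoset_mult_add[OF assms] by (simp add: quot_def ring.defs FactRing_def)

lemma (in kalgebra) kalg_quot: "ideal I M \<Longrightarrow> kalg (quot M I)"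
  by (rule kalg_image[OF kalg carrier_quot])
    (simp_all add: quot_add quot_smult coset_eq_zero_iff ideal_subspace subspaceD(2) quot_mult)

lemma (in kalgebra) alg_hom_coset: "ideal I M \<Longrightarrow> (\<lambda>x. I +> x) \<in> alg_hom M (quot M I)"
  by (rule alg_homI) (simp_all add: klinear_coset ideal_subspace quot_mult)

text \<open>The second part is the form in which the factorization is used when a value at a coset is
  computed on some chosen representative.\<close>

lemma (in vspace) quot_factor_linear:
  assumes I: "submodule I ring_of_type_algebra M" and N: "kvs N" and f: "klinear M N f"
    and ker: "\<And>x. x \<in> I \<Longrightarrow> f x = \<zero>\<^bsub>N\<^esub>"
  shows "\<exists>g. klinear (quot M I) N g \<and> (\<forall>x \<in> carrier M. g (I +> x) = f x)"
    and "x \<in> carrier M \<Longrightarrow> y \<in> I +> x \<Longrightarrow> f y = f x"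
proof -
  interpret N: vspace N by (rule vspace.intro[OF N])
  show const: "f y = f x" if "x \<in> carrier M" "y \<in> I +> x" for x y
  proof -
    from that have y: "y \<in> carrier M" "y \<ominus> x \<in> I"
      by (simp_all add: mem_coset_iff_diff[OF I])
    then have "f y \<ominus>\<^bsub>N\<^esub> f x = \<zero>\<^bsub>N\<^esub>"
      using ker that by (simp flip: klinear_diff[OF kvs N f])
    then show ?thesis using that y by (simp add: N.diff_eq_zero_iff klinear_closed[OF f])
  qed
  define g where "g = (\<lambda>P. f (SOME x. x \<in> P))"
  have g: "g (I +> x) = f x" if "x \<in> carrier M" for x
  proof -
    have "x \<in> I +> x" using that by (simp add: mem_coset_iff[OF I])
    then have "(SOME y. y \<in> I +> x) \<in> I +> x" by (rule someI)
    then show ?thesis unfolding g_def by (rule const[OF that])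
  qed
  have "klinear (quot M I) N g"
    by (rule klinearI)
      (auto simp: carrier_quot quot_add[OF I] quot_smult[OF I] g klinear_closed[OF f]
        klinear_add[OF f] klinear_smult[OF f])
  with g show "\<exists>g. klinear (quot M I) N g \<and> (\<forall>x \<in> carrier M. g (I +> x) = f x)" by blast
qed

lemma (in kalgebra) ideal_kernel:
  assumes "kalg N" "f \<in> alg_hom M N" shows "ideal {x \<in> carrier M. f x = \<zero>\<^bsub>N\<^esub>} M"
proof -
  interpret N: kalgebra N by (rule kalgebra.intro[OF assms(1)])
  have "submodule {x \<in> carrier M. f x \<in> {\<zero>\<^bsub>N\<^esub>}} ring_of_type_algebra M"
    using subspace_kernel[OF kvs N.kvs alg_homD(1)[OF assms(2)]] N.subspace_zero by blast
  then show ?thesis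
    by (intro idealI_subspace) (auto simp: alg_homD[OF assms(2)])
qed

text \<open>The kernel of \<open>f\<close> is an ideal, so it contains the ideal generated by \<open>S\<close> as soon as it contains
  \<open>S\<close>.\<close>

lemma (in kalgebra) quot_Idl_factor:
  assumes S: "S \<subseteq> carrier M" and N: "kalg N" and f: "f \<in> alg_hom M N"
    and ker: "\<And>x. x \<in> S \<Longrightarrow> f x = \<zero>\<^bsub>N\<^esub>"
  shows "\<exists>g \<in> alg_hom (quot M (Idl S)) N. \<forall>x \<in> carrier M. g (Idl S +> x) = f x"
proof -
  interpret N: kalgebra N by (rule kalgebra.intro[OF N])
  have I: "ideal (Idl S) M" by (rule genideal_ideal[OF S])
  have "Idl S \<subseteq> {x \<in> carrier M. f x = \<zero>\<^bsub>N\<^esub>}"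
    by (rule genideal_minimal[OF ideal_kernel[OF N f]]) (use S ker in auto)
  then obtain g where g: "klinear (quot M (Idl S)) N g" "\<forall>x \<in> carrier M. g (Idl S +> x) = f x"
    using quot_factor_linear(1)[OF ideal_subspace[OF I] N.kvs alg_homD(1)[OF f]] by blast
  have "g \<in> alg_hom (quot M (Idl S)) N"
    by (rule alg_homI[OF g(1)]) (auto simp: g(2) carrier_quot quot_mult[OF I] alg_homD[OF f])
  with g show ?thesis by blast
qed

section \<open>Linear combinations and monoid algebras\<close>

abbreviation keys where "keys \<equiv> Poly_Mapping.keys"
abbreviation lookup where "lookup \<equiv> Poly_Mapping.lookup"
abbreviation single where "single \<equiv> Poly_Mapping.single"

lemma monoid_algebra_sel [simp]:
  "carrier (monoid_algebra G) = {p. keys p \<subseteq> carrier G}"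
  "\<zero>\<^bsub>monoid_algebra G\<^esub> = 0"
  "\<one>\<^bsub>monoid_algebra G\<^esub> = pt \<one>\<^bsub>G\<^esub>"
  "p \<oplus>\<^bsub>monoid_algebra G\<^esub> q = p + q"
  "c \<odot>\<^bsub>monoid_algebra G\<^esub> p = Poly_Mapping.map ((*) c) p"
  by (simp_all add: monoid_algebra_def)

lemma lookup_scale [simp]: "lookup (Poly_Mapping.map ((*) c) p) x = c * lookup p x" for c :: "'k::field"
  by (simp add: Poly_Mapping.map.rep_eq when_def)

lemma scale_zero [simp]: "Poly_Mapping.map ((*) c) 0 = 0" for c :: "'k::field"
  by (intro poly_mapping_eqI) simp

lemma keys_scale: "keys (Poly_Mapping.map ((*) c) p) \<subseteq> keys p" for c :: "'k::field"
  by (auto simp: in_keys_iff)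

lemma kvs_monoid_algebra: "kvs (monoid_algebra G :: ('k::field, 'x \<Rightarrow>\<^sub>0 'k) module)"
proof -
  have "abelian_group (monoid_algebra G :: ('k, 'x \<Rightarrow>\<^sub>0 'k) module)"
  proof (rule abelian_groupI)
    fix p :: "'x \<Rightarrow>\<^sub>0 'k" assume "p \<in> carrier (monoid_algebra G)"
    then show "\<exists>q\<in>carrier (monoid_algebra G). q \<oplus>\<^bsub>monoid_algebra G\<^esub> p = \<zero>\<^bsub>monoid_algebra G\<^esub>"
      by (intro bexI[of _ "- p"]) auto
  next
    fix p q :: "'x \<Rightarrow>\<^sub>0 'k"
    assume "p \<in> carrier (monoid_algebra G)" "q \<in> carrier (monoid_algebra G)"
    then show "p \<oplus>\<^bsub>monoid_algebra G\<^esub> q \<in> carrier (monoid_algebra G)"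
      using keys_add[of p q] by auto
  qed (auto simp: algebra_simps)
  moreover have "keys p \<subseteq> carrier G \<Longrightarrow> keys (Poly_Mapping.map ((*) c) p) \<subseteq> carrier G"
    for p :: "'x \<Rightarrow>\<^sub>0 'k" and c
    by (rule subset_trans[OF keys_scale])
  ultimately show ?thesis
    by (intro moduleI cring_from_type_algebra)
      (auto intro!: poly_mapping_eqI simp: lookup_add algebra_simps)
qed

interpretation MA: vspace "monoid_algebra G :: ('k::field, 'x \<Rightarrow>\<^sub>0 'k) module" for G
  by (rule vspace.intro[OF kvs_monoid_algebra])

lemma monoid_algebra_diff:
  assumes "p \<in> carrier (monoid_algebra G)" "q \<in> carrier (monoid_algebra G)"
  shows "p \<ominus>\<^bsub>monoid_algebra G\<^esub> q = p - q"
  using assms MA.minus_eq_smult[OF assms]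
  by (auto intro!: poly_mapping_eqI simp: lookup_add lookup_minus)

lemma single_eq_scale: "single x c = Poly_Mapping.map ((*) c) (pt x)" for c :: "'k::field"
  by (intro poly_mapping_eqI) (simp add: lookup_single when_def)

lemma poly_mapping_single_induct [consumes 1, case_names zero add]:
  fixes p :: "'x \<Rightarrow>\<^sub>0 'k::ab_group_add"
  assumes "keys p \<subseteq> K" "P 0"
    and "\<And>x c p. x \<in> K \<Longrightarrow> keys p \<subseteq> K \<Longrightarrow> P p \<Longrightarrow> P (single x c + p)"
  shows "P p"
proof -
  have "finite F \<Longrightarrow> keys p = F \<Longrightarrow> F \<subseteq> K \<Longrightarrow> P p" for F and p :: "'x \<Rightarrow>\<^sub>0 'k"
  proof (induction F arbitrary: p rule: finite_induct)
    case (insert x F)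
    define q where "q = p - single x (lookup p x)"
    have "keys q = F"
      using insert.hyps(2) insert.prems(1)
      by (auto simp: q_def in_keys_iff lookup_minus lookup_single when_def set_eq_iff)
    with insert have "P q" by blast
    moreover have "p = single x (lookup p x) + q" by (simp add: q_def)
    ultimately show ?case
      using assms(3)[of x q "lookup p x"] insert.prems \<open>keys q = F\<close> by auto
  qed (use assms(2) in auto)
  from this[OF finite_keys refl assms(1)] show ?thesis .
qed

context vspace
begin

lemma free_ext_superset:
  assumes "finite S" "keys p \<subseteq> S" "g \<in> S \<rightarrow> carrier M"
  shows "free_ext M g p = (\<Oplus>x\<in>S. lookup p x \<odot> g x)"
  unfolding free_ext_def
  by (rule add.finprod_mono_neutral_cong_left)
    (use assms in \<open>auto simp: in_keys_iff Pi_iff\<close>)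

lemma free_ext_closed: "g \<in> keys p \<rightarrow> carrier M \<Longrightarrow> free_ext M g p \<in> carrier M"
  unfolding free_ext_def by (intro finsum_closed) auto

lemma free_ext_add:
  assumes "g \<in> keys p \<union> keys q \<rightarrow> carrier M"
  shows "free_ext M g (p + q) = free_ext M g p \<oplus> free_ext M g q"
proof -
  let ?S = "keys p \<union> keys q"
  have "free_ext M g (p + q) = (\<Oplus>x\<in>?S. lookup (p + q) x \<odot> g x)"
    using assms keys_add[of p q] by (intro free_ext_superset) auto
  also have "\<dots> = (\<Oplus>x\<in>?S. lookup p x \<odot> g x \<oplus> lookup q x \<odot> g x)"
    using assms by (intro finsum_cong') (auto simp: lookup_add smult_add_left Pi_iff)
  also have "\<dots> = (\<Oplus>x\<in>?S. lookup p x \<odot> g x) \<oplus> (\<Oplus>x\<in>?S. lookup q x \<odot> g x)"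
    using assms by (intro finsum_addf) auto
  also have "\<dots> = free_ext M g p \<oplus> free_ext M g q"
    using assms by (subst (1 2) free_ext_superset[of ?S]) auto
  finally show ?thesis .
qed

lemma free_ext_zero [simp]: "free_ext M g 0 = \<zero>"
  by (simp add: free_ext_def)

lemma free_ext_single: "g x \<in> carrier M \<Longrightarrow> free_ext M g (single x c) = c \<odot> g x"
  by (subst free_ext_superset[of "{x}"]) auto

lemma free_ext_pt [simp]: "g x \<in> carrier M \<Longrightarrow> free_ext M g (pt x) = g x"
  by (simp add: free_ext_single)

lemma free_ext_smult:
  assumes "g \<in> keys p \<rightarrow> carrier M"
  shows "free_ext M g (Poly_Mapping.map ((*) c) p) = c \<odot> free_ext M g p"
  using subset_refl[of "keys p"] assms
proof (induction p rule: poly_mapping_single_induct[where K = "keys p"])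
  case zero
  show ?case by simp
next
  case (add x d q)
  have g: "g \<in> S \<rightarrow> carrier M" if "S \<subseteq> insert x (keys q)" for S using add that assms by auto
  have "Poly_Mapping.map ((*) c) (single x d + q) = single x (c * d) + Poly_Mapping.map ((*) c) q"
    by (intro poly_mapping_eqI) (simp add: lookup_add lookup_single when_def algebra_simps)
  moreover have k: "keys (single x (c * d)) \<union> keys (Poly_Mapping.map ((*) c) q) \<subseteq> insert x (keys q)"
    "keys (single x d) \<union> keys q \<subseteq> insert x (keys q)"
    using keys_scale[of c q] by (auto split: if_splits)
  moreover have "g x \<in> carrier M" using g[of "{x}"] by simp
  moreover have gq: "g \<in> keys q \<rightarrow> carrier M" by (rule g) auto
  ultimately show ?case
    by (simp add: free_ext_add[OF g[OF k(1)]] free_ext_add[OF g[OF k(2)]] free_ext_single add.IH[OF gq]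
        smult_add_right smult_smult free_ext_closed[OF gq])
qed

text \<open>The universal property of the free vector space.\<close>

lemma klinear_free_ext:
  "g \<in> carrier G \<rightarrow> carrier M \<Longrightarrow> klinear (monoid_algebra G) M (free_ext M g)"
  by (intro klinearI)
    (auto simp: subset_iff intro!: free_ext_closed free_ext_add free_ext_smult)

lemma free_ext_cong:
  "(\<And>x. x \<in> keys p \<Longrightarrow> g x = h x) \<Longrightarrow> h \<in> keys p \<rightarrow> carrier M \<Longrightarrow> free_ext M g p = free_ext M h p"
  unfolding free_ext_def by (intro finsum_cong') auto

end

lemma klinear_free_ext_comp:
  assumes "kvs M" "kvs N" "klinear M N f" "g \<in> keys p \<rightarrow> carrier M"
  shows "f (free_ext M g p) = free_ext N (\<lambda>x. f (g x)) p"
proof -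
  interpret M: vspace M by (rule vspace.intro[OF assms(1)])
  interpret N: vspace N by (rule vspace.intro[OF assms(2)])
  have fg: "(\<lambda>x. f (g x)) \<in> keys p \<rightarrow> carrier N" using klinear_closed[OF assms(3)] assms(4) by auto
  from subset_refl[of "keys p"] show ?thesis
  proof (induction p rule: poly_mapping_single_induct[where K = "keys p"])
    case zero
    show ?case by (simp add: klinear_zero[OF assms(1-3)])
  next
    case (add x d q)
    have k: "keys (single x d) \<subseteq> keys p" using add by (cases "d = 0") auto
    have "g \<in> S \<rightarrow> carrier M" "(\<lambda>x. f (g x)) \<in> S \<rightarrow> carrier N" if "S \<subseteq> keys p" for S
      using that assms(4) fg by auto
    note G = this[OF k] this[OF add(2)] this[of "keys (single x d) \<union> keys q"]
    have gx: "g x \<in> carrier M" using add assms by auto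
    show ?case
      using G k add(2,3) gx klinear_closed[OF assms(3) gx]
      by (simp add: M.free_ext_add N.free_ext_add klinear_add[OF assms(3)] M.free_ext_closed
          M.free_ext_single N.free_ext_single klinear_smult[OF assms(3)])
  qed
qed

lemma klinear_monoid_algebra_eqI:
  assumes "kvs N" "klinear (monoid_algebra G) N f" "klinear (monoid_algebra G) N h"
    and "\<And>x. x \<in> carrier G \<Longrightarrow> f (pt x) = h (pt x)" "p \<in> carrier (monoid_algebra G)"
  shows "f p = h p"
proof -
  interpret N: vspace N by (rule vspace.intro[OF assms(1)])
  from assms(5) have "keys p \<subseteq> carrier G" by simp
  then show ?thesis
  proof (induction p rule: poly_mapping_single_induct)
    case zero
    have "F 0 = \<zero>\<^bsub>N\<^esub>" if "klinear (monoid_algebra G) N F" for F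
      using klinear_zero[OF kvs_monoid_algebra assms(1) that] by simp
    then show ?case using assms(2,3) by metis
  next
    case (add x c q)
    have "F (single x c + q) = c \<odot>\<^bsub>N\<^esub> F (pt x) \<oplus>\<^bsub>N\<^esub> F q" if "klinear (monoid_algebra G) N F" for F
      using klinear_add[OF that, of "single x c" q] klinear_smult[OF that, of "pt x" c] add
      by (simp add: single_eq_scale[symmetric])
    from this[OF assms(2)] this[OF assms(3)] show ?case using assms(4) add by simp
  qed
qed

lemma klinear_cong:
  assumes "kvs M" "klinear M N f" "\<And>x. x \<in> carrier M \<Longrightarrow> g x = f x"
  shows "klinear M N g"
proof -
  interpret M: vspace M by (rule vspace.intro[OF assms(1)])
  show ?thesis by (rule klinearI)
    (simp_all add: assms(3) klinear_closed[OF assms(2)] klinear_add[OF assms(2)] klinear_smult[OF assms(2)])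
qed

lemma klinear_zero_fun: "kvs N \<Longrightarrow> klinear M N (\<lambda>_. \<zero>\<^bsub>N\<^esub>)"
proof -
  assume "kvs N"
  then interpret N: vspace N by (rule vspace.intro)
  show ?thesis by (rule klinearI) auto
qed

lemma klinear_combination:
  assumes "kvs M" "kvs N" "\<And>x. x \<in> keys p \<Longrightarrow> klinear M N (g x)"
  shows "klinear M N (\<lambda>u. free_ext N (\<lambda>x. g x u) p)"
proof -
  interpret N: vspace N by (rule vspace.intro[OF assms(2)])
  from subset_refl[of "keys p"] show ?thesis
  proof (induction p rule: poly_mapping_single_induct[where K = "keys p"])
    case zero
    show ?case by (simp add: klinear_zero_fun assms(2))
  next
    case (add x d q)
    have "klinear M N (\<lambda>u. d \<odot>\<^bsub>N\<^esub> g x u \<oplus>\<^bsub>N\<^esub> free_ext N (\<lambda>x. g x u) q)"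
      by (intro klinear_add_fun klinear_smult_fun assms add)
    moreover have "free_ext N (\<lambda>x. g x u) (single x d + q) =
      d \<odot>\<^bsub>N\<^esub> g x u \<oplus>\<^bsub>N\<^esub> free_ext N (\<lambda>x. g x u) q" if "u \<in> carrier M" for u
    proof -
      have "g y u \<in> carrier N" if "y \<in> keys p" for y
        using klinear_closed[OF assms(3)[OF that] \<open>u \<in> carrier M\<close>] .
      then have "(\<lambda>x. g x u) \<in> keys (single x d) \<union> keys q \<rightarrow> carrier N" "g x u \<in> carrier N"
        using add by (cases "d = 0"; auto)+
      then show ?thesis by (simp add: N.free_ext_add N.free_ext_single)
    qed
    ultimately show ?case by (rule klinear_cong[OF assms(1)])
  qed
qed

lemma keys_diff_subset: "keys p \<subseteq> S \<Longrightarrow> keys q \<subseteq> S \<Longrightarrow> keys (p - q) \<subseteq> S"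
  for p q :: "'x \<Rightarrow>\<^sub>0 'k::field"
proof
  assume *: "keys p \<subseteq> S" "keys q \<subseteq> S"
  fix x assume "x \<in> keys (p - q)"
  then have "lookup p x \<noteq> 0 \<or> lookup q x \<noteq> 0" by (auto simp: in_keys_iff lookup_minus)
  with * show "x \<in> S" by (auto simp: in_keys_iff)
qed

lemma monoid_algebra_mult:
  "p \<otimes>\<^bsub>monoid_algebra G\<^esub> q =
    (\<Sum>x\<in>keys p. \<Sum>y\<in>keys q. single (x \<otimes>\<^bsub>G\<^esub> y) (lookup p x * lookup q y))"
  by (simp add: monoid_algebra_def)

lemma monoid_algebra_mult_superset:
  assumes "finite S" "finite T" "keys p \<subseteq> S" "keys q \<subseteq> T"
  shows "p \<otimes>\<^bsub>monoid_algebra G\<^esub> q =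
    (\<Sum>x\<in>S. \<Sum>y\<in>T. single (x \<otimes>\<^bsub>G\<^esub> y) (lookup p x * lookup q y))"
proof -
  have "(\<Sum>y\<in>keys q. single (x \<otimes>\<^bsub>G\<^esub> y) (lookup p x * lookup q y)) =
      (\<Sum>y\<in>T. single (x \<otimes>\<^bsub>G\<^esub> y) (lookup p x * lookup q y))" for x
    by (rule sum.mono_neutral_left) (use assms in \<open>auto simp: in_keys_iff\<close>)
  then have "p \<otimes>\<^bsub>monoid_algebra G\<^esub> q =
      (\<Sum>x\<in>keys p. \<Sum>y\<in>T. single (x \<otimes>\<^bsub>G\<^esub> y) (lookup p x * lookup q y))"
    by (simp add: monoid_algebra_mult)
  also have "\<dots> = (\<Sum>x\<in>S. \<Sum>y\<in>T. single (x \<otimes>\<^bsub>G\<^esub> y) (lookup p x * lookup q y))"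
    by (rule sum.mono_neutral_left) (use assms in \<open>auto simp: in_keys_iff\<close>)
  finally show ?thesis .
qed

lemma monoid_algebra_mult_pt [simp]:
  "pt x \<otimes>\<^bsub>monoid_algebra G\<^esub> pt y = (pt (x \<otimes>\<^bsub>G\<^esub> y) :: 'x \<Rightarrow>\<^sub>0 'k::field)"
  by (subst monoid_algebra_mult_superset[of "{x}" "{y}"]) auto

lemma monoid_algebra_mult_add:
  fixes p p' q q' :: "'x \<Rightarrow>\<^sub>0 'k::field"
  shows "(p + p') \<otimes>\<^bsub>monoid_algebra G\<^esub> q = p \<otimes>\<^bsub>monoid_algebra G\<^esub> q + p' \<otimes>\<^bsub>monoid_algebra G\<^esub> q"
    and "q \<otimes>\<^bsub>monoid_algebra G\<^esub> (p + p') = q \<otimes>\<^bsub>monoid_algebra G\<^esub> p + q \<otimes>\<^bsub>monoid_algebra G\<^esub> p'"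
  using keys_add[of p p']
  by (simp_all add: monoid_algebra_mult_superset[of "keys p \<union> keys p'" "keys q"]
      monoid_algebra_mult_superset[of "keys q" "keys p \<union> keys p'"]
      lookup_add distrib_left distrib_right single_add sum.distrib)

lemma scale_single: "Poly_Mapping.map ((*) c) (single x d) = single x (c * d)" for c :: "'k::field"
  by (intro poly_mapping_eqI) (simp add: lookup_single when_def)

lemma scale_add: "Poly_Mapping.map ((*) c) (p + q) = Poly_Mapping.map ((*) c) p + Poly_Mapping.map ((*) c) q"
  for c :: "'k::field"
  by (intro poly_mapping_eqI) (simp add: lookup_add algebra_simps)

lemma scale_sum: "Poly_Mapping.map ((*) c) (\<Sum>x\<in>S. f x) = (\<Sum>x\<in>S. Poly_Mapping.map ((*) c) (f x))"
  for c :: "'k::field"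
  by (induction S rule: infinite_finite_induct) (simp_all add: scale_add)

lemma monoid_algebra_mult_scale:
  fixes p q :: "'x \<Rightarrow>\<^sub>0 'k::field"
  shows "Poly_Mapping.map ((*) c) p \<otimes>\<^bsub>monoid_algebra G\<^esub> q = Poly_Mapping.map ((*) c) (p \<otimes>\<^bsub>monoid_algebra G\<^esub> q)"
    and "q \<otimes>\<^bsub>monoid_algebra G\<^esub> Poly_Mapping.map ((*) c) p = Poly_Mapping.map ((*) c) (q \<otimes>\<^bsub>monoid_algebra G\<^esub> p)"
  using keys_scale[of c p]
  by (simp_all add: monoid_algebra_mult_superset[of "keys p" "keys q"]
      monoid_algebra_mult_superset[of "keys q" "keys p"]
      scale_sum scale_single algebra_simps)

lemma monoid_algebra_mult_closed:
  fixes p q :: "'x \<Rightarrow>\<^sub>0 'k::field"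
  assumes "monoid G" "p \<in> carrier (monoid_algebra G)" "q \<in> carrier (monoid_algebra G)"
  shows "p \<otimes>\<^bsub>monoid_algebra G\<^esub> q \<in> carrier (monoid_algebra G)"
proof -
  interpret monoid G by fact
  have sum: "keys (\<Sum>x\<in>S. f x) \<subseteq> carrier G" if "\<And>x. x \<in> S \<Longrightarrow> keys (f x) \<subseteq> carrier G"
    for S and f :: "'y \<Rightarrow> 'x \<Rightarrow>\<^sub>0 'k"
    using that
  proof (induction S rule: infinite_finite_induct)
    case (insert x F)
    then show ?case using keys_add[of "f x" "sum f F"] by auto
  qed auto
  have "keys (\<Sum>x\<in>keys p. \<Sum>y\<in>keys q. single (x \<otimes>\<^bsub>G\<^esub> y) (lookup p x * lookup q y)) \<subseteq> carrier G"
    by (intro sum) (use assms in \<open>auto split: if_splits\<close>)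
  then show ?thesis by (simp add: monoid_algebra_mult)
qed

lemma kalg_monoid_algebra:
  assumes "monoid G" shows "kalg (monoid_algebra G :: ('k::field, 'x \<Rightarrow>\<^sub>0 'k) module)"
proof -
  interpret G: monoid G by fact
  let ?R = "monoid_algebra G :: ('k, 'x \<Rightarrow>\<^sub>0 'k) module"
  note closed = monoid_algebra_mult_closed[OF assms]
  have lin: "klinear ?R ?R (\<lambda>p. p \<otimes>\<^bsub>?R\<^esub> q)" "klinear ?R ?R (\<lambda>p. q \<otimes>\<^bsub>?R\<^esub> p)"
    if "q \<in> carrier ?R" for q
    by (intro klinearI closed that; simp add: monoid_algebra_mult_add monoid_algebra_mult_scale)+
  note eqI = klinear_monoid_algebra_eqI[OF kvs_monoid_algebra[of G]]
  note pt_mult = monoid_algebra_mult_pt[where 'k = 'k]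
  have pt: "pt x \<in> carrier ?R" if "x \<in> carrier G" for x using that by simp
  have a1: "(pt x \<otimes>\<^bsub>?R\<^esub> pt y) \<otimes>\<^bsub>?R\<^esub> r = pt x \<otimes>\<^bsub>?R\<^esub> (pt y \<otimes>\<^bsub>?R\<^esub> r)"
    if "x \<in> carrier G" "y \<in> carrier G" "r \<in> carrier ?R" for x y r
    by (rule eqI[OF lin(2) klinear_comp[OF lin(2) lin(2)] _ that(3)])
      (use that pt closed in \<open>simp_all add: G.m_assoc\<close>)
  have a2: "(pt x \<otimes>\<^bsub>?R\<^esub> q) \<otimes>\<^bsub>?R\<^esub> r = pt x \<otimes>\<^bsub>?R\<^esub> (q \<otimes>\<^bsub>?R\<^esub> r)"
    if "x \<in> carrier G" "q \<in> carrier ?R" "r \<in> carrier ?R" for x q r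
    by (rule eqI[OF klinear_comp[OF lin(2) lin(1)] klinear_comp[OF lin(1) lin(2)] _ that(2)])
      (use that pt a1 in simp_all)
  have a3: "(p \<otimes>\<^bsub>?R\<^esub> q) \<otimes>\<^bsub>?R\<^esub> r = p \<otimes>\<^bsub>?R\<^esub> (q \<otimes>\<^bsub>?R\<^esub> r)"
    if "p \<in> carrier ?R" "q \<in> carrier ?R" "r \<in> carrier ?R" for p q r
    by (rule eqI[OF klinear_comp[OF lin(1) lin(1)] lin(1) _ that(1)])
      (use that a2 closed in simp_all)
  have id: "klinear ?R ?R (\<lambda>p. p)" by (rule klinearI) simp_all
  have one: "\<one>\<^bsub>?R\<^esub> \<in> carrier ?R" by simp
  have l_one: "\<one>\<^bsub>?R\<^esub> \<otimes>\<^bsub>?R\<^esub> p = p" if "p \<in> carrier ?R" for p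
    by (rule eqI[OF lin(2)[OF one] id _ that]) simp
  have r_one: "p \<otimes>\<^bsub>?R\<^esub> \<one>\<^bsub>?R\<^esub> = p" if "p \<in> carrier ?R" for p
    by (rule eqI[OF lin(1)[OF one] id _ that]) simp
  show ?thesis
    by (rule kalgI[OF kvs_monoid_algebra closed one a3 l_one r_one])
      (simp_all only: monoid_algebra_sel monoid_algebra_mult_add monoid_algebra_mult_scale)
qed

section \<open>Tensor products\<close>

definition kbilinear ::
  "('k::field, 'm) module \<Rightarrow> ('k, 'n) module \<Rightarrow> ('k, 'p) module \<Rightarrow> ('m \<Rightarrow> 'n \<Rightarrow> 'p) \<Rightarrow> bool" where
  "kbilinear M N P f \<longleftrightarrow>
     (\<forall>y \<in> carrier N. klinear M P (\<lambda>x. f x y)) \<and> (\<forall>x \<in> carrier M. klinear N P (f x))"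

lemma kbilinearI:
  "(\<And>y. y \<in> carrier N \<Longrightarrow> klinear M P (\<lambda>x. f x y)) \<Longrightarrow> (\<And>x. x \<in> carrier M \<Longrightarrow> klinear N P (f x)) \<Longrightarrow>
    kbilinear M N P f"
  by (simp add: kbilinear_def)

lemma kbilinearD:
  "kbilinear M N P f \<Longrightarrow> y \<in> carrier N \<Longrightarrow> klinear M P (\<lambda>x. f x y)"
  "kbilinear M N P f \<Longrightarrow> x \<in> carrier M \<Longrightarrow> klinear N P (f x)"
  by (simp_all add: kbilinear_def)

lemma kbilinear_closed:
  "kbilinear M N P f \<Longrightarrow> x \<in> carrier M \<Longrightarrow> y \<in> carrier N \<Longrightarrow> f x y \<in> carrier P"
  using klinear_closed[OF kbilinearD(2)] .

abbreviation tensor_gens where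
  "tensor_gens M N \<equiv>
     {pt (x \<oplus>\<^bsub>M\<^esub> x', y) - pt (x, y) - pt (x', y) | x x' y.
         x \<in> carrier M \<and> x' \<in> carrier M \<and> y \<in> carrier N} \<union>
      {pt (x, y \<oplus>\<^bsub>N\<^esub> y') - pt (x, y) - pt (x, y') | x y y'.
         x \<in> carrier M \<and> y \<in> carrier N \<and> y' \<in> carrier N} \<union>
      {pt (c \<odot>\<^bsub>M\<^esub> x, y) - Poly_Mapping.single (x, y) c | c x y.
         x \<in> carrier M \<and> y \<in> carrier N} \<union>
      {pt (x, c \<odot>\<^bsub>N\<^esub> y) - Poly_Mapping.single (x, y) c | c x y.
         x \<in> carrier M \<and> y \<in> carrier N}"

lemma carrier_DirProd [simp]: "carrier (M \<times>\<times> N) = carrier M \<times> carrier N"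
  by (simp add: DirProd_def)

locale tensor_space = M: vspace M + N: vspace N
  for M :: "('k::field, 'm) module" and N :: "('k, 'n) module"
begin

abbreviation "F \<equiv> (monoid_algebra (M \<times>\<times> N) :: ('k, 'm \<times> 'n \<Rightarrow>\<^sub>0 'k) module)"

lemma tensor_gens_carrier: "tensor_gens M N \<subseteq> carrier F"
proof
  fix p :: "'m \<times> 'n \<Rightarrow>\<^sub>0 'k" assume p: "p \<in> tensor_gens M N"
  have k: "keys (single (x, y) c :: 'm \<times> 'n \<Rightarrow>\<^sub>0 'k) \<subseteq> carrier M \<times> carrier N"
    if "x \<in> carrier M" "y \<in> carrier N" for x y c
    using that by auto
  show "p \<in> carrier F"
    unfolding monoid_algebra_sel(1) carrier_DirProd mem_Collect_eq
    by (insert p[unfolded Un_iff mem_Collect_eq]; elim disjE exE conjE; hypsubst;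
        intro keys_diff_subset k M.a_closed N.a_closed M.smult_closed N.smult_closed; assumption)
qed

lemma subspace_tensor_rel: "submodule (tensor_rel M N) ring_of_type_algebra F"
  unfolding tensor_rel_def by (rule MA.subspace_kspan[OF tensor_gens_carrier])

lemma gen_in_rel: "p \<in> tensor_gens M N \<Longrightarrow> p \<in> tensor_rel M N"
  unfolding tensor_rel_def by (rule kspan_base)

lemma kvs_tensor: "kvs (tensor M N)"
  unfolding tensor_def by (rule MA.kvs_quot[OF subspace_tensor_rel])

sublocale T: vspace "tensor M N"
  by (rule vspace.intro[OF kvs_tensor])

abbreviation proj where "proj p \<equiv> tensor_rel M N +>\<^bsub>F\<^esub> p"

lemma klinear_proj: "klinear F (tensor M N) proj"
  unfolding tensor_def by (rule MA.klinear_coset[OF subspace_tensor_rel])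

lemma tens_proj: "tens M N x y = proj (pt (x, y))"
  by (simp add: tens_def)

lemma tens_closed [simp, intro]: "x \<in> carrier M \<Longrightarrow> y \<in> carrier N \<Longrightarrow> tens M N x y \<in> carrier (tensor M N)"
  unfolding tens_proj by (rule klinear_closed[OF klinear_proj]) simp

lemma kbilinear_tens: "kbilinear M N (tensor M N) (tens M N)"
proof -
  have mem: "pt (x, y) \<in> carrier F" if "x \<in> carrier M" "y \<in> carrier N" for x y
    using that by simp
  note coset_eq = MA.coset_eq_iff[OF subspace_tensor_rel, THEN iffD2]
  have diff: "p \<ominus>\<^bsub>F\<^esub> q = p - q" if "p \<in> carrier F" "q \<in> carrier F" for p q
    using that by (rule monoid_algebra_diff)
  have add: "proj p = proj q \<oplus>\<^bsub>tensor M N\<^esub> proj r"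
    if "p - q - r \<in> tensor_rel M N" "p \<in> carrier F" "q \<in> carrier F" "r \<in> carrier F" for p q r
  proof -
    have qr: "q \<oplus>\<^bsub>F\<^esub> r \<in> carrier F" using that(3,4) by (rule MA.a_closed)
    have "p \<ominus>\<^bsub>F\<^esub> (q \<oplus>\<^bsub>F\<^esub> r) = p - q - r"
      unfolding diff[OF that(2) qr] by (simp add: diff_diff_eq)
    with that(1) have "proj p = proj (q \<oplus>\<^bsub>F\<^esub> r)"
      by (intro coset_eq that qr) simp
    then show ?thesis by (simp only: klinear_add[OF klinear_proj that(3,4)])
  qed
  have smult: "proj p = c \<odot>\<^bsub>tensor M N\<^esub> proj (pt z)"
    if "p - single z c \<in> tensor_rel M N" "p \<in> carrier F" "pt z \<in> carrier F" for p z c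
  proof -
    have cz: "c \<odot>\<^bsub>F\<^esub> pt z \<in> carrier F" using that(3) by (rule MA.smult_closed)
    have "p \<ominus>\<^bsub>F\<^esub> (c \<odot>\<^bsub>F\<^esub> pt z) = p - single z c"
      unfolding diff[OF that(2) cz] by (simp add: single_eq_scale[symmetric])
    with that(1) have "proj p = proj (c \<odot>\<^bsub>F\<^esub> pt z)"
      by (intro coset_eq that cz) simp
    then show ?thesis by (simp only: klinear_smult[OF klinear_proj that(3)])
  qed
  show ?thesis
    by (intro kbilinearI klinearI tens_closed; (unfold tens_proj)?;
        (rule add[OF gen_in_rel] smult[OF gen_in_rel])?; (intro mem)?) blast+
qed

text \<open>Whatever representative the choice operator picks from \<open>t\<close>, it is an element of the free vector
  space that projects to \<open>t\<close>.\<close>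

lemma mem_carrier_tensor:
  assumes "t \<in> carrier (tensor M N)"
  obtains p where "p \<in> carrier F" "t = proj p" "(SOME p. p \<in> t) = p"
proof -
  from assms obtain q where q: "q \<in> carrier F" "t = proj q"
    by (auto simp: tensor_def carrier_quot)
  have "q \<in> t" unfolding q(2) using q(1) by (subst MA.mem_coset_iff[OF subspace_tensor_rel q(1)]) simp
  then have "(SOME p. p \<in> t) \<in> t" by (rule someI)
  then have "(SOME p. p \<in> t) \<in> carrier F" "t = proj (SOME p. p \<in> t)"
    unfolding q(2) by (simp_all only: MA.mem_coset_iff[OF subspace_tensor_rel q(1)])
  then show thesis by (rule that) simp
qed

lemma tensor_induct [consumes 1, case_names tens add smult]:
  assumes "t \<in> carrier (tensor M N)"
    and tens: "\<And>x y. x \<in> carrier M \<Longrightarrow> y \<in> carrier N \<Longrightarrow> Q (tens M N x y)"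
    and add: "\<And>s t. s \<in> carrier (tensor M N) \<Longrightarrow> t \<in> carrier (tensor M N) \<Longrightarrow> Q s \<Longrightarrow> Q t \<Longrightarrow>
      Q (s \<oplus>\<^bsub>tensor M N\<^esub> t)"
    and smult: "\<And>c t. t \<in> carrier (tensor M N) \<Longrightarrow> Q t \<Longrightarrow> Q (c \<odot>\<^bsub>tensor M N\<^esub> t)"
  shows "Q t"
proof -
  obtain p where p: "p \<in> carrier F" "t = proj p" by (rule mem_carrier_tensor[OF assms(1)])
  from p(1) have "keys p \<subseteq> carrier (M \<times>\<times> N)" by simp
  then have "Q (proj p)"
  proof (induction p rule: poly_mapping_single_induct)
    case zero
    have "Q (0 \<odot>\<^bsub>tensor M N\<^esub> tens M N \<zero>\<^bsub>M\<^esub> \<zero>\<^bsub>N\<^esub>)" by (intro smult tens tens_closed) auto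
    moreover have "proj 0 = \<zero>\<^bsub>tensor M N\<^esub>"
      using klinear_zero[OF kvs_monoid_algebra kvs_tensor klinear_proj] by simp
    ultimately show ?case by simp
  next
    case (add z c q)
    obtain x y where z: "z = (x, y)" "x \<in> carrier M" "y \<in> carrier N" using add(1) by auto
    have e: "proj (single z c + q) = c \<odot>\<^bsub>tensor M N\<^esub> tens M N x y \<oplus>\<^bsub>tensor M N\<^esub> proj q"
      using klinear_add[OF klinear_proj, of "single z c" q] klinear_smult[OF klinear_proj, of "pt z" c] add z
      by (simp add: single_eq_scale[symmetric] tens_proj)
    show ?case unfolding e
      by (intro assms(3) assms(4) tens tens_closed T.smult_closed z klinear_closed[OF klinear_proj] add) (use add in simp)
  qed
  with p show ?thesis by simp
qed

lemma tensor_eqI: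
  assumes P: "kvs P" and f: "klinear (tensor M N) P f" and g: "klinear (tensor M N) P g"
    and "\<And>x y. x \<in> carrier M \<Longrightarrow> y \<in> carrier N \<Longrightarrow> f (tens M N x y) = g (tens M N x y)"
    and "t \<in> carrier (tensor M N)"
  shows "f t = g t"
  using assms(5) by (induction rule: tensor_induct)
    (simp_all add: assms(4) klinear_add[OF f] klinear_add[OF g] klinear_smult[OF f] klinear_smult[OF g])

text \<open>The universal property of the tensor product.\<close>

lemma
  assumes P: "kvs P" and f: "kbilinear M N P f"
  shows klinear_tens_ext: "klinear (tensor M N) P (tens_ext P f)"
    and tens_ext_tens: "x \<in> carrier M \<Longrightarrow> y \<in> carrier N \<Longrightarrow> tens_ext P f (tens M N x y) = f x y"
proof -
  interpret P: vspace P by (rule vspace.intro[OF P])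
  let ?g = "\<lambda>(x, y). f x y"
  let ?f = "free_ext P ?g"
  have g: "?g \<in> carrier (M \<times>\<times> N) \<rightarrow> carrier P"
    using kbilinear_closed[OF f] by auto
  have F: "klinear F P ?f" by (rule P.klinear_free_ext[OF g])
  have F_diff: "?f (p - q) = ?f p \<ominus>\<^bsub>P\<^esub> ?f q" if "p \<in> carrier F" "q \<in> carrier F" for p q
    using klinear_diff[OF kvs_monoid_algebra P F that] by (simp only: monoid_algebra_diff[OF that])
  have F_pt: "?f (pt (x, y)) = f x y" if "x \<in> carrier M" "y \<in> carrier N" for x y
    using kbilinear_closed[OF f that] by simp
  have F_single: "?f (single (x, y) c) = c \<odot>\<^bsub>P\<^esub> f x y" if "x \<in> carrier M" "y \<in> carrier N" for x y c
    using kbilinear_closed[OF f that] by (simp add: P.free_ext_single)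
  have s: "single (x, y) c \<in> carrier F" if "x \<in> carrier M" "y \<in> carrier N" for x y c
    using that by simp
  have s2: "p - q \<in> carrier F" if "p \<in> carrier F" "q \<in> carrier F" for p q :: "'m \<times> 'n \<Rightarrow>\<^sub>0 'k"
    using that by (simp add: keys_diff_subset)
  have cancel: "(a \<oplus>\<^bsub>P\<^esub> b) \<ominus>\<^bsub>P\<^esub> a \<ominus>\<^bsub>P\<^esub> b = \<zero>\<^bsub>P\<^esub>" if "a \<in> carrier P" "b \<in> carrier P" for a b
    using that by (simp add: P.a_comm[of a b] P.add_diff_cancel P.diff_eq_zero_iff)
  have cancel2: "a \<ominus>\<^bsub>P\<^esub> a = \<zero>\<^bsub>P\<^esub>" if "a \<in> carrier P" for a
    using that by (simp add: P.diff_eq_zero_iff)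
  have gens: "tensor_gens M N \<subseteq> {p \<in> carrier F. ?f p \<in> {\<zero>\<^bsub>P\<^esub>}}"
    using f
    by (auto simp only: s2 s F_diff F_pt F_single M.a_closed N.a_closed M.smult_closed N.smult_closed
        mem_Collect_eq insert_iff empty_iff simp_thms
        klinear_add[OF kbilinearD(1)[OF f]] klinear_add[OF kbilinearD(2)[OF f]]
        klinear_smult[OF kbilinearD(1)[OF f]] klinear_smult[OF kbilinearD(2)[OF f]]
        cancel cancel2 kbilinear_closed[OF f] P.smult_closed P.smult_1 P.a_closed)
  have "tensor_rel M N \<subseteq> {p \<in> carrier F. ?f p \<in> {\<zero>\<^bsub>P\<^esub>}}"
    unfolding tensor_rel_def
    by (rule MA.kspan_least[OF subspace_kernel[OF kvs_monoid_algebra P F P.subspace_zero] gens])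
  then have ker: "?f p = \<zero>\<^bsub>P\<^esub>" if "p \<in> tensor_rel M N" for p using that by auto
  note factor = MA.quot_factor_linear[OF subspace_tensor_rel P F]
  have ext: "tens_ext P f (proj p) = ?f p" if p: "p \<in> carrier F" for p
  proof -
    have "p \<in> proj p" using p by (subst MA.mem_coset_iff[OF subspace_tensor_rel p]) simp
    then have "(SOME q. q \<in> proj p) \<in> proj p" by (rule someI)
    from factor(2)[OF ker p this] show ?thesis by (simp add: tens_ext_def)
  qed
  then show "tens_ext P f (tens M N x y) = f x y" if "x \<in> carrier M" "y \<in> carrier N"
    using s[OF that, of 1] by (simp only: tens_proj F_pt[OF that])
  obtain h where h: "klinear (tensor M N) P h" "\<And>p. p \<in> carrier F \<Longrightarrow> h (proj p) = ?f p"
    using factor(1)[OF ker] unfolding tensor_def by auto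
  show "klinear (tensor M N) P (tens_ext P f)"
  proof (rule klinear_cong[OF kvs_tensor h(1)])
    fix t assume "t \<in> carrier (tensor M N)"
    then obtain p where "p \<in> carrier F" "t = proj p" by (rule mem_carrier_tensor)
    then show "tens_ext P f t = h t" by (simp only: ext h(2))
  qed
qed

lemma tens_ext_closed:
  assumes "kvs P" "\<And>x y. x \<in> carrier M \<Longrightarrow> y \<in> carrier N \<Longrightarrow> f x y \<in> carrier P"
    "t \<in> carrier (tensor M N)"
  shows "tens_ext P f t \<in> carrier P"
proof -
  obtain p where p: "p \<in> carrier F" "(SOME p. p \<in> t) = p" by (rule mem_carrier_tensor[OF assms(3)])
  interpret P: vspace P by (rule vspace.intro[OF assms(1)])
  show ?thesis unfolding tens_ext_def p(2)
    by (rule P.free_ext_closed) (use p(1) assms(2) in auto)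
qed

lemma tens_ext_cong:
  assumes "kvs P" "\<And>x y. x \<in> carrier M \<Longrightarrow> y \<in> carrier N \<Longrightarrow> g x y \<in> carrier P"
    "\<And>x y. x \<in> carrier M \<Longrightarrow> y \<in> carrier N \<Longrightarrow> f x y = g x y"
    "t \<in> carrier (tensor M N)"
  shows "tens_ext P f t = tens_ext P g t"
proof -
  obtain p where p: "p \<in> carrier F" "(SOME p. p \<in> t) = p" by (rule mem_carrier_tensor[OF assms(4)])
  interpret P: vspace P by (rule vspace.intro[OF assms(1)])
  show ?thesis unfolding tens_ext_def p(2)
    by (rule P.free_ext_cong) (use p(1) assms(2,3) in auto)
qed

text \<open>Both sides are computed on the same chosen representative of \<open>t\<close>.\<close>

lemma klinear_tens_ext_comp:
  assumes "kvs P" "kvs Q" "klinear P Q h"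
    "\<And>x y. x \<in> carrier M \<Longrightarrow> y \<in> carrier N \<Longrightarrow> f x y \<in> carrier P" "t \<in> carrier (tensor M N)"
  shows "h (tens_ext P f t) = tens_ext Q (\<lambda>x y. h (f x y)) t"
proof -
  obtain p where p: "p \<in> carrier F" "(SOME p. p \<in> t) = p" by (rule mem_carrier_tensor[OF assms(5)])
  have "(\<lambda>(x, y). f x y) \<in> keys p \<rightarrow> carrier P" using p(1) assms(4) by auto
  from klinear_free_ext_comp[OF assms(1-3) this] show ?thesis
    unfolding tens_ext_def p(2) by (simp add: case_prod_unfold)
qed

text \<open>For a fixed \<open>t\<close> the chosen representative does not depend on the parameter, so linearity in the
  parameter holds summand by summand.\<close>

lemma klinear_tens_ext_param:
  assumes "kvs L" "kvs P" "t \<in> carrier (tensor M N)"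
    "\<And>x y. x \<in> carrier M \<Longrightarrow> y \<in> carrier N \<Longrightarrow> klinear L P (\<lambda>u. f u x y)"
  shows "klinear L P (\<lambda>u. tens_ext P (f u) t)"
proof -
  obtain p where p: "p \<in> carrier F" "(SOME p. p \<in> t) = p" by (rule mem_carrier_tensor[OF assms(3)])
  have "klinear L P (\<lambda>u. free_ext P (\<lambda>z. case z of (x, y) \<Rightarrow> f u x y) p)"
    by (rule klinear_combination[OF assms(1,2)]) (use p(1) assms(4) in auto)
  then show ?thesis unfolding tens_ext_def p(2) .
qed

end

lemma dirsum_sel [simp]:
  "carrier (dirsum M N) = carrier M \<times> carrier N"
  "(x, y) \<oplus>\<^bsub>dirsum M N\<^esub> (x', y') = (x \<oplus>\<^bsub>M\<^esub> x', y \<oplus>\<^bsub>N\<^esub> y')"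
  "c \<odot>\<^bsub>dirsum M N\<^esub> (x, y) = (c \<odot>\<^bsub>M\<^esub> x, c \<odot>\<^bsub>N\<^esub> y)"
  "\<zero>\<^bsub>dirsum M N\<^esub> = (\<zero>\<^bsub>M\<^esub>, \<zero>\<^bsub>N\<^esub>)"
  by (simp_all add: dirsum_def ring.defs RDirProd_def DirProd_def monoid.defs)

lemma kvs_dirsum:
  assumes "kvs M" "kvs N" shows "kvs (dirsum M N)"
proof -
  interpret M: vspace M by (rule vspace.intro[OF assms(1)])
  interpret N: vspace N by (rule vspace.intro[OF assms(2)])
  have "abelian_group (dirsum M N)"
  proof (rule abelian_groupI)
    fix z assume "z \<in> carrier (dirsum M N)"
    then show "\<exists>z'\<in>carrier (dirsum M N). z' \<oplus>\<^bsub>dirsum M N\<^esub> z = \<zero>\<^bsub>dirsum M N\<^esub>"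
      by (intro bexI[of _ "(\<ominus>\<^bsub>M\<^esub> fst z, \<ominus>\<^bsub>N\<^esub> snd z)"]) (auto simp: M.l_neg N.l_neg)
  qed (auto simp: M.a_ac N.a_ac)
  then show ?thesis
    by (intro moduleI cring_from_type_algebra)
      (auto simp: M.smult_add_left N.smult_add_left M.smult_add_right N.smult_add_right
        M.smult_smult N.smult_smult)
qed

section \<open>Tensor algebras and symmetric algebras\<close>

lemma monoid_word_monoid: "monoid (word_monoid W)"
  by (rule monoidI) auto

abbreviation talg_gens where
  "talg_gens W \<equiv> {pt [x \<oplus>\<^bsub>W\<^esub> y] - pt [x] - pt [y] | x y. x \<in> carrier W \<and> y \<in> carrier W} \<union>
      {pt [c \<odot>\<^bsub>W\<^esub> x] - Poly_Mapping.single [x] c | c x. x \<in> carrier W}"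

locale tensor_algebra = W: vspace W for W :: "('k::field, 'w) module"
begin

abbreviation "F \<equiv> (monoid_algebra (word_monoid (carrier W)) :: ('k, 'w list \<Rightarrow>\<^sub>0 'k) module)"

sublocale F: kalgebra "monoid_algebra (word_monoid (carrier W)) :: ('k, 'w list \<Rightarrow>\<^sub>0 'k) module"
  by (rule kalgebra.intro[OF kalg_monoid_algebra[OF monoid_word_monoid]])

lemma pt_closed: "ws \<in> lists (carrier W) \<Longrightarrow> pt ws \<in> carrier F"
  by simp

lemma talg_gens_carrier: "talg_gens W \<subseteq> carrier F"
proof
  fix p :: "'w list \<Rightarrow>\<^sub>0 'k" assume p: "p \<in> talg_gens W"
  have k: "keys (single [x] c :: 'w list \<Rightarrow>\<^sub>0 'k) \<subseteq> lists (carrier W)" if "x \<in> carrier W" for x c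
    using that by auto
  show "p \<in> carrier F"
    unfolding monoid_algebra_sel(1) monoid.simps partial_object.simps mem_Collect_eq
    by (insert p[unfolded Un_iff mem_Collect_eq]; elim disjE exE conjE; hypsubst;
        intro keys_diff_subset k W.a_closed W.smult_closed; assumption)
qed

lemma ideal_talg_rel: "ideal (talg_rel W) F"
  unfolding talg_rel_def by (rule F.genideal_ideal[OF talg_gens_carrier])

lemma kalg_talg: "kalg (talg W)"
  unfolding talg_def by (rule F.kalg_quot[OF ideal_talg_rel])

sublocale T: kalgebra "talg W"
  by (rule kalgebra.intro[OF kalg_talg])

definition tproj :: "('w list \<Rightarrow>\<^sub>0 'k) \<Rightarrow> ('w list \<Rightarrow>\<^sub>0 'k) set" where
  "tproj p = talg_rel W +>\<^bsub>F\<^esub> p"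

lemma alg_hom_tproj: "tproj \<in> alg_hom F (talg W)"
  using F.alg_hom_coset[OF ideal_talg_rel] unfolding talg_def tproj_def[abs_def] .

lemmas tproj = alg_homD[OF alg_hom_tproj]

lemma talg_in_tproj: "talg_in W x = tproj (pt [x])"
  by (simp add: talg_in_def tproj_def)

lemma carrier_talg: "carrier (talg W) = tproj ` carrier F"
  unfolding talg_def tproj_def[abs_def] by (rule carrier_quot)

lemma talg_in_closed [simp, intro]: "x \<in> carrier W \<Longrightarrow> talg_in W x \<in> carrier (talg W)"
  unfolding talg_in_tproj by (rule tproj(3)) simp

lemma tproj_eq_zero: "p \<in> talg_rel W \<Longrightarrow> tproj p = \<zero>\<^bsub>talg W\<^esub>"
proof -
  assume "p \<in> talg_rel W"
  then have "talg_rel W +>\<^bsub>F\<^esub> p = talg_rel W"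
    using MA.coset_eq_zero_iff[OF F.ideal_subspace[OF ideal_talg_rel] ideal.Icarr[OF ideal_talg_rel]]
    by blast
  then show ?thesis by (simp add: tproj_def talg_def)
qed

lemma tproj_diff:
  "p \<in> carrier F \<Longrightarrow> q \<in> carrier F \<Longrightarrow> tproj (p - q) = tproj p \<ominus>\<^bsub>talg W\<^esub> tproj q"
  using klinear_diff[OF kvs_monoid_algebra T.kvs tproj(1), of p q] monoid_algebra_diff[of p "word_monoid (carrier W)" q]
  by simp

lemma klinear_talg_in: "klinear W (talg W) (talg_in W)"
proof (rule klinearI)
  have gen: "p \<in> talg_gens W \<Longrightarrow> tproj p = \<zero>\<^bsub>talg W\<^esub>" for p
    by (rule tproj_eq_zero, unfold talg_rel_def, rule subsetD[OF F.genideal_self[OF talg_gens_carrier]])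
  have mem: "pt [x] \<in> carrier F" if "x \<in> carrier W" for x using that by simp
  have mem2: "p - q \<in> carrier F" if "p \<in> carrier F" "q \<in> carrier F" for p q :: "'w list \<Rightarrow>\<^sub>0 'k"
    using that by (simp add: keys_diff_subset)
  fix x y assume x: "x \<in> carrier W" and y: "y \<in> carrier W"
  have "tproj (pt [x \<oplus>\<^bsub>W\<^esub> y] - pt [x] - pt [y]) = \<zero>\<^bsub>talg W\<^esub>"
    by (rule gen) (use x y in blast)
  then have "talg_in W (x \<oplus>\<^bsub>W\<^esub> y) \<ominus>\<^bsub>talg W\<^esub> talg_in W x = talg_in W y"
    using x y mem
    by (simp only: tproj_diff mem2 mem W.a_closed T.diff_eq_zero_iff tproj(3) T.minus_closed talg_in_tproj)
  then show "talg_in W (x \<oplus>\<^bsub>W\<^esub> y) = talg_in W x \<oplus>\<^bsub>talg W\<^esub> talg_in W y"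
    using T.diff_add_cancel[of "talg_in W (x \<oplus>\<^bsub>W\<^esub> y)" "talg_in W x"] x y
    by (simp add: T.a_comm)
next
  fix c x assume x: "x \<in> carrier W"
  have s: "single [x] c \<in> carrier F" using x by simp
  have "pt [c \<odot>\<^bsub>W\<^esub> x] - single [x] c \<in> talg_rel W"
    by (unfold talg_rel_def, rule subsetD[OF F.genideal_self[OF talg_gens_carrier]]) (use x in blast)
  then have "tproj (pt [c \<odot>\<^bsub>W\<^esub> x]) \<ominus>\<^bsub>talg W\<^esub> tproj (single [x] c) = \<zero>\<^bsub>talg W\<^esub>"
    using tproj_eq_zero x s by (subst tproj_diff[symmetric]) simp_all
  then have "tproj (pt [c \<odot>\<^bsub>W\<^esub> x]) = tproj (single [x] c)"
    using x s by (subst (asm) T.diff_eq_zero_iff) (simp_all add: tproj(3))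
  also have "\<dots> = c \<odot>\<^bsub>talg W\<^esub> tproj (pt [x])"
    using tproj(5)[of "pt [x]" c] x by (simp add: single_eq_scale[symmetric])
  finally show "talg_in W (c \<odot>\<^bsub>W\<^esub> x) = c \<odot>\<^bsub>talg W\<^esub> talg_in W x" by (simp add: talg_in_tproj)
qed simp

lemma tproj_Cons:
  assumes "w \<in> carrier W" "ws \<in> lists (carrier W)"
  shows "tproj (pt (w # ws)) = talg_in W w \<otimes>\<^bsub>talg W\<^esub> tproj (pt ws)"
proof -
  have "pt (w # ws) = pt [w] \<otimes>\<^bsub>F\<^esub> pt ws" by simp
  then show ?thesis using assms by (simp only: talg_in_tproj) (rule tproj(6); simp)
qed

lemma tproj_Nil: "tproj (pt []) = \<one>\<^bsub>talg W\<^esub>"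
  using tproj(7) by simp

lemma talg_induct [consumes 1, case_names word add smult]:
  assumes "t \<in> carrier (talg W)"
    and word: "\<And>ws. ws \<in> lists (carrier W) \<Longrightarrow> Q (tproj (pt ws))"
    and add: "\<And>s t. s \<in> carrier (talg W) \<Longrightarrow> t \<in> carrier (talg W) \<Longrightarrow> Q s \<Longrightarrow> Q t \<Longrightarrow> Q (s \<oplus>\<^bsub>talg W\<^esub> t)"
    and smult: "\<And>c t. t \<in> carrier (talg W) \<Longrightarrow> Q t \<Longrightarrow> Q (c \<odot>\<^bsub>talg W\<^esub> t)"
  shows "Q t"
proof -
  obtain p where p: "p \<in> carrier F" "t = tproj p" using assms(1) carrier_talg by blast
  from p(1) have "keys p \<subseteq> lists (carrier W)" by simp
  then have "Q (tproj p)"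
  proof (induction p rule: poly_mapping_single_induct)
    case zero
    have "Q (0 \<odot>\<^bsub>talg W\<^esub> tproj (pt []))" by (intro smult word tproj(3)) auto
    moreover have "tproj 0 = \<zero>\<^bsub>talg W\<^esub>"
      using klinear_zero[OF kvs_monoid_algebra T.kvs tproj(1)] by simp
    moreover have "tproj (pt []) \<in> carrier (talg W)" by (rule tproj(3)) simp
    ultimately show ?case by simp
  next
    case (add ws c q)
    have mem: "tproj (pt ws) \<in> carrier (talg W)" "tproj q \<in> carrier (talg W)"
      using add by (auto intro!: tproj(3))
    have e: "tproj (single ws c + q) = c \<odot>\<^bsub>talg W\<^esub> tproj (pt ws) \<oplus>\<^bsub>talg W\<^esub> tproj q"
      using tproj(4)[of "single ws c" q] tproj(5)[of "pt ws" c] add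
      by (simp add: single_eq_scale[symmetric])
    show ?case unfolding e
      by (intro assms(3) assms(4) word mem T.smult_closed add)
  qed
  with p show ?thesis by simp
qed

text \<open>The universal property of the tensor algebra.\<close>

lemma talg_lift:
  assumes P: "kalg P" and f: "klinear W P f"
  shows "\<exists>h \<in> alg_hom (talg W) P. \<forall>x \<in> carrier W. h (talg_in W x) = f x"
proof -
  interpret P: kalgebra P by (rule kalgebra.intro[OF P])
  define g where "g ws = foldr (\<lambda>w a. f w \<otimes>\<^bsub>P\<^esub> a) ws \<one>\<^bsub>P\<^esub>" for ws
  have fc: "f w \<in> carrier P" if "w \<in> carrier W" for w using that by (rule klinear_closed[OF f])
  have gc: "g ws \<in> carrier P" if "ws \<in> lists (carrier W)" for ws
    using that by (induction ws) (auto simp: g_def fc)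
  have g_append: "g (us @ ws) = g us \<otimes>\<^bsub>P\<^esub> g ws"
    if "us \<in> lists (carrier W)" "ws \<in> lists (carrier W)" for us ws
    using that(1)
  proof (induction us)
    case Nil
    have "g [] = \<one>\<^bsub>P\<^esub>" by (simp add: g_def)
    then show ?case using gc[OF that(2)] by simp
  next
    case (Cons u us)
    have "g (u # vs) = f u \<otimes>\<^bsub>P\<^esub> g vs" for vs by (simp add: g_def)
    then show ?case using Cons gc that(2) fc by (simp add: P.m_assoc)
  qed
  let ?G = "free_ext P g"
  have G: "klinear F P ?G" by (rule P.klinear_free_ext) (use gc in auto)
  have G_pt: "?G (pt ws) = g ws" if "ws \<in> lists (carrier W)" for ws using gc[OF that] by simp
  have linr: "klinear P P (\<lambda>x. x \<otimes>\<^bsub>P\<^esub> y)" and linl: "klinear P P (\<lambda>x. y \<otimes>\<^bsub>P\<^esub> x)" if "y \<in> carrier P" for y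
    using that by (auto intro!: klinearI simp: P.l_distr P.r_distr P.mult_smult_left P.mult_smult_right)
  have Flin: "klinear F F (\<lambda>x. x \<otimes>\<^bsub>F\<^esub> y)" "klinear F F (\<lambda>x. y \<otimes>\<^bsub>F\<^esub> x)" if "y \<in> carrier F" for y
    using that by (auto intro!: klinearI simp: monoid_algebra_mult_add monoid_algebra_mult_scale
      simp del: monoid_algebra_sel(1) intro: F.m_closed)
  have m1: "?G (pt us \<otimes>\<^bsub>F\<^esub> q) = ?G (pt us) \<otimes>\<^bsub>P\<^esub> ?G q"
    if "us \<in> lists (carrier W)" "q \<in> carrier F" for us q
    by (rule klinear_monoid_algebra_eqI[OF P.kvs klinear_comp[OF Flin(2) G] klinear_comp[OF G linl] _ that(2)])
      (use that gc in \<open>simp_all add: g_append\<close>)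
  have m2: "?G (p \<otimes>\<^bsub>F\<^esub> q) = ?G p \<otimes>\<^bsub>P\<^esub> ?G q" if "p \<in> carrier F" "q \<in> carrier F" for p q
    by (rule klinear_monoid_algebra_eqI[OF P.kvs klinear_comp[OF Flin(1) G] klinear_comp[OF G linr] _ that(1)])
      (use that m1 klinear_closed[OF G] in simp_all)
  have hom: "?G \<in> alg_hom F P"
    by (rule alg_homI[OF G m2]) (simp_all add: g_def)
  have g1: "g [w] = f w" if "w \<in> carrier W" for w using fc[OF that] by (simp add: g_def)
  have s: "single [x] c \<in> carrier F" if "x \<in> carrier W" for x c using that by simp
  have s2: "p - q \<in> carrier F" if "p \<in> carrier F" "q \<in> carrier F" for p q :: "'w list \<Rightarrow>\<^sub>0 'k"
    using that by (simp add: keys_diff_subset)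
  have G_diff: "?G (p - q) = ?G p \<ominus>\<^bsub>P\<^esub> ?G q" if "p \<in> carrier F" "q \<in> carrier F" for p q
    using klinear_diff[OF kvs_monoid_algebra P.kvs G that] by (simp only: monoid_algebra_diff[OF that])
  have G_single: "?G (single [x] c) = c \<odot>\<^bsub>P\<^esub> f x" if "x \<in> carrier W" for x c
    using g1[OF that] fc[OF that] by (simp add: P.free_ext_single)
  have cancel: "(a \<oplus>\<^bsub>P\<^esub> b) \<ominus>\<^bsub>P\<^esub> a \<ominus>\<^bsub>P\<^esub> b = \<zero>\<^bsub>P\<^esub>" if "a \<in> carrier P" "b \<in> carrier P" for a b
    using that by (simp add: P.a_comm[of a b] P.add_diff_cancel P.diff_eq_zero_iff)
  have cancel2: "a \<ominus>\<^bsub>P\<^esub> a = \<zero>\<^bsub>P\<^esub>" if "a \<in> carrier P" for a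
    using that by (simp add: P.diff_eq_zero_iff)
  have "?G p = \<zero>\<^bsub>P\<^esub>" if p: "p \<in> talg_gens W" for p
    by (insert p[unfolded Un_iff mem_Collect_eq]; elim disjE exE conjE; hypsubst)
      (simp_all only: s2 s G_diff G_single W.a_closed W.smult_closed klinear_add[OF f]
        klinear_smult[OF f] cancel cancel2 fc P.smult_closed P.smult_1 P.a_closed)
  from F.quot_Idl_factor[OF talg_gens_carrier P hom this] obtain h where
    h: "h \<in> alg_hom (talg W) P" "\<forall>p \<in> carrier F. h (tproj p) = ?G p"
    unfolding talg_def talg_rel_def tproj_def by blast
  have "h (talg_in W x) = f x" if "x \<in> carrier W" for x
    using h(2) that g1[OF that] G_pt[of "[x]"] by (simp add: talg_in_tproj)
  with h(1) show ?thesis by blast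
qed

end

abbreviation sym_gens where
  "sym_gens V \<equiv> {(talg_in V v \<otimes>\<^bsub>talg V\<^esub> talg_in V v') \<ominus>\<^bsub>talg V\<^esub> (talg_in V v' \<otimes>\<^bsub>talg V\<^esub> talg_in V v) | v v'.
        v \<in> carrier V \<and> v' \<in> carrier V}"

text \<open>Symmetry is required for adjacent letters only: these transpositions generate all permutations,
  and they are what the relations of \<open>Sym(V)\<close> impose on words.\<close>

definition sym_multilinear :: "('k::field, 'v) module \<Rightarrow> ('k, 'n) module \<Rightarrow> ('v list \<Rightarrow> 'n) \<Rightarrow> bool" where
  "sym_multilinear V N g \<longleftrightarrow> (\<forall>ws \<in> lists (carrier V). g ws \<in> carrier N) \<and>
     (\<forall>u \<in> lists (carrier V). \<forall>w \<in> lists (carrier V). klinear V N (\<lambda>x. g (u @ x # w))) \<and>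
     (\<forall>u \<in> lists (carrier V). \<forall>w \<in> lists (carrier V). \<forall>x \<in> carrier V. \<forall>y \<in> carrier V.
        g (u @ x # y # w) = g (u @ y # x # w))"

locale symmetric_algebra = tensor_algebra V for V :: "('k::field, 'v) module"
begin

lemma sym_gens_carrier: "sym_gens V \<subseteq> carrier (talg V)"
  by auto

lemma ideal_sym_rel: "ideal (sym_rel V) (talg V)"
  unfolding sym_rel_def by (rule T.genideal_ideal[OF sym_gens_carrier])

lemma kalg_symalg: "kalg (symalg V)"
  unfolding symalg_def by (rule T.kalg_quot[OF ideal_sym_rel])

sublocale S: kalgebra "symalg V"
  by (rule kalgebra.intro[OF kalg_symalg])

definition sproj :: "('v list \<Rightarrow>\<^sub>0 'k) \<Rightarrow> ('v list \<Rightarrow>\<^sub>0 'k) set set" where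
  "sproj p = sym_rel V +>\<^bsub>talg V\<^esub> tproj p"

lemma alg_hom_sproj: "sproj \<in> alg_hom F (symalg V)"
  using alg_hom_comp[OF alg_hom_tproj T.alg_hom_coset[OF ideal_sym_rel]]
  unfolding symalg_def sproj_def[abs_def] .

lemmas sproj = alg_homD[OF alg_hom_sproj]

lemma klinear_sym_in: "klinear V (symalg V) (sym_in V)"
  using klinear_comp[OF klinear_talg_in alg_homD(1)[OF T.alg_hom_coset[OF ideal_sym_rel]]]
  unfolding symalg_def sym_in_def[abs_def] .

lemma sym_in_closed [simp, intro]: "v \<in> carrier V \<Longrightarrow> sym_in V v \<in> carrier (symalg V)"
  by (rule klinear_closed[OF klinear_sym_in])

definition sym_word :: "'v list \<Rightarrow> ('v list \<Rightarrow>\<^sub>0 'k) set set" where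
  "sym_word ws = foldr (\<lambda>v f. sym_in V v \<otimes>\<^bsub>symalg V\<^esub> f) ws \<one>\<^bsub>symalg V\<^esub>"

lemma sym_word_simps [simp]:
  "sym_word [] = \<one>\<^bsub>symalg V\<^esub>" "sym_word (v # ws) = sym_in V v \<otimes>\<^bsub>symalg V\<^esub> sym_word ws"
  by (simp_all add: sym_word_def)

lemma sym_word_closed [simp, intro]: "ws \<in> lists (carrier V) \<Longrightarrow> sym_word ws \<in> carrier (symalg V)"
  by (induction ws) auto

lemma sproj_pt: "ws \<in> lists (carrier V) \<Longrightarrow> sproj (pt ws) = sym_word ws"
proof (induction ws)
  case Nil
  show ?case using sproj(7) by simp
next
  case (Cons w ws)
  then have mem: "talg_in V w \<in> carrier (talg V)" "tproj (pt ws) \<in> carrier (talg V)"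
    by (auto intro!: tproj(3))
  have "sproj (pt (w # ws)) = sym_rel V +>\<^bsub>talg V\<^esub> (talg_in V w \<otimes>\<^bsub>talg V\<^esub> tproj (pt ws))"
    using Cons by (simp add: sproj_def tproj_Cons)
  also have "\<dots> = sym_in V w \<otimes>\<^bsub>symalg V\<^esub> sproj (pt ws)"
    unfolding symalg_def sym_in_def sproj_def by (rule T.quot_mult[OF ideal_sym_rel mem, symmetric])
  finally show ?case using Cons by simp
qed

lemma sym_in_commute:
  assumes "v \<in> carrier V" "w \<in> carrier V"
  shows "sym_in V v \<otimes>\<^bsub>symalg V\<^esub> sym_in V w = sym_in V w \<otimes>\<^bsub>symalg V\<^esub> sym_in V v"
proof -
  have "(talg_in V v \<otimes>\<^bsub>talg V\<^esub> talg_in V w) \<ominus>\<^bsub>talg V\<^esub> (talg_in V w \<otimes>\<^bsub>talg V\<^esub> talg_in V v) \<in> sym_rel V"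
    unfolding sym_rel_def by (rule subsetD[OF T.genideal_self[OF sym_gens_carrier]]) (use assms in blast)
  then have "sym_rel V +>\<^bsub>talg V\<^esub> (talg_in V v \<otimes>\<^bsub>talg V\<^esub> talg_in V w) =
      sym_rel V +>\<^bsub>talg V\<^esub> (talg_in V w \<otimes>\<^bsub>talg V\<^esub> talg_in V v)"
    using assms by (subst T.coset_eq_iff[OF T.ideal_subspace[OF ideal_sym_rel]]) auto
  then show ?thesis
    using assms unfolding symalg_def sym_in_def by (simp add: T.quot_mult[OF ideal_sym_rel])
qed

lemma mem_carrier_symalg:
  assumes "f \<in> carrier (symalg V)"
  obtains p where "p \<in> carrier F" "f = sproj p" "(SOME p. p \<in> \<Union>f) = p"
proof -
  note cosetT = T.mem_coset_iff[OF T.ideal_subspace[OF ideal_sym_rel]]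
  note cosetF = MA.mem_coset_iff[OF F.ideal_subspace[OF ideal_talg_rel]]
  from assms obtain t where t: "t \<in> carrier (talg V)" "f = sym_rel V +>\<^bsub>talg V\<^esub> t"
    unfolding symalg_def carrier_quot by blast
  then obtain q where q: "q \<in> carrier F" "t = tproj q" unfolding carrier_talg by blast
  have "q \<in> t" using q by (simp add: tproj_def cosetF del: monoid_algebra_sel)
  moreover have "t \<in> f" unfolding t(2) by (subst cosetT[OF t(1)]) (simp add: t(1))
  ultimately have "q \<in> \<Union>f" by blast
  then have "(SOME p. p \<in> \<Union>f) \<in> \<Union>f" by (rule someI)
  then obtain t' where t': "(SOME p. p \<in> \<Union>f) \<in> t'" "t' \<in> f" by blast
  from t'(2) have t'f: "t' \<in> carrier (talg V)" "f = sym_rel V +>\<^bsub>talg V\<^esub> t'"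
    unfolding t(2) cosetT[OF t(1)] by simp_all
  then obtain q' where q': "q' \<in> carrier F" "t' = tproj q'" unfolding carrier_talg by blast
  from t'(1) have "(SOME p. p \<in> \<Union>f) \<in> carrier F" "tproj (SOME p. p \<in> \<Union>f) = t'"
    unfolding q'(2) tproj_def cosetF[OF q'(1)] by blast+
  with t'f(2) show thesis by (intro that[of "SOME p. p \<in> \<Union>f"]) (auto simp: sproj_def)
qed

lemma sym_induct [consumes 1, case_names word add smult]:
  assumes "f \<in> carrier (symalg V)"
    and word: "\<And>ws. ws \<in> lists (carrier V) \<Longrightarrow> Q (sym_word ws)"
    and add: "\<And>s t. s \<in> carrier (symalg V) \<Longrightarrow> t \<in> carrier (symalg V) \<Longrightarrow> Q s \<Longrightarrow> Q t \<Longrightarrow> Q (s \<oplus>\<^bsub>symalg V\<^esub> t)"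
    and smult: "\<And>c t. t \<in> carrier (symalg V) \<Longrightarrow> Q t \<Longrightarrow> Q (c \<odot>\<^bsub>symalg V\<^esub> t)"
  shows "Q f"
proof -
  note quot = T.klinear_coset[OF T.ideal_subspace[OF ideal_sym_rel], folded symalg_def]
  obtain t where t: "t \<in> carrier (talg V)" "f = sym_rel V +>\<^bsub>talg V\<^esub> t"
    using assms(1) unfolding symalg_def carrier_quot by blast
  from t(1) have "Q (sym_rel V +>\<^bsub>talg V\<^esub> t)"
  proof (induction rule: talg_induct)
    case (word ws)
    then show ?case using assms(2)[OF word] sproj_pt[OF word] by (simp add: sproj_def)
  next
    case (add s t)
    then show ?case by (simp only: klinear_add[OF quot]) (intro assms(3) klinear_closed[OF quot])
  next
    case (smult c t)
    then show ?case by (simp only: klinear_smult[OF quot]) (intro assms(4) klinear_closed[OF quot])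
  qed
  with t show ?thesis by simp
qed

lemma sym_eqI:
  assumes P: "kvs P" and f: "klinear (symalg V) P f" and g: "klinear (symalg V) P g"
    and "\<And>ws. ws \<in> lists (carrier V) \<Longrightarrow> f (sym_word ws) = g (sym_word ws)"
    and "t \<in> carrier (symalg V)"
  shows "f t = g t"
  using assms(5) by (induction rule: sym_induct)
    (simp_all add: assms(4) klinear_add[OF f] klinear_add[OF g] klinear_smult[OF f] klinear_smult[OF g])

text \<open>An ideal of the free algebra on \<open>V\<close> that contains the defining relations of \<open>Sym(V)\<close> contains
  the whole kernel of the projection, because \<open>Sym(V)\<close> then maps onto the quotient by that ideal.\<close>

lemma sproj_kernel:
  assumes I: "ideal I F" and tg: "talg_gens V \<subseteq> I"
    and comm: "\<And>v w. v \<in> carrier V \<Longrightarrow> w \<in> carrier V \<Longrightarrow> pt [v, w] - pt [w, v] \<in> I"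
    and p: "p \<in> carrier F" "sproj p = \<zero>\<^bsub>symalg V\<^esub>"
  shows "p \<in> I"
proof -
  let ?Q = "quot F I"
  interpret Q: kalgebra ?Q by (rule kalgebra.intro[OF F.kalg_quot[OF I]])
  note proj = F.alg_hom_coset[OF I]
  have zero: "I +>\<^bsub>F\<^esub> q = \<zero>\<^bsub>?Q\<^esub> \<longleftrightarrow> q \<in> I" if "q \<in> carrier F" for q
    using MA.coset_eq_zero_iff[OF F.ideal_subspace[OF I] that] by simp
  have "I +>\<^bsub>F\<^esub> q = \<zero>\<^bsub>?Q\<^esub>" if "q \<in> talg_gens V" for q
    using zero talg_gens_carrier that tg by blast
  from F.quot_Idl_factor[OF talg_gens_carrier Q.kalg proj this] obtain h where
    h: "h \<in> alg_hom (talg V) ?Q" "\<And>q. q \<in> carrier F \<Longrightarrow> h (tproj q) = I +>\<^bsub>F\<^esub> q"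
    unfolding talg_def talg_rel_def tproj_def by blast
  have "h x = \<zero>\<^bsub>?Q\<^esub>" if "x \<in> sym_gens V" for x
  proof -
    from that obtain v w where vw: "v \<in> carrier V" "w \<in> carrier V"
      and x: "x = (talg_in V v \<otimes>\<^bsub>talg V\<^esub> talg_in V w) \<ominus>\<^bsub>talg V\<^esub> (talg_in V w \<otimes>\<^bsub>talg V\<^esub> talg_in V v)"
      by blast
    have m: "talg_in V v \<otimes>\<^bsub>talg V\<^esub> talg_in V w = tproj (pt [v, w])"
      "talg_in V w \<otimes>\<^bsub>talg V\<^esub> talg_in V v = tproj (pt [w, v])"
      using vw tproj_Cons[of v "[w]"] tproj_Cons[of w "[v]"] by (simp_all add: talg_in_tproj)
    have mem: "pt [v, w] \<in> carrier F" "pt [w, v] \<in> carrier F" using vw by simp_all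
    have mem2: "pt [v, w] - pt [w, v] \<in> carrier F" using ideal.Icarr[OF I comm[OF vw]] .
    have "x = tproj (pt [v, w] - pt [w, v])" unfolding x m by (rule tproj_diff[OF mem, symmetric])
    then show ?thesis using h(2)[OF mem2] zero[OF mem2] comm[OF vw] by simp
  qed
  from T.quot_Idl_factor[OF sym_gens_carrier Q.kalg h(1) this] obtain h' where
    h': "h' \<in> alg_hom (symalg V) ?Q" "\<And>t. t \<in> carrier (talg V) \<Longrightarrow> h' (sym_rel V +>\<^bsub>talg V\<^esub> t) = h t"
    unfolding symalg_def sym_rel_def by blast
  have "h' (sproj p) = I +>\<^bsub>F\<^esub> p"
    unfolding sproj_def using h(2)[OF p(1)] h'(2)[OF tproj(3)[OF p(1)]] by simp
  moreover have "h' (sproj p) = \<zero>\<^bsub>?Q\<^esub>"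
    unfolding p(2) by (rule klinear_zero[OF S.kvs Q.kvs alg_homD(1)[OF h'(1)]])
  ultimately show ?thesis using zero[OF p(1)] by simp
qed

text \<open>Symmetric multilinear maps on words factor through \<open>Sym(V)\<close>: the polynomials all of whose
  multiples by words are annihilated form an ideal to which the preceding lemma applies.\<close>

lemma
  assumes N: "kvs N" and g: "sym_multilinear V N g"
  shows klinear_sym_ext: "klinear (symalg V) N (sym_ext N g)"
    and sym_ext_word: "ws \<in> lists (carrier V) \<Longrightarrow> sym_ext N g (sym_word ws) = g ws"
proof -
  interpret N: vspace N by (rule vspace.intro[OF N])
  let ?L = "lists (carrier V)"
  let ?G = "free_ext N g"
  have gc: "g ws \<in> carrier N" if "ws \<in> ?L" for ws using g that by (auto simp: sym_multilinear_def)
  have glin: "klinear V N (\<lambda>x. g (u @ x # w))" if "u \<in> ?L" "w \<in> ?L" for u w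
    using g that by (auto simp: sym_multilinear_def)
  have gsym: "g (u @ x # y # w) = g (u @ y # x # w)"
    if "u \<in> ?L" "w \<in> ?L" "x \<in> carrier V" "y \<in> carrier V" for u w x y
    using g that unfolding sym_multilinear_def by blast
  have G: "klinear F N ?G" by (rule N.klinear_free_ext) (use gc in auto)
  have G_pt: "?G (pt ws) = g ws" if "ws \<in> ?L" for ws using gc[OF that] by simp
  have Flin: "klinear F F (\<lambda>x. x \<otimes>\<^bsub>F\<^esub> y)" "klinear F F (\<lambda>x. y \<otimes>\<^bsub>F\<^esub> x)" if "y \<in> carrier F" for y
    using that by (auto intro!: klinearI simp: monoid_algebra_mult_add monoid_algebra_mult_scale
      simp del: monoid_algebra_sel(1) intro: F.m_closed)
  \<comment> \<open>The kernel of \<open>?G\<close> need not be an ideal; the set \<open>I\<close> below is the largest ideal inside it.\<close>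
  define H where "H u w p = ?G ((pt u \<otimes>\<^bsub>F\<^esub> p) \<otimes>\<^bsub>F\<^esub> pt w)" for u w p
  have H: "klinear F N (H u w)" if "u \<in> ?L" "w \<in> ?L" for u w
    unfolding H_def[abs_def]
    by (rule klinear_comp[OF klinear_comp[OF Flin(2) Flin(1)] G]) (use that in simp_all)
  have H_pt: "H u w (pt x) = g (u @ x @ w)" if "u \<in> ?L" "w \<in> ?L" "x \<in> ?L" for u w x
    using that G_pt[of "u @ x @ w"] by (simp add: H_def)
  define I where "I = {p \<in> carrier F. \<forall>u \<in> ?L. \<forall>w \<in> ?L. H u w p = \<zero>\<^bsub>N\<^esub>}"
  have zero: "klinear F N (\<lambda>_. \<zero>\<^bsub>N\<^esub>)" by (rule klinear_zero_fun[OF N])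
  have left: "H u w (q \<otimes>\<^bsub>F\<^esub> p) = \<zero>\<^bsub>N\<^esub>" if "p \<in> I" "q \<in> carrier F" "u \<in> ?L" "w \<in> ?L" for p q u w
  proof -
    have p: "p \<in> carrier F" using that(1) by (simp add: I_def)
    show ?thesis
    proof (rule klinear_monoid_algebra_eqI[OF N klinear_comp[OF Flin(1)[OF p] H[OF that(3,4)]] zero _ that(2)])
      fix x assume "x \<in> carrier (word_monoid (carrier V))"
      then have x: "x \<in> ?L" by simp
      have "pt u \<otimes>\<^bsub>F\<^esub> (pt x \<otimes>\<^bsub>F\<^esub> p) = pt (u @ x) \<otimes>\<^bsub>F\<^esub> p"
        using F.m_assoc[of "pt u" "pt x" p] p x that by simp
      then have "H u w (pt x \<otimes>\<^bsub>F\<^esub> p) = H (u @ x) w p" by (simp add: H_def)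
      then show "H u w (pt x \<otimes>\<^bsub>F\<^esub> p) = \<zero>\<^bsub>N\<^esub>" using that(1,3,4) x by (simp add: I_def)
    qed
  qed
  have right: "H u w (p \<otimes>\<^bsub>F\<^esub> q) = \<zero>\<^bsub>N\<^esub>" if "p \<in> I" "q \<in> carrier F" "u \<in> ?L" "w \<in> ?L" for p q u w
  proof -
    have p: "p \<in> carrier F" using that(1) by (simp add: I_def)
    show ?thesis
    proof (rule klinear_monoid_algebra_eqI[OF N klinear_comp[OF Flin(2)[OF p] H[OF that(3,4)]] zero _ that(2)])
      fix x assume "x \<in> carrier (word_monoid (carrier V))"
      then have x: "x \<in> ?L" by simp
      have c: "pt u \<in> carrier F" "pt x \<in> carrier F" "pt w \<in> carrier F" using that x by simp_all
      have "(pt u \<otimes>\<^bsub>F\<^esub> (p \<otimes>\<^bsub>F\<^esub> pt x)) \<otimes>\<^bsub>F\<^esub> pt w = (pt u \<otimes>\<^bsub>F\<^esub> p) \<otimes>\<^bsub>F\<^esub> (pt x \<otimes>\<^bsub>F\<^esub> pt w)"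
        using c p by (simp only: F.m_assoc F.m_closed)
      then have "H u w (p \<otimes>\<^bsub>F\<^esub> pt x) = H u (x @ w) p" by (simp add: H_def)
      then show "H u w (p \<otimes>\<^bsub>F\<^esub> pt x) = \<zero>\<^bsub>N\<^esub>" using that(1,3,4) x by (simp add: I_def)
    qed
  qed
  have "submodule I ring_of_type_algebra F"
  proof (rule MA.subspaceI)
    show "\<zero>\<^bsub>F\<^esub> \<in> I" unfolding I_def using klinear_zero[OF kvs_monoid_algebra N H] by auto
    fix p q c assume "p \<in> I" "q \<in> I"
    then show "p \<oplus>\<^bsub>F\<^esub> q \<in> I" unfolding I_def using klinear_add[OF H]
      by (auto simp del: monoid_algebra_sel intro: MA.a_closed)
  next
    fix p c assume "p \<in> I"
    then show "c \<odot>\<^bsub>F\<^esub> p \<in> I" unfolding I_def using klinear_smult[OF H]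
      by (auto simp del: monoid_algebra_sel intro: MA.smult_closed)
  qed (auto simp: I_def)
  then have ideal: "ideal I F"
    by (rule F.idealI_subspace) (use left right in \<open>auto simp: I_def simp del: monoid_algebra_sel intro: F.m_closed\<close>)
  have H_diff: "H u w (p - q) = H u w p \<ominus>\<^bsub>N\<^esub> H u w q"
    if "u \<in> ?L" "w \<in> ?L" "p \<in> carrier F" "q \<in> carrier F" for u w p q
    using klinear_diff[OF kvs_monoid_algebra N H[OF that(1,2)] that(3,4)] by (simp only: monoid_algebra_diff[OF that(3,4)])
  have H_single: "H u w (single [x] c) = c \<odot>\<^bsub>N\<^esub> g (u @ x # w)" if "u \<in> ?L" "w \<in> ?L" "x \<in> carrier V" for u w x c
    using klinear_smult[OF H[OF that(1,2)], of "pt [x]" c] H_pt[of u w "[x]"] that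
    by (simp add: single_eq_scale[symmetric])
  have s: "single [x] c \<in> carrier F" if "x \<in> carrier V" for x c using that by simp
  have s2: "p - q \<in> carrier F" if "p \<in> carrier F" "q \<in> carrier F" for p q :: "'v list \<Rightarrow>\<^sub>0 'k"
    using that by (simp add: keys_diff_subset)
  have gc1: "g (u @ x # w) \<in> carrier N" if "u \<in> ?L" "w \<in> ?L" "x \<in> carrier V" for u w x
    using that gc by simp
  have cancel: "(a \<oplus>\<^bsub>N\<^esub> b) \<ominus>\<^bsub>N\<^esub> a \<ominus>\<^bsub>N\<^esub> b = \<zero>\<^bsub>N\<^esub>" if "a \<in> carrier N" "b \<in> carrier N" for a b
    using that by (simp add: N.a_comm[of a b] N.add_diff_cancel N.diff_eq_zero_iff)
  have cancel2: "a \<ominus>\<^bsub>N\<^esub> a = \<zero>\<^bsub>N\<^esub>" if "a \<in> carrier N" for a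
    using that by (simp add: N.diff_eq_zero_iff)
  have tg: "talg_gens V \<subseteq> I"
  proof
    fix p assume p: "p \<in> talg_gens V"
    have "p \<in> carrier F" using p talg_gens_carrier by blast
    moreover have "H u w p = \<zero>\<^bsub>N\<^esub>" if uw: "u \<in> ?L" "w \<in> ?L" for u w
      by (insert p[unfolded Un_iff mem_Collect_eq]; elim disjE exE conjE; hypsubst)
        (simp_all only: H_diff[OF uw] H_single[OF uw] s s2 W.a_closed W.smult_closed klinear_add[OF glin[OF uw]]
          klinear_smult[OF glin[OF uw]] gc1[OF uw] cancel cancel2 N.smult_1 N.a_closed N.smult_closed)
    ultimately show "p \<in> I" by (simp add: I_def)
  qed
  have comm: "pt [v, w] - pt [w, v] \<in> I" if "v \<in> carrier V" "w \<in> carrier V" for v w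
  proof -
    have m: "pt [v, w] \<in> carrier F" "pt [w, v] \<in> carrier F" using that by simp_all
    have "H a b (pt [v, w] - pt [w, v]) = \<zero>\<^bsub>N\<^esub>" if "a \<in> ?L" "b \<in> ?L" for a b
      using gsym[OF that \<open>v \<in> carrier V\<close> \<open>w \<in> carrier V\<close>] gc[of "a @ w # v # b"]
        H_pt[OF that, of "[v, w]"] H_pt[OF that, of "[w, v]"] \<open>v \<in> carrier V\<close> \<open>w \<in> carrier V\<close> that
      by (simp add: H_diff[OF that m] cancel2)
    with s2[OF m] show ?thesis by (simp add: I_def)
  qed
  have ker: "?G p = \<zero>\<^bsub>N\<^esub>" if "p \<in> carrier F" "sproj p = \<zero>\<^bsub>symalg V\<^esub>" for p
  proof -
    have "p \<in> I" by (rule sproj_kernel[OF ideal tg comm that])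
    then have "H [] [] p = \<zero>\<^bsub>N\<^esub>" by (simp add: I_def)
    moreover have "(pt [] \<otimes>\<^bsub>F\<^esub> p) \<otimes>\<^bsub>F\<^esub> pt [] = p"
      using that(1) F.l_one[of p] F.r_one[of p] by simp
    ultimately show ?thesis by (simp add: H_def)
  qed
  have ext: "sym_ext N g (sproj p) = ?G p" if p: "p \<in> carrier F" for p
  proof -
    obtain q where q: "q \<in> carrier F" "sproj p = sproj q" "(SOME q. q \<in> \<Union>(sproj p)) = q"
      by (rule mem_carrier_symalg[OF sproj(3)[OF p]])
    have "sproj (p \<ominus>\<^bsub>F\<^esub> q) = \<zero>\<^bsub>symalg V\<^esub>"
      using klinear_diff[OF kvs_monoid_algebra S.kvs sproj(1) p q(1)] q(2) sproj(3)[OF q(1)]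
      by (simp add: S.diff_eq_zero_iff)
    then have "?G p \<ominus>\<^bsub>N\<^esub> ?G q = \<zero>\<^bsub>N\<^esub>"
      using ker[of "p \<ominus>\<^bsub>F\<^esub> q"] MA.minus_closed[OF p q(1)] klinear_diff[OF kvs_monoid_algebra N G p q(1)] by simp
    then have "?G p = ?G q"
      using N.diff_eq_zero_iff klinear_closed[OF G p] klinear_closed[OF G q(1)] by blast
    then show ?thesis unfolding sym_ext_def q(3) by (rule sym)
  qed
  show "sym_ext N g (sym_word ws) = g ws" if "ws \<in> ?L"
    using ext[of "pt ws"] G_pt[OF that] sproj_pt[OF that] that by simp
  have S_carrier: "\<exists>p \<in> carrier F. x = sproj p" if "x \<in> carrier (symalg V)" for x
    using mem_carrier_symalg[OF that] by blast
  show "klinear (symalg V) N (sym_ext N g)"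
  proof (rule klinearI)
    fix x y c assume "x \<in> carrier (symalg V)" "y \<in> carrier (symalg V)"
    then obtain p q where p: "p \<in> carrier F" "x = sproj p" and q: "q \<in> carrier F" "y = sproj q"
      using S_carrier by blast
    show "sym_ext N g (x \<oplus>\<^bsub>symalg V\<^esub> y) = sym_ext N g x \<oplus>\<^bsub>N\<^esub> sym_ext N g y"
      unfolding p(2) q(2) sproj(4)[OF p(1) q(1), symmetric] ext[OF p(1)] ext[OF q(1)]
        ext[OF MA.a_closed[OF p(1) q(1)]] by (rule klinear_add[OF G p(1) q(1)])
  next
    fix x c assume "x \<in> carrier (symalg V)"
    then obtain p where p: "p \<in> carrier F" "x = sproj p" using S_carrier by blast
    show "sym_ext N g (c \<odot>\<^bsub>symalg V\<^esub> x) = c \<odot>\<^bsub>N\<^esub> sym_ext N g x"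
      unfolding p(2) sproj(5)[OF p(1), symmetric] ext[OF p(1)] ext[OF MA.smult_closed[OF p(1)]]
      by (rule klinear_smult[OF G p(1)])
    show "sym_ext N g x \<in> carrier N"
      unfolding p(2) ext[OF p(1)] by (rule klinear_closed[OF G p(1)])
  qed
qed

lemma klinear_sym_ext_param:
  assumes "kvs L" "kvs N" "f \<in> carrier (symalg V)"
    "\<And>ws. ws \<in> lists (carrier V) \<Longrightarrow> klinear L N (\<lambda>u. g u ws)"
  shows "klinear L N (\<lambda>u. sym_ext N (g u) f)"
proof -
  obtain p where p: "p \<in> carrier F" "(SOME p. p \<in> \<Union>f) = p" by (rule mem_carrier_symalg[OF assms(3)])
  have k: "keys p \<subseteq> lists (carrier V)" using p(1) by simp
  have "klinear L N (\<lambda>u. free_ext N (g u) p)"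
    by (rule klinear_combination[OF assms(1,2)], rule assms(4), erule subsetD[OF k])
  then show ?thesis unfolding sym_ext_def p(2) .
qed

lemma sym_word_append:
  "us \<in> lists (carrier V) \<Longrightarrow> ws \<in> lists (carrier V) \<Longrightarrow>
    sym_word (us @ ws) = sym_word us \<otimes>\<^bsub>symalg V\<^esub> sym_word ws"
  by (induction us) (auto simp: S.m_assoc)

lemma sym_multilinear_sym_word: "sym_multilinear V (symalg V) sym_word"
  unfolding sym_multilinear_def
proof (intro conjI ballI)
  fix u w x y assume uw: "u \<in> lists (carrier V)" "w \<in> lists (carrier V)"
  have e: "sym_word (u @ x # w) = sym_word u \<otimes>\<^bsub>symalg V\<^esub> (sym_in V x \<otimes>\<^bsub>symalg V\<^esub> sym_word w)"
    if "x \<in> carrier V" for x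
    using sym_word_append[OF uw(1), of "x # w"] uw(2) that by simp
  note c = sym_word_closed[OF uw(1)] sym_word_closed[OF uw(2)]
  show "klinear V (symalg V) (\<lambda>x. sym_word (u @ x # w))"
    by (rule klinearI)
      (simp_all add: e c klinear_add[OF klinear_sym_in] klinear_smult[OF klinear_sym_in] S.l_distr
        S.r_distr S.mult_smult_left S.mult_smult_right del: in_lists_conv_set)
  assume xy: "x \<in> carrier V" "y \<in> carrier V"
  have "sym_in V x \<otimes>\<^bsub>symalg V\<^esub> (sym_in V y \<otimes>\<^bsub>symalg V\<^esub> sym_word w) =
      sym_in V y \<otimes>\<^bsub>symalg V\<^esub> (sym_in V x \<otimes>\<^bsub>symalg V\<^esub> sym_word w)"
    using xy c by (simp only: S.m_assoc[symmetric] sym_in_closed sym_in_commute)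
  then show "sym_word (u @ x # y # w) = sym_word (u @ y # x # w)"
    using sym_word_append[OF uw(1), of "x # y # w"] sym_word_append[OF uw(1), of "y # x # w"] uw(2) xy
    by simp
qed auto

end

section \<open>Sweedler sums\<close>

locale cocommutative_module =
  fixes A :: "('k::field, 'a) module"
    and \<Delta> :: "'a \<Rightarrow> ('a \<times> 'a \<Rightarrow>\<^sub>0 'k) set"
    and V :: "('k, 'v) module"
    and act :: "'a \<Rightarrow> 'v \<Rightarrow> 'v"
  assumes cocomm: "cocomm_algebra A \<Delta>"
    and alg_module: "alg_module A V act"
begin

sublocale A: kalgebra A
  by (rule kalgebra.intro) (use cocomm in \<open>simp add: cocomm_algebra_def\<close>)

sublocale V: vspace V
  by (rule vspace.intro) (use alg_module in \<open>simp add: alg_module_def\<close>)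

sublocale symmetric_algebra V
  by unfold_locales

sublocale AA: tensor_space A A
  by unfold_locales

sublocale SA: tensor_space "symalg V" A
  by unfold_locales

abbreviation "Sym \<equiv> symalg V"

lemma klinear_\<Delta>: "klinear A (tensor A A) \<Delta>"
  using cocomm by (auto simp: cocomm_algebra_def alg_hom_def)

lemma \<Delta>_closed [simp, intro]: "a \<in> carrier A \<Longrightarrow> \<Delta> a \<in> carrier (tensor A A)"
  by (rule klinear_closed[OF klinear_\<Delta>])

lemma \<Delta>_one: "\<Delta> \<one>\<^bsub>A\<^esub> = tens A A \<one>\<^bsub>A\<^esub> \<one>\<^bsub>A\<^esub>"
proof -
  have "\<Delta> \<one>\<^bsub>A\<^esub> = \<one>\<^bsub>tensor A A\<^esub>"
    using cocomm by (auto simp: cocomm_algebra_def alg_homD(7))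
  then show ?thesis by (simp add: tensor_def tens_def DirProd_def)
qed

lemma klinear_act: "a \<in> carrier A \<Longrightarrow> klinear V V (act a)"
  and klinear_act_left: "v \<in> carrier V \<Longrightarrow> klinear A V (\<lambda>a. act a v)"
  and act_one: "v \<in> carrier V \<Longrightarrow> act \<one>\<^bsub>A\<^esub> v = v"
  using alg_module by (auto simp: alg_module_def)

lemma act_closed [simp, intro]: "a \<in> carrier A \<Longrightarrow> v \<in> carrier V \<Longrightarrow> act a v \<in> carrier V"
  by (rule klinear_closed[OF klinear_act])

abbreviation sweedler :: "('k, 'p) module \<Rightarrow> ('a \<Rightarrow> 'a \<Rightarrow> 'p) \<Rightarrow> 'a \<Rightarrow> 'p" where
  "sweedler P f a \<equiv> tens_ext P f (\<Delta> a)"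

lemma klinear_sweedler: "kvs P \<Longrightarrow> kbilinear A A P f \<Longrightarrow> klinear A P (sweedler P f)"
  by (rule klinear_comp[OF klinear_\<Delta> AA.klinear_tens_ext])

lemma sweedler_one: "kvs P \<Longrightarrow> kbilinear A A P f \<Longrightarrow> sweedler P f \<one>\<^bsub>A\<^esub> = f \<one>\<^bsub>A\<^esub> \<one>\<^bsub>A\<^esub>"
  unfolding \<Delta>_one by (rule AA.tens_ext_tens) auto

text \<open>Cocommutativity, evaluated on a bilinear map.\<close>

lemma sweedler_swap:
  assumes P: "kvs P" and f: "kbilinear A A P f" and a: "a \<in> carrier A"
  shows "sweedler P (\<lambda>x y. f y x) a = sweedler P f a"
proof -
  have "tens_ext P f (sweedler (tensor A A) (\<lambda>x y. tens A A y x) a) =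
      sweedler P (\<lambda>x y. tens_ext P f (tens A A y x)) a"
    by (rule AA.klinear_tens_ext_comp[OF AA.kvs_tensor P AA.klinear_tens_ext[OF P f]]) (use a in auto)
  also have "\<dots> = sweedler P (\<lambda>x y. f y x) a"
    by (rule AA.tens_ext_cong[OF P]) (use a kbilinear_closed[OF f] in \<open>auto simp: AA.tens_ext_tens[OF P f]\<close>)
  moreover have "sweedler (tensor A A) (\<lambda>x y. tens A A y x) a = \<Delta> a"
    using cocomm a by (auto simp: cocomm_algebra_def)
  ultimately show ?thesis by simp
qed

text \<open>Coassociativity, evaluated on a trilinear map; \<open>G\<close> is curried, so trilinearity is linearity in
  each slot.\<close>

lemma sweedler_assoc:
  assumes P: "kvs P"
    and G1: "\<And>y z. y \<in> carrier A \<Longrightarrow> z \<in> carrier A \<Longrightarrow> klinear A P (\<lambda>x. G x y z)"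
    and G2: "\<And>x z. x \<in> carrier A \<Longrightarrow> z \<in> carrier A \<Longrightarrow> klinear A P (\<lambda>y. G x y z)"
    and G3: "\<And>x y. x \<in> carrier A \<Longrightarrow> y \<in> carrier A \<Longrightarrow> klinear A P (\<lambda>z. G x y z)"
    and a: "a \<in> carrier A"
  shows "sweedler P (\<lambda>x y. sweedler P (\<lambda>x1 x2. G x1 x2 y) x) a = sweedler P (\<lambda>x y. sweedler P (G x) y) a"
proof -
  interpret R: tensor_space A "tensor A A" by unfold_locales
  interpret L: tensor_space "tensor A A" A by unfold_locales
  let ?TR = "tensor A (tensor A A)" and ?TL = "tensor (tensor A A) A"
  have Gx: "kbilinear A A P (G x)" if "x \<in> carrier A" for x
    by (rule kbilinearI) (use that G2 G3 in auto)
  have Gc: "G x y z \<in> carrier P" if "x \<in> carrier A" "y \<in> carrier A" "z \<in> carrier A" for x y z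
    by (rule klinear_closed[OF G3]) (use that in auto)
  have bl: "kbilinear A (tensor A A) P (\<lambda>x. tens_ext P (G x))"
    by (intro kbilinearI AA.klinear_tens_ext_param AA.klinear_tens_ext P Gx A.kvs G1)
  let ?l = "tens_ext P (\<lambda>x. tens_ext P (G x))"
  have l: "klinear ?TR P ?l" by (rule R.klinear_tens_ext[OF P bl])
  have l_tens: "?l (tens A (tensor A A) x u) = tens_ext P (G x) u"
    if "x \<in> carrier A" "u \<in> carrier (tensor A A)" for x u by (rule R.tens_ext_tens[OF P bl that])
  have t3: "kbilinear A A ?TR (\<lambda>x y. tens A (tensor A A) x (tens A A y z))" if "z \<in> carrier A" for z
    by (intro kbilinearI kbilinearD(1)[OF R.kbilinear_tens] AA.tens_closed that
      klinear_comp[OF kbilinearD(1)[OF AA.kbilinear_tens that] kbilinearD(2)[OF R.kbilinear_tens]])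
  have t3': "klinear A ?TR (\<lambda>z. tens A (tensor A A) x (tens A A y z))" if "x \<in> carrier A" "y \<in> carrier A" for x y
    by (rule klinear_comp[OF kbilinearD(2)[OF AA.kbilinear_tens] kbilinearD(2)[OF R.kbilinear_tens]]) (use that in auto)
  have rb: "kbilinear (tensor A A) A ?TR (\<lambda>u z. tens_ext ?TR (\<lambda>x y. tens A (tensor A A) x (tens A A y z)) u)"
    by (intro kbilinearI AA.klinear_tens_ext AA.klinear_tens_ext_param R.kvs_tensor t3 t3' A.kvs)
  let ?r = "tens_ext ?TR (\<lambda>u z. tens_ext ?TR (\<lambda>x y. tens A (tensor A A) x (tens A A y z)) u)"
  have r: "klinear ?TL ?TR ?r" by (rule L.klinear_tens_ext[OF R.kvs_tensor rb])
  have tc: "tens_ext ?TR (\<lambda>x1 x2. tens A (tensor A A) x1 (tens A A x2 y)) (\<Delta> x) \<in> carrier ?TR"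
    if "x \<in> carrier A" "y \<in> carrier A" for x y
    by (rule AA.tens_ext_closed[OF R.kvs_tensor]) (use that in auto)
  have "?r (sweedler ?TL (\<lambda>x y. tens (tensor A A) A (\<Delta> x) y) a) =
      sweedler ?TR (\<lambda>x y. ?r (tens (tensor A A) A (\<Delta> x) y)) a"
    by (rule AA.klinear_tens_ext_comp[OF L.kvs_tensor R.kvs_tensor r]) (use a in auto)
  also have "\<dots> = sweedler ?TR (\<lambda>x y. sweedler ?TR (\<lambda>x1 x2. tens A (tensor A A) x1 (tens A A x2 y)) x) a"
    by (rule AA.tens_ext_cong[OF R.kvs_tensor])
      (use a tc in \<open>auto simp: L.tens_ext_tens[OF R.kvs_tensor rb]\<close>)
  finally have lhs: "?r (sweedler ?TL (\<lambda>x y. tens (tensor A A) A (\<Delta> x) y) a) =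
      sweedler ?TR (\<lambda>x y. sweedler ?TR (\<lambda>x1 x2. tens A (tensor A A) x1 (tens A A x2 y)) x) a" .
  have in1: "?l (sweedler ?TR (\<lambda>x1 x2. tens A (tensor A A) x1 (tens A A x2 y)) x) =
      sweedler P (\<lambda>x1 x2. G x1 x2 y) x" if "x \<in> carrier A" "y \<in> carrier A" for x y
  proof -
    have "?l (sweedler ?TR (\<lambda>x1 x2. tens A (tensor A A) x1 (tens A A x2 y)) x) =
        sweedler P (\<lambda>x1 x2. ?l (tens A (tensor A A) x1 (tens A A x2 y))) x"
      by (rule AA.klinear_tens_ext_comp[OF R.kvs_tensor P l]) (use that in auto)
    also have "\<dots> = sweedler P (\<lambda>x1 x2. G x1 x2 y) x"
      by (rule AA.tens_ext_cong[OF P])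
        (use that Gc in \<open>auto simp: l_tens AA.tens_ext_tens[OF P Gx]\<close>)
    finally show ?thesis .
  qed
  have sc: "sweedler P (\<lambda>x1 x2. G x1 x2 y) x \<in> carrier P" "sweedler P (G x) y \<in> carrier P"
    if "x \<in> carrier A" "y \<in> carrier A" for x y
    by (rule AA.tens_ext_closed[OF P]; use that Gc in auto)+
  have "sweedler P (\<lambda>x y. sweedler P (\<lambda>x1 x2. G x1 x2 y) x) a =
      sweedler P (\<lambda>x y. ?l (sweedler ?TR (\<lambda>x1 x2. tens A (tensor A A) x1 (tens A A x2 y)) x)) a"
    by (rule AA.tens_ext_cong[OF P, symmetric]) (use a sc in \<open>auto simp: in1\<close>)
  also have "\<dots> = ?l (sweedler ?TR (\<lambda>x y. sweedler ?TR (\<lambda>x1 x2. tens A (tensor A A) x1 (tens A A x2 y)) x) a)"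
    by (rule AA.klinear_tens_ext_comp[OF R.kvs_tensor P l, symmetric]) (use a tc in auto)
  also have "\<dots> = ?l (sweedler ?TR (\<lambda>x y. tens A (tensor A A) x (\<Delta> y)) a)"
    unfolding lhs[symmetric] using cocomm a by (auto simp: cocomm_algebra_def)
  also have "\<dots> = sweedler P (\<lambda>x y. ?l (tens A (tensor A A) x (\<Delta> y))) a"
    by (rule AA.klinear_tens_ext_comp[OF R.kvs_tensor P l]) (use a in auto)
  also have "\<dots> = sweedler P (\<lambda>x y. sweedler P (G x) y) a"
    by (rule AA.tens_ext_cong[OF P]) (use a sc in \<open>auto simp: l_tens\<close>)
  finally show ?thesis .
qed

section \<open>The smash product\<close>

abbreviation "wact \<equiv> word_act A \<Delta> V act"

lemma klinear_mult_left: "x \<in> carrier Sym \<Longrightarrow> klinear Sym Sym (\<lambda>y. x \<otimes>\<^bsub>Sym\<^esub> y)"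
  and klinear_mult_right: "x \<in> carrier Sym \<Longrightarrow> klinear Sym Sym (\<lambda>y. y \<otimes>\<^bsub>Sym\<^esub> x)"
  by (auto intro!: klinearI simp: S.l_distr S.r_distr S.mult_smult_left S.mult_smult_right)

lemma klinear_sym_act: "v \<in> carrier V \<Longrightarrow> klinear A Sym (\<lambda>x. sym_in V (act x v))"
  by (rule klinear_comp[OF klinear_act_left klinear_sym_in])

lemma klinear_act_sym: "a \<in> carrier A \<Longrightarrow> klinear V Sym (\<lambda>v. sym_in V (act a v))"
  by (rule klinear_comp[OF klinear_act klinear_sym_in])

lemma kbilinear_sym_act_mult:
  "v \<in> carrier V \<Longrightarrow> klinear A Sym f \<Longrightarrow> kbilinear A A Sym (\<lambda>x y. sym_in V (act x v) \<otimes>\<^bsub>Sym\<^esub> f y)"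
  by (intro kbilinearI klinear_comp[OF klinear_sym_act klinear_mult_right]
      klinear_comp[OF _ klinear_mult_left]) (auto intro: klinear_closed)

lemma klinear_wact:
  "vs \<in> lists (carrier V) \<Longrightarrow> vs \<noteq> [] \<Longrightarrow> klinear A Sym (wact vs)"
proof (induction vs)
  case (Cons v vs)
  show ?case
  proof (cases "vs = []")
    case True
    then show ?thesis using Cons klinear_sym_act by simp
  next
    case False
    with Cons have "klinear A Sym (sweedler Sym (\<lambda>x y. sym_in V (act x v) \<otimes>\<^bsub>Sym\<^esub> wact vs y))"
      by (intro klinear_sweedler S.kvs kbilinear_sym_act_mult) auto
    with False show ?thesis by simp
  qed
qed simp

lemma wact_closed [simp, intro]:
  "vs \<in> lists (carrier V) \<Longrightarrow> vs \<noteq> [] \<Longrightarrow> a \<in> carrier A \<Longrightarrow> wact vs a \<in> carrier Sym"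
  by (rule klinear_closed[OF klinear_wact])

lemma klinear_wact_word:
  assumes "w \<in> lists (carrier V)"
  shows "u \<in> lists (carrier V) \<Longrightarrow> a \<in> carrier A \<Longrightarrow> klinear V Sym (\<lambda>x. wact (u @ x # w) a)"
proof (induction u arbitrary: a)
  case Nil
  show ?case
  proof (cases "w = []")
    case True
    then show ?thesis using klinear_act_sym[OF Nil(2)] by simp
  next
    case False
    have "klinear V Sym (\<lambda>x. sweedler Sym (\<lambda>p q. sym_in V (act p x) \<otimes>\<^bsub>Sym\<^esub> wact w q) a)"
      by (intro AA.klinear_tens_ext_param V.kvs S.kvs \<Delta>_closed Nil
          klinear_comp[OF klinear_act_sym klinear_mult_right] wact_closed assms False)
    with False show ?thesis by simp
  qed
next
  case (Cons v u)
  have "klinear V Sym (\<lambda>x. sweedler Sym (\<lambda>p q. sym_in V (act p v) \<otimes>\<^bsub>Sym\<^esub> wact (u @ x # w) q) a)"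
    by (intro AA.klinear_tens_ext_param V.kvs S.kvs \<Delta>_closed Cons
          klinear_comp[OF Cons.IH klinear_mult_left] sym_in_closed act_closed) (use Cons in auto)
  then show ?case by simp
qed

text \<open>The action on words descends to \<open>Sym(V)\<close>. For the first two letters, coassociativity brings the
  two components that act on them together, and cocommutativity then exchanges these components.\<close>

lemma wact_swap:
  assumes w: "w \<in> lists (carrier V)" and x: "x \<in> carrier V" and y: "y \<in> carrier V"
  shows "u \<in> lists (carrier V) \<Longrightarrow> a \<in> carrier A \<Longrightarrow> wact (u @ x # y # w) a = wact (u @ y # x # w) a"
proof (induction u arbitrary: a)
  case Nil
  note a = Nil(2)
  have comm: "sym_in V (act p x) \<otimes>\<^bsub>Sym\<^esub> sym_in V (act q y) = sym_in V (act q y) \<otimes>\<^bsub>Sym\<^esub> sym_in V (act p x)"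
    if "p \<in> carrier A" "q \<in> carrier A" for p q
    using that x y by (intro sym_in_commute) auto
  show ?case
  proof (cases "w = []")
    case True
    have bl: "kbilinear A A Sym (\<lambda>p q. sym_in V (act p y) \<otimes>\<^bsub>Sym\<^esub> sym_in V (act q x))"
      by (intro kbilinear_sym_act_mult klinear_sym_act x y)
    have "sweedler Sym (\<lambda>p q. sym_in V (act p x) \<otimes>\<^bsub>Sym\<^esub> sym_in V (act q y)) a =
        sweedler Sym (\<lambda>p q. sym_in V (act q y) \<otimes>\<^bsub>Sym\<^esub> sym_in V (act p x)) a"
      by (rule AA.tens_ext_cong[OF S.kvs]) (use a x y comm in auto)
    also have "\<dots> = sweedler Sym (\<lambda>p q. sym_in V (act p y) \<otimes>\<^bsub>Sym\<^esub> sym_in V (act q x)) a"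
      by (rule sweedler_swap[OF S.kvs bl a])
    finally show ?thesis using True by simp
  next
    case False
    define G where "G u v p q r = sym_in V (act p u) \<otimes>\<^bsub>Sym\<^esub> (sym_in V (act q v) \<otimes>\<^bsub>Sym\<^esub> wact w r)" for u v p q r
    have Gc: "G u v p q r \<in> carrier Sym"
      if "u \<in> carrier V" "v \<in> carrier V" "p \<in> carrier A" "q \<in> carrier A" "r \<in> carrier A" for u v p q r
      unfolding G_def using that False w by auto
    have G1: "klinear A Sym (\<lambda>p. G u v p q r)"
      if "u \<in> carrier V" "v \<in> carrier V" "q \<in> carrier A" "r \<in> carrier A" for u v q r
      unfolding G_def using that False w by (intro klinear_comp[OF klinear_sym_act klinear_mult_right]) auto
    have G2: "klinear A Sym (\<lambda>q. G u v p q r)"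
      if "u \<in> carrier V" "v \<in> carrier V" "p \<in> carrier A" "r \<in> carrier A" for u v p r
      unfolding G_def using that False w
      by (intro klinear_comp[OF klinear_comp[OF klinear_sym_act klinear_mult_right] klinear_mult_left]) auto
    have G3: "klinear A Sym (\<lambda>r. G u v p q r)"
      if "u \<in> carrier V" "v \<in> carrier V" "p \<in> carrier A" "q \<in> carrier A" for u v p q
      unfolding G_def using that False w
      by (intro klinear_comp[OF klinear_comp[OF klinear_wact klinear_mult_left] klinear_mult_left]) auto
    have expand: "wact (u # v # w) a = sweedler Sym (\<lambda>p r. sweedler Sym (\<lambda>p1 p2. G u v p1 p2 r) p) a"
      if uv: "u \<in> carrier V" "v \<in> carrier V" for u v
    proof -
      have "sym_in V (act p u) \<otimes>\<^bsub>Sym\<^esub> sweedler Sym (\<lambda>q r. sym_in V (act q v) \<otimes>\<^bsub>Sym\<^esub> wact w r) q =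
          sweedler Sym (G u v p) q" if "p \<in> carrier A" "q \<in> carrier A" for p q
        unfolding G_def
        by (rule AA.klinear_tens_ext_comp[OF S.kvs S.kvs klinear_mult_left]) (use that uv w False in auto)
      then have "wact (u # v # w) a = sweedler Sym (\<lambda>p q. sweedler Sym (G u v p) q) a"
        using a uv False Gc by (simp, intro AA.tens_ext_cong[OF S.kvs]) (auto intro!: AA.tens_ext_closed S.kvs)
      also have "\<dots> = sweedler Sym (\<lambda>p r. sweedler Sym (\<lambda>p1 p2. G u v p1 p2 r) p) a"
        by (rule sweedler_assoc[OF S.kvs G1[OF uv] G2[OF uv] G3[OF uv] a, symmetric])
      finally show ?thesis .
    qed
    have sw: "sweedler Sym (\<lambda>p1 p2. G x y p1 p2 r) p = sweedler Sym (\<lambda>p1 p2. G y x p1 p2 r) p"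
      if "p \<in> carrier A" "r \<in> carrier A" for p r
    proof -
      have "G x y p2 p1 r = G y x p1 p2 r" if "p1 \<in> carrier A" "p2 \<in> carrier A" for p1 p2
        using comm[OF that(2,1)] that \<open>r \<in> carrier A\<close> x y w False by (simp add: G_def S.m_assoc[symmetric])
      then have "sweedler Sym (\<lambda>p1 p2. G x y p2 p1 r) p = sweedler Sym (\<lambda>p1 p2. G y x p1 p2 r) p"
        by (intro AA.tens_ext_cong[OF S.kvs]) (use that x y Gc in auto)
      moreover have "sweedler Sym (\<lambda>p1 p2. G x y p2 p1 r) p = sweedler Sym (\<lambda>p1 p2. G x y p1 p2 r) p"
        by (rule sweedler_swap[OF S.kvs]) (use that x y G1 G2 in \<open>auto intro!: kbilinearI\<close>)
      ultimately show ?thesis by simp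
    qed
    have "wact (x # y # w) a = wact (y # x # w) a"
      unfolding expand[OF x y] expand[OF y x]
      by (rule AA.tens_ext_cong[OF S.kvs]) (use a x y Gc sw in \<open>auto intro!: AA.tens_ext_closed S.kvs\<close>)
    then show ?thesis by simp
  qed
next
  case (Cons v u)
  have "sweedler Sym (\<lambda>p q. sym_in V (act p v) \<otimes>\<^bsub>Sym\<^esub> wact (u @ x # y # w) q) a =
      sweedler Sym (\<lambda>p q. sym_in V (act p v) \<otimes>\<^bsub>Sym\<^esub> wact (u @ y # x # w) q) a"
    by (rule AA.tens_ext_cong[OF S.kvs]) (use Cons w x y in auto)
  then show ?case by simp
qed

text \<open>This follows from \<open>\<Delta>(1) = 1 \<otimes> 1\<close> by induction on the word.\<close>

lemma wact_one:
  "vs \<in> lists (carrier V) \<Longrightarrow> vs \<noteq> [] \<Longrightarrow> wact vs \<one>\<^bsub>A\<^esub> = sym_word vs"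
proof (induction vs)
  case (Cons v vs)
  show ?case
  proof (cases "vs = []")
    case True
    then show ?thesis using Cons by (simp add: act_one)
  next
    case False
    with Cons have "kbilinear A A Sym (\<lambda>x y. sym_in V (act x v) \<otimes>\<^bsub>Sym\<^esub> wact vs y)"
      by (intro kbilinear_sym_act_mult klinear_wact) auto
    from sweedler_one[OF S.kvs this] False Cons show ?thesis by (simp add: act_one)
  qed
qed simp

end

lemma klinear_id: "klinear M M (\<lambda>x. x)"
  by (rule klinearI) auto

context cocommutative_module
begin

abbreviation "B \<equiv> smash A \<Delta> V act"
abbreviation "SymA \<equiv> tensor (symalg V) A"
abbreviation "tn \<equiv> tens (symalg V) A"

lemma smash_sel [simp]:
  "carrier B = carrier SymA" "x \<oplus>\<^bsub>B\<^esub> y = x \<oplus>\<^bsub>SymA\<^esub> y" "c \<odot>\<^bsub>B\<^esub> x = c \<odot>\<^bsub>SymA\<^esub> x"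
  "\<zero>\<^bsub>B\<^esub> = \<zero>\<^bsub>SymA\<^esub>" "\<one>\<^bsub>B\<^esub> = \<one>\<^bsub>SymA\<^esub>"
  "x \<otimes>\<^bsub>B\<^esub> y = smash_mult A \<Delta> V act x y"
  by (simp_all add: smash_def)

lemma kvs_smash: "kvs B"
  by (rule kvs_image[OF SA.kvs_tensor, where f = "\<lambda>x. x"]) simp_all

sublocale B: vspace B
  by (rule vspace.intro[OF kvs_smash])

lemma klinear_smash_from [simp]: "klinear B N f \<longleftrightarrow> klinear SymA N f"
  by (simp add: klinear_def)

lemma klinear_smash_to [simp]: "klinear N B f \<longleftrightarrow> klinear N SymA f"
  by (simp add: klinear_def)

lemma smash_one: "\<one>\<^bsub>B\<^esub> = tn \<one>\<^bsub>Sym\<^esub> \<one>\<^bsub>A\<^esub>"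
  by (simp add: tensor_def tens_def DirProd_def)

lemma sweedler_smash:
  assumes "\<And>x y. x \<in> carrier A \<Longrightarrow> y \<in> carrier A \<Longrightarrow> f x y \<in> carrier SymA" "a \<in> carrier A"
  shows "sweedler B f a = sweedler SymA f a"
  using AA.klinear_tens_ext_comp[OF SA.kvs_tensor kvs_smash, of "\<lambda>x. x" f "\<Delta> a"] assms
  by (simp add: klinear_id)

abbreviation "sword \<equiv> smash_word A \<Delta> V act"

lemma klinear_tn_left: "a \<in> carrier A \<Longrightarrow> klinear Sym SymA (\<lambda>f. tn f a)"
  and klinear_tn_right: "f \<in> carrier Sym \<Longrightarrow> klinear A SymA (tn f)"
  using kbilinearD[OF SA.kbilinear_tens] by blast+

lemma klinear_A_mult_left: "x \<in> carrier A \<Longrightarrow> klinear A A (\<lambda>y. x \<otimes>\<^bsub>A\<^esub> y)"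
  and klinear_A_mult_right: "x \<in> carrier A \<Longrightarrow> klinear A A (\<lambda>y. y \<otimes>\<^bsub>A\<^esub> x)"
  by (auto intro!: klinearI simp: A.l_distr A.r_distr A.mult_smult_left A.mult_smult_right)

lemma sword_Nil [simp]: "sword f b [] a = tn f (b \<otimes>\<^bsub>A\<^esub> a)"
  by (simp add: smash_word_def)

lemma sword_nonempty:
  "vs \<noteq> [] \<Longrightarrow> sword f b vs a =
    sweedler SymA (\<lambda>x y. tn (f \<otimes>\<^bsub>Sym\<^esub> wact vs x) (y \<otimes>\<^bsub>A\<^esub> a)) b"
  by (simp add: smash_word_def)

lemma kbilinear_sword:
  assumes "vs \<in> lists (carrier V)" "vs \<noteq> []" "f \<in> carrier Sym" "a \<in> carrier A"
  shows "kbilinear A A SymA (\<lambda>x y. tn (f \<otimes>\<^bsub>Sym\<^esub> wact vs x) (y \<otimes>\<^bsub>A\<^esub> a))"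
  by (intro kbilinearI klinear_comp[OF klinear_comp[OF klinear_wact klinear_mult_left] klinear_tn_left]
      klinear_comp[OF klinear_A_mult_right klinear_tn_right] assms A.m_closed S.m_closed wact_closed)

lemma sword_closed:
  assumes "vs \<in> lists (carrier V)" "f \<in> carrier Sym" "b \<in> carrier A" "a \<in> carrier A"
  shows "sword f b vs a \<in> carrier SymA"
proof (cases "vs = []")
  case False
  then show ?thesis
    using AA.tens_ext_closed[OF SA.kvs_tensor kbilinear_closed[OF kbilinear_sword[OF assms(1) False assms(2,4)]]] assms(3)
    by (simp add: sword_nonempty)
qed (use assms in auto)

lemma klinear_sword_left:
  assumes "vs \<in> lists (carrier V)" "b \<in> carrier A" "a \<in> carrier A"
  shows "klinear Sym SymA (\<lambda>f. sword f b vs a)"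
proof (cases "vs = []")
  case False
  then show ?thesis unfolding sword_nonempty[OF False]
    by (intro AA.klinear_tens_ext_param SA.kvs_tensor S.kvs \<Delta>_closed assms A.m_closed
        klinear_comp[OF klinear_mult_right klinear_tn_left] wact_closed)
qed (use assms in \<open>simp add: klinear_tn_left\<close>)

lemma klinear_sword_mid:
  assumes "vs \<in> lists (carrier V)" "f \<in> carrier Sym" "a \<in> carrier A"
  shows "klinear A SymA (\<lambda>b. sword f b vs a)"
proof (cases "vs = []")
  case False
  then show ?thesis unfolding sword_nonempty[OF False]
    by (intro klinear_sweedler SA.kvs_tensor kbilinear_sword assms)
next
  case True
  have "klinear A SymA (\<lambda>b. tn f (b \<otimes>\<^bsub>A\<^esub> a))"
    by (rule klinear_comp[OF klinear_A_mult_right klinear_tn_right]) (use assms in auto)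
  with True show ?thesis by simp
qed

lemma klinear_sword_right:
  assumes "vs \<in> lists (carrier V)" "f \<in> carrier Sym" "b \<in> carrier A"
  shows "klinear A SymA (sword f b vs)"
proof (cases "vs = []")
  case False
  have "klinear A SymA (\<lambda>a. sweedler SymA (\<lambda>x y. tn (f \<otimes>\<^bsub>Sym\<^esub> wact vs x) (y \<otimes>\<^bsub>A\<^esub> a)) b)"
    by (intro AA.klinear_tens_ext_param SA.kvs_tensor A.kvs \<Delta>_closed assms S.m_closed
        klinear_comp[OF klinear_A_mult_left klinear_tn_right] wact_closed False)
  then show ?thesis by (rule klinear_cong[OF A.kvs]) (rule sword_nonempty[OF False])
next
  case True
  have "klinear A SymA (\<lambda>a. tn f (b \<otimes>\<^bsub>A\<^esub> a))"
    by (rule klinear_comp[OF klinear_A_mult_left klinear_tn_right]) (use assms in auto)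
  then show ?thesis by (rule klinear_cong[OF A.kvs]) (simp add: True)
qed

text \<open>The product with a word only depends on its class in \<open>Sym(V)\<close>, so the multiplication of the
  smash product is well defined.\<close>

lemma sym_multilinear_sword:
  assumes f: "f \<in> carrier Sym" and b: "b \<in> carrier A" and a: "a \<in> carrier A"
  shows "sym_multilinear V SymA (\<lambda>vs. sword f b vs a)"
  unfolding sym_multilinear_def
proof (intro conjI ballI)
  fix u w x y assume uw: "u \<in> lists (carrier V)" "w \<in> lists (carrier V)"
  have ne: "u @ x # w' \<noteq> []" for x w' by simp
  have m: "u @ x # w \<in> lists (carrier V)" if "x \<in> carrier V" for x using uw that by simp
  show "klinear V SymA (\<lambda>x. sword f b (u @ x # w) a)"
    unfolding sword_nonempty[OF ne]
    by (intro AA.klinear_tens_ext_param SA.kvs_tensor V.kvs \<Delta>_closed a b A.m_closed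
        klinear_comp[OF klinear_comp[OF klinear_wact_word klinear_mult_left] klinear_tn_left] uw f)
  assume xy: "x \<in> carrier V" "y \<in> carrier V"
  show "sword f b (u @ x # y # w) a = sword f b (u @ y # x # w) a"
    unfolding sword_nonempty[OF ne]
    by (rule AA.tens_ext_cong[OF SA.kvs_tensor])
      (use uw xy f a b m in \<open>auto simp: wact_swap[OF uw(2) xy uw(1)]\<close>)
qed (rule sword_closed[OF _ f b a])

abbreviation sright :: "_ \<Rightarrow> 'a \<Rightarrow> _ \<Rightarrow> 'a \<Rightarrow> _" where
  "sright f b g a \<equiv> sym_ext SymA (\<lambda>vs. sword f b vs a) g"

lemma kbilinear_sright:
  assumes f: "f \<in> carrier Sym" and b: "b \<in> carrier A"
  shows "kbilinear Sym A SymA (sright f b)"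
  by (intro kbilinearI klinear_sym_ext klinear_sym_ext_param SA.kvs_tensor A.kvs
      sym_multilinear_sword klinear_sword_right f b)

lemma kbilinear_smash_left:
  assumes "t \<in> carrier SymA"
  shows "kbilinear Sym A SymA (\<lambda>f b. tens_ext SymA (sright f b) t)"
  by (intro kbilinearI SA.klinear_tens_ext_param klinear_sym_ext_param SA.kvs_tensor S.kvs A.kvs
      klinear_sword_left klinear_sword_mid assms)

lemma klinear_smash_mult_left: "t \<in> carrier SymA \<Longrightarrow> klinear SymA SymA (\<lambda>s. smash_mult A \<Delta> V act s t)"
  unfolding smash_mult_def
  by (rule SA.klinear_tens_ext[OF SA.kvs_tensor kbilinear_smash_left])

lemma klinear_smash_mult_right:
  assumes "s \<in> carrier SymA" shows "klinear SymA SymA (\<lambda>t. smash_mult A \<Delta> V act s t)"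
  unfolding smash_mult_def
  by (intro SA.klinear_tens_ext_param SA.kvs_tensor SA.klinear_tens_ext kbilinear_sright assms)

lemma smash_mult_closed:
  "s \<in> carrier SymA \<Longrightarrow> t \<in> carrier SymA \<Longrightarrow> smash_mult A \<Delta> V act s t \<in> carrier SymA"
  by (rule klinear_closed[OF klinear_smash_mult_left])

lemma smash_mult_tn:
  assumes "f \<in> carrier Sym" "b \<in> carrier A" "vs \<in> lists (carrier V)" "a \<in> carrier A"
  shows "smash_mult A \<Delta> V act (tn f b) (tn (sym_word vs) a) = sword f b vs a"
proof -
  have t: "tn (sym_word vs) a \<in> carrier SymA" using assms by auto
  have "smash_mult A \<Delta> V act (tn f b) (tn (sym_word vs) a) = tens_ext SymA (sright f b) (tn (sym_word vs) a)"
    unfolding smash_mult_def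
    by (rule SA.tens_ext_tens[OF SA.kvs_tensor kbilinear_smash_left[OF t]]) (use assms in auto)
  also have "\<dots> = sright f b (sym_word vs) a"
    by (rule SA.tens_ext_tens[OF SA.kvs_tensor kbilinear_sright]) (use assms in auto)
  also have "\<dots> = sword f b vs a"
    by (rule sym_ext_word[OF SA.kvs_tensor sym_multilinear_sword]) (use assms in auto)
  finally show ?thesis .
qed

abbreviation "iV \<equiv> smashV A V"
abbreviation "iA \<equiv> smashA A V"

lemma iV_tn: "v \<in> carrier V \<Longrightarrow> iV v = tn (sym_word [v]) \<one>\<^bsub>A\<^esub>"
  and iA_tn: "iA a = tn (sym_word []) a"
  by (simp_all add: smashV_def smashA_def)

lemma iV_closed [simp, intro]: "v \<in> carrier V \<Longrightarrow> iV v \<in> carrier SymA"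
  and iA_closed [simp, intro]: "a \<in> carrier A \<Longrightarrow> iA a \<in> carrier SymA"
  by (auto simp: smashV_def smashA_def)

lemma klinear_iV: "klinear V SymA iV"
  unfolding smashV_def[abs_def] by (rule klinear_comp[OF klinear_sym_in klinear_tn_left]) auto

lemma klinear_iA: "klinear A SymA iA"
  unfolding smashA_def[abs_def] by (rule klinear_tn_right) auto

lemma smash_iV_word:
  assumes "v \<in> carrier V" "vs \<in> lists (carrier V)" "a \<in> carrier A"
  shows "iV v \<otimes>\<^bsub>B\<^esub> tn (sym_word vs) a = tn (sym_word (v # vs)) a"
proof (cases "vs = []")
  case True
  then show ?thesis using assms by (simp add: smashV_def smash_mult_tn[where vs = "[]", simplified])
next
  case False
  have "iV v \<otimes>\<^bsub>B\<^esub> tn (sym_word vs) a = sword (sym_in V v) \<one>\<^bsub>A\<^esub> vs a"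
    using assms by (simp add: smashV_def smash_mult_tn)
  also have "\<dots> = tn (sym_in V v \<otimes>\<^bsub>Sym\<^esub> wact vs \<one>\<^bsub>A\<^esub>) (\<one>\<^bsub>A\<^esub> \<otimes>\<^bsub>A\<^esub> a)"
    unfolding sword_nonempty[OF False]
    by (rule sweedler_one[OF SA.kvs_tensor kbilinear_sword]) (use assms False in auto)
  also have "\<dots> = tn (sym_word (v # vs)) a" using assms False by (simp add: wact_one)
  finally show ?thesis .
qed

lemma smash_iV_iA: "v \<in> carrier V \<Longrightarrow> a \<in> carrier A \<Longrightarrow> iV v \<otimes>\<^bsub>B\<^esub> iA a = tn (sym_in V v) a"
  using smash_iV_word[of v "[]" a] by (simp add: iA_tn)

lemma smash_iV_iV:
  assumes "v \<in> carrier V" "w \<in> carrier V"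
  shows "iV v \<otimes>\<^bsub>B\<^esub> iV w = tn (sym_word [v, w]) \<one>\<^bsub>A\<^esub>"
  using smash_iV_word[of v "[w]" "\<one>\<^bsub>A\<^esub>"] assms by (simp add: smashV_def)

lemma smash_iA_iA:
  "a \<in> carrier A \<Longrightarrow> b \<in> carrier A \<Longrightarrow> iA a \<otimes>\<^bsub>B\<^esub> iA b = iA (a \<otimes>\<^bsub>A\<^esub> b)"
  using smash_mult_tn[of "\<one>\<^bsub>Sym\<^esub>" a "[]" b] by (simp add: smashA_def)

lemma smash_iA_iV:
  assumes "a \<in> carrier A" "v \<in> carrier V"
  shows "iA a \<otimes>\<^bsub>B\<^esub> iV v = sweedler SymA (\<lambda>x y. iV (act x v) \<otimes>\<^bsub>B\<^esub> iA y) a"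
proof -
  have "iA a \<otimes>\<^bsub>B\<^esub> iV v = sword \<one>\<^bsub>Sym\<^esub> a [v] \<one>\<^bsub>A\<^esub>"
    using assms smash_mult_tn[of "\<one>\<^bsub>Sym\<^esub>" a "[v]" "\<one>\<^bsub>A\<^esub>"] by (simp add: smashA_def iV_tn)
  also have "\<dots> = sweedler SymA (\<lambda>x y. iV (act x v) \<otimes>\<^bsub>B\<^esub> iA y) a"
    by (subst sword_nonempty, simp, rule AA.tens_ext_cong[OF SA.kvs_tensor])
      (use assms in \<open>simp_all add: smash_iV_iA[simplified]\<close>)
  finally show ?thesis .
qed

section \<open>The grading of the smash product\<close>

abbreviation "Bdeg \<equiv> smash_deg A \<Delta> V act"

lemma sym_deg_gens: "{foldr (\<lambda>v f. sym_in V v \<otimes>\<^bsub>Sym\<^esub> f) vs \<one>\<^bsub>Sym\<^esub> | vs. vs \<in> lists (carrier V) \<and> length vs = n}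
    = {sym_word vs | vs. vs \<in> lists (carrier V) \<and> length vs = n}"
  by (simp add: sym_word_def)

lemma sym_gens_deg_carrier: "{sym_word vs | vs. vs \<in> lists (carrier V) \<and> length vs = n} \<subseteq> carrier Sym"
  by auto

lemma sym_deg_carrier: "sym_deg V n \<subseteq> carrier Sym"
  unfolding sym_deg_def sym_deg_gens by (rule S.kspan_subset[OF sym_gens_deg_carrier])

lemma smash_deg_gens_carrier: "{tn f a | f a. f \<in> sym_deg V n \<and> a \<in> carrier A} \<subseteq> carrier B"
  using sym_deg_carrier by auto

lemma subspace_Bdeg: "submodule (Bdeg n) ring_of_type_algebra B"
  unfolding smash_deg_def by (rule B.subspace_kspan[OF smash_deg_gens_carrier])

lemma Bdeg_carrier: "b \<in> Bdeg n \<Longrightarrow> b \<in> carrier SymA"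
  using B.subspaceD(1)[OF subspace_Bdeg] by auto

lemma tn_word_Bdeg:
  "vs \<in> lists (carrier V) \<Longrightarrow> a \<in> carrier A \<Longrightarrow> tn (sym_word vs) a \<in> Bdeg (length vs)"
  unfolding smash_deg_def sym_deg_def sym_deg_gens
  by (intro kspan_base CollectI exI[of _ "sym_word vs"] exI[of _ a] exI[of _ vs] conjI refl)

lemma iV_Bdeg: "v \<in> carrier V \<Longrightarrow> iV v \<in> Bdeg 1"
  using tn_word_Bdeg[of "[v]" "\<one>\<^bsub>A\<^esub>"] by (simp add: iV_tn)

lemma iA_Bdeg: "a \<in> carrier A \<Longrightarrow> iA a \<in> Bdeg 0"
  using tn_word_Bdeg[of "[]" a] by (simp add: iA_tn)

lemma smash_induct [consumes 1, case_names word add smult]: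
  assumes "b \<in> carrier SymA"
    and word: "\<And>vs a. vs \<in> lists (carrier V) \<Longrightarrow> a \<in> carrier A \<Longrightarrow> Q (tn (sym_word vs) a)"
    and add: "\<And>s t. s \<in> carrier SymA \<Longrightarrow> t \<in> carrier SymA \<Longrightarrow> Q s \<Longrightarrow> Q t \<Longrightarrow> Q (s \<oplus>\<^bsub>SymA\<^esub> t)"
    and smult: "\<And>c t. t \<in> carrier SymA \<Longrightarrow> Q t \<Longrightarrow> Q (c \<odot>\<^bsub>SymA\<^esub> t)"
  shows "Q b"
  using assms(1)
proof (induction rule: SA.tensor_induct)
  case (tens f a)
  note a = tens(2)
  from tens(1) show ?case
  proof (induction rule: sym_induct)
    case (word ws)
    then show ?case using a by (rule assms(2))
  next
    case (add s t)
    then show ?case by (simp only: klinear_add[OF klinear_tn_left[OF a]]) (intro assms(3) SA.tens_closed a)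
  next
    case (smult c t)
    then show ?case by (simp only: klinear_smult[OF klinear_tn_left[OF a]]) (intro assms(4) SA.tens_closed a)
  qed
qed (intro assms; assumption)+

lemma smash_eqI:
  assumes P: "kvs P" and f: "klinear SymA P f" and g: "klinear SymA P g"
    and "\<And>vs a. vs \<in> lists (carrier V) \<Longrightarrow> a \<in> carrier A \<Longrightarrow> f (tn (sym_word vs) a) = g (tn (sym_word vs) a)"
    and "b \<in> carrier SymA"
  shows "f b = g b"
  using assms(5) by (induction rule: smash_induct)
    (simp_all add: assms(4) klinear_add[OF f] klinear_add[OF g] klinear_smult[OF f] klinear_smult[OF g]
      del: in_lists_conv_set)

definition sym_part :: "nat \<Rightarrow> ('v list \<Rightarrow>\<^sub>0 'k) set set \<Rightarrow> ('v list \<Rightarrow>\<^sub>0 'k) set set" where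
  "sym_part n = sym_ext Sym (\<lambda>vs. if length vs = n then sym_word vs else \<zero>\<^bsub>Sym\<^esub>)"

lemma sym_multilinear_part:
  "sym_multilinear V Sym (\<lambda>vs. if length vs = n then sym_word vs else \<zero>\<^bsub>Sym\<^esub>)"
  unfolding sym_multilinear_def
proof (intro conjI ballI)
  fix u w assume uw: "u \<in> lists (carrier V)" "w \<in> lists (carrier V)"
  show "klinear V Sym (\<lambda>x. if length (u @ x # w) = n then sym_word (u @ x # w) else \<zero>\<^bsub>Sym\<^esub>)"
    using sym_multilinear_sym_word uw unfolding sym_multilinear_def
    by (cases "Suc (length u + length w) = n") (simp_all add: klinear_zero_fun[OF S.kvs] del: in_lists_conv_set)
next
  fix u w x y assume "u \<in> lists (carrier V)" "w \<in> lists (carrier V)" "x \<in> carrier V" "y \<in> carrier V"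
  with sym_multilinear_sym_word have "sym_word (u @ x # y # w) = sym_word (u @ y # x # w)"
    unfolding sym_multilinear_def by blast
  then show "(if length (u @ x # y # w) = n then sym_word (u @ x # y # w) else \<zero>\<^bsub>Sym\<^esub>) =
      (if length (u @ y # x # w) = n then sym_word (u @ y # x # w) else \<zero>\<^bsub>Sym\<^esub>)"
    by simp
qed auto

lemma klinear_sym_part: "klinear Sym Sym (sym_part n)"
  unfolding sym_part_def by (rule klinear_sym_ext[OF S.kvs sym_multilinear_part])

lemma sym_part_word:
  "vs \<in> lists (carrier V) \<Longrightarrow> sym_part n (sym_word vs) = (if length vs = n then sym_word vs else \<zero>\<^bsub>Sym\<^esub>)"
  unfolding sym_part_def by (rule sym_ext_word[OF S.kvs sym_multilinear_part])

text \<open>The projection to the component of degree \<open>n\<close>. The homogeneous subspaces are spans of tensors,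
  and these projections are what shows that their sum is direct.\<close>

definition part :: "nat \<Rightarrow> (('v list \<Rightarrow>\<^sub>0 'k) set set \<times> 'a \<Rightarrow>\<^sub>0 'k) set \<Rightarrow> (('v list \<Rightarrow>\<^sub>0 'k) set set \<times> 'a \<Rightarrow>\<^sub>0 'k) set" where
  "part n = tens_ext SymA (\<lambda>f a. tn (sym_part n f) a)"

lemma kbilinear_part: "kbilinear Sym A SymA (\<lambda>f a. tn (sym_part n f) a)"
  by (intro kbilinearI klinear_comp[OF klinear_sym_part klinear_tn_left] klinear_tn_right
      klinear_closed[OF klinear_sym_part])

lemma klinear_part: "klinear SymA SymA (part n)"
  unfolding part_def by (rule SA.klinear_tens_ext[OF SA.kvs_tensor kbilinear_part])

lemma part_tn: "f \<in> carrier Sym \<Longrightarrow> a \<in> carrier A \<Longrightarrow> part n (tn f a) = tn (sym_part n f) a"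
  unfolding part_def by (rule SA.tens_ext_tens[OF SA.kvs_tensor kbilinear_part])

lemma tn_zero: "a \<in> carrier A \<Longrightarrow> tn \<zero>\<^bsub>Sym\<^esub> a = \<zero>\<^bsub>SymA\<^esub>"
  by (rule klinear_zero[OF S.kvs SA.kvs_tensor klinear_tn_left])

lemma part_word:
  assumes "vs \<in> lists (carrier V)" "a \<in> carrier A"
  shows "part n (tn (sym_word vs) a) = (if length vs = n then tn (sym_word vs) a else \<zero>\<^bsub>SymA\<^esub>)"
  using assms part_tn[OF sym_word_closed[OF assms(1)] assms(2)]
  by (simp add: sym_part_word tn_zero del: in_lists_conv_set)

lemma part_closed [simp, intro]: "b \<in> carrier SymA \<Longrightarrow> part n b \<in> carrier SymA"
  by (rule klinear_closed[OF klinear_part])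

lemma sym_part_deg: "f \<in> sym_deg V m \<Longrightarrow> sym_part n f = (if m = n then f else \<zero>\<^bsub>Sym\<^esub>)"
proof -
  assume f: "f \<in> sym_deg V m"
  have k: "klinear Sym Sym (\<lambda>f. if m = n then f else \<zero>\<^bsub>Sym\<^esub>)"
    by (cases "m = n") (simp_all add: klinear_id klinear_zero_fun[OF S.kvs])
  show ?thesis
  proof (rule klinear_eq_on_span[OF S.kvs S.kvs klinear_sym_part k sym_gens_deg_carrier])
    show "f \<in> kspan Sym {sym_word vs | vs. vs \<in> lists (carrier V) \<and> length vs = m}"
      using f unfolding sym_deg_def sym_deg_gens .
  next
    fix x assume "x \<in> {sym_word vs | vs. vs \<in> lists (carrier V) \<and> length vs = m}"
    then obtain vs where "x = sym_word vs" "vs \<in> lists (carrier V)" "length vs = m" by blast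
    then show "sym_part n x = (if m = n then x else \<zero>\<^bsub>Sym\<^esub>)" by (simp only: sym_part_word)
  qed
qed

lemma part_Bdeg:
  assumes "b \<in> Bdeg m"
  shows "part n b = (if m = n then b else \<zero>\<^bsub>SymA\<^esub>)"
proof -
  have k: "klinear B B (\<lambda>f. if m = n then f else \<zero>\<^bsub>SymA\<^esub>)"
    by (cases "m = n") (simp_all add: klinear_id klinear_zero_fun[OF SA.kvs_tensor])
  have p: "klinear B B (part n)" using klinear_part by simp
  show ?thesis
    by (rule klinear_eq_on_span[OF kvs_smash kvs_smash p k smash_deg_gens_carrier])
      (use assms sym_deg_carrier in \<open>auto simp: part_tn sym_part_deg tn_zero subset_iff smash_deg_def\<close>)
qed

lemma part_in_Bdeg: "b \<in> carrier SymA \<Longrightarrow> part n b \<in> Bdeg n"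
proof (induction rule: smash_induct)
  case (word vs a)
  then show ?case using tn_word_Bdeg[OF word] B.subspaceD(2)[OF subspace_Bdeg]
    by (auto simp: part_word simp del: in_lists_conv_set)
next
  case (add s t)
  then show ?case using B.subspaceD(3)[OF subspace_Bdeg] by (auto simp: klinear_add[OF klinear_part])
next
  case (smult c t)
  then show ?case using B.subspaceD(4)[OF subspace_Bdeg] by (auto simp: klinear_smult[OF klinear_part])
qed

lemma part_bounded: "b \<in> carrier SymA \<Longrightarrow> \<exists>N. \<forall>n>N. part n b = \<zero>\<^bsub>SymA\<^esub>"
proof (induction rule: smash_induct)
  case (word vs a)
  then show ?case by (intro exI[of _ "length vs"]) (auto simp: part_word simp del: in_lists_conv_set)
next
  case (add s t)
  then obtain N M where "\<forall>n>N. part n s = \<zero>\<^bsub>SymA\<^esub>" "\<forall>n>M. part n t = \<zero>\<^bsub>SymA\<^esub>" by blast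
  with add(1,2) show ?case
    by (intro exI[of _ "max N M"]) (simp add: klinear_add[OF klinear_part])
next
  case (smult c t)
  then obtain N where "\<forall>n>N. part n t = \<zero>\<^bsub>SymA\<^esub>" by blast
  with smult(1) show ?case by (intro exI[of _ N]) (simp add: klinear_smult[OF klinear_part])
qed

text \<open>The homogeneous components determine an element, since the sum of all of them is the identity.\<close>

lemma part_sum: "b \<in> carrier SymA \<Longrightarrow> \<exists>N. \<forall>M\<ge>N. (\<Oplus>\<^bsub>SymA\<^esub>n\<in>{..M}. part n b) = b"
proof (induction rule: smash_induct)
  case (word vs a)
  have "(\<Oplus>\<^bsub>SymA\<^esub>n\<in>{..M}. part n (tn (sym_word vs) a)) = tn (sym_word vs) a" if "length vs \<le> M" for M
  proof -
    have "(\<Oplus>\<^bsub>SymA\<^esub>n\<in>{..M}. part n (tn (sym_word vs) a)) =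
        (\<Oplus>\<^bsub>SymA\<^esub>n\<in>{..M}. if length vs = n then tn (sym_word vs) a else \<zero>\<^bsub>SymA\<^esub>)"
      by (rule SA.T.finsum_cong') (use word in \<open>auto simp: part_word simp del: in_lists_conv_set\<close>)
    also have "\<dots> = tn (sym_word vs) a"
      by (rule SA.T.finsum_singleton) (use word that in auto)
    finally show ?thesis .
  qed
  then show ?case by blast
next
  case (add s t)
  then obtain N M where N: "\<forall>n\<ge>N. (\<Oplus>\<^bsub>SymA\<^esub>n\<in>{..n}. part n s) = s" "\<forall>n\<ge>M. (\<Oplus>\<^bsub>SymA\<^esub>n\<in>{..n}. part n t) = t"
    by blast
  have "(\<Oplus>\<^bsub>SymA\<^esub>n\<in>{..k}. part n (s \<oplus>\<^bsub>SymA\<^esub> t)) = s \<oplus>\<^bsub>SymA\<^esub> t" if "max N M \<le> k" for k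
  proof -
    have "(\<Oplus>\<^bsub>SymA\<^esub>n\<in>{..k}. part n (s \<oplus>\<^bsub>SymA\<^esub> t)) = (\<Oplus>\<^bsub>SymA\<^esub>n\<in>{..k}. part n s \<oplus>\<^bsub>SymA\<^esub> part n t)"
      by (rule SA.T.finsum_cong') (use add in \<open>auto simp: klinear_add[OF klinear_part]\<close>)
    also have "\<dots> = (\<Oplus>\<^bsub>SymA\<^esub>n\<in>{..k}. part n s) \<oplus>\<^bsub>SymA\<^esub> (\<Oplus>\<^bsub>SymA\<^esub>n\<in>{..k}. part n t)"
      by (rule SA.T.finsum_addf) (use add in auto)
    finally show ?thesis using N that by simp
  qed
  then show ?case by blast
next
  case (smult c t)
  then obtain N where N: "\<forall>n\<ge>N. (\<Oplus>\<^bsub>SymA\<^esub>n\<in>{..n}. part n t) = t" by blast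
  have "(\<Oplus>\<^bsub>SymA\<^esub>n\<in>{..k}. part n (c \<odot>\<^bsub>SymA\<^esub> t)) = c \<odot>\<^bsub>SymA\<^esub> t" if "N \<le> k" for k
  proof -
    have "(\<Oplus>\<^bsub>SymA\<^esub>n\<in>{..k}. part n (c \<odot>\<^bsub>SymA\<^esub> t)) = (\<Oplus>\<^bsub>SymA\<^esub>n\<in>{..k}. c \<odot>\<^bsub>SymA\<^esub> part n t)"
      by (rule SA.T.finsum_cong') (use smult in \<open>auto simp: klinear_smult[OF klinear_part]\<close>)
    also have "\<dots> = c \<odot>\<^bsub>SymA\<^esub> (\<Oplus>\<^bsub>SymA\<^esub>n\<in>{..k}. part n t)"
      using module.finsum_smult_ldistr[OF SA.kvs_tensor, of "{..k}" c "\<lambda>n. part n t"] smult by auto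
    finally show ?thesis using N that by simp
  qed
  then show ?case by blast
qed

lemma part_eq_zeroD:
  assumes "b \<in> carrier SymA" "\<And>n. part n b = \<zero>\<^bsub>SymA\<^esub>" shows "b = \<zero>\<^bsub>SymA\<^esub>"
  using part_sum[OF assms(1)] assms(2) by (auto simp: SA.T.finsum_zero)

end

section \<open>Filtered algebras, Rees algebras and associated graded algebras\<close>

locale filtered_algebra = kalgebra H for H :: "('k::field, 'h) module" (structure) +
  fixes Fl :: "nat \<Rightarrow> 'h set"
  assumes Fl_subspace: "submodule (Fl n) ring_of_type_algebra H"
    and Fl_Suc: "Fl n \<subseteq> Fl (Suc n)"
    and Fl_mult: "x \<in> Fl m \<Longrightarrow> y \<in> Fl n \<Longrightarrow> x \<otimes> y \<in> Fl (m + n)"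
    and Fl_one: "\<one> \<in> Fl 0"
    and Fl_exhaust: "x \<in> carrier H \<Longrightarrow> \<exists>n. x \<in> Fl n"
begin

lemma Fl_carrier: "x \<in> Fl n \<Longrightarrow> x \<in> carrier H"
  using subspaceD(1)[OF Fl_subspace] by blast

lemma Fl_zero: "\<zero> \<in> Fl n"
  by (rule subspaceD(2)[OF Fl_subspace])

abbreviation "below \<equiv> filt_below H Fl"

lemma below_simps: "below 0 = {\<zero>}" "below (Suc n) = Fl n"
  by (simp_all add: filt_below_def)

lemma below_subspace: "submodule (below n) ring_of_type_algebra H"
  by (cases n) (simp_all add: below_simps subspace_zero Fl_subspace)

lemma below_Fl: "below n \<subseteq> Fl n"
  by (cases n) (use Fl_zero Fl_Suc in \<open>auto simp: below_simps\<close>)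

lemma below_mult_left: "x \<in> below m \<Longrightarrow> y \<in> Fl n \<Longrightarrow> x \<otimes> y \<in> below (m + n)"
  using Fl_mult[of x "m - 1" y n] subspaceD(2)[OF below_subspace]
  by (cases m) (auto simp: below_simps Fl_carrier)

lemma below_mult_right: "x \<in> Fl m \<Longrightarrow> y \<in> below n \<Longrightarrow> x \<otimes> y \<in> below (m + n)"
  using Fl_mult[of x m y "n - 1"] subspaceD(2)[OF below_subspace]
  by (cases n) (auto simp: below_simps Fl_carrier)

abbreviation "G \<equiv> gr H Fl"

text \<open>The Rees algebra \<open>\<Oplus>\<^sub>n F\<^sub>n t\<^sup>n\<close>. An element is stored as its sequence of coefficients, so
  that the product is the one of the polynomial ring over \<open>H\<close>.\<close>

definition rees :: "('k, nat \<Rightarrow> 'h) module" where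
  "rees = \<lparr>carrier = {x \<in> up H. \<forall>n. x n \<in> Fl n},
     monoid.mult = (\<lambda>x y n. \<Oplus>i\<in>{..n}. x i \<otimes> y (n - i)),
     one = (\<lambda>n. if n = 0 then \<one> else \<zero>),
     ring.zero = (\<lambda>_. \<zero>),
     ring.add = (\<lambda>x y n. x n \<oplus> y n),
     module.smult = (\<lambda>c x n. c \<odot> x n)\<rparr>"

lemma rees_sel [simp]:
  "carrier rees = {x \<in> up H. \<forall>n. x n \<in> Fl n}"
  "x \<otimes>\<^bsub>rees\<^esub> y = (\<lambda>n. \<Oplus>i\<in>{..n}. x i \<otimes> y (n - i))"
  "\<one>\<^bsub>rees\<^esub> = (\<lambda>n. if n = 0 then \<one> else \<zero>)"
  "\<zero>\<^bsub>rees\<^esub> = (\<lambda>_. \<zero>)"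
  "x \<oplus>\<^bsub>rees\<^esub> y = (\<lambda>n. x n \<oplus> y n)"
  "c \<odot>\<^bsub>rees\<^esub> x = (\<lambda>n. c \<odot> x n)"
  by (simp_all add: rees_def)

lemma reesI:
  assumes "\<And>n. x n \<in> Fl n" "bound \<zero> N x" shows "x \<in> carrier rees"
proof -
  have "x \<in> up H" using assms(2) by (intro mem_upI Fl_carrier[OF assms(1)]) blast
  then show ?thesis using assms(1) by simp
qed

lemma Fl_finsum: "finite S \<Longrightarrow> (\<And>i. i \<in> S \<Longrightarrow> f i \<in> Fl n) \<Longrightarrow> (\<Oplus>i\<in>S. f i) \<in> Fl n"
proof (induction S rule: finite_induct)
  case (insert i S)
  then have "f \<in> S \<rightarrow> carrier H" "f i \<in> carrier H" using Fl_carrier by blast+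
  then show ?case using insert subspaceD(3)[OF Fl_subspace] by simp
qed (simp add: Fl_zero)

lemma up_smult: "x \<in> up H \<Longrightarrow> (\<lambda>n. c \<odot> x n) \<in> up H"
proof
  assume x: "x \<in> up H"
  then show "c \<odot> x n \<in> carrier H" for n by auto
  from x obtain n where "bound \<zero> n x" by auto
  then show "\<exists>n. bound \<zero> n (\<lambda>n. c \<odot> x n)" by (intro exI[of _ n]) (auto simp: bound_def)
qed

lemma kvs_rees: "kvs rees"
proof -
  have "abelian_group rees"
  proof (rule abelian_groupI)
    fix x assume x: "x \<in> carrier rees"
    then have "(\<lambda>n. (-1) \<odot> x n) \<in> carrier rees" by (auto simp: up_smult subspaceD(4)[OF Fl_subspace])
    moreover have "(-1) \<odot> x n \<oplus> x n = \<zero>" for n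
      using x Fl_carrier[of "x n" n] by (simp add: smult_uminus_1 l_neg)
    ultimately show "\<exists>y\<in>carrier rees. y \<oplus>\<^bsub>rees\<^esub> x = \<zero>\<^bsub>rees\<^esub>" by (intro bexI) simp_all
  qed (auto simp: up_add_closed subspaceD(3)[OF Fl_subspace] Fl_zero a_ac mem_upD)
  then show ?thesis
    by (intro moduleI cring_from_type_algebra)
      (auto simp: up_smult subspaceD(4)[OF Fl_subspace] smult_add_left smult_add_right smult_smult mem_upD)
qed

lemma kalg_rees: "kalg rees"
proof -
  have U: "ring (UP H)" by (rule UP_ring.UP_ring) (rule UP_ring.intro[OF ring_axioms])
  note mon = ringE(2)[OF U]
  have UPm: "x \<otimes>\<^bsub>UP H\<^esub> y = (\<lambda>n. \<Oplus>i\<in>{..n}. x i \<otimes> y (n - i))" if "x \<in> up H" "y \<in> up H" for x y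
    using that by (simp add: UP_def)
  have UPa: "x \<oplus>\<^bsub>UP H\<^esub> y = (\<lambda>n. x n \<oplus> y n)" if "x \<in> up H" "y \<in> up H" for x y
    using that by (simp add: UP_def)
  have UPc: "carrier (UP H) = up H" "\<one>\<^bsub>UP H\<^esub> = (\<lambda>n. if n = 0 then \<one> else \<zero>)" by (simp_all add: UP_def)
  have m: "(\<lambda>n. \<Oplus>i\<in>{..n}. x i \<otimes> y (n - i)) \<in> up H" if "x \<in> up H" "y \<in> up H" for x y
    using monoid.m_closed[OF mon, unfolded UPc, OF that] UPm[OF that] by simp
  have a: "(\<lambda>n. x n \<oplus> y n) \<in> up H" if "x \<in> up H" "y \<in> up H" for x y
    using abelian_groupE(1)[OF ringE(1)[OF U], unfolded UPc, OF that] UPa[OF that] by simp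
  have mF: "(\<Oplus>i\<in>{..n}. x i \<otimes> y (n - i)) \<in> Fl n" if "\<forall>n. x n \<in> Fl n" "\<forall>n. y n \<in> Fl n" for x y n
  proof (rule Fl_finsum)
    fix i assume "i \<in> {..n}"
    then show "x i \<otimes> y (n - i) \<in> Fl n" using Fl_mult[of "x i" i "y (n - i)" "n - i"] that by simp
  qed simp
  show ?thesis
  proof (rule kalgI[OF kvs_rees])
    fix x y z assume "x \<in> carrier rees" "y \<in> carrier rees" "z \<in> carrier rees"
    then have c: "x \<in> up H" "y \<in> up H" "z \<in> up H" and f: "\<forall>n. x n \<in> Fl n" "\<forall>n. y n \<in> Fl n" by auto
    show "(x \<otimes>\<^bsub>rees\<^esub> y) \<otimes>\<^bsub>rees\<^esub> z = x \<otimes>\<^bsub>rees\<^esub> (y \<otimes>\<^bsub>rees\<^esub> z)"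
      using monoid.m_assoc[OF mon, unfolded UPc, OF c] c m by (simp add: UPm)
    show "(x \<oplus>\<^bsub>rees\<^esub> y) \<otimes>\<^bsub>rees\<^esub> z = (x \<otimes>\<^bsub>rees\<^esub> z) \<oplus>\<^bsub>rees\<^esub> (y \<otimes>\<^bsub>rees\<^esub> z)"
      using ringE(3)[OF U, unfolded UPc, OF c] c m a by (simp add: UPm UPa)
    show "z \<otimes>\<^bsub>rees\<^esub> (x \<oplus>\<^bsub>rees\<^esub> y) = (z \<otimes>\<^bsub>rees\<^esub> x) \<oplus>\<^bsub>rees\<^esub> (z \<otimes>\<^bsub>rees\<^esub> y)"
      using ringE(4)[OF U, unfolded UPc, OF c] c m a by (simp add: UPm UPa)
  next
    fix x y assume "x \<in> carrier rees" "y \<in> carrier rees"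
    then have c: "x \<in> up H" "y \<in> up H" and f: "\<forall>n. x n \<in> Fl n" "\<forall>n. y n \<in> Fl n" by auto
    show "x \<otimes>\<^bsub>rees\<^esub> y \<in> carrier rees" using m[OF c] mF[OF f] by simp
  next
    fix x assume "x \<in> carrier rees"
    then have c: "x \<in> up H" by auto
    show "\<one>\<^bsub>rees\<^esub> \<otimes>\<^bsub>rees\<^esub> x = x"
      using monoid.l_one[OF mon, unfolded UPc, OF c] UPm[OF up_one_closed c] by simp
    show "x \<otimes>\<^bsub>rees\<^esub> \<one>\<^bsub>rees\<^esub> = x"
      using monoid.r_one[OF mon, unfolded UPc, OF c] UPm[OF c up_one_closed] by simp
  next
    show "\<one>\<^bsub>rees\<^esub> \<in> carrier rees" by (simp add: up_one_closed Fl_one Fl_zero)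
  next
    fix c x y assume "x \<in> carrier rees" "y \<in> carrier rees"
    then have xy: "x n \<in> carrier H" "y n \<in> carrier H" for n by auto
    have s: "c \<odot> (\<Oplus>i\<in>{..n}. x i \<otimes> y (n - i)) = (\<Oplus>i\<in>{..n}. c \<odot> (x i \<otimes> y (n - i)))" for n
      using module.finsum_smult_ldistr[OF kvs, of "{..n}" c "\<lambda>i. x i \<otimes> y (n - i)"] xy by auto
    show "(c \<odot>\<^bsub>rees\<^esub> x) \<otimes>\<^bsub>rees\<^esub> y = c \<odot>\<^bsub>rees\<^esub> (x \<otimes>\<^bsub>rees\<^esub> y)"
      using xy by (simp add: s mult_smult_left)
    show "x \<otimes>\<^bsub>rees\<^esub> (c \<odot>\<^bsub>rees\<^esub> y) = c \<odot>\<^bsub>rees\<^esub> (x \<otimes>\<^bsub>rees\<^esub> y)"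
      using xy by (simp add: s mult_smult_right)
  qed
qed

sublocale R: kalgebra rees
  by (rule kalgebra.intro[OF kalg_rees])

text \<open>The associated graded algebra is the Rees algebra modulo \<open>t\<close>; this is the projection.\<close>

definition cls :: "(nat \<Rightarrow> 'h) \<Rightarrow> nat \<Rightarrow> 'h set" where
  "cls x = (\<lambda>n. below n +> x n)"

lemma some_coset:
  assumes "x \<in> Fl n"
  shows "(SOME y. y \<in> below n +> x) \<in> Fl n" "(SOME y. y \<in> below n +> x) \<ominus> x \<in> below n"
proof -
  have x: "x \<in> carrier H" using assms by (rule Fl_carrier)
  have "x \<in> below n +> x" using x subspaceD(2)[OF below_subspace] 
    by (simp add: mem_coset_iff_diff[OF below_subspace] a_minus_def r_neg)
  then have "(SOME y. y \<in> below n +> x) \<in> below n +> x" by (rule someI)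
  then have y: "(SOME y. y \<in> below n +> x) \<in> carrier H" "(SOME y. y \<in> below n +> x) \<ominus> x \<in> below n"
    by (simp_all only: mem_coset_iff_diff[OF below_subspace x])
  then show "(SOME y. y \<in> below n +> x) \<ominus> x \<in> below n" by simp
  then have "(SOME y. y \<in> below n +> x) \<ominus> x \<in> Fl n" using below_Fl by blast
  then have "((SOME y. y \<in> below n +> x) \<ominus> x) \<oplus> x \<in> Fl n"
    using subspaceD(3)[OF Fl_subspace] assms by blast
  then show "(SOME y. y \<in> below n +> x) \<in> Fl n" using diff_add_cancel[OF y(1) x] by simp
qed

lemma coset_finsum:
  assumes U: "submodule U ring_of_type_algebra H" and "finite S"
    and "\<And>i. i \<in> S \<Longrightarrow> f i \<in> carrier H \<and> g i \<in> carrier H \<and> f i \<ominus> g i \<in> U"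
  shows "U +> (\<Oplus>i\<in>S. f i) = U +> (\<Oplus>i\<in>S. g i)"
  using assms(2,3)
proof (induction S rule: finite_induct)
  case (insert i S)
  have fg: "f \<in> S \<rightarrow> carrier H" "g \<in> S \<rightarrow> carrier H" "f i \<in> carrier H" "g i \<in> carrier H" "f i \<ominus> g i \<in> U"
    using insert by auto
  have "U +> f i = U +> g i" using fg by (simp add: coset_eq_iff[OF U])
  moreover have "U +> finsum H f S = U +> finsum H g S" by (rule insert.IH) (use insert in auto)
  ultimately show ?case
    using insert fg by (simp add: quot_add[OF U, symmetric])
qed simp

lemma cls_add:
  assumes "x \<in> carrier rees" "y \<in> carrier rees" shows "cls (x \<oplus>\<^bsub>rees\<^esub> y) = cls x \<oplus>\<^bsub>G\<^esub> cls y"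
proof -
  have "x n \<in> carrier H" "y n \<in> carrier H" for n using assms by auto
  then show ?thesis
    using abelian_subgroup.a_rcos_sum[OF subspace_abelian_subgroup[OF below_subspace]]
    by (simp add: cls_def gr_def)
qed

lemma cls_smult:
  assumes "x \<in> carrier rees" shows "cls (c \<odot>\<^bsub>rees\<^esub> x) = c \<odot>\<^bsub>G\<^esub> cls x"
proof -
  have "below n +> (c \<odot> (SOME y. y \<in> below n +> x n)) = below n +> (c \<odot> x n)" for n
  proof -
    define y where "y = (SOME y. y \<in> below n +> x n)"
    have x: "x n \<in> Fl n" using assms by simp
    note y = some_coset[OF x, folded y_def]
    have "c \<odot> y \<ominus> c \<odot> x n = c \<odot> (y \<ominus> x n)"
      using Fl_carrier[OF x] Fl_carrier[OF y(1)] by (simp add: minus_eq_smult smult_add_right smult_smult)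
    then have "c \<odot> y \<ominus> c \<odot> x n \<in> below n" using subspaceD(4)[OF below_subspace y(2)] by simp
    then show ?thesis unfolding y_def[symmetric]
      using Fl_carrier[OF x] Fl_carrier[OF y(1)] by (simp add: coset_eq_iff[OF below_subspace])
  qed
  then show ?thesis by (simp add: cls_def gr_def)
qed

lemma cls_mult:
  assumes "x \<in> carrier rees" "y \<in> carrier rees" shows "cls (x \<otimes>\<^bsub>rees\<^esub> y) = cls x \<otimes>\<^bsub>G\<^esub> cls y"
proof -
  have "below n +> (\<Oplus>i\<in>{..n}. (SOME u. u \<in> below i +> x i) \<otimes> (SOME u. u \<in> below (n - i) +> y (n - i))) =
      below n +> (\<Oplus>i\<in>{..n}. x i \<otimes> y (n - i))" for n
  proof (rule coset_finsum[OF below_subspace])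
    fix i assume "i \<in> {..n}"
    then have i: "i + (n - i) = n" by simp
    define u v where "u = (SOME u. u \<in> below i +> x i)" and "v = (SOME u. u \<in> below (n - i) +> y (n - i))"
    have x: "x i \<in> Fl i" and y: "y (n - i) \<in> Fl (n - i)" using assms by simp_all
    note u = some_coset[OF x, folded u_def] and v = some_coset[OF y, folded v_def]
    note c = Fl_carrier[OF x] Fl_carrier[OF y] Fl_carrier[OF u(1)] Fl_carrier[OF v(1)]
    have "u \<otimes> v \<ominus> x i \<otimes> y (n - i) = (u \<ominus> x i) \<otimes> v \<oplus> x i \<otimes> (v \<ominus> y (n - i))"
      using c by (simp add: a_minus_def l_distr r_distr l_minus r_minus a_assoc r_neg1 a_lcomm
        l_neg r_neg2)
    also have "\<dots> \<in> below n"
      using below_mult_left[OF u(2) v(1)] below_mult_right[OF x v(2)] subspaceD(3)[OF below_subspace]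
      by (simp add: i)
    finally show "u \<otimes> v \<in> carrier H \<and> x i \<otimes> y (n - i) \<in> carrier H \<and> u \<otimes> v \<ominus> x i \<otimes> y (n - i) \<in> below n"
      using c by simp
  qed simp
  then show ?thesis by (simp add: cls_def gr_def)
qed

lemma cls_one: "cls \<one>\<^bsub>rees\<^esub> = \<one>\<^bsub>G\<^esub>"
  by (simp add: cls_def gr_def)

lemma cls_zero: "cls \<zero>\<^bsub>rees\<^esub> = \<zero>\<^bsub>G\<^esub>"
  by (simp add: cls_def gr_def fun_eq_iff coset_zero below_subspace)

lemma carrier_gr: "carrier G = cls ` carrier rees"
proof (intro equalityI subsetI)
  fix P assume "P \<in> carrier G"
  then have P: "\<And>n. \<exists>x\<in>Fl n. P n = below n +> x" and fin: "finite {n. P n \<noteq> below n}"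
    by (auto simp: gr_def)
  define x where "x n = (if P n = below n then \<zero> else SOME x. x \<in> Fl n \<and> P n = below n +> x)" for n
  have x: "x n \<in> Fl n \<and> P n = below n +> x n" for n
  proof (cases "P n = below n")
    case True
    then show ?thesis by (simp add: x_def Fl_zero coset_zero below_subspace)
  next
    case False
    then show ?thesis using someI_ex[of "\<lambda>x. x \<in> Fl n \<and> P n = below n +> x"] P[of n] by (auto simp: x_def)
  qed
  obtain N where N: "\<forall>n\<in>{n. P n \<noteq> below n}. n \<le> N"
    using fin[unfolded finite_nat_set_iff_bounded_le] by blast
  have "bound \<zero> N x"
  proof
    fix m assume "N < m"
    with N have "P m = below m" by force
    then show "x m = \<zero>" by (simp add: x_def)
  qed
  then have "x \<in> carrier rees" using x by (intro reesI) auto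
  moreover have "P = cls x" using x by (simp add: cls_def fun_eq_iff)
  ultimately show "P \<in> cls ` carrier rees" by blast
next
  fix P assume "P \<in> cls ` carrier rees"
  then obtain x where x: "x \<in> up H" "\<And>n. x n \<in> Fl n" and P: "P = cls x" by auto
  obtain N where "bound \<zero> N x" using x(1) by auto
  then have "P n = below n" if "N < n" for n
    using that by (simp add: P cls_def bound_def coset_zero[OF below_subspace])
  then have "{n. P n \<noteq> below n} \<subseteq> {..N}" by (auto simp: not_less[symmetric])
  then have "finite {n. P n \<noteq> below n}" by (rule finite_subset) simp
  then show "P \<in> carrier G" using x by (auto simp: gr_def P cls_def)
qed

lemma kalg_gr: "kalg G"
  by (rule kalg_image[OF kalg_rees carrier_gr]) (rule cls_add cls_smult cls_zero cls_mult cls_one; assumption?)+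

sublocale G: kalgebra G
  by (rule kalgebra.intro[OF kalg_gr])

lemma alg_hom_cls: "cls \<in> alg_hom rees G"
  by (intro alg_homI klinearI) (simp_all only: carrier_gr image_eqI cls_add cls_smult cls_mult cls_one)

lemma cls_eq_iff:
  assumes "x \<in> carrier rees" "y \<in> carrier rees"
  shows "cls x = cls y \<longleftrightarrow> (\<forall>n. x n \<ominus> y n \<in> below n)"
proof -
  have "x n \<in> carrier H" "y n \<in> carrier H" for n using assms by auto
  then show ?thesis by (simp add: cls_def fun_eq_iff coset_eq_iff[OF below_subspace])
qed

definition homog :: "nat \<Rightarrow> 'h \<Rightarrow> nat \<Rightarrow> 'h" where
  "homog n h = (\<lambda>m. if m = n then h else \<zero>)"

lemma homog_closed [simp, intro]:
  assumes "h \<in> Fl n" shows "homog n h \<in> carrier rees"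
proof -
  have "bound \<zero> n (homog n h)" by (auto simp: homog_def)
  then show ?thesis by (rule reesI[rotated]) (use assms Fl_zero in \<open>simp add: homog_def\<close>)
qed

lemma cls_homog: "h \<in> Fl n \<Longrightarrow> cls (homog n h) = gr_in H Fl n h"
  by (simp add: fun_eq_iff cls_def homog_def gr_in_def coset_zero[OF below_subspace])

lemma homog_mult:
  assumes "x \<in> Fl m" "y \<in> Fl n"
  shows "homog m x \<otimes>\<^bsub>rees\<^esub> homog n y = homog (m + n) (x \<otimes> y)"
proof -
  note c = Fl_carrier[OF assms(1)] Fl_carrier[OF assms(2)]
  have "(\<Oplus>i\<in>{..k}. homog m x i \<otimes> homog n y (k - i)) = homog (m + n) (x \<otimes> y) k" for k
  proof -
    have "(\<Oplus>i\<in>{..k}. homog m x i \<otimes> homog n y (k - i)) =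
        (\<Oplus>i\<in>{..k}. if m = i then x \<otimes> homog n y (k - m) else \<zero>)"
      by (rule finsum_cong') (use c in \<open>auto simp: homog_def\<close>)
    also have "\<dots> = homog (m + n) (x \<otimes> y) k"
    proof (cases "m \<le> k")
      case True
      then have "(\<Oplus>i\<in>{..k}. if m = i then x \<otimes> homog n y (k - m) else \<zero>) = x \<otimes> homog n y (k - m)"
        by (intro add.finprod_singleton) (use c in \<open>auto simp: homog_def\<close>)
      then show ?thesis using True c by (auto simp: homog_def)
    next
      case False
      then have "(\<Oplus>i\<in>{..k}. if m = i then x \<otimes> homog n y (k - m) else \<zero>) = (\<Oplus>i\<in>{..k}. \<zero>)"
        by (intro finsum_cong') auto
      then show ?thesis using False by (simp add: homog_def finsum_zero)
    qed
    finally show ?thesis .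
  qed
  then show ?thesis by (simp add: fun_eq_iff)
qed

lemma gr_in_closed: "h \<in> Fl n \<Longrightarrow> gr_in H Fl n h \<in> carrier G"
  unfolding cls_homog[symmetric] carrier_gr by (intro imageI homog_closed)

lemma gr_in_mult:
  "x \<in> Fl m \<Longrightarrow> y \<in> Fl n \<Longrightarrow> gr_in H Fl m x \<otimes>\<^bsub>G\<^esub> gr_in H Fl n y = gr_in H Fl (m + n) (x \<otimes> y)"
  by (simp only: cls_homog[symmetric] Fl_mult cls_mult[symmetric] homog_closed homog_mult)

lemma klinear_homog:
  assumes "kvs L" "klinear L H f" "\<And>u. u \<in> carrier L \<Longrightarrow> f u \<in> Fl n"
  shows "klinear L rees (\<lambda>u. homog n (f u))"
  by (rule klinearI)
    (use assms(3) homog_closed in \<open>auto simp: homog_def fun_eq_iff klinear_add[OF assms(2)] klinear_smult[OF assms(2)]\<close>)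

lemma klinear_gr_in:
  assumes "kvs L" "klinear L H f" "\<And>u. u \<in> carrier L \<Longrightarrow> f u \<in> Fl n"
  shows "klinear L G (\<lambda>u. gr_in H Fl n (f u))"
  by (rule klinear_cong[OF assms(1) klinear_comp[OF klinear_homog[OF assms] alg_homD(1)[OF alg_hom_cls]]], assumption)
    (rule cls_homog[OF assms(3), symmetric])

lemma gr_in_below: "h \<in> below n \<Longrightarrow> gr_in H Fl n h = \<zero>\<^bsub>G\<^esub>"
proof -
  assume "h \<in> below n"
  then have "below n +> h = below n" using coset_eq_zero_iff[OF below_subspace] below_Fl Fl_carrier by blast
  then show ?thesis by (simp add: gr_in_def gr_def fun_eq_iff)
qed

end

section \<open>The algebra with deformed relations\<close>

locale deformed_smash = cocommutative_module A \<Delta> V act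
  for A :: "('k::field, 'a) module"
    and \<Delta> :: "'a \<Rightarrow> ('a \<times> 'a \<Rightarrow>\<^sub>0 'k) set"
    and V :: "('k, 'v) module"
    and act :: "'a \<Rightarrow> 'v \<Rightarrow> 'v" +
  fixes lam :: "('a \<times> 'v \<Rightarrow>\<^sub>0 'k) set \<Rightarrow> 'a"
    and kap :: "('v \<times> 'v \<Rightarrow>\<^sub>0 'k) set \<Rightarrow> 'v \<times> 'a"
  assumes lam: "klinear (tensor A V) A lam"
    and kap: "klinear (wedge_space V) (dirsum V A) kap"
begin

sublocale AV: tensor_space A V
  by unfold_locales

sublocale VV: tensor_space V V
  by unfold_locales

abbreviation "W \<equiv> dirsum V A"

sublocale D: tensor_algebra "dirsum V A"
  by (rule tensor_algebra.intro, rule vspace.intro, rule kvs_dirsum[OF V.kvs A.kvs])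

abbreviation lamf :: "'a \<Rightarrow> 'v \<Rightarrow> 'a" where "lamf a v \<equiv> lam (tens A V a v)"
abbreviation kapV :: "'v \<Rightarrow> 'v \<Rightarrow> 'v" where "kapV v w \<equiv> fst (kap (wedge V v w))"
abbreviation kapA :: "'v \<Rightarrow> 'v \<Rightarrow> 'a" where "kapA v w \<equiv> snd (kap (wedge V v w))"

lemma lamf_closed [simp, intro]: "a \<in> carrier A \<Longrightarrow> v \<in> carrier V \<Longrightarrow> lamf a v \<in> carrier A"
  by (rule klinear_closed[OF lam]) auto

lemma kap_closed [simp, intro]:
  assumes "v \<in> carrier V" "w \<in> carrier V" shows "kapV v w \<in> carrier V" "kapA v w \<in> carrier A"
proof -
  have "wedge V v w \<in> carrier (wedge_space V)"
    unfolding wedge_space_def by (simp, rule kspan_base) (use assms in blast)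
  from klinear_closed[OF kap this] show "kapV v w \<in> carrier V" "kapA v w \<in> carrier A"
    by (simp_all add: mem_Times_iff)
qed

abbreviation "TW \<equiv> talg (dirsum V A)"
abbreviation "jV v \<equiv> talg_in (dirsum V A) (v, \<zero>\<^bsub>A\<^esub>)"
abbreviation "jA a \<equiv> talg_in (dirsum V A) (\<zero>\<^bsub>V\<^esub>, a)"

lemma jV_closed [simp, intro]: "v \<in> carrier V \<Longrightarrow> jV v \<in> carrier TW"
  and jA_closed [simp, intro]: "a \<in> carrier A \<Longrightarrow> jA a \<in> carrier TW"
  by auto

definition "unit_rel = jA \<one>\<^bsub>A\<^esub> \<ominus>\<^bsub>TW\<^esub> \<one>\<^bsub>TW\<^esub>"
definition "mult_rel a b = (jA a \<otimes>\<^bsub>TW\<^esub> jA b) \<ominus>\<^bsub>TW\<^esub> jA (a \<otimes>\<^bsub>A\<^esub> b)"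
definition "act_rel a v = ((jA a \<otimes>\<^bsub>TW\<^esub> jV v) \<ominus>\<^bsub>TW\<^esub> sweedler TW (\<lambda>x y. jV (act x v) \<otimes>\<^bsub>TW\<^esub> jA y) a)
  \<ominus>\<^bsub>TW\<^esub> jA (lamf a v)"
definition "comm_rel v w = ((jV v \<otimes>\<^bsub>TW\<^esub> jV w) \<ominus>\<^bsub>TW\<^esub> (jV w \<otimes>\<^bsub>TW\<^esub> jV v))
  \<ominus>\<^bsub>TW\<^esub> talg_in (dirsum V A) (kap (wedge V v w))"

definition "rels = {unit_rel} \<union> {mult_rel a b | a b. a \<in> carrier A \<and> b \<in> carrier A} \<union>
  {act_rel a v | a v. a \<in> carrier A \<and> v \<in> carrier V} \<union>
  {comm_rel v w | v w. v \<in> carrier V \<and> w \<in> carrier V}"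

abbreviation "Hrel \<equiv> Hlk_rel A \<Delta> V act lam kap"
abbreviation "HH \<equiv> Hlk A \<Delta> V act lam kap"
abbreviation "Hg \<equiv> Hlk_in A \<Delta> V act lam kap"
abbreviation "hV v \<equiv> Hg (Inl v)"
abbreviation "hA a \<equiv> Hg (Inr a)"
abbreviation "HF \<equiv> Hlk_filt A \<Delta> V act lam kap"

lemma Hrel_Idl: "Hrel = Idl\<^bsub>TW\<^esub> rels"
  unfolding Hlk_rel_def rels_def unit_rel_def mult_rel_def act_rel_def comm_rel_def Let_def ..

lemma sweedler_jVA_closed:
  "a \<in> carrier A \<Longrightarrow> v \<in> carrier V \<Longrightarrow> sweedler TW (\<lambda>x y. jV (act x v) \<otimes>\<^bsub>TW\<^esub> jA y) a \<in> carrier TW"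
  by (rule AA.tens_ext_closed[OF D.T.kvs]) auto

lemma kap_in_closed:
  "v \<in> carrier V \<Longrightarrow> w \<in> carrier V \<Longrightarrow> talg_in (dirsum V A) (kap (wedge V v w)) \<in> carrier TW"
  by (rule D.talg_in_closed) (simp add: mem_Times_iff)

lemma rels_carrier: "rels \<subseteq> carrier TW"
  unfolding rels_def unit_rel_def mult_rel_def act_rel_def comm_rel_def
  by (auto intro!: sweedler_jVA_closed kap_in_closed)

lemma ideal_Hrel: "ideal Hrel TW"
  unfolding Hrel_Idl by (rule D.T.genideal_ideal[OF rels_carrier])

lemma kalg_HH: "kalg HH"
  unfolding Hlk_def by (rule D.T.kalg_quot[OF ideal_Hrel])

sublocale H: kalgebra "Hlk A \<Delta> V act lam kap"
  by (rule kalgebra.intro[OF kalg_HH])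

definition hproj where "hproj t = Hrel +>\<^bsub>TW\<^esub> t"

lemma alg_hom_hproj: "hproj \<in> alg_hom TW HH"
  using D.T.alg_hom_coset[OF ideal_Hrel] unfolding Hlk_def hproj_def[abs_def] .

lemmas hproj = alg_homD[OF alg_hom_hproj]

lemma hproj_diff: "s \<in> carrier TW \<Longrightarrow> t \<in> carrier TW \<Longrightarrow> hproj (s \<ominus>\<^bsub>TW\<^esub> t) = hproj s \<ominus>\<^bsub>HH\<^esub> hproj t"
  by (rule klinear_diff[OF D.T.kvs H.kvs hproj(1)])

lemma hV_hproj: "hV v = hproj (jV v)" and hA_hproj: "hA a = hproj (jA a)"
  by (simp_all add: Hlk_in_def hproj_def)

lemma klinear_jV: "klinear V TW (\<lambda>v. jV v)"
  by (rule klinear_comp[OF _ D.klinear_talg_in]) (rule klinearI, auto)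

lemma klinear_jA: "klinear A TW (\<lambda>a. jA a)"
  by (rule klinear_comp[OF _ D.klinear_talg_in]) (rule klinearI, auto)

lemma klinear_hV: "klinear V HH (\<lambda>v. hV v)"
  unfolding hV_hproj by (rule klinear_comp[OF klinear_jV hproj(1)])

lemma klinear_hA: "klinear A HH (\<lambda>a. hA a)"
  unfolding hA_hproj by (rule klinear_comp[OF klinear_jA hproj(1)])

lemma hV_closed [simp, intro]: "v \<in> carrier V \<Longrightarrow> hV v \<in> carrier HH"
  and hA_closed [simp, intro]: "a \<in> carrier A \<Longrightarrow> hA a \<in> carrier HH"
  by (rule klinear_closed[OF klinear_hV], assumption) (rule klinear_closed[OF klinear_hA])

lemma rel_zero: "r \<in> rels \<Longrightarrow> hproj r = \<zero>\<^bsub>HH\<^esub>"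
proof -
  assume r: "r \<in> rels"
  then have "r \<in> Hrel" unfolding Hrel_Idl using D.T.genideal_self[OF rels_carrier] by blast
  then have "Hrel +>\<^bsub>TW\<^esub> r = Hrel"
    using D.T.coset_eq_zero_iff[OF D.T.ideal_subspace[OF ideal_Hrel]] r rels_carrier by blast
  then show ?thesis by (simp add: hproj_def Hlk_def)
qed

lemma hA_one: "hA \<one>\<^bsub>A\<^esub> = \<one>\<^bsub>HH\<^esub>"
proof -
  have "hproj (jA \<one>\<^bsub>A\<^esub> \<ominus>\<^bsub>TW\<^esub> \<one>\<^bsub>TW\<^esub>) = \<zero>\<^bsub>HH\<^esub>"
    by (rule rel_zero) (simp add: rels_def unit_rel_def)
  then have "hA \<one>\<^bsub>A\<^esub> \<ominus>\<^bsub>HH\<^esub> \<one>\<^bsub>HH\<^esub> = \<zero>\<^bsub>HH\<^esub>" by (simp add: hproj_diff hproj(7) hA_hproj)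
  then show ?thesis by (simp add: H.diff_eq_zero_iff)
qed

lemma hA_mult: "a \<in> carrier A \<Longrightarrow> b \<in> carrier A \<Longrightarrow> hA a \<otimes>\<^bsub>HH\<^esub> hA b = hA (a \<otimes>\<^bsub>A\<^esub> b)"
proof -
  assume ab: "a \<in> carrier A" "b \<in> carrier A"
  have "hproj ((jA a \<otimes>\<^bsub>TW\<^esub> jA b) \<ominus>\<^bsub>TW\<^esub> jA (a \<otimes>\<^bsub>A\<^esub> b)) = \<zero>\<^bsub>HH\<^esub>"
    by (rule rel_zero) (use ab in \<open>auto simp: rels_def mult_rel_def\<close>)
  then have "(hA a \<otimes>\<^bsub>HH\<^esub> hA b) \<ominus>\<^bsub>HH\<^esub> hA (a \<otimes>\<^bsub>A\<^esub> b) = \<zero>\<^bsub>HH\<^esub>"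
    using ab by (simp add: hproj_diff hproj(6) hA_hproj)
  then show ?thesis using ab by (simp add: H.diff_eq_zero_iff)
qed

lemma hA_hV:
  assumes a: "a \<in> carrier A" and v: "v \<in> carrier V"
  shows "hA a \<otimes>\<^bsub>HH\<^esub> hV v = sweedler HH (\<lambda>x y. hV (act x v) \<otimes>\<^bsub>HH\<^esub> hA y) a \<oplus>\<^bsub>HH\<^esub> hA (lamf a v)"
proof -
  let ?s = "sweedler HH (\<lambda>x y. hV (act x v) \<otimes>\<^bsub>HH\<^esub> hA y) a"
  have s: "?s \<in> carrier HH" by (rule AA.tens_ext_closed[OF H.kvs]) (use a v in auto)
  have "hproj (sweedler TW (\<lambda>x y. jV (act x v) \<otimes>\<^bsub>TW\<^esub> jA y) a) =
      sweedler HH (\<lambda>x y. hproj (jV (act x v) \<otimes>\<^bsub>TW\<^esub> jA y)) a"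
    by (rule AA.klinear_tens_ext_comp[OF D.T.kvs H.kvs hproj(1)]) (use a v in auto)
  also have "\<dots> = ?s"
    by (rule AA.tens_ext_cong[OF H.kvs]) (use a v in \<open>auto simp: hproj(6) hV_hproj hA_hproj intro!: hproj(3)\<close>)
  finally have e: "hproj (sweedler TW (\<lambda>x y. jV (act x v) \<otimes>\<^bsub>TW\<^esub> jA y) a) = ?s" .
  have "hproj (act_rel a v) = \<zero>\<^bsub>HH\<^esub>"
    by (rule rel_zero) (use a v in \<open>auto simp: rels_def\<close>)
  then have "(hA a \<otimes>\<^bsub>HH\<^esub> hV v) \<ominus>\<^bsub>HH\<^esub> ?s \<ominus>\<^bsub>HH\<^esub> hA (lamf a v) = \<zero>\<^bsub>HH\<^esub>"
    using a v e by (simp add: act_rel_def hproj_diff hproj(6) hA_hproj hV_hproj sweedler_jVA_closed)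
  then have "(hA a \<otimes>\<^bsub>HH\<^esub> hV v) \<ominus>\<^bsub>HH\<^esub> ?s = hA (lamf a v)"
    using a v s by (subst (asm) H.diff_eq_zero_iff) auto
  then show ?thesis
    using H.diff_add_cancel[of "hA a \<otimes>\<^bsub>HH\<^esub> hV v" ?s] a v s by (simp add: H.a_comm)
qed

lemma hV_hV:
  assumes v: "v \<in> carrier V" and w: "w \<in> carrier V"
  shows "(hV v \<otimes>\<^bsub>HH\<^esub> hV w) \<ominus>\<^bsub>HH\<^esub> (hV w \<otimes>\<^bsub>HH\<^esub> hV v) = hV (kapV v w) \<oplus>\<^bsub>HH\<^esub> hA (kapA v w)"
proof -
  have "kap (wedge V v w) = (kapV v w, \<zero>\<^bsub>A\<^esub>) \<oplus>\<^bsub>W\<^esub> (\<zero>\<^bsub>V\<^esub>, kapA v w)"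
    using v w by simp
  then have "talg_in W (kap (wedge V v w)) = jV (kapV v w) \<oplus>\<^bsub>TW\<^esub> jA (kapA v w)"
    using klinear_add[OF D.klinear_talg_in, of "(kapV v w, \<zero>\<^bsub>A\<^esub>)" "(\<zero>\<^bsub>V\<^esub>, kapA v w)"] v w by simp
  then have e: "hproj (talg_in W (kap (wedge V v w))) = hV (kapV v w) \<oplus>\<^bsub>HH\<^esub> hA (kapA v w)"
    using v w by (simp add: hproj(4) hV_hproj hA_hproj)
  have "hproj (comm_rel v w) = \<zero>\<^bsub>HH\<^esub>"
    by (rule rel_zero) (use v w in \<open>auto simp: rels_def\<close>)
  moreover have "hproj (comm_rel v w) =
      (hV v \<otimes>\<^bsub>HH\<^esub> hV w) \<ominus>\<^bsub>HH\<^esub> (hV w \<otimes>\<^bsub>HH\<^esub> hV v) \<ominus>\<^bsub>HH\<^esub> hproj (talg_in W (kap (wedge V v w)))"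
    unfolding comm_rel_def hV_hproj using v w
    by (simp only: hproj_diff hproj(6) jV_closed kap_in_closed D.T.m_closed D.T.minus_closed)
  ultimately have "(hV v \<otimes>\<^bsub>HH\<^esub> hV w) \<ominus>\<^bsub>HH\<^esub> (hV w \<otimes>\<^bsub>HH\<^esub> hV v) \<ominus>\<^bsub>HH\<^esub> (hV (kapV v w) \<oplus>\<^bsub>HH\<^esub> hA (kapA v w)) = \<zero>\<^bsub>HH\<^esub>"
    unfolding e by simp
  then show ?thesis
    using v w by (subst (asm) H.diff_eq_zero_iff) auto
qed

text \<open>The hypotheses list the images of the four families of relations under the map that \<open>gV\<close> and
  \<open>gA\<close> induce on the tensor algebra, solved for the product on the left.\<close>

lemma HH_lift:
  assumes P: "kalg P" and gV: "klinear V P gV" and gA: "klinear A P gA"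
    and one: "gA \<one>\<^bsub>A\<^esub> = \<one>\<^bsub>P\<^esub>"
    and mult: "\<And>a b. a \<in> carrier A \<Longrightarrow> b \<in> carrier A \<Longrightarrow> gA a \<otimes>\<^bsub>P\<^esub> gA b = gA (a \<otimes>\<^bsub>A\<^esub> b)"
    and act: "\<And>a v. a \<in> carrier A \<Longrightarrow> v \<in> carrier V \<Longrightarrow>
      gA a \<otimes>\<^bsub>P\<^esub> gV v = sweedler P (\<lambda>x y. gV (act x v) \<otimes>\<^bsub>P\<^esub> gA y) a \<oplus>\<^bsub>P\<^esub> gA (lamf a v)"
    and comm: "\<And>v w. v \<in> carrier V \<Longrightarrow> w \<in> carrier V \<Longrightarrow>
      (gV v \<otimes>\<^bsub>P\<^esub> gV w) \<ominus>\<^bsub>P\<^esub> (gV w \<otimes>\<^bsub>P\<^esub> gV v) = gV (kapV v w) \<oplus>\<^bsub>P\<^esub> gA (kapA v w)"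
  shows "\<exists>h \<in> alg_hom HH P. (\<forall>v \<in> carrier V. h (hV v) = gV v) \<and> (\<forall>a \<in> carrier A. h (hA a) = gA a)"
proof -
  interpret P: kalgebra P by (rule kalgebra.intro[OF P])
  note gVc = klinear_closed[OF gV] and gAc = klinear_closed[OF gA]
  have zero: "gV \<zero>\<^bsub>V\<^esub> = \<zero>\<^bsub>P\<^esub>" "gA \<zero>\<^bsub>A\<^esub> = \<zero>\<^bsub>P\<^esub>"
    by (rule klinear_zero[OF V.kvs P.kvs gV], rule klinear_zero[OF A.kvs P.kvs gA])
  have "klinear W P (\<lambda>w. gV (fst w) \<oplus>\<^bsub>P\<^esub> gA (snd w))"
    by (intro klinear_add_fun P.kvs klinear_comp[OF _ gV] klinear_comp[OF _ gA]; rule klinearI; auto)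
  from D.talg_lift[OF P this] obtain h where h: "h \<in> alg_hom TW P"
    "\<And>w. w \<in> carrier W \<Longrightarrow> h (talg_in W w) = gV (fst w) \<oplus>\<^bsub>P\<^esub> gA (snd w)" by blast
  note hh = alg_homD[OF h(1)]
  have hjV: "h (jV v) = gV v" if "v \<in> carrier V" for v using h(2)[of "(v, \<zero>\<^bsub>A\<^esub>)"] that by (simp add: zero gVc)
  have hjA: "h (jA a) = gA a" if "a \<in> carrier A" for a using h(2)[of "(\<zero>\<^bsub>V\<^esub>, a)"] that by (simp add: zero gAc)
  have h_diff: "h (s \<ominus>\<^bsub>TW\<^esub> t) = h s \<ominus>\<^bsub>P\<^esub> h t" if "s \<in> carrier TW" "t \<in> carrier TW" for s t
    by (rule klinear_diff[OF D.T.kvs P.kvs hh(1) that])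
  have d0: "x \<ominus>\<^bsub>P\<^esub> x = \<zero>\<^bsub>P\<^esub>" if "x \<in> carrier P" for x using that by (simp add: P.diff_eq_zero_iff)
  have "h r = \<zero>\<^bsub>P\<^esub>" if "r \<in> rels" for r
  proof -
    from that consider "r = unit_rel" | a b where "r = mult_rel a b" "a \<in> carrier A" "b \<in> carrier A"
      | a v where "r = act_rel a v" "a \<in> carrier A" "v \<in> carrier V"
      | v w where "r = comm_rel v w" "v \<in> carrier V" "w \<in> carrier V"
      unfolding rels_def by blast
    then show ?thesis
    proof cases
      case 1
      then show ?thesis by (simp add: unit_rel_def h_diff hjA hh(7) one d0)
    next
      case 2
      then show ?thesis by (simp add: mult_rel_def h_diff hh(6) hjA mult d0 gAc)
    next
      case (3 a v)
      let ?s = "sweedler P (\<lambda>x y. gV (act x v) \<otimes>\<^bsub>P\<^esub> gA y) a"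
      have s: "?s \<in> carrier P" by (rule AA.tens_ext_closed[OF P.kvs]) (use 3 gVc gAc in auto)
      have "h (sweedler TW (\<lambda>x y. jV (act x v) \<otimes>\<^bsub>TW\<^esub> jA y) a) = sweedler P (\<lambda>x y. h (jV (act x v) \<otimes>\<^bsub>TW\<^esub> jA y)) a"
        by (rule AA.klinear_tens_ext_comp[OF D.T.kvs P.kvs hh(1)]) (use 3 in auto)
      also have "\<dots> = ?s"
        by (rule AA.tens_ext_cong[OF P.kvs]) (use 3 gVc gAc in \<open>auto simp: hh(6) hjV hjA\<close>)
      finally show ?thesis
        using 3 s by (simp add: act_rel_def h_diff hh(6) hjA hjV sweedler_jVA_closed act gAc
            P.a_comm[of ?s] P.add_diff_cancel d0)
    next
      case (4 v w)
      have "h (talg_in W (kap (wedge V v w))) = gV (kapV v w) \<oplus>\<^bsub>P\<^esub> gA (kapA v w)"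
        using 4 by (intro h(2)) (simp add: mem_Times_iff)
      then have "h (comm_rel v w) = (gV (kapV v w) \<oplus>\<^bsub>P\<^esub> gA (kapA v w)) \<ominus>\<^bsub>P\<^esub> (gV (kapV v w) \<oplus>\<^bsub>P\<^esub> gA (kapA v w))"
        using 4 unfolding comm_rel_def
        by (simp only: h_diff hh(6) hjV jV_closed kap_in_closed D.T.m_closed D.T.minus_closed comm)
      then show ?thesis using 4 by (simp add: d0 gVc gAc)
    qed
  qed
  from D.T.quot_Idl_factor[OF rels_carrier P h(1) this] obtain g where
    g: "g \<in> alg_hom HH P" "\<And>t. t \<in> carrier TW \<Longrightarrow> g (hproj t) = h t"
    unfolding Hlk_def Hrel_Idl hproj_def by blast
  show ?thesis
    by (rule bexI[OF _ g(1)]) (simp add: hV_hproj hA_hproj g(2) hjV hjA)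
qed

subsection \<open>The filtration\<close>

definition hword :: "('v + 'a) list \<Rightarrow> (('v \<times> 'a) list \<Rightarrow>\<^sub>0 'k) set set" where
  "hword gs = foldr (\<lambda>g h. Hg g \<otimes>\<^bsub>HH\<^esub> h) gs \<one>\<^bsub>HH\<^esub>"

abbreviation "gens \<equiv> carrier V <+> carrier A"
abbreviation nV :: "('v + 'a) list \<Rightarrow> nat" where "nV gs \<equiv> length (filter isl gs)"

lemma Hg_closed: "g \<in> gens \<Longrightarrow> Hg g \<in> carrier HH"
  by auto

lemma hword_simps [simp]: "hword [] = \<one>\<^bsub>HH\<^esub>" "hword (g # gs) = Hg g \<otimes>\<^bsub>HH\<^esub> hword gs"
  by (simp_all add: hword_def)

lemma hword_closed: "gs \<in> lists gens \<Longrightarrow> hword gs \<in> carrier HH"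
  by (induction gs) (auto simp: Hg_closed)

lemma hword_append: "gs \<in> lists gens \<Longrightarrow> gs' \<in> lists gens \<Longrightarrow> hword (gs @ gs') = hword gs \<otimes>\<^bsub>HH\<^esub> hword gs'"
  by (induction gs) (auto simp: hword_closed Hg_closed H.m_assoc simp del: in_lists_conv_set)

lemma HF_def: "HF n = kspan HH {hword gs | gs. gs \<in> lists gens \<and> nV gs \<le> n}"
  by (simp add: Hlk_filt_def hword_def)

lemma HF_gens_carrier: "{hword gs | gs. gs \<in> lists gens \<and> nV gs \<le> n} \<subseteq> carrier HH"
  using hword_closed by blast

lemma HF_subspace: "submodule (HF n) ring_of_type_algebra HH"
  unfolding HF_def by (rule H.subspace_kspan[OF HF_gens_carrier])

lemma hword_HF: "gs \<in> lists gens \<Longrightarrow> nV gs \<le> n \<Longrightarrow> hword gs \<in> HF n"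
  unfolding HF_def by (rule kspan_base) blast

lemma HF_mult:
  assumes "x \<in> HF m" "y \<in> HF n" shows "x \<otimes>\<^bsub>HH\<^esub> y \<in> HF (m + n)"
proof -
  have lin: "klinear HH HH (\<lambda>x. x \<otimes>\<^bsub>HH\<^esub> y)" "klinear HH HH (\<lambda>x. y \<otimes>\<^bsub>HH\<^esub> x)" if "y \<in> carrier HH" for y
    using that by (auto intro!: klinearI simp: H.l_distr H.r_distr H.mult_smult_left H.mult_smult_right)
  have y: "y \<in> carrier HH" using H.subspaceD(1)[OF HF_subspace] assms(2) by blast
  have 1: "hword gs \<otimes>\<^bsub>HH\<^esub> y \<in> HF (m + n)" if gs: "gs \<in> lists gens" "nV gs \<le> m" for gs
  proof -
    have "{hword gs | gs. gs \<in> lists gens \<and> nV gs \<le> n} \<subseteq> {y \<in> carrier HH. hword gs \<otimes>\<^bsub>HH\<^esub> y \<in> HF (m + n)}"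
    proof
      fix z assume "z \<in> {hword gs | gs. gs \<in> lists gens \<and> nV gs \<le> n}"
      then obtain gs' where g: "z = hword gs'" "gs' \<in> lists gens" "nV gs' \<le> n" by blast
      have "hword (gs @ gs') \<in> HF (m + n)"
        by (rule hword_HF) (use g gs in \<open>auto simp: append_in_lists_conv\<close>)
      then show "z \<in> {y \<in> carrier HH. hword gs \<otimes>\<^bsub>HH\<^esub> y \<in> HF (m + n)}"
        using g gs by (simp add: hword_append hword_closed del: in_lists_conv_set)
    qed
    from H.kspan_least[OF subspace_kernel[OF H.kvs H.kvs lin(2)[OF hword_closed[OF gs(1)]] HF_subspace] this]
    show ?thesis using assms(2) unfolding HF_def[of n] by blast
  qed
  have "{hword gs | gs. gs \<in> lists gens \<and> nV gs \<le> m} \<subseteq> {x \<in> carrier HH. x \<otimes>\<^bsub>HH\<^esub> y \<in> HF (m + n)}"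
    using 1 hword_closed by blast
  from H.kspan_least[OF subspace_kernel[OF H.kvs H.kvs lin(1)[OF y] HF_subspace] this]
  show ?thesis using assms(1) unfolding HF_def[of m] by blast
qed

lemma HF_Suc: "HF n \<subseteq> HF (Suc n)"
  unfolding HF_def[of n] by (rule H.kspan_least[OF HF_subspace]) (auto intro: hword_HF)

lemma HF_one: "\<one>\<^bsub>HH\<^esub> \<in> HF 0"
  using hword_HF[of "[]" 0] by simp

lemma hV_HF: "v \<in> carrier V \<Longrightarrow> hV v \<in> HF 1"
  using hword_HF[of "[Inl v]" 1] by (simp add: InlI)

lemma hA_HF: "a \<in> carrier A \<Longrightarrow> hA a \<in> HF 0"
  using hword_HF[of "[Inr a]" 0] by (simp add: InrI)

lemma HF_mono: "m \<le> n \<Longrightarrow> HF m \<subseteq> HF n"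
  by (rule lift_Suc_mono_le[of HF]) (rule HF_Suc)

lemma hproj_W: "w \<in> carrier W \<Longrightarrow> hproj (talg_in W w) = hV (fst w) \<oplus>\<^bsub>HH\<^esub> hA (snd w)"
proof -
  assume w: "w \<in> carrier W"
  then have "talg_in W w = jV (fst w) \<oplus>\<^bsub>TW\<^esub> jA (snd w)"
    using klinear_add[OF D.klinear_talg_in, of "(fst w, \<zero>\<^bsub>A\<^esub>)" "(\<zero>\<^bsub>V\<^esub>, snd w)"] by (auto simp: mem_Times_iff)
  then show ?thesis using w by (simp add: hproj(4) hV_hproj hA_hproj mem_Times_iff)
qed

text \<open>Every element of the tensor algebra is a combination of words in \<open>V \<oplus> A\<close>, and each letter lies
  in \<open>F\<^sub>1\<close>.\<close>

lemma HF_exhaust: "x \<in> carrier HH \<Longrightarrow> \<exists>n. x \<in> HF n"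
proof -
  assume "x \<in> carrier HH"
  then obtain t where t: "t \<in> carrier TW" "x = hproj t"
    unfolding Hlk_def carrier_quot hproj_def by blast
  from t(1) have "\<exists>n. hproj t \<in> HF n"
  proof (induction rule: D.talg_induct)
    case (word ws)
    then show ?case
    proof (induction ws)
      case Nil
      then show ?case using HF_one by (auto simp: D.tproj_Nil hproj(7))
    next
      case (Cons w ws)
      then obtain n where n: "hproj (D.tproj (pt ws)) \<in> HF n" by auto
      have w: "w \<in> carrier W" "ws \<in> lists (carrier W)" using Cons by auto
      have "hproj (talg_in W w) \<in> HF 1"
        unfolding hproj_W[OF w(1)] using w(1) hA_HF HF_mono[of 0 1]
        by (intro H.subspaceD(3)[OF HF_subspace] hV_HF) (auto simp: mem_Times_iff)
      from HF_mult[OF this n] have "hproj (D.tproj (pt (w # ws))) \<in> HF (1 + n)"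
        using w D.talg_in_closed[OF w(1)] D.tproj(3)[OF D.pt_closed[OF w(2)]]
        by (simp only: D.tproj_Cons[OF w] hproj(6))
      then show ?case by blast
    qed
  next
    case (add s t)
    then obtain m n where mn: "hproj s \<in> HF m" "hproj t \<in> HF n" by blast
    have "hproj s \<in> HF (max m n)" "hproj t \<in> HF (max m n)"
      using mn HF_mono[of m "max m n"] HF_mono[of n "max m n"] by auto
    then have "hproj (s \<oplus>\<^bsub>TW\<^esub> t) \<in> HF (max m n)"
      using add by (simp add: hproj(4) H.subspaceD(3)[OF HF_subspace])
    then show ?case by blast
  next
    case (smult c t)
    then obtain n where "hproj t \<in> HF n" by blast
    then have "hproj (c \<odot>\<^bsub>TW\<^esub> t) \<in> HF n"
      using smult by (simp add: hproj(5) H.subspaceD(4)[OF HF_subspace])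
    then show ?case by blast
  qed
  with t show ?thesis by simp
qed

sublocale HF: filtered_algebra "Hlk A \<Delta> V act lam kap" "Hlk_filt A \<Delta> V act lam kap"
  by (intro filtered_algebra.intro filtered_algebra_axioms.intro H.kalgebra_axioms HF_subspace HF_Suc
      HF_mult HF_one HF_exhaust)

abbreviation "Gr \<equiv> gr HH HF"
abbreviation "gin \<equiv> gr_in HH HF"

end

context filtered_algebra
begin

lemma gr_in_cong:
  assumes "x \<in> Fl n" "y \<in> Fl n" "x \<ominus> y \<in> below n" shows "gr_in H Fl n x = gr_in H Fl n y"
proof -
  have "below n +> x = below n +> y"
    using assms coset_eq_iff[OF below_subspace] Fl_carrier by blast
  then show ?thesis by (simp add: gr_in_def fun_eq_iff)
qed

lemma gr_in_add:
  assumes "x \<in> Fl n" "y \<in> Fl n" shows "gr_in H Fl n (x \<oplus> y) = gr_in H Fl n x \<oplus>\<^bsub>G\<^esub> gr_in H Fl n y"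
proof -
  have "homog n (x \<oplus> y) = homog n x \<oplus>\<^bsub>rees\<^esub> homog n y" by (auto simp: homog_def fun_eq_iff)
  then show ?thesis
    using assms by (simp only: cls_homog[symmetric] subspaceD(3)[OF Fl_subspace] cls_add homog_closed)
qed

lemma gr_in_smult:
  assumes "x \<in> Fl n" shows "gr_in H Fl n (c \<odot> x) = c \<odot>\<^bsub>G\<^esub> gr_in H Fl n x"
proof -
  have "homog n (c \<odot> x) = c \<odot>\<^bsub>rees\<^esub> homog n x" by (auto simp: homog_def fun_eq_iff)
  then show ?thesis
    using assms by (simp only: cls_homog[symmetric] subspaceD(4)[OF Fl_subspace] cls_smult homog_closed)
qed

lemma gr_in_one: "gr_in H Fl 0 \<one> = \<one>\<^bsub>G\<^esub>"
proof -
  have "homog 0 \<one> = \<one>\<^bsub>rees\<^esub>" by (simp add: homog_def fun_eq_iff)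
  then show ?thesis by (simp only: cls_homog[symmetric] Fl_one cls_one)
qed

text \<open>An element of the Rees algebra is the finite sum of its homogeneous parts, and \<open>cls\<close> is linear
  and onto.\<close>

lemma gr_generated:
  assumes U: "submodule U ring_of_type_algebra G"
    and hom: "\<And>n x. x \<in> Fl n \<Longrightarrow> gr_in H Fl n x \<in> U"
  shows "carrier G \<subseteq> U"
proof
  have *: "x \<in> carrier rees \<Longrightarrow> (\<forall>n\<ge>N. x n = \<zero>) \<Longrightarrow> cls x \<in> U" for x N
  proof (induction N arbitrary: x)
    case 0
    then have "x = \<zero>\<^bsub>rees\<^esub>" by (auto simp: fun_eq_iff)
    then show ?case using G.subspaceD(2)[OF U] by (simp only: cls_zero)
  next
    case (Suc N)
    let ?y = "x(N := \<zero>)"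
    have y0: "\<forall>n\<ge>N. ?y n = \<zero>" using Suc.prems(2) by (auto simp: Suc_le_eq)
    have xn: "x n \<in> Fl n" for n using Suc.prems by simp
    have y: "?y \<in> carrier rees"
    proof (rule reesI)
      show "?y n \<in> Fl n" for n using xn Fl_zero by simp
      show "bound \<zero> N ?y"
      proof
        fix m assume "N < m"
        then show "?y m = \<zero>" using y0[rule_format, of m] by simp
      qed
    qed
    have "x = ?y \<oplus>\<^bsub>rees\<^esub> homog N (x N)"
      using Fl_carrier[OF xn] by (auto simp: fun_eq_iff homog_def)
    then have e: "cls x = cls ?y \<oplus>\<^bsub>G\<^esub> gr_in H Fl N (x N)"
      using cls_add[OF y homog_closed[OF xn]] cls_homog[OF xn] by metis
    show ?case unfolding e by (rule G.subspaceD(3)[OF U Suc.IH[OF y y0] hom[OF xn]])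
  qed
  fix P assume "P \<in> carrier G"
  then obtain x where x: "x \<in> carrier rees" "P = cls x" unfolding carrier_gr by blast
  then obtain N where "bound \<zero> N x" by auto
  then have "\<forall>n\<ge>Suc N. x n = \<zero>" by (auto simp: bound_def)
  with * x show "P \<in> U" by blast
qed

end

section \<open>The natural map onto the associated graded algebra\<close>

context deformed_smash
begin

lemmas hV_HF' = hV_HF[unfolded One_nat_def]

abbreviation "gV v \<equiv> gin (Suc 0) (hV v)"
abbreviation "gA a \<equiv> gin 0 (hA a)"

lemma klinear_gV: "klinear V Gr (\<lambda>v. gV v)"
  by (rule HF.klinear_gr_in[OF V.kvs klinear_hV hV_HF'])

lemma klinear_gA: "klinear A Gr (\<lambda>a. gA a)"
  by (rule HF.klinear_gr_in[OF A.kvs klinear_hA hA_HF])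

lemma gV_closed [simp, intro]: "v \<in> carrier V \<Longrightarrow> gV v \<in> carrier Gr"
  and gA_closed [simp, intro]: "a \<in> carrier A \<Longrightarrow> gA a \<in> carrier Gr"
  by (rule klinear_closed[OF klinear_gV], assumption) (rule klinear_closed[OF klinear_gA])

lemma gA_one: "gA \<one>\<^bsub>A\<^esub> = \<one>\<^bsub>Gr\<^esub>"
  by (simp add: hA_one HF.gr_in_one)

lemma gA_mult: "a \<in> carrier A \<Longrightarrow> b \<in> carrier A \<Longrightarrow> gA a \<otimes>\<^bsub>Gr\<^esub> gA b = gA (a \<otimes>\<^bsub>A\<^esub> b)"
  using HF.gr_in_mult[OF hA_HF hA_HF, of a b] by (simp add: hA_mult)

text \<open>The commutator of \<open>v\<close> and \<open>w\<close> is \<open>\<kappa>(v, w)\<close>, which lies in \<open>F\<^sub>1\<close> and hence vanishes in \<open>F\<^sub>2 /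
  F\<^sub>1\<close>.\<close>

lemma gV_commute:
  assumes v: "v \<in> carrier V" and w: "w \<in> carrier V"
  shows "gV v \<otimes>\<^bsub>Gr\<^esub> gV w = gV w \<otimes>\<^bsub>Gr\<^esub> gV v"
proof -
  have "(hV v \<otimes>\<^bsub>HH\<^esub> hV w) \<ominus>\<^bsub>HH\<^esub> (hV w \<otimes>\<^bsub>HH\<^esub> hV v) \<in> HF (Suc 0)"
    unfolding hV_hV[OF v w]
    by (intro H.subspaceD(3)[OF HF_subspace] hV_HF' subsetD[OF HF_mono[of 0 "Suc 0"] hA_HF]) (use v w in auto)
  then have "gin 2 (hV v \<otimes>\<^bsub>HH\<^esub> hV w) = gin 2 (hV w \<otimes>\<^bsub>HH\<^esub> hV v)"
    using HF_mult[OF hV_HF' hV_HF'] v w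
    by (intro HF.gr_in_cong) (auto simp: HF.below_simps numeral_2_eq_2)
  then show ?thesis
    using HF.gr_in_mult[OF hV_HF' hV_HF'] v w by (simp add: numeral_2_eq_2)
qed

lemma klinear_Gr_mult_left: "x \<in> carrier Gr \<Longrightarrow> klinear Gr Gr (\<lambda>y. x \<otimes>\<^bsub>Gr\<^esub> y)"
  and klinear_Gr_mult_right: "x \<in> carrier Gr \<Longrightarrow> klinear Gr Gr (\<lambda>y. y \<otimes>\<^bsub>Gr\<^esub> x)"
  by (auto intro!: klinearI simp: HF.G.l_distr HF.G.r_distr HF.G.mult_smult_left HF.G.mult_smult_right)

lemma klinear_H_mult_left: "x \<in> carrier HH \<Longrightarrow> klinear HH HH (\<lambda>y. x \<otimes>\<^bsub>HH\<^esub> y)"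
  and klinear_H_mult_right: "x \<in> carrier HH \<Longrightarrow> klinear HH HH (\<lambda>y. y \<otimes>\<^bsub>HH\<^esub> x)"
  by (auto intro!: klinearI simp: H.l_distr H.r_distr H.mult_smult_left H.mult_smult_right)

text \<open>The term \<open>\<lambda>(a, v)\<close> lies in \<open>F\<^sub>0\<close> and hence vanishes in \<open>F\<^sub>1 / F\<^sub>0\<close>.\<close>

lemma gA_gV:
  assumes a: "a \<in> carrier A" and v: "v \<in> carrier V"
  shows "gA a \<otimes>\<^bsub>Gr\<^esub> gV v = sweedler Gr (\<lambda>x y. gV (act x v) \<otimes>\<^bsub>Gr\<^esub> gA y) a"
proof -
  let ?f = "\<lambda>x y. hV (act x v) \<otimes>\<^bsub>HH\<^esub> hA y"
  let ?g = "\<lambda>x y. gV (act x v) \<otimes>\<^bsub>Gr\<^esub> gA y"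
  have f: "kbilinear A A HH ?f"
    by (intro kbilinearI klinear_comp[OF klinear_comp[OF klinear_act_left klinear_hV] klinear_H_mult_right]
        klinear_comp[OF klinear_hA klinear_H_mult_left]) (use v in auto)
  have g: "kbilinear A A Gr ?g"
    by (intro kbilinearI klinear_comp[OF klinear_comp[OF klinear_act_left klinear_gV] klinear_Gr_mult_right]
        klinear_comp[OF klinear_gA klinear_Gr_mult_left]) (use v in auto)
  note fl = AA.klinear_tens_ext[OF H.kvs f] and gl = AA.klinear_tens_ext[OF HF.G.kvs g]
  have f1: "?f x y \<in> HF (Suc 0)" if "x \<in> carrier A" "y \<in> carrier A" for x y
    using HF_mult[OF hV_HF' hA_HF] that v by fastforce
  have fF: "tens_ext HH ?f t \<in> HF (Suc 0)" if "t \<in> carrier (tensor A A)" for t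
    using that
  proof (induction rule: AA.tensor_induct)
    case (tens x y)
    then show ?case by (simp only: AA.tens_ext_tens[OF H.kvs f] f1)
  next
    case (add s t)
    then show ?case by (simp only: klinear_add[OF fl] H.subspaceD(3)[OF HF_subspace])
  next
    case (smult c t)
    then show ?case by (simp only: klinear_smult[OF fl] H.subspaceD(4)[OF HF_subspace])
  qed
  have e: "gin (Suc 0) (tens_ext HH ?f t) = tens_ext Gr ?g t" if "t \<in> carrier (tensor A A)" for t
  proof (rule AA.tensor_eqI[OF HF.G.kvs HF.klinear_gr_in[OF AA.kvs_tensor fl fF] gl _ that])
    fix x y assume xy: "x \<in> carrier A" "y \<in> carrier A"
    have "gin (Suc 0) (?f x y) = ?g x y"
      using HF.gr_in_mult[OF hV_HF'[OF act_closed[OF xy(1) v]] hA_HF[OF xy(2)]] by simp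
    then show "gin (Suc 0) (tens_ext HH ?f (tens A A x y)) = tens_ext Gr ?g (tens A A x y)"
      by (simp only: AA.tens_ext_tens[OF H.kvs f xy] AA.tens_ext_tens[OF HF.G.kvs g xy])
  qed
  let ?s = "sweedler HH ?f a"
  have s: "?s \<in> HF (Suc 0)" using fF a by blast
  have l: "hA (lamf a v) \<in> HF 0" using a v by (intro hA_HF) auto
  have p: "hA a \<otimes>\<^bsub>HH\<^esub> hV v \<in> HF (Suc 0)" using HF_mult[OF hA_HF[OF a] hV_HF'[OF v]] by simp
  have "(hA a \<otimes>\<^bsub>HH\<^esub> hV v) \<ominus>\<^bsub>HH\<^esub> ?s = hA (lamf a v)"
    unfolding hA_hV[OF a v] using HF.Fl_carrier[OF s] a v by (simp add: H.a_comm[of ?s] H.add_diff_cancel)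
  then have "gin (Suc 0) (hA a \<otimes>\<^bsub>HH\<^esub> hV v) = gin (Suc 0) ?s"
    using l by (intro HF.gr_in_cong p s) (simp add: HF.below_simps)
  then show ?thesis
    using HF.gr_in_mult[OF hA_HF[OF a] hV_HF'[OF v]] e[OF \<Delta>_closed[OF a]] by simp
qed

definition gword :: "'v list \<Rightarrow> nat \<Rightarrow> (('v \<times> 'a) list \<Rightarrow>\<^sub>0 'k) set set set" where
  "gword vs = foldr (\<lambda>v x. gV v \<otimes>\<^bsub>Gr\<^esub> x) vs \<one>\<^bsub>Gr\<^esub>"

lemma gword_simps [simp]: "gword [] = \<one>\<^bsub>Gr\<^esub>" "gword (v # vs) = gV v \<otimes>\<^bsub>Gr\<^esub> gword vs"
  by (simp_all add: gword_def)

lemma gword_closed [simp, intro]: "vs \<in> lists (carrier V) \<Longrightarrow> gword vs \<in> carrier Gr"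
  by (induction vs) auto

lemma gword_append:
  "us \<in> lists (carrier V) \<Longrightarrow> vs \<in> lists (carrier V) \<Longrightarrow> gword (us @ vs) = gword us \<otimes>\<^bsub>Gr\<^esub> gword vs"
  by (induction us) (auto simp: HF.G.m_assoc)

lemma sym_multilinear_gword: "sym_multilinear V Gr gword"
  unfolding sym_multilinear_def
proof (intro conjI ballI)
  fix u w x y assume uw: "u \<in> lists (carrier V)" "w \<in> lists (carrier V)"
  note c = gword_closed[OF uw(1)] gword_closed[OF uw(2)]
  have "klinear V Gr (\<lambda>x. gword u \<otimes>\<^bsub>Gr\<^esub> (gV x \<otimes>\<^bsub>Gr\<^esub> gword w))"
    by (intro klinear_comp[OF klinear_comp[OF klinear_gV klinear_Gr_mult_right] klinear_Gr_mult_left] c)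
  then show "klinear V Gr (\<lambda>x. gword (u @ x # w))"
    by (rule klinear_cong[OF V.kvs]) (use gword_append[OF uw(1)] uw(2) in simp)
  assume xy: "x \<in> carrier V" "y \<in> carrier V"
  have "gV x \<otimes>\<^bsub>Gr\<^esub> (gV y \<otimes>\<^bsub>Gr\<^esub> gword w) = gV y \<otimes>\<^bsub>Gr\<^esub> (gV x \<otimes>\<^bsub>Gr\<^esub> gword w)"
    using xy c by (simp only: HF.G.m_assoc[symmetric] gV_closed gV_commute)
  then show "gword (u @ x # y # w) = gword (u @ y # x # w)"
    using gword_append[OF uw(1), of "x # y # w"] gword_append[OF uw(1), of "y # x # w"] uw(2) xy by simp
qed auto

definition "nuS = sym_ext Gr gword"
definition "nu = tens_ext Gr (\<lambda>f a. nuS f \<otimes>\<^bsub>Gr\<^esub> gA a)"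

lemma klinear_nuS: "klinear Sym Gr nuS"
  unfolding nuS_def by (rule klinear_sym_ext[OF HF.G.kvs sym_multilinear_gword])

lemma nuS_word: "vs \<in> lists (carrier V) \<Longrightarrow> nuS (sym_word vs) = gword vs"
  unfolding nuS_def by (rule sym_ext_word[OF HF.G.kvs sym_multilinear_gword])

lemma nuS_closed [simp, intro]: "f \<in> carrier Sym \<Longrightarrow> nuS f \<in> carrier Gr"
  by (rule klinear_closed[OF klinear_nuS])

lemma nuS_sym_in: "v \<in> carrier V \<Longrightarrow> nuS (sym_in V v) = gV v"
  using nuS_word[of "[v]"] by simp

lemma nuS_mult: "f \<in> carrier Sym \<Longrightarrow> g \<in> carrier Sym \<Longrightarrow> nuS (f \<otimes>\<^bsub>Sym\<^esub> g) = nuS f \<otimes>\<^bsub>Gr\<^esub> nuS g"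
proof -
  have 1: "nuS (sym_word us \<otimes>\<^bsub>Sym\<^esub> g) = gword us \<otimes>\<^bsub>Gr\<^esub> nuS g"
    if "us \<in> lists (carrier V)" "g \<in> carrier Sym" for us g
  proof (rule sym_eqI[OF HF.G.kvs klinear_comp[OF klinear_mult_left klinear_nuS]
        klinear_comp[OF klinear_nuS klinear_Gr_mult_left] _ that(2)])
    fix ws assume "ws \<in> lists (carrier V)"
    then show "nuS (sym_word us \<otimes>\<^bsub>Sym\<^esub> sym_word ws) = gword us \<otimes>\<^bsub>Gr\<^esub> nuS (sym_word ws)"
      using that(1) nuS_word[of "us @ ws"] by (simp add: sym_word_append gword_append nuS_word)
  qed (use that in auto)
  assume fg: "f \<in> carrier Sym" "g \<in> carrier Sym"
  show ?thesis
    by (rule sym_eqI[OF HF.G.kvs klinear_comp[OF klinear_mult_right[OF fg(2)] klinear_nuS]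
        klinear_comp[OF klinear_nuS klinear_Gr_mult_right[OF nuS_closed[OF fg(2)]]] _ fg(1)])
      (simp only: 1[OF _ fg(2)] nuS_word)
qed

lemma kbilinear_nu: "kbilinear Sym A Gr (\<lambda>f a. nuS f \<otimes>\<^bsub>Gr\<^esub> gA a)"
  by (intro kbilinearI klinear_comp[OF klinear_nuS klinear_Gr_mult_right]
      klinear_comp[OF klinear_gA klinear_Gr_mult_left]) auto

lemma klinear_nu: "klinear SymA Gr nu"
  unfolding nu_def by (rule SA.klinear_tens_ext[OF HF.G.kvs kbilinear_nu])

lemma nu_tn: "f \<in> carrier Sym \<Longrightarrow> a \<in> carrier A \<Longrightarrow> nu (tn f a) = nuS f \<otimes>\<^bsub>Gr\<^esub> gA a"
  unfolding nu_def by (rule SA.tens_ext_tens[OF HF.G.kvs kbilinear_nu])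

text \<open>In the associated graded algebra, elements of \<open>A\<close> move past words exactly as they do in the
  smash product; coassociativity is what makes the induction on the word work.\<close>

lemma gA_gword:
  assumes "vs \<in> lists (carrier V)" "vs \<noteq> []" "b \<in> carrier A"
  shows "gA b \<otimes>\<^bsub>Gr\<^esub> gword vs = sweedler Gr (\<lambda>x y. nuS (wact vs x) \<otimes>\<^bsub>Gr\<^esub> gA y) b"
  using assms
proof (induction vs arbitrary: b)
  case (Cons v vs)
  then have v: "v \<in> carrier V" and vs: "vs \<in> lists (carrier V)" and b: "b \<in> carrier A" by auto
  show ?case
  proof (cases "vs = []")
    case True
    have "sweedler Gr (\<lambda>x y. gV (act x v) \<otimes>\<^bsub>Gr\<^esub> gA y) b = sweedler Gr (\<lambda>x y. nuS (wact [v] x) \<otimes>\<^bsub>Gr\<^esub> gA y) b"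
      by (rule AA.tens_ext_cong[OF HF.G.kvs]) (use v b in \<open>auto simp: nuS_sym_in\<close>)
    then show ?thesis using True v b gA_gV[OF b v] by simp
  next
    case False
    define K where "K x y z = gV (act x v) \<otimes>\<^bsub>Gr\<^esub> (nuS (wact vs y) \<otimes>\<^bsub>Gr\<^esub> gA z)" for x y z
    have Kc: "K x y z \<in> carrier Gr" if "x \<in> carrier A" "y \<in> carrier A" "z \<in> carrier A" for x y z
      unfolding K_def using that v vs False by auto
    have K1: "klinear A Gr (\<lambda>x. K x y z)" if "y \<in> carrier A" "z \<in> carrier A" for y z
      unfolding K_def using that v vs False
      by (intro klinear_comp[OF klinear_comp[OF klinear_act_left klinear_gV] klinear_Gr_mult_right]) auto
    have K2: "klinear A Gr (\<lambda>y. K x y z)" if "x \<in> carrier A" "z \<in> carrier A" for x z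
      unfolding K_def using that v vs False
      by (intro klinear_comp[OF klinear_comp[OF klinear_comp[OF klinear_wact klinear_nuS]
            klinear_Gr_mult_right] klinear_Gr_mult_left]) auto
    have K3: "klinear A Gr (\<lambda>z. K x y z)" if "x \<in> carrier A" "y \<in> carrier A" for x y
      unfolding K_def using that v vs False
      by (intro klinear_comp[OF klinear_comp[OF klinear_gA klinear_Gr_mult_left] klinear_Gr_mult_left]) auto
    have gg: "gV (act x v) \<otimes>\<^bsub>Gr\<^esub> gA y \<in> carrier Gr" if "x \<in> carrier A" "y \<in> carrier A" for x y
      using that v by auto
    have sc: "sweedler Gr (K x) y \<in> carrier Gr" "sweedler Gr (\<lambda>x1 x2. K x1 x2 y) x \<in> carrier Gr"
      if "x \<in> carrier A" "y \<in> carrier A" for x y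
      by (rule AA.tens_ext_closed[OF HF.G.kvs]; use that Kc in auto)+
    have in1: "(gV (act x v) \<otimes>\<^bsub>Gr\<^esub> gA y) \<otimes>\<^bsub>Gr\<^esub> gword vs = sweedler Gr (K x) y"
      if xy: "x \<in> carrier A" "y \<in> carrier A" for x y
    proof -
      have "(gV (act x v) \<otimes>\<^bsub>Gr\<^esub> gA y) \<otimes>\<^bsub>Gr\<^esub> gword vs = gV (act x v) \<otimes>\<^bsub>Gr\<^esub> (gA y \<otimes>\<^bsub>Gr\<^esub> gword vs)"
        using xy v vs by (intro HF.G.m_assoc) auto
      also have "\<dots> = gV (act x v) \<otimes>\<^bsub>Gr\<^esub> sweedler Gr (\<lambda>p q. nuS (wact vs p) \<otimes>\<^bsub>Gr\<^esub> gA q) y"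
        using Cons.IH[OF False xy(2)] by simp
      also have "\<dots> = sweedler Gr (K x) y"
        unfolding K_def
        by (rule AA.klinear_tens_ext_comp[OF HF.G.kvs HF.G.kvs klinear_Gr_mult_left]) (use xy v vs False in auto)
      finally show ?thesis .
    qed
    have in2: "nuS (wact (v # vs) x) \<otimes>\<^bsub>Gr\<^esub> gA y = sweedler Gr (\<lambda>x1 x2. K x1 x2 y) x"
      if xy: "x \<in> carrier A" "y \<in> carrier A" for x y
    proof -
      have lin: "klinear Sym Gr (\<lambda>f. nuS f \<otimes>\<^bsub>Gr\<^esub> gA y)"
        by (rule klinear_comp[OF klinear_nuS klinear_Gr_mult_right]) (use xy in auto)
      have "nuS (wact (v # vs) x) \<otimes>\<^bsub>Gr\<^esub> gA y =
          sweedler Gr (\<lambda>x1 x2. nuS (sym_in V (act x1 v) \<otimes>\<^bsub>Sym\<^esub> wact vs x2) \<otimes>\<^bsub>Gr\<^esub> gA y) x"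
        using False by (simp, intro AA.klinear_tens_ext_comp[OF S.kvs HF.G.kvs lin]) (use xy v vs in auto)
      also have "\<dots> = sweedler Gr (\<lambda>x1 x2. K x1 x2 y) x"
        by (rule AA.tens_ext_cong[OF HF.G.kvs])
          (use xy v vs False Kc in \<open>auto simp: nuS_mult nuS_sym_in K_def HF.G.m_assoc\<close>)
      finally show ?thesis .
    qed
    have "gA b \<otimes>\<^bsub>Gr\<^esub> gword (v # vs) = (gA b \<otimes>\<^bsub>Gr\<^esub> gV v) \<otimes>\<^bsub>Gr\<^esub> gword vs"
      using b v vs by (simp add: HF.G.m_assoc)
    also have "\<dots> = sweedler Gr (\<lambda>x y. (gV (act x v) \<otimes>\<^bsub>Gr\<^esub> gA y) \<otimes>\<^bsub>Gr\<^esub> gword vs) b"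
      unfolding gA_gV[OF b v]
      by (rule AA.klinear_tens_ext_comp[OF HF.G.kvs HF.G.kvs klinear_Gr_mult_right]) (use b v vs in auto)
    also have "\<dots> = sweedler Gr (\<lambda>x y. sweedler Gr (K x) y) b"
      by (rule AA.tens_ext_cong[OF HF.G.kvs]) (use b sc in1 in auto)
    also have "\<dots> = sweedler Gr (\<lambda>x y. sweedler Gr (\<lambda>x1 x2. K x1 x2 y) x) b"
      by (rule sweedler_assoc[OF HF.G.kvs K1 K2 K3 b, symmetric])
    also have "\<dots> = sweedler Gr (\<lambda>x y. nuS (wact (v # vs) x) \<otimes>\<^bsub>Gr\<^esub> gA y) b"
    proof (rule AA.tens_ext_cong[OF HF.G.kvs])
      fix x y assume xy: "x \<in> carrier A" "y \<in> carrier A"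
      show "nuS (wact (v # vs) x) \<otimes>\<^bsub>Gr\<^esub> gA y \<in> carrier Gr" unfolding in2[OF xy] by (rule sc(2)[OF xy])
      show "sweedler Gr (\<lambda>x1 x2. K x1 x2 y) x = nuS (wact (v # vs) x) \<otimes>\<^bsub>Gr\<^esub> gA y" by (rule in2[OF xy, symmetric])
    qed (use b in auto)
    finally show ?thesis .
  qed
qed simp

lemma nu_sword:
  assumes f: "f \<in> carrier Sym" and b: "b \<in> carrier A" and vs: "vs \<in> lists (carrier V)" and a: "a \<in> carrier A"
  shows "nu (sword f b vs a) = (nuS f \<otimes>\<^bsub>Gr\<^esub> gA b) \<otimes>\<^bsub>Gr\<^esub> (gword vs \<otimes>\<^bsub>Gr\<^esub> gA a)"
proof (cases "vs = []")
  case True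
  then show ?thesis using f b a by (simp add: nu_tn gA_mult[symmetric] HF.G.m_assoc)
next
  case False
  have lin: "klinear Gr Gr (\<lambda>u. nuS f \<otimes>\<^bsub>Gr\<^esub> (u \<otimes>\<^bsub>Gr\<^esub> gA a))"
    by (rule klinear_comp[OF klinear_Gr_mult_right klinear_Gr_mult_left]) (use f a in auto)
  have "nu (sword f b vs a) = sweedler Gr (\<lambda>x y. nu (tn (f \<otimes>\<^bsub>Sym\<^esub> wact vs x) (y \<otimes>\<^bsub>A\<^esub> a))) b"
    unfolding sword_nonempty[OF False]
    by (rule AA.klinear_tens_ext_comp[OF SA.kvs_tensor HF.G.kvs klinear_nu]) (use f b vs a False in auto)
  also have "\<dots> = sweedler Gr (\<lambda>x y. nuS f \<otimes>\<^bsub>Gr\<^esub> ((nuS (wact vs x) \<otimes>\<^bsub>Gr\<^esub> gA y) \<otimes>\<^bsub>Gr\<^esub> gA a)) b"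
    by (rule AA.tens_ext_cong[OF HF.G.kvs])
      (use f b vs a False in \<open>auto simp: nu_tn nuS_mult gA_mult[symmetric] HF.G.m_assoc\<close>)
  also have "\<dots> = nuS f \<otimes>\<^bsub>Gr\<^esub> (sweedler Gr (\<lambda>x y. nuS (wact vs x) \<otimes>\<^bsub>Gr\<^esub> gA y) b \<otimes>\<^bsub>Gr\<^esub> gA a)"
    by (rule AA.klinear_tens_ext_comp[OF HF.G.kvs HF.G.kvs lin, symmetric]) (use b vs False in auto)
  also have "\<dots> = (nuS f \<otimes>\<^bsub>Gr\<^esub> gA b) \<otimes>\<^bsub>Gr\<^esub> (gword vs \<otimes>\<^bsub>Gr\<^esub> gA a)"
    unfolding gA_gword[OF vs False b, symmetric] using f b vs a by (simp add: HF.G.m_assoc)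
  finally show ?thesis .
qed

lemma nu_mult: 
  assumes s: "s \<in> carrier SymA" and t: "t \<in> carrier SymA"
  shows "nu (smash_mult A \<Delta> V act s t) = nu s \<otimes>\<^bsub>Gr\<^esub> nu t"
proof -
  note nuc = klinear_closed[OF klinear_nu]
  have 1: "nu (smash_mult A \<Delta> V act (tn f b) t) = nu (tn f b) \<otimes>\<^bsub>Gr\<^esub> nu t"
    if f: "f \<in> carrier Sym" and b: "b \<in> carrier A" for f b
  proof (rule smash_eqI[OF HF.G.kvs klinear_comp[OF klinear_smash_mult_right klinear_nu]
        klinear_comp[OF klinear_nu klinear_Gr_mult_left] _ t])
    fix vs a assume va: "vs \<in> lists (carrier V)" "a \<in> carrier A"
    show "nu (smash_mult A \<Delta> V act (tn f b) (tn (sym_word vs) a)) = nu (tn f b) \<otimes>\<^bsub>Gr\<^esub> nu (tn (sym_word vs) a)"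
      unfolding smash_mult_tn[OF f b va] nu_sword[OF f b va] nu_tn[OF f b]
        nu_tn[OF sym_word_closed[OF va(1)] va(2)] nuS_word[OF va(1)] ..
  qed (use f b nuc in auto)
  show ?thesis
    by (rule smash_eqI[OF HF.G.kvs klinear_comp[OF klinear_smash_mult_left[OF t] klinear_nu]
        klinear_comp[OF klinear_nu klinear_Gr_mult_right[OF nuc[OF t]]] _ s])
      (intro 1 sym_word_closed; assumption)
qed

abbreviation "natural \<equiv> natural_gr_map A \<Delta> V act lam kap"

lemma natural_nu: "natural nu"
proof -
  have "nu (iV v) = gV v" if "v \<in> carrier V" for v
    using that by (simp add: smashV_def nu_tn nuS_sym_in gA_one)
  moreover have iA: "nu (iA a) = gA a" if "a \<in> carrier A" for a
    using that nuS_word[of "[]"] by (simp add: smashA_def nu_tn)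
  moreover have "nu \<in> alg_hom B Gr"
  proof (rule alg_homI)
    show "nu \<one>\<^bsub>B\<^esub> = \<one>\<^bsub>Gr\<^esub>"
      unfolding smash_one using iA[of "\<one>\<^bsub>A\<^esub>"] by (simp add: smashA_def gA_one)
  qed (simp_all add: klinear_nu nu_mult)
  ultimately show ?thesis by (simp add: natural_gr_map_def)
qed

lemma naturalD:
  assumes "natural n"
  shows "n \<in> alg_hom B Gr" "\<And>v. v \<in> carrier V \<Longrightarrow> n (iV v) = gV v" "\<And>a. a \<in> carrier A \<Longrightarrow> n (iA a) = gA a"
  using assms by (simp_all add: natural_gr_map_def Let_def)

text \<open>The image of a natural map is a subalgebra that contains the classes of all generators.\<close>

lemma natural_surj:
  assumes n: "natural n" shows "n ` carrier B = carrier Gr"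
proof
  note hom = alg_homD[OF naturalD(1)[OF n]]
  show "n ` carrier B \<subseteq> carrier Gr" using hom(3) by blast
  have U: "submodule (n ` carrier B) ring_of_type_algebra Gr"
  proof (rule HF.G.subspaceI)
    show "\<zero>\<^bsub>Gr\<^esub> \<in> n ` carrier B"
      using klinear_zero[OF kvs_smash HF.G.kvs hom(1)] B.zero_closed by (metis image_eqI)
    fix x y c assume "x \<in> n ` carrier B" "y \<in> n ` carrier B"
    then obtain u w where u: "u \<in> carrier B" "x = n u" "w \<in> carrier B" "y = n w" by blast
    show "x \<oplus>\<^bsub>Gr\<^esub> y \<in> n ` carrier B"
      unfolding u(2,4) hom(4)[OF u(1,3), symmetric] using u(1,3) by (intro imageI B.a_closed)
  next
    fix c x assume "x \<in> n ` carrier B"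
    then obtain u where u: "u \<in> carrier B" "x = n u" by blast
    show "c \<odot>\<^bsub>Gr\<^esub> x \<in> n ` carrier B"
      unfolding u(2) hom(5)[OF u(1), symmetric] using u(1) by (intro imageI B.smult_closed)
  qed (use hom(3) in blast)
  have word: "gin (nV gs) (hword gs) \<in> n ` carrier B" if "gs \<in> lists gens" for gs
    using that
  proof (induction gs)
    case Nil
    have "n \<one>\<^bsub>B\<^esub> = gin 0 \<one>\<^bsub>HH\<^esub>" by (simp only: hom(7) HF.gr_in_one)
    moreover have "\<one>\<^bsub>B\<^esub> \<in> carrier B" unfolding smash_one by simp
    ultimately show ?case by (simp, metis image_eqI smash_sel(1))
  next
    case (Cons g gs)
    then obtain u where u: "u \<in> carrier SymA" "gin (nV gs) (hword gs) = n u" by auto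
    have w: "hword gs \<in> HF (nV gs)" using Cons by (intro hword_HF) auto
    from Cons have "g \<in> gens" by simp
    then show ?case
    proof
      fix v assume g: "g = Inl v" and v: "v \<in> carrier V"
      have "gin (nV (g # gs)) (hword (g # gs)) = gV v \<otimes>\<^bsub>Gr\<^esub> gin (nV gs) (hword gs)"
        using HF.gr_in_mult[OF hV_HF'[OF v] w] g by simp
      also have "\<dots> = n (iV v \<otimes>\<^bsub>B\<^esub> u)"
        unfolding u(2) naturalD(2)[OF n v, symmetric] by (rule hom(6)[symmetric]) (use u v in auto)
      finally show ?thesis using smash_mult_closed[OF iV_closed[OF v] u(1)] by auto
    next
      fix a assume g: "g = Inr a" and a: "a \<in> carrier A"
      have "gin (nV (g # gs)) (hword (g # gs)) = gA a \<otimes>\<^bsub>Gr\<^esub> gin (nV gs) (hword gs)"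
        using HF.gr_in_mult[OF hA_HF[OF a] w] g by simp
      also have "\<dots> = n (iA a \<otimes>\<^bsub>B\<^esub> u)"
        unfolding u(2) naturalD(3)[OF n a, symmetric] by (rule hom(6)[symmetric]) (use u a in auto)
      finally show ?thesis using smash_mult_closed[OF iA_closed[OF a] u(1)] by auto
    qed
  qed
  have *: "x \<in> HF m \<and> gin m x \<in> n ` carrier B" if "x \<in> HF m" for m x
    using that[unfolded HF_def] HF_gens_carrier
  proof (induction rule: H.kspan_induct)
    case (base x)
    then obtain gs where gs: "x = hword gs" "gs \<in> lists gens" "nV gs \<le> m" by blast
    have x: "x \<in> HF m" unfolding gs(1) by (rule hword_HF[OF gs(2,3)])
    show ?case
    proof (cases "nV gs = m")
      case True
      then show ?thesis using word[OF gs(2)] x gs(1) by simp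
    next
      case False
      then have "x \<in> HF.below m"
        using gs hword_HF[OF gs(2), of "m - 1"] by (cases m) (auto simp: HF.below_simps)
      then show ?thesis
        using x HF.gr_in_below HF.G.subspaceD(2)[OF U] by simp
    qed
  next
    case zero
    have "\<zero>\<^bsub>HH\<^esub> \<in> HF.below m" by (rule H.subspaceD(2)[OF HF.below_subspace])
    then show ?case using HF.gr_in_below HF.G.subspaceD(2)[OF U] HF.Fl_zero by simp
  next
    case (add x y)
    then show ?case
      using HF.gr_in_add H.subspaceD(3)[OF HF_subspace] HF.G.subspaceD(3)[OF U] by auto
  next
    case (smult c x)
    then show ?case
      using HF.gr_in_smult H.subspaceD(4)[OF HF_subspace] HF.G.subspaceD(4)[OF U] by auto
  qed
  show "carrier Gr \<subseteq> n ` carrier B" by (rule HF.gr_generated[OF U]) (use * in blast)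
qed

definition vword :: "'v list \<Rightarrow> 'a \<Rightarrow> (('v \<times> 'a) list \<Rightarrow>\<^sub>0 'k) set set" where
  "vword vs a = foldr (\<lambda>v h. hV v \<otimes>\<^bsub>HH\<^esub> h) vs (hA a)"

lemma vword_simps [simp]: "vword [] a = hA a" "vword (v # vs) a = hV v \<otimes>\<^bsub>HH\<^esub> vword vs a"
  by (simp_all add: vword_def)

lemma vword_HF: "vs \<in> lists (carrier V) \<Longrightarrow> a \<in> carrier A \<Longrightarrow> vword vs a \<in> HF (length vs)"
proof (induction vs)
  case (Cons v vs)
  then show ?case using HF_mult[OF hV_HF', of v "vword vs a" "length vs"] by simp
qed (simp add: hA_HF)

text \<open>A natural map is known on generators only; words of this form are products of generators in \<open>B\<close>,
  without any reordering.\<close>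

lemma natural_word:
  assumes n: "natural n" and "vs \<in> lists (carrier V)" "a \<in> carrier A"
  shows "n (tn (sym_word vs) a) = gin (length vs) (vword vs a)"
  using assms(2)
proof (induction vs)
  case Nil
  show ?case using naturalD(3)[OF n assms(3)] by (simp add: smashA_def)
next
  case (Cons v vs)
  then have v: "v \<in> carrier V" and vs: "vs \<in> lists (carrier V)" by auto
  have "n (tn (sym_word (v # vs)) a) = n (iV v \<otimes>\<^bsub>B\<^esub> tn (sym_word vs) a)"
    by (simp only: smash_iV_word[OF v vs assms(3)])
  also have "\<dots> = n (iV v) \<otimes>\<^bsub>Gr\<^esub> n (tn (sym_word vs) a)"
    by (rule alg_homD(6)[OF naturalD(1)[OF n]]) (use v vs assms(3) in auto)
  also have "\<dots> = gin (length (v # vs)) (vword (v # vs) a)"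
    using naturalD(2)[OF n v] Cons.IH HF.gr_in_mult[OF hV_HF'[OF v] vword_HF[OF vs assms(3)]] by simp
  finally show ?case .
qed

end

lemma (in vspace) free_ext_subspace:
  assumes U: "submodule U ring_of_type_algebra M" and g: "\<And>x. x \<in> keys p \<Longrightarrow> g x \<in> U"
  shows "free_ext M g p \<in> U"
proof -
  have "finite S \<Longrightarrow> S \<subseteq> keys p \<Longrightarrow> (\<Oplus>x\<in>S. lookup p x \<odot> g x) \<in> U" for S
  proof (induction S rule: finite_induct)
    case (insert x S)
    have c: "g y \<in> carrier M" if "y \<in> keys p" for y using g[OF that] subspaceD(1)[OF U] by blast
    have "(\<lambda>x. lookup p x \<odot> g x) \<in> S \<rightarrow> carrier M" "lookup p x \<odot> g x \<in> carrier M"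
      using insert c by auto
    moreover have "lookup p x \<odot> g x \<in> U" using subspaceD(4)[OF U g] insert by blast
    ultimately show ?case using insert subspaceD(3)[OF U] by simp
  qed (simp add: subspaceD(2)[OF U])
  then show ?thesis by (simp add: free_ext_def)
qed

lemma (in tensor_space) tens_ext_subspace:
  assumes "kvs P" "submodule U ring_of_type_algebra P"
    "\<And>x y. x \<in> carrier M \<Longrightarrow> y \<in> carrier N \<Longrightarrow> f x y \<in> U" "t \<in> carrier (tensor M N)"
  shows "tens_ext P f t \<in> U"
proof -
  obtain p where p: "p \<in> carrier F" "(SOME p. p \<in> t) = p" by (rule mem_carrier_tensor[OF assms(4)])
  interpret P: vspace P by (rule vspace.intro[OF assms(1)])
  show ?thesis unfolding tens_ext_def p(2)
    by (rule P.free_ext_subspace[OF assms(2)]) (use p(1) assms(3) in auto)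
qed

lemma klinear_finsum:
  assumes "kvs M" "kvs N" "klinear M N f" "finite S" "g \<in> S \<rightarrow> carrier M"
  shows "f (\<Oplus>\<^bsub>M\<^esub>i\<in>S. g i) = (\<Oplus>\<^bsub>N\<^esub>i\<in>S. f (g i))"
proof -
  interpret M: vspace M by (rule vspace.intro[OF assms(1)])
  interpret N: vspace N by (rule vspace.intro[OF assms(2)])
  note fc = klinear_closed[OF assms(3)]
  show ?thesis
    using assms(4,5)
  proof (induction S rule: finite_induct)
    case empty
    then show ?case by (simp add: klinear_zero[OF assms(1-3)])
  next
    case (insert i S)
    then have "g \<in> S \<rightarrow> carrier M" "g i \<in> carrier M" "(\<lambda>i. f (g i)) \<in> S \<rightarrow> carrier N" using fc by auto
    then show ?case using insert fc by (simp add: klinear_add[OF assms(3)])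
  qed
qed

context cocommutative_module
begin

lemma subspace_sym_deg: "submodule (sym_deg V n) ring_of_type_algebra Sym"
  unfolding sym_deg_def sym_deg_gens by (rule S.subspace_kspan[OF sym_gens_deg_carrier])

lemma sym_in_mult_deg:
  assumes "v \<in> carrier V" "f \<in> sym_deg V n" shows "sym_in V v \<otimes>\<^bsub>Sym\<^esub> f \<in> sym_deg V (Suc n)"
proof -
  have "{sym_word vs | vs. vs \<in> lists (carrier V) \<and> length vs = n} \<subseteq>
      {f \<in> carrier Sym. sym_in V v \<otimes>\<^bsub>Sym\<^esub> f \<in> sym_deg V (Suc n)}"
  proof
    fix f assume "f \<in> {sym_word vs | vs. vs \<in> lists (carrier V) \<and> length vs = n}"
    then obtain vs where vs: "f = sym_word vs" "vs \<in> lists (carrier V)" "length vs = n" by blast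
    have "sym_word (v # vs) \<in> sym_deg V (Suc n)"
      unfolding sym_deg_def sym_deg_gens
      by (rule kspan_base, rule CollectI, rule exI[of _ "v # vs"]) (use vs assms(1) in simp)
    then show "f \<in> {f \<in> carrier Sym. sym_in V v \<otimes>\<^bsub>Sym\<^esub> f \<in> sym_deg V (Suc n)}"
      using vs by (simp del: in_lists_conv_set)
  qed
  from S.kspan_least[OF subspace_kernel[OF S.kvs S.kvs klinear_mult_left subspace_sym_deg] this]
  show ?thesis using assms unfolding sym_deg_def[of V n] sym_deg_gens by auto
qed

lemma wact_deg:
  "vs \<in> lists (carrier V) \<Longrightarrow> vs \<noteq> [] \<Longrightarrow> a \<in> carrier A \<Longrightarrow> wact vs a \<in> sym_deg V (length vs)"
proof (induction vs arbitrary: a)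
  case (Cons v vs)
  have one: "\<one>\<^bsub>Sym\<^esub> \<in> sym_deg V 0"
    unfolding sym_deg_def sym_deg_gens
    by (rule kspan_base, rule CollectI, rule exI[of _ "[]"]) simp
  show ?case
  proof (cases "vs = []")
    case True
    have "sym_in V (act a v) \<otimes>\<^bsub>Sym\<^esub> \<one>\<^bsub>Sym\<^esub> \<in> sym_deg V (Suc 0)"
      by (rule sym_in_mult_deg[OF _ one]) (use Cons in auto)
    then show ?thesis using True Cons by simp
  next
    case False
    have "sweedler Sym (\<lambda>x y. sym_in V (act x v) \<otimes>\<^bsub>Sym\<^esub> wact vs y) a \<in> sym_deg V (Suc (length vs))"
      by (rule AA.tens_ext_subspace[OF S.kvs subspace_sym_deg])
        (use Cons False in \<open>auto intro!: sym_in_mult_deg Cons.IH\<close>)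
    then show ?thesis using False by simp
  qed
qed simp

lemma tn_Bdeg: "f \<in> sym_deg V n \<Longrightarrow> a \<in> carrier A \<Longrightarrow> tn f a \<in> Bdeg n"
  unfolding smash_deg_def by (rule kspan_base) blast

lemma Bdeg_eqI: "b \<in> Bdeg n \<Longrightarrow> part n b = b"
  by (simp add: part_Bdeg)

lemma Bdeg_sub: "submodule (Bdeg n) ring_of_type_algebra SymA"
proof -
  note s = B.subspaceD[OF subspace_Bdeg[of n]]
  show ?thesis by (rule SA.T.subspaceI) (use s in auto)
qed

text \<open>Multiplication by \<open>v\<close> lengthens words by one letter. Multiplication by \<open>a\<close> preserves degrees
  because the action on words preserves their length.\<close>

lemma iV_mult_Bdeg:
  assumes v: "v \<in> carrier V" and b: "b \<in> Bdeg n" shows "smash_mult A \<Delta> V act (iV v) b \<in> Bdeg (Suc n)"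
proof -
  have lin: "klinear SymA SymA (\<lambda>b. smash_mult A \<Delta> V act (iV v) (part n b))"
    by (rule klinear_comp[OF klinear_part klinear_smash_mult_right]) (use v in auto)
  have "smash_mult A \<Delta> V act (iV v) (part n b) \<in> Bdeg (Suc n)" if "b \<in> carrier SymA" for b
    using that
  proof (induction rule: smash_induct)
    case (word vs a)
    have "tn (sym_word (v # vs)) a \<in> Bdeg (Suc (length vs))"
      using tn_word_Bdeg[of "v # vs" a] word v by simp
    then show ?case
      using word v smash_iV_word[OF v word] klinear_zero[OF SA.kvs_tensor SA.kvs_tensor klinear_smash_mult_right[OF iV_closed[OF v]]]
        SA.T.subspaceD(2)[OF Bdeg_sub]
      by (auto simp add: part_word simp del: in_lists_conv_set sym_word_simps)
  next
    case (add s t)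
    then show ?case by (simp only: klinear_add[OF lin] SA.T.subspaceD(3)[OF Bdeg_sub])
  next
    case (smult c t)
    then show ?case by (simp only: klinear_smult[OF lin] SA.T.subspaceD(4)[OF Bdeg_sub])
  qed
  from this[OF Bdeg_carrier[OF b]] show ?thesis by (simp only: Bdeg_eqI[OF b])
qed

lemma iA_mult_Bdeg:
  assumes a: "a \<in> carrier A" and b: "b \<in> Bdeg n" shows "smash_mult A \<Delta> V act (iA a) b \<in> Bdeg n"
proof -
  have lin: "klinear SymA SymA (\<lambda>b. smash_mult A \<Delta> V act (iA a) (part n b))"
    by (rule klinear_comp[OF klinear_part klinear_smash_mult_right]) (use a in auto)
  have w: "smash_mult A \<Delta> V act (iA a) (tn (sym_word vs) c) \<in> Bdeg (length vs)"
    if vs: "vs \<in> lists (carrier V)" and c: "c \<in> carrier A" for vs c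
  proof -
    have e: "smash_mult A \<Delta> V act (iA a) (tn (sym_word vs) c) = sword \<one>\<^bsub>Sym\<^esub> a vs c"
      using smash_mult_tn[of "\<one>\<^bsub>Sym\<^esub>" a vs c] a vs c by (simp add: smashA_def)
    show ?thesis
    proof (cases "vs = []")
      case True
      then show ?thesis unfolding e using iA_Bdeg[of "a \<otimes>\<^bsub>A\<^esub> c"] a c by (simp add: smashA_def)
    next
      case False
      show ?thesis
        unfolding e sword_nonempty[OF False]
        by (rule AA.tens_ext_subspace[OF SA.kvs_tensor Bdeg_sub])
          (use a c vs False in \<open>auto intro!: tn_Bdeg wact_deg\<close>)
    qed
  qed
  have "smash_mult A \<Delta> V act (iA a) (part n b) \<in> Bdeg n" if "b \<in> carrier SymA" for b
    using that
  proof (induction rule: smash_induct)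
    case (word vs c)
    then show ?case
      using w[OF word] klinear_zero[OF SA.kvs_tensor SA.kvs_tensor klinear_smash_mult_right[OF iA_closed[OF a]]]
        SA.T.subspaceD(2)[OF Bdeg_sub]
      by (auto simp add: part_word simp del: in_lists_conv_set sym_word_simps)
  next
    case (add s t)
    then show ?case by (simp only: klinear_add[OF lin] SA.T.subspaceD(3)[OF Bdeg_sub])
  next
    case (smult c t)
    then show ?case by (simp only: klinear_smult[OF lin] SA.T.subspaceD(4)[OF Bdeg_sub])
  qed
  from this[OF Bdeg_carrier[OF b]] show ?thesis by (simp only: Bdeg_eqI[OF b])
qed

end

section \<open>Algebras over \<open>k[t]\<close> and their specializations\<close>

definition restrict_scalars :: "('k::field poly, 'm) module \<Rightarrow> ('k, 'm) module" where
  "restrict_scalars M = ring.extend (ring.truncate M) \<lparr>module.smult = (\<lambda>a. module.smult M [:a:])\<rparr>"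

lemma restrict_scalars_sel [simp]:
  "carrier (restrict_scalars M) = carrier M" "x \<otimes>\<^bsub>restrict_scalars M\<^esub> y = x \<otimes>\<^bsub>M\<^esub> y"
  "\<one>\<^bsub>restrict_scalars M\<^esub> = \<one>\<^bsub>M\<^esub>" "\<zero>\<^bsub>restrict_scalars M\<^esub> = \<zero>\<^bsub>M\<^esub>"
  "x \<oplus>\<^bsub>restrict_scalars M\<^esub> y = x \<oplus>\<^bsub>M\<^esub> y" "c \<odot>\<^bsub>restrict_scalars M\<^esub> x = [:c:] \<odot>\<^bsub>M\<^esub> x"
  by (simp_all add: restrict_scalars_def ring.defs)

lemma restrict_scalars_ops:
  "monoid.mult (restrict_scalars M) = monoid.mult M" "ring.add (restrict_scalars M) = ring.add M"
  by (simp_all add: restrict_scalars_def ring.defs)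

text \<open>Specialization is the quotient of the underlying algebra over the field by the ideal that \<open>t -
  c\<close> generates.\<close>

lemma specialize_quot:
  "specialize M c = quot (restrict_scalars M) ((\<lambda>p. [:- c, 1:] \<odot>\<^bsub>M\<^esub> p) ` carrier M)"
  by (simp add: specialize_def quot_def Let_def ring.defs FactRing_def A_RCOSETS_defs a_r_coset_defs
      rcoset_mult_def[abs_def] set_add_defs set_mult_def[abs_def] restrict_scalars_ops)

locale kt_algebra =
  fixes M :: "('k::field poly, 'm) module" (structure)
  assumes kt: "assoc_algebra ring_of_type_algebra M"
begin

lemma kt_module: "module ring_of_type_algebra M" and kt_ring: "ring M"
  using kt by (simp_all add: assoc_algebra_def)

sublocale ring M by (rule kt_ring)

lemma kt_smult_closed [simp, intro]: "x \<in> carrier M \<Longrightarrow> f \<odot> x \<in> carrier M"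
  using module.smult_closed[OF kt_module] by simp

lemma kt_add_left: "x \<in> carrier M \<Longrightarrow> (f + g) \<odot> x = f \<odot> x \<oplus> g \<odot> x"
  using module.smult_l_distr[OF kt_module, of f g] by simp

lemma kt_add_right: "x \<in> carrier M \<Longrightarrow> y \<in> carrier M \<Longrightarrow> f \<odot> (x \<oplus> y) = f \<odot> x \<oplus> f \<odot> y"
  using module.smult_r_distr[OF kt_module, of f] by simp

lemma kt_smult_smult: "x \<in> carrier M \<Longrightarrow> f \<odot> (g \<odot> x) = (f * g) \<odot> x"
  using module.smult_assoc1[OF kt_module, of f g] by simp

lemma kt_one: "x \<in> carrier M \<Longrightarrow> 1 \<odot> x = x"
  using module.smult_one[OF kt_module] by simp

lemma kt_mult_left: "x \<in> carrier M \<Longrightarrow> y \<in> carrier M \<Longrightarrow> (f \<odot> x) \<otimes> y = f \<odot> (x \<otimes> y)"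
  and kt_mult_right: "x \<in> carrier M \<Longrightarrow> y \<in> carrier M \<Longrightarrow> x \<otimes> (f \<odot> y) = f \<odot> (x \<otimes> y)"
  using kt by (simp_all add: assoc_algebra_def)

abbreviation "M' \<equiv> restrict_scalars M"

lemma kalg_restrict: "kalg M'"
proof (rule kalgI)
  have "abelian_group M'"
  proof (rule abelian_groupI)
    fix x assume "x \<in> carrier M'"
    then show "\<exists>y\<in>carrier M'. y \<oplus>\<^bsub>M'\<^esub> x = \<zero>\<^bsub>M'\<^esub>" by (intro bexI[of _ "\<ominus> x"]) (auto simp: l_neg)
  qed (auto simp: a_ac)
  then show "kvs M'"
    by (intro moduleI cring_from_type_algebra)
      (auto simp: kt_add_left[symmetric] kt_add_right kt_smult_smult kt_one mult.commute simp flip: one_pCons)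
qed (auto simp: m_assoc l_distr r_distr kt_mult_left kt_mult_right)

sublocale K: kalgebra "restrict_scalars M"
  by (rule kalgebra.intro[OF kalg_restrict])

abbreviation spec_ideal :: "'k \<Rightarrow> 'm set" where "spec_ideal c \<equiv> (\<lambda>p. [:- c, 1:] \<odot> p) ` carrier M"

lemma ideal_spec: "ideal (spec_ideal c) M'"
proof (rule K.idealI_subspace)
  show "submodule (spec_ideal c) ring_of_type_algebra M'"
  proof (rule K.subspaceI)
    show "\<zero>\<^bsub>M'\<^esub> \<in> spec_ideal c"
      using module.smult_r_null[OF kt_module, of "[:- c, 1:]"] by (auto intro!: image_eqI[of _ _ \<zero>])
  next
    fix x y assume "x \<in> spec_ideal c" "y \<in> spec_ideal c"
    then obtain u v where "u \<in> carrier M" "x = [:- c, 1:] \<odot> u" "v \<in> carrier M" "y = [:- c, 1:] \<odot> v" by blast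
    then show "x \<oplus>\<^bsub>M'\<^esub> y \<in> spec_ideal c" by (auto simp: kt_add_right intro!: image_eqI[of _ _ "u \<oplus> v"])
  next
    fix x d assume "x \<in> spec_ideal c"
    then obtain u where "u \<in> carrier M" "x = [:- c, 1:] \<odot> u" by blast
    then show "d \<odot>\<^bsub>M'\<^esub> x \<in> spec_ideal c"
      by (auto simp: kt_smult_smult mult.commute intro!: image_eqI[of _ _ "[:d:] \<odot> u"])
  qed auto
next
  fix x y assume "x \<in> spec_ideal c" "y \<in> carrier M'"
  then obtain u where "u \<in> carrier M" "x = [:- c, 1:] \<odot> u" "y \<in> carrier M" by auto
  then show "y \<otimes>\<^bsub>M'\<^esub> x \<in> spec_ideal c" "x \<otimes>\<^bsub>M'\<^esub> y \<in> spec_ideal c"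
    by (auto simp: kt_mult_right kt_mult_left)
qed

lemma kalg_specialize: "kalg (specialize M c)"
  unfolding specialize_quot by (rule K.kalg_quot[OF ideal_spec])

definition sproj :: "'k \<Rightarrow> 'm \<Rightarrow> 'm set" where "sproj c p = spec_ideal c +>\<^bsub>M'\<^esub> p"

lemma alg_hom_sproj: "sproj c \<in> alg_hom M' (specialize M c)"
  using K.alg_hom_coset[OF ideal_spec] unfolding specialize_quot sproj_def[abs_def] .

lemma carrier_specialize: "carrier (specialize M c) = sproj c ` carrier M"
  unfolding specialize_quot carrier_quot sproj_def[abs_def] by simp

lemma sproj_eq_iff:
  "x \<in> carrier M \<Longrightarrow> y \<in> carrier M \<Longrightarrow> sproj c x = sproj c y \<longleftrightarrow> x \<ominus>\<^bsub>M'\<^esub> y \<in> spec_ideal c"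
  unfolding sproj_def using K.coset_eq_iff[OF K.ideal_subspace[OF ideal_spec]] by simp

lemma sproj_t:
  assumes "x \<in> carrier M" shows "sproj c ([:0, 1:] \<odot> x) = sproj c ([:c:] \<odot> x)"
proof -
  have "[:0, 1:] \<odot> x = ([:- c, 1:] + [:c:]) \<odot> x" by simp
  also have "\<dots> = [:- c, 1:] \<odot> x \<oplus>\<^bsub>M'\<^esub> [:c:] \<odot> x"
    using assms by (simp only: kt_add_left restrict_scalars_sel)
  finally have "[:0, 1:] \<odot> x \<ominus>\<^bsub>M'\<^esub> [:c:] \<odot> x = [:- c, 1:] \<odot> x"
    using K.add_diff_cancel[of "[:- c, 1:] \<odot> x" "[:c:] \<odot> x"] assms by simp
  then show ?thesis using assms by (subst sproj_eq_iff) auto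
qed

end

section \<open>Algebra structures on polynomials over the smash product\<close>

text \<open>The part of the notion of a deformation that does not involve the value at \<open>t = 0\<close>. It is shared
  by a given deformation and by the one that is constructed from the Rees algebra, for which the
  value at \<open>t = 0\<close> is a theorem.\<close>

locale smash_seq = cocommutative_module A \<Delta> V act
  for A :: "('k::field, 'a) module"
    and \<Delta> :: "'a \<Rightarrow> ('a \<times> 'a \<Rightarrow>\<^sub>0 'k) set"
    and V :: "('k, 'v) module"
    and act :: "'a \<Rightarrow> 'v \<Rightarrow> 'v" +
  fixes Bt :: "('k poly, nat \<Rightarrow> (('v list \<Rightarrow>\<^sub>0 'k) set set \<times> 'a \<Rightarrow>\<^sub>0 'k) set) module"
  assumes seq_kt: "assoc_algebra ring_of_type_algebra Bt"
    and seq_carrier: "carrier Bt = up (smash A \<Delta> V act)"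
    and seq_add: "\<And>p q. p \<in> up (smash A \<Delta> V act) \<Longrightarrow> q \<in> up (smash A \<Delta> V act) \<Longrightarrow>
      p \<oplus>\<^bsub>Bt\<^esub> q = (\<lambda>n. p n \<oplus>\<^bsub>smash A \<Delta> V act\<^esub> q n)"
    and seq_smult: "\<And>f p. p \<in> up (smash A \<Delta> V act) \<Longrightarrow>
      f \<odot>\<^bsub>Bt\<^esub> p = (\<lambda>n. \<Oplus>\<^bsub>smash A \<Delta> V act\<^esub>i\<in>{..n}. poly.coeff f i \<odot>\<^bsub>smash A \<Delta> V act\<^esub> p (n - i))"
begin

sublocale Bt: kt_algebra Bt
  by (rule kt_algebra.intro[OF seq_kt])

abbreviation "t \<equiv> [:0, 1:] :: 'k poly"
abbreviation "Btk \<equiv> restrict_scalars Bt"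

lemma carrier_Bt: "carrier Bt = up B"
  by (rule seq_carrier)

lemma Bt_closed: "p \<in> carrier Bt \<Longrightarrow> p n \<in> carrier SymA"
  using mem_upD[of p B n] by (simp add: carrier_Bt)

lemma Bt_bound: "p \<in> carrier Bt \<Longrightarrow> \<exists>N. \<forall>n>N. p n = \<zero>\<^bsub>SymA\<^esub>"
  by (auto simp: carrier_Bt up_def bound_def)

lemma BtI: "(\<And>n. p n \<in> carrier SymA) \<Longrightarrow> (\<And>n. n > N \<Longrightarrow> p n = \<zero>\<^bsub>SymA\<^esub>) \<Longrightarrow> p \<in> carrier Bt"
  unfolding carrier_Bt by (intro mem_upI exI[of _ N]) (auto simp: bound_def)

lemma Bt_add: "p \<in> carrier Bt \<Longrightarrow> q \<in> carrier Bt \<Longrightarrow> p \<oplus>\<^bsub>Bt\<^esub> q = (\<lambda>n. p n \<oplus>\<^bsub>SymA\<^esub> q n)"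
  using seq_add by (simp add: carrier_Bt)

lemma Bt_smult:
  "p \<in> carrier Bt \<Longrightarrow> f \<odot>\<^bsub>Bt\<^esub> p = (\<lambda>n. \<Oplus>\<^bsub>B\<^esub>i\<in>{..n}. poly.coeff f i \<odot>\<^bsub>SymA\<^esub> p (n - i))"
  using seq_smult by (simp add: carrier_Bt)

lemma Bt_smult_const:
  assumes "p \<in> carrier Bt" shows "[:c:] \<odot>\<^bsub>Bt\<^esub> p = (\<lambda>n. c \<odot>\<^bsub>SymA\<^esub> p n)"
proof
  fix n
  note c = Bt_closed[OF assms]
  have "(\<Oplus>\<^bsub>B\<^esub>i\<in>{..n}. poly.coeff [:c:] i \<odot>\<^bsub>SymA\<^esub> p (n - i)) =
      (\<Oplus>\<^bsub>B\<^esub>i\<in>{..n}. if 0 = i then c \<odot>\<^bsub>SymA\<^esub> p n else \<zero>\<^bsub>B\<^esub>)"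
    by (rule B.finsum_cong') (auto simp: c coeff_pCons split: nat.split)
  also have "\<dots> = c \<odot>\<^bsub>SymA\<^esub> p n"
    by (rule B.finsum_singleton) (auto simp: c)
  finally show "([:c:] \<odot>\<^bsub>Bt\<^esub> p) n = c \<odot>\<^bsub>SymA\<^esub> p n" by (simp add: Bt_smult[OF assms])
qed

lemma Bt_t:
  assumes "p \<in> carrier Bt"
  shows "t \<odot>\<^bsub>Bt\<^esub> p = (\<lambda>n. case n of 0 \<Rightarrow> \<zero>\<^bsub>SymA\<^esub> | Suc m \<Rightarrow> p m)"
proof
  fix n
  note c = Bt_closed[OF assms]
  have "(\<Oplus>\<^bsub>B\<^esub>i\<in>{..n}. poly.coeff t i \<odot>\<^bsub>SymA\<^esub> p (n - i)) =
      (\<Oplus>\<^bsub>B\<^esub>i\<in>{..n}. if 1 = i then p (n - 1) else \<zero>\<^bsub>B\<^esub>)"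
    by (rule B.finsum_cong') (auto simp: c coeff_pCons split: nat.split)
  also have "\<dots> = (case n of 0 \<Rightarrow> \<zero>\<^bsub>SymA\<^esub> | Suc m \<Rightarrow> p m)"
  proof (cases n)
    case 0
    then show ?thesis by simp
  next
    case (Suc m)
    have "(\<Oplus>\<^bsub>B\<^esub>i\<in>{..n}. if 1 = i then p (n - 1) else \<zero>\<^bsub>B\<^esub>) = p (n - 1)"
      by (rule B.finsum_singleton) (auto simp: c Suc)
    then show ?thesis by (simp add: Suc)
  qed
  finally show "(t \<odot>\<^bsub>Bt\<^esub> p) n = (case n of 0 \<Rightarrow> \<zero>\<^bsub>SymA\<^esub> | Suc m \<Rightarrow> p m)" by (simp add: Bt_smult[OF assms])
qed

lemma klinear_comp_Bt: "klinear Btk SymA (\<lambda>p. p n)"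
  by (rule klinearI) (simp_all add: Bt_closed Bt_add Bt_smult_const)

lemma Bt_zero: "\<zero>\<^bsub>Bt\<^esub> = (\<lambda>n. \<zero>\<^bsub>SymA\<^esub>)"
  using klinear_zero[OF Bt.K.kvs SA.kvs_tensor klinear_comp_Bt] by (simp add: fun_eq_iff)

lemma Bt_diff: "p \<in> carrier Bt \<Longrightarrow> q \<in> carrier Bt \<Longrightarrow> (p \<ominus>\<^bsub>Btk\<^esub> q) n = p n \<ominus>\<^bsub>SymA\<^esub> q n"
  using klinear_diff[OF Bt.K.kvs SA.kvs_tensor klinear_comp_Bt] by simp

lemma B_diff: "x \<in> carrier SymA \<Longrightarrow> y \<in> carrier SymA \<Longrightarrow> x \<ominus>\<^bsub>B\<^esub> y = x \<ominus>\<^bsub>SymA\<^esub> y"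
  using B.minus_eq_smult[of x y] SA.T.minus_eq_smult[of x y] by simp

text \<open>All elements of a coset of \<open>t B\<^sub>t\<close> have the same constant coefficient.\<close>

lemma constant_coeff:
  assumes p: "p \<in> carrier Bt" shows "the_elem ((\<lambda>p. p 0) ` Bt.sproj 0 p) = p 0"
proof -
  note mem = Bt.K.mem_coset_iff_diff[OF Bt.K.ideal_subspace[OF Bt.ideal_spec[of 0]], of p]
  have "q 0 = p 0" if "q \<in> Bt.sproj 0 p" for q
  proof -
    from that have q: "q \<in> carrier Bt" "q \<ominus>\<^bsub>Btk\<^esub> p \<in> Bt.spec_ideal 0"
      unfolding Bt.sproj_def using p mem[of q] by simp_all
    then obtain u where u: "u \<in> carrier Bt" "q \<ominus>\<^bsub>Btk\<^esub> p = t \<odot>\<^bsub>Bt\<^esub> u" by auto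
    have "q 0 \<ominus>\<^bsub>SymA\<^esub> p 0 = \<zero>\<^bsub>SymA\<^esub>"
      unfolding Bt_diff[OF q(1) p, symmetric] u(2) Bt_t[OF u(1)] by simp
    then show ?thesis using SA.T.diff_eq_zero_iff[OF Bt_closed[OF q(1)] Bt_closed[OF p]] by simp
  qed
  moreover have "p \<in> Bt.sproj 0 p"
    unfolding Bt.sproj_def
    using p mem[of p] Bt.K.diff_eq_zero_iff[of p p] Bt.K.subspaceD(2)[OF Bt.K.ideal_subspace[OF Bt.ideal_spec[of 0]]]
    by simp
  ultimately have "(\<lambda>p. p 0) ` Bt.sproj 0 p = {p 0}" by blast
  then show ?thesis by simp
qed

abbreviation "cs b \<equiv> const_seq B b"

lemma cs_apply: "cs b n = (if n = 0 then b else \<zero>\<^bsub>SymA\<^esub>)"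
  by (simp add: const_seq_def)

lemma cs_closed [simp, intro]: "b \<in> carrier SymA \<Longrightarrow> cs b \<in> carrier Bt"
  by (rule BtI[of _ 0]) (auto simp: cs_apply)

lemma klinear_cs: "klinear SymA Btk (\<lambda>b. cs b)"
  by (rule klinearI) (auto simp: Bt_add Bt_smult_const cs_apply fun_eq_iff)

text \<open>The elements of \<open>B\<^sub>t\<close> are built from their constant terms, since \<open>p = p\<^sub>0 + t p'\<close>.\<close>

lemma Bt_split:
  assumes "p \<in> carrier Bt"
  shows "p = cs (p 0) \<oplus>\<^bsub>Bt\<^esub> t \<odot>\<^bsub>Bt\<^esub> (\<lambda>n. p (Suc n))" "(\<lambda>n. p (Suc n)) \<in> carrier Bt"
proof -
  obtain N where "\<forall>n>N. p n = \<zero>\<^bsub>SymA\<^esub>" using Bt_bound[OF assms] by blast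
  then show c: "(\<lambda>n. p (Suc n)) \<in> carrier Bt" using Bt_closed[OF assms] by (intro BtI[of _ N]) auto
  have "cs (p 0) \<in> carrier Bt" "t \<odot>\<^bsub>Bt\<^esub> (\<lambda>n. p (Suc n)) \<in> carrier Bt" using Bt_closed[OF assms] c by auto
  then show "p = cs (p 0) \<oplus>\<^bsub>Bt\<^esub> t \<odot>\<^bsub>Bt\<^esub> (\<lambda>n. p (Suc n))"
    using Bt_closed[OF assms] by (auto simp: Bt_add Bt_t[OF c] cs_apply fun_eq_iff split: nat.split)
qed

end

section \<open>From a graded deformation to the PBW property\<close>

locale smash_deformation = deformed_smash A \<Delta> V act lam kap
  for A :: "('k::field, 'a) module"
    and \<Delta> :: "'a \<Rightarrow> ('a \<times> 'a \<Rightarrow>\<^sub>0 'k) set"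
    and V :: "('k, 'v) module"
    and act :: "'a \<Rightarrow> 'v \<Rightarrow> 'v"
    and lam :: "('a \<times> 'v \<Rightarrow>\<^sub>0 'k) set \<Rightarrow> 'a"
    and kap :: "('v \<times> 'v \<Rightarrow>\<^sub>0 'k) set \<Rightarrow> 'v \<times> 'a" +
  fixes Bt :: "('k poly, nat \<Rightarrow> (('v list \<Rightarrow>\<^sub>0 'k) set set \<times> 'a \<Rightarrow>\<^sub>0 'k) set) module"
  assumes graded: "graded_deformation (smash A \<Delta> V act) (smash_deg A \<Delta> V act) Bt"
    and compat: "mu_compatible A \<Delta> V act lam kap Bt"
begin

lemma deform: "deformation B Bt"
  using graded by (simp add: graded_deformation_def)

sublocale smash_seq A \<Delta> V act Bt
  by (intro smash_seq.intro smash_seq_axioms.intro cocommutative_module_axioms)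
    (use deform in \<open>simp_all add: deformation_def\<close>)

text \<open>Both facts are read off from the isomorphism \<open>B\<^sub>t / t B\<^sub>t \<cong> B\<close>.\<close>

lemma
  shows mult_Bt_0: "p \<in> carrier Bt \<Longrightarrow> q \<in> carrier Bt \<Longrightarrow> (p \<otimes>\<^bsub>Bt\<^esub> q) 0 = smash_mult A \<Delta> V act (p 0) (q 0)"
    and one_Bt_0: "\<one>\<^bsub>Bt\<^esub> 0 = \<one>\<^bsub>SymA\<^esub>"
proof -
  let ?z = "\<lambda>P. the_elem ((\<lambda>p. p 0) ` P)"
  have "?z \<in> alg_iso (specialize Bt 0) B" using deform by (simp add: deformation_def)
  then have z: "?z \<in> alg_hom (specialize Bt 0) B" by (simp add: alg_iso_def)
  note s = alg_homD[OF Bt.alg_hom_sproj[of 0]]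
  note zs = constant_coeff
  show "(p \<otimes>\<^bsub>Bt\<^esub> q) 0 = smash_mult A \<Delta> V act (p 0) (q 0)" if "p \<in> carrier Bt" "q \<in> carrier Bt"
    using alg_homD(6)[OF z, of "Bt.sproj 0 p" "Bt.sproj 0 q"] s(3) s(6)[of p q] that
    by (simp add: zs[symmetric])
  show "\<one>\<^bsub>Bt\<^esub> 0 = \<one>\<^bsub>SymA\<^esub>"
    using alg_homD(7)[OF z] s(7) zs[of "\<one>\<^bsub>Bt\<^esub>"] by simp
qed

lemma mu_0: "b \<in> carrier SymA \<Longrightarrow> b' \<in> carrier SymA \<Longrightarrow> (cs b \<otimes>\<^bsub>Bt\<^esub> cs b') 0 = smash_mult A \<Delta> V act b b'"
  by (simp add: mult_Bt_0 cs_apply)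

lemma mu_deg:
  assumes "b \<in> Bdeg m" "b' \<in> Bdeg n" "j \<ge> 1"
  shows "(cs b \<otimes>\<^bsub>Bt\<^esub> cs b') j \<in> (if j \<le> m + n then Bdeg (m + n - j) else {\<zero>\<^bsub>SymA\<^esub>})"
proof -
  have "\<forall>j\<ge>1. \<forall>m n. \<forall>b\<in>Bdeg m. \<forall>b'\<in>Bdeg n.
      mu B Bt j b b' \<in> (if j \<le> m + n then Bdeg (m + n - j) else {\<zero>\<^bsub>B\<^esub>})"
    using graded unfolding graded_deformation_def by (rule conjunct2)
  with assms show ?thesis unfolding mu_def smash_sel by blast
qed

lemma mu_A:
  assumes "a \<in> carrier A" "b \<in> carrier A" shows "cs (iA a) \<otimes>\<^bsub>Bt\<^esub> cs (iA b) = cs (iA (a \<otimes>\<^bsub>A\<^esub> b))"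
proof
  fix j show "(cs (iA a) \<otimes>\<^bsub>Bt\<^esub> cs (iA b)) j = cs (iA (a \<otimes>\<^bsub>A\<^esub> b)) j"
    using mu_deg[OF iA_Bdeg iA_Bdeg, of a b j] mu_0[of "iA a" "iA b"] smash_iA_iA[of a b] assms
    by (cases "j = 0") (auto simp: cs_apply)
qed

text \<open>The unit of the deformation is the constant sequence \<open>1\<close>: the difference of the two is an
  idempotent without constant term, hence divisible by every power of \<open>t\<close>.\<close>

lemma Bt_one: "cs (iA \<one>\<^bsub>A\<^esub>) = \<one>\<^bsub>Bt\<^esub>"
proof -
  define e where "e = cs (iA \<one>\<^bsub>A\<^esub>)"
  have e: "e \<in> carrier Bt" "e \<otimes>\<^bsub>Bt\<^esub> e = e" using mu_A[of "\<one>\<^bsub>A\<^esub>" "\<one>\<^bsub>A\<^esub>"] by (auto simp: e_def)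
  define d where "d = \<one>\<^bsub>Bt\<^esub> \<ominus>\<^bsub>Bt\<^esub> e"
  have d: "d \<in> carrier Bt" using e by (simp add: d_def)
  have dd: "d \<otimes>\<^bsub>Bt\<^esub> d = d"
    using e by (simp add: d_def a_minus_def Bt.l_distr Bt.r_distr Bt.l_minus Bt.r_minus Bt.a_assoc
        Bt.l_neg Bt.r_neg)
  have d_e: "d \<oplus>\<^bsub>Bt\<^esub> e = \<one>\<^bsub>Bt\<^esub>"
    using e by (simp add: d_def a_minus_def Bt.a_assoc Bt.l_neg)
  have "d 0 \<oplus>\<^bsub>SymA\<^esub> \<one>\<^bsub>SymA\<^esub> = \<one>\<^bsub>SymA\<^esub>"
    using arg_cong[OF d_e, of "\<lambda>p. p 0"] one_Bt_0 d e smash_one by (simp add: Bt_add e_def cs_apply smashA_def)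
  moreover have "d 0 \<in> carrier SymA" "\<one>\<^bsub>SymA\<^esub> \<in> carrier SymA" using Bt_closed[OF d] smash_one by auto
  ultimately have d0: "d 0 = \<zero>\<^bsub>SymA\<^esub>" by (metis SA.T.add_diff_cancel SA.T.diff_eq_zero_iff)
  define d1 where "d1 n = d (Suc n)" for n
  obtain N where "\<forall>n>N. d n = \<zero>\<^bsub>SymA\<^esub>" using Bt_bound[OF d] by blast
  then have d1: "d1 \<in> carrier Bt" using Bt_closed[OF d] by (intro BtI[of _ N]) (auto simp: d1_def)
  have dt: "d = t \<odot>\<^bsub>Bt\<^esub> d1"
    unfolding Bt_t[OF d1] by (auto simp: fun_eq_iff d1_def d0 split: nat.split)
  \<comment> \<open>From \<open>d = d d = t (d1 d)\<close>, a multiple of \<open>d\<close> is \<open>t\<close> times another multiple of \<open>d\<close>.\<close>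
  have *: "x \<in> carrier Bt \<Longrightarrow> i < N \<Longrightarrow> (x \<otimes>\<^bsub>Bt\<^esub> d) i = \<zero>\<^bsub>SymA\<^esub>" for x i N
  proof (induction N arbitrary: x i)
    case (Suc N)
    have "x \<otimes>\<^bsub>Bt\<^esub> d = x \<otimes>\<^bsub>Bt\<^esub> ((t \<odot>\<^bsub>Bt\<^esub> d1) \<otimes>\<^bsub>Bt\<^esub> d)" by (simp only: dt[symmetric] dd)
    also have "\<dots> = t \<odot>\<^bsub>Bt\<^esub> ((x \<otimes>\<^bsub>Bt\<^esub> d1) \<otimes>\<^bsub>Bt\<^esub> d)"
      using Suc.prems d d1 by (simp add: Bt.kt_mult_left Bt.kt_mult_right Bt.m_assoc)
    finally have "x \<otimes>\<^bsub>Bt\<^esub> d = t \<odot>\<^bsub>Bt\<^esub> ((x \<otimes>\<^bsub>Bt\<^esub> d1) \<otimes>\<^bsub>Bt\<^esub> d)" .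
    then show ?case
      using Suc.IH[of "x \<otimes>\<^bsub>Bt\<^esub> d1" "i - 1"] Suc.prems d d1 by (cases i) (simp_all add: Bt_t)
  qed simp
  have "d i = \<zero>\<^bsub>SymA\<^esub>" for i using *[of "\<one>\<^bsub>Bt\<^esub>" i "Suc i"] d by simp
  then have "d = \<zero>\<^bsub>Bt\<^esub>" by (simp add: Bt_zero fun_eq_iff)
  then show ?thesis using d_e e by (simp add: e_def)
qed

subsection \<open>Homogeneous elements\<close>

text \<open>The homogeneous elements of degree \<open>N\<close> of \<open>B[t]\<close>, where \<open>t\<close> has degree one.\<close>

definition hom :: "nat \<Rightarrow> (nat \<Rightarrow> (('v list \<Rightarrow>\<^sub>0 'k) set set \<times> 'a \<Rightarrow>\<^sub>0 'k) set) set" where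
  "hom N = {p. \<forall>j. p j \<in> (if j \<le> N then Bdeg (N - j) else {\<zero>\<^bsub>SymA\<^esub>})}"

lemma hom_Bt: "p \<in> hom N \<Longrightarrow> p \<in> carrier Bt"
proof (rule BtI[of _ N])
  assume p: "p \<in> hom N"
  have j: "p n \<in> (if n \<le> N then Bdeg (N - n) else {\<zero>\<^bsub>SymA\<^esub>})" for n using p by (simp add: hom_def)
  show "p n \<in> carrier SymA" for n using j[of n] Bdeg_carrier by (auto split: if_splits)
  show "p n = \<zero>\<^bsub>SymA\<^esub>" if "n > N" for n using j[of n] that by simp
qed

lemma Bdeg_zero: "\<zero>\<^bsub>SymA\<^esub> \<in> Bdeg n"
  by (rule SA.T.subspaceD(2)[OF Bdeg_sub])

lemma hom_add:
  assumes "p \<in> hom N" "q \<in> hom N" shows "p \<oplus>\<^bsub>Bt\<^esub> q \<in> hom N"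
  unfolding hom_def Bt_add[OF assms[THEN hom_Bt]]
proof (rule CollectI, rule allI)
  fix j
  have "p j \<in> (if j \<le> N then Bdeg (N - j) else {\<zero>\<^bsub>SymA\<^esub>})" "q j \<in> (if j \<le> N then Bdeg (N - j) else {\<zero>\<^bsub>SymA\<^esub>})"
    using assms by (simp_all add: hom_def)
  then show "p j \<oplus>\<^bsub>SymA\<^esub> q j \<in> (if j \<le> N then Bdeg (N - j) else {\<zero>\<^bsub>SymA\<^esub>})"
    using SA.T.subspaceD(3)[OF Bdeg_sub] by (auto split: if_splits)
qed

lemma hom_t:
  assumes "p \<in> hom N" shows "t \<odot>\<^bsub>Bt\<^esub> p \<in> hom (Suc N)"
  unfolding hom_def Bt_t[OF hom_Bt[OF assms]]
proof (rule CollectI, rule allI)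
  fix j
  have p: "p i \<in> (if i \<le> N then Bdeg (N - i) else {\<zero>\<^bsub>SymA\<^esub>})" for i using assms by (simp add: hom_def)
  show "(case j of 0 \<Rightarrow> \<zero>\<^bsub>SymA\<^esub> | Suc m \<Rightarrow> p m) \<in> (if j \<le> Suc N then Bdeg (Suc N - j) else {\<zero>\<^bsub>SymA\<^esub>})"
  proof (cases j)
    case (Suc m)
    then show ?thesis using p[of m] by (simp split: if_splits)
  qed (simp add: Bdeg_zero)
qed

lemma hom_cs: "b \<in> Bdeg N \<Longrightarrow> cs b \<in> hom N"
  by (auto simp: hom_def cs_apply Bdeg_zero)

lemma cs_mult_hom:
  assumes b: "b \<in> Bdeg m" "b' \<in> Bdeg n" and m: "smash_mult A \<Delta> V act b b' \<in> Bdeg (m + n)"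
  shows "cs b \<otimes>\<^bsub>Bt\<^esub> cs b' \<in> hom (m + n)"
  unfolding hom_def
proof (rule CollectI, rule allI)
  fix j show "(cs b \<otimes>\<^bsub>Bt\<^esub> cs b') j \<in> (if j \<le> m + n then Bdeg (m + n - j) else {\<zero>\<^bsub>SymA\<^esub>})"
  proof (cases "j = 0")
    case True
    then show ?thesis using m mu_0[OF Bdeg_carrier[OF b(1)] Bdeg_carrier[OF b(2)]] by simp
  qed (use mu_deg[OF b] in simp)
qed

lemma hom_split:
  assumes "p \<in> hom N"
  shows "p 0 \<in> Bdeg N" "N = 0 \<Longrightarrow> p = cs (p 0)" "N = Suc M \<Longrightarrow> (\<lambda>n. p (Suc n)) \<in> hom M"
proof -
  have j: "p n \<in> (if n \<le> N then Bdeg (N - n) else {\<zero>\<^bsub>SymA\<^esub>})" for n using assms by (simp add: hom_def)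
  show "p 0 \<in> Bdeg N" using j[of 0] by simp
  show "p = cs (p 0)" if "N = 0"
  proof
    fix n show "p n = cs (p 0) n" using j[of n] that by (simp add: cs_apply split: if_splits)
  qed
  show "(\<lambda>n. p (Suc n)) \<in> hom M" if "N = Suc M"
    unfolding hom_def
  proof (rule CollectI, rule allI)
    fix i show "p (Suc i) \<in> (if i \<le> M then Bdeg (M - i) else {\<zero>\<^bsub>SymA\<^esub>})" using j[of "Suc i"] that by (simp split: if_splits)
  qed
qed

text \<open>By \<open>p = p\<^sub>0 + t p'\<close> and induction on the degree, the grading of the multiplication maps, which
  concerns constant sequences, controls the product of a constant sequence with any homogeneous
  element.\<close>

lemma cs_mult_hom_gen:
  assumes b: "b \<in> Bdeg m" and m: "\<And>n b'. b' \<in> Bdeg n \<Longrightarrow> smash_mult A \<Delta> V act b b' \<in> Bdeg (m + n)"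
  shows "q \<in> hom N \<Longrightarrow> cs b \<otimes>\<^bsub>Bt\<^esub> q \<in> hom (m + N)"
proof (induction N arbitrary: q)
  case 0
  note q = hom_split(1)[OF 0]
  show ?case
    by (subst hom_split(2)[OF 0 refl]) (use cs_mult_hom[OF b q m[OF q]] in simp)
next
  case (Suc N)
  let ?q = "\<lambda>n. q (Suc n)"
  note q = hom_split(1)[OF Suc.prems] hom_split(3)[OF Suc.prems refl]
  have c: "cs b \<in> carrier Bt" "cs (q 0) \<in> carrier Bt" "?q \<in> carrier Bt"
    using b q(1) hom_Bt[OF q(2)] Bdeg_carrier by auto
  have "cs b \<otimes>\<^bsub>Bt\<^esub> q = cs b \<otimes>\<^bsub>Bt\<^esub> (cs (q 0) \<oplus>\<^bsub>Bt\<^esub> t \<odot>\<^bsub>Bt\<^esub> ?q)"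
    by (rule arg_cong[where f = "\<lambda>x. cs b \<otimes>\<^bsub>Bt\<^esub> x", OF Bt_split(1)[OF hom_Bt[OF Suc.prems]]])
  also have "\<dots> = cs b \<otimes>\<^bsub>Bt\<^esub> cs (q 0) \<oplus>\<^bsub>Bt\<^esub> t \<odot>\<^bsub>Bt\<^esub> (cs b \<otimes>\<^bsub>Bt\<^esub> ?q)"
    using c by (simp add: Bt.r_distr Bt.kt_mult_right)
  finally show ?case
    using hom_add[OF cs_mult_hom[OF b q(1) m[OF q(1)]]] hom_t[OF Suc.IH[OF q(2)]] by simp
qed

definition bgen :: "'v + 'a \<Rightarrow> (('v list \<Rightarrow>\<^sub>0 'k) set set \<times> 'a \<Rightarrow>\<^sub>0 'k) set" where
  "bgen g = (case g of Inl v \<Rightarrow> iV v | Inr a \<Rightarrow> iA a)"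

lemma bgen_simps [simp]: "bgen (Inl v) = iV v" "bgen (Inr a) = iA a"
  by (simp_all add: bgen_def)

definition bword :: "('v + 'a) list \<Rightarrow> nat \<Rightarrow> (('v list \<Rightarrow>\<^sub>0 'k) set set \<times> 'a \<Rightarrow>\<^sub>0 'k) set" where
  "bword gs = foldr (\<lambda>g x. cs (bgen g) \<otimes>\<^bsub>Bt\<^esub> x) gs \<one>\<^bsub>Bt\<^esub>"

lemma bword_simps [simp]: "bword [] = \<one>\<^bsub>Bt\<^esub>" "bword (g # gs) = cs (bgen g) \<otimes>\<^bsub>Bt\<^esub> bword gs"
  by (simp_all add: bword_def)

lemma bgen_closed: "g \<in> gens \<Longrightarrow> bgen g \<in> carrier SymA"
  by auto

lemma bword_hom: "gs \<in> lists gens \<Longrightarrow> bword gs \<in> hom (nV gs)"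
proof (induction gs)
  case Nil
  show ?case using hom_cs[OF iA_Bdeg[OF A.one_closed]] by (simp add: Bt_one)
next
  case (Cons g gs)
  from Cons have "g \<in> gens" "bword gs \<in> hom (nV gs)" by auto
  then show ?case
  proof (elim PlusE)
    fix v assume w: "bword gs \<in> hom (nV gs)" and g: "g = Inl v" and v: "v \<in> carrier V"
    have "cs (iV v) \<otimes>\<^bsub>Bt\<^esub> bword gs \<in> hom (1 + nV gs)"
      by (rule cs_mult_hom_gen[OF iV_Bdeg[OF v] _ w]) (simp add: iV_mult_Bdeg[OF v])
    then show ?thesis by (simp add: g)
  next
    fix a assume w: "bword gs \<in> hom (nV gs)" and g: "g = Inr a" and a: "a \<in> carrier A"
    have "cs (iA a) \<otimes>\<^bsub>Bt\<^esub> bword gs \<in> hom (0 + nV gs)"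
      by (rule cs_mult_hom_gen[OF iA_Bdeg[OF a] _ w]) (simp add: iA_mult_Bdeg[OF a])
    then show ?thesis by (simp add: g)
  qed
qed

lemma bword_Bt: "gs \<in> lists gens \<Longrightarrow> bword gs \<in> carrier Bt"
  by (rule hom_Bt[OF bword_hom])

abbreviation "vgs vs a \<equiv> map Inl vs @ [Inr a]"

lemma vgs_gens: "vs \<in> lists (carrier V) \<Longrightarrow> a \<in> carrier A \<Longrightarrow> vgs vs a \<in> lists gens"
  by auto

lemma nV_vgs: "nV (vgs vs a) = length vs"
  by (induction vs) auto

lemma bword_vgs_0:
  "vs \<in> lists (carrier V) \<Longrightarrow> a \<in> carrier A \<Longrightarrow> bword (vgs vs a) 0 = tn (sym_word vs) a"
proof (induction vs)
  case Nil
  then show ?case by (simp add: cs_apply smashA_def)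
next
  case (Cons v vs)
  then have v: "v \<in> carrier V" "vs \<in> lists (carrier V)" by auto
  have "bword (vgs (v # vs) a) 0 = smash_mult A \<Delta> V act (iV v) (tn (sym_word vs) a)"
    using mult_Bt_0[OF cs_closed[OF iV_closed[OF v(1)]] bword_Bt[OF vgs_gens[OF v(2) Cons.prems(2)]]]
      Cons.IH[OF v(2) Cons.prems(2)] by (simp add: cs_apply del: in_lists_conv_set)
  then show ?case using smash_iV_word[OF v Cons.prems(2)] by simp
qed

lemma hword_vgs: "vs \<in> lists (carrier V) \<Longrightarrow> a \<in> carrier A \<Longrightarrow> hword (vgs vs a) = vword vs a"
  by (induction vs) auto

subsection \<open>The homomorphism to the specialization\<close>

abbreviation "S1 \<equiv> specialize Bt 1"
abbreviation "pr \<equiv> Bt.sproj 1"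

sublocale S1: kalgebra S1
  by (rule kalgebra.intro[OF Bt.kalg_specialize])

lemmas pr = alg_homD[OF Bt.alg_hom_sproj[of 1]]

lemma pr_t: "x \<in> carrier Bt \<Longrightarrow> pr (t \<odot>\<^bsub>Bt\<^esub> x) = pr x"
  using Bt.sproj_t[of x 1] Bt.kt_one[of x] by (simp flip: one_pCons)

lemma klinear_pr_cs: "klinear SymA S1 (\<lambda>b. pr (cs b))"
  by (rule klinear_comp[OF klinear_cs pr(1)])

lemma compat_lam:
  "a \<in> carrier A \<Longrightarrow> v \<in> carrier V \<Longrightarrow>
    iA (lamf a v) = (cs (iA a) \<otimes>\<^bsub>Bt\<^esub> cs (iV v)) 1 \<ominus>\<^bsub>B\<^esub> sweedler B (\<lambda>x y. (cs (iV (act x v)) \<otimes>\<^bsub>Bt\<^esub> cs (iA y)) 1) a"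
  using compat by (simp add: mu_compatible_def Let_def mu_def)

lemma compat_kap:
  assumes "v \<in> carrier V" "w \<in> carrier V"
  shows "iV (kapV v w) = (cs (iV v) \<otimes>\<^bsub>Bt\<^esub> cs (iV w)) 1 \<ominus>\<^bsub>B\<^esub> (cs (iV w) \<otimes>\<^bsub>Bt\<^esub> cs (iV v)) 1"
    "iA (kapA v w) = (cs (iV v) \<otimes>\<^bsub>Bt\<^esub> cs (iV w)) 2 \<ominus>\<^bsub>B\<^esub> (cs (iV w) \<otimes>\<^bsub>Bt\<^esub> cs (iV v)) 2"
  using compat assms by (simp_all add: mu_compatible_def Let_def mu_def)

lemma mu_high:
  assumes "b \<in> Bdeg m" "b' \<in> Bdeg n" "j > m + n" shows "(cs b \<otimes>\<^bsub>Bt\<^esub> cs b') j = \<zero>\<^bsub>SymA\<^esub>"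
  using mu_deg[OF assms(1,2), of j] assms(3) by auto

text \<open>The first relation of \<open>H\<close> in homogeneous form. The factors have total degree one, so only the
  coefficients of \<open>1\<close> and \<open>t\<close> occur: the former is the relation in \<open>B\<close>, the latter is the
  condition on \<open>\<mu>\<^sub>1\<close>.\<close>

lemma act_relation:
  assumes a: "a \<in> carrier A" and v: "v \<in> carrier V"
  shows "cs (iA a) \<otimes>\<^bsub>Bt\<^esub> cs (iV v) =
    sweedler Btk (\<lambda>x y. cs (iV (act x v)) \<otimes>\<^bsub>Bt\<^esub> cs (iA y)) a \<oplus>\<^bsub>Bt\<^esub> t \<odot>\<^bsub>Bt\<^esub> cs (iA (lamf a v))"
proof -
  let ?f = "\<lambda>x y. cs (iV (act x v)) \<otimes>\<^bsub>Bt\<^esub> cs (iA y)"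
  let ?Z = "sweedler Btk ?f a"
  have fc: "?f x y \<in> carrier Bt" if "x \<in> carrier A" "y \<in> carrier A" for x y using that v by auto
  have Z: "?Z \<in> carrier Bt" using AA.tens_ext_closed[OF Bt.K.kvs, of ?f "\<Delta> a"] fc a by simp
  have Zj: "?Z j = sweedler SymA (\<lambda>x y. ?f x y j) a" for j
    by (rule AA.klinear_tens_ext_comp[OF Bt.K.kvs SA.kvs_tensor klinear_comp_Bt]) (use fc a in auto)
  have l: "cs (iA (lamf a v)) \<in> carrier Bt" "t \<odot>\<^bsub>Bt\<^esub> cs (iA (lamf a v)) \<in> carrier Bt" using a v by auto
  let ?P = "cs (iA a) \<otimes>\<^bsub>Bt\<^esub> cs (iV v)"
  have P: "?P \<in> carrier Bt" using a v by auto
  have "?P j = ?Z j \<oplus>\<^bsub>SymA\<^esub> (t \<odot>\<^bsub>Bt\<^esub> cs (iA (lamf a v))) j" for j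
  proof -
    consider "j = 0" | "j = 1" | "j > 1" by linarith
    then show ?thesis
    proof cases
      case 1
      have "?Z 0 = sweedler SymA (\<lambda>x y. iV (act x v) \<otimes>\<^bsub>B\<^esub> iA y) a"
        unfolding Zj by (rule AA.tens_ext_cong[OF SA.kvs_tensor]) (use a v smash_mult_closed in \<open>auto simp: mu_0\<close>)
      then have "?P 0 = ?Z 0" using smash_iA_iV[OF a v] mu_0[of "iA a" "iV v"] a v by simp
      then show ?thesis using 1 Bt_closed[OF Z] by (simp add: Bt_t[OF l(1)])
    next
      case 2
      have "?Z 1 = sweedler B (\<lambda>x y. ?f x y 1) a"
        unfolding Zj by (rule sweedler_smash[symmetric]) (use fc Bt_closed a in auto)
      then have "iA (lamf a v) = ?P 1 \<ominus>\<^bsub>SymA\<^esub> ?Z 1"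
        using compat_lam[OF a v] Bt_closed[OF P, of 1] Bt_closed[OF Z, of 1] by (simp add: B_diff)
      then have "?P 1 = ?Z 1 \<oplus>\<^bsub>SymA\<^esub> iA (lamf a v)"
        using SA.T.diff_add_cancel[OF Bt_closed[OF P, of 1] Bt_closed[OF Z, of 1]] Bt_closed[OF Z, of 1] Bt_closed[OF P, of 1]
        by (simp add: SA.T.a_comm)
      then show ?thesis using 2 by (simp add: Bt_t[OF l(1)] cs_apply)
    next
      case 3
      have "?Z j = sweedler SymA (\<lambda>x y. \<zero>\<^bsub>SymA\<^esub>) a"
        unfolding Zj
        by (rule AA.tens_ext_cong[OF SA.kvs_tensor]) (use a v 3 mu_high[OF iV_Bdeg iA_Bdeg] in auto)
      also have "\<dots> = \<zero>\<^bsub>SymA\<^esub>"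
        using AA.tens_ext_subspace[OF SA.kvs_tensor SA.T.subspace_zero, of "\<lambda>x y. \<zero>\<^bsub>SymA\<^esub>" "\<Delta> a"] a by simp
      finally show ?thesis
        using 3 mu_high[OF iA_Bdeg[OF a] iV_Bdeg[OF v]] by (auto simp: Bt_t[OF l(1)] cs_apply split: nat.split)
    qed
  qed
  then show ?thesis by (simp add: Bt_add[OF Z l(2)] fun_eq_iff)
qed

text \<open>The second relation of \<open>H\<close> in homogeneous form: the factors have total degree two, the constant
  terms cancel because \<open>Sym(V)\<close> is commutative, and the coefficients of \<open>t\<close> and \<open>t\<^sup>2\<close> are the
  conditions on \<open>\<mu>\<^sub>1\<close> and \<open>\<mu>\<^sub>2\<close>.\<close>

lemma comm_relation:
  assumes v: "v \<in> carrier V" and w: "w \<in> carrier V"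
  shows "(cs (iV v) \<otimes>\<^bsub>Bt\<^esub> cs (iV w)) \<ominus>\<^bsub>Btk\<^esub> (cs (iV w) \<otimes>\<^bsub>Bt\<^esub> cs (iV v)) =
    t \<odot>\<^bsub>Bt\<^esub> cs (iV (kapV v w)) \<oplus>\<^bsub>Bt\<^esub> t \<odot>\<^bsub>Bt\<^esub> (t \<odot>\<^bsub>Bt\<^esub> cs (iA (kapA v w)))"
proof -
  let ?P = "cs (iV v) \<otimes>\<^bsub>Bt\<^esub> cs (iV w)" and ?Q = "cs (iV w) \<otimes>\<^bsub>Bt\<^esub> cs (iV v)"
  have PQ: "?P \<in> carrier Bt" "?Q \<in> carrier Bt" using v w by auto
  have l: "cs (iV (kapV v w)) \<in> carrier Bt" "cs (iA (kapA v w)) \<in> carrier Bt"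
    "t \<odot>\<^bsub>Bt\<^esub> cs (iA (kapA v w)) \<in> carrier Bt" using v w by auto
  have PQc: "?P j \<in> carrier SymA" "?Q j \<in> carrier SymA" for j using PQ Bt_closed by auto
  have r1: "(t \<odot>\<^bsub>Bt\<^esub> cs (iV (kapV v w))) j = (if j = 1 then iV (kapV v w) else \<zero>\<^bsub>SymA\<^esub>)" for j
    unfolding Bt_t[OF l(1)] by (simp add: cs_apply split: nat.split)
  have r2: "(t \<odot>\<^bsub>Bt\<^esub> (t \<odot>\<^bsub>Bt\<^esub> cs (iA (kapA v w)))) j = (if j = 2 then iA (kapA v w) else \<zero>\<^bsub>SymA\<^esub>)" for j
    unfolding Bt_t[OF l(3)] unfolding Bt_t[OF l(2)] by (simp add: cs_apply split: nat.split)
  have k1: "?P 1 \<ominus>\<^bsub>SymA\<^esub> ?Q 1 = iV (kapV v w)"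
    unfolding B_diff[OF PQc, symmetric] by (rule compat_kap(1)[OF v w, symmetric])
  have k2: "?P 2 \<ominus>\<^bsub>SymA\<^esub> ?Q 2 = iA (kapA v w)"
    unfolding B_diff[OF PQc, symmetric] by (rule compat_kap(2)[OF v w, symmetric])
  have "?P j \<ominus>\<^bsub>SymA\<^esub> ?Q j =
      (t \<odot>\<^bsub>Bt\<^esub> cs (iV (kapV v w))) j \<oplus>\<^bsub>SymA\<^esub> (t \<odot>\<^bsub>Bt\<^esub> (t \<odot>\<^bsub>Bt\<^esub> cs (iA (kapA v w)))) j" for j
  proof -
    have zero: "?P j \<ominus>\<^bsub>SymA\<^esub> ?Q j = \<zero>\<^bsub>SymA\<^esub>" if "?P j = ?Q j"
      using that SA.T.diff_eq_zero_iff[OF PQc(1)[of j] PQc(2)[of j]] by blast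
    consider "j = 0" | "j = 1" | "j = 2" | "j > 2" by linarith
    then show ?thesis
    proof cases
      case 1
      have "sym_word [v, w] = sym_word [w, v]"
        using sym_in_commute[OF v w] v w by simp
      then have "?P 0 = ?Q 0"
        using mu_0[of "iV v" "iV w"] mu_0[of "iV w" "iV v"] v w smash_iV_iV[OF v w] smash_iV_iV[OF w v] by simp
      then show ?thesis unfolding r1 r2 using 1 zero by simp
    next
      case 2
      then show ?thesis unfolding r1 r2 using k1 v w by simp
    next
      case 3
      then show ?thesis unfolding r1 r2 using k2 v w by simp
    next
      case 4
      have "?P j = \<zero>\<^bsub>SymA\<^esub>" "?Q j = \<zero>\<^bsub>SymA\<^esub>"
        using 4 mu_high[OF iV_Bdeg[OF v] iV_Bdeg[OF w], of j] mu_high[OF iV_Bdeg[OF w] iV_Bdeg[OF v], of j] by simp_all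
      then show ?thesis unfolding r1 r2 using 4 zero by simp
    qed
  qed
  moreover have "t \<odot>\<^bsub>Bt\<^esub> cs (iV (kapV v w)) \<in> carrier Bt" "t \<odot>\<^bsub>Bt\<^esub> (t \<odot>\<^bsub>Bt\<^esub> cs (iA (kapA v w))) \<in> carrier Bt"
    using l by auto
  ultimately show ?thesis using PQ by (auto simp: fun_eq_iff Bt_diff Bt_add)
qed

text \<open>At \<open>t = 1\<close> the two homogeneous relations become the defining relations of \<open>H\<close>.\<close>

lemma spec_hom:
  "\<exists>h \<in> alg_hom HH S1. (\<forall>v \<in> carrier V. h (hV v) = pr (cs (iV v))) \<and> (\<forall>a \<in> carrier A. h (hA a) = pr (cs (iA a)))"
proof (rule HH_lift[OF S1.kalg klinear_comp[OF klinear_iV klinear_pr_cs] klinear_comp[OF klinear_iA klinear_pr_cs]])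
  show "pr (cs (iA \<one>\<^bsub>A\<^esub>)) = \<one>\<^bsub>S1\<^esub>" using pr(7) by (simp add: Bt_one)
  show "pr (cs (iA a)) \<otimes>\<^bsub>S1\<^esub> pr (cs (iA b)) = pr (cs (iA (a \<otimes>\<^bsub>A\<^esub> b)))"
    if "a \<in> carrier A" "b \<in> carrier A" for a b
    using pr(6)[of "cs (iA a)" "cs (iA b)"] mu_A[OF that] that by simp
next
  fix a v assume a: "a \<in> carrier A" and v: "v \<in> carrier V"
  let ?f = "\<lambda>x y. cs (iV (act x v)) \<otimes>\<^bsub>Bt\<^esub> cs (iA y)"
  let ?Z = "sweedler Btk ?f a"
  have fc: "?f x y \<in> carrier Bt" if "x \<in> carrier A" "y \<in> carrier A" for x y using that v by auto
  have Z: "?Z \<in> carrier Bt" using AA.tens_ext_closed[OF Bt.K.kvs, of ?f "\<Delta> a"] fc a by simp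
  have "pr ?Z = sweedler S1 (\<lambda>x y. pr (?f x y)) a"
    by (rule AA.klinear_tens_ext_comp[OF Bt.K.kvs S1.kvs pr(1)]) (use fc a in auto)
  also have "\<dots> = sweedler S1 (\<lambda>x y. pr (cs (iV (act x v))) \<otimes>\<^bsub>S1\<^esub> pr (cs (iA y))) a"
  proof (rule AA.tens_ext_cong[OF S1.kvs])
    fix x y assume xy: "x \<in> carrier A" "y \<in> carrier A"
    have c: "cs (iV (act x v)) \<in> carrier Btk" "cs (iA y) \<in> carrier Btk" using xy v by auto
    show "pr (cs (iV (act x v))) \<otimes>\<^bsub>S1\<^esub> pr (cs (iA y)) \<in> carrier S1"
      by (intro S1.m_closed pr(3) c)
    show "pr (?f x y) = pr (cs (iV (act x v))) \<otimes>\<^bsub>S1\<^esub> pr (cs (iA y))"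
      using pr(6)[OF c] by simp
  qed (use a in auto)
  finally have e: "pr ?Z = sweedler S1 (\<lambda>x y. pr (cs (iV (act x v))) \<otimes>\<^bsub>S1\<^esub> pr (cs (iA y))) a" .
  have l: "cs (iA (lamf a v)) \<in> carrier Bt" using a v by auto
  have "pr (cs (iA a)) \<otimes>\<^bsub>S1\<^esub> pr (cs (iV v)) = pr (cs (iA a) \<otimes>\<^bsub>Bt\<^esub> cs (iV v))"
    using pr(6)[of "cs (iA a)" "cs (iV v)"] a v by simp
  also have "\<dots> = pr ?Z \<oplus>\<^bsub>S1\<^esub> pr (cs (iA (lamf a v)))"
    unfolding act_relation[OF a v] using pr(4)[of ?Z "t \<odot>\<^bsub>Bt\<^esub> cs (iA (lamf a v))"] Z l by (simp add: pr_t)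
  finally show "pr (cs (iA a)) \<otimes>\<^bsub>S1\<^esub> pr (cs (iV v)) =
      sweedler S1 (\<lambda>x y. pr (cs (iV (act x v))) \<otimes>\<^bsub>S1\<^esub> pr (cs (iA y))) a \<oplus>\<^bsub>S1\<^esub> pr (cs (iA (lamf a v)))"
    unfolding e .
next
  fix v w assume v: "v \<in> carrier V" and w: "w \<in> carrier V"
  have c: "cs (iV v) \<in> carrier Btk" "cs (iV w) \<in> carrier Btk" "cs (iV (kapV v w)) \<in> carrier Bt"
    "cs (iA (kapA v w)) \<in> carrier Bt" using v w by auto
  have "(pr (cs (iV v)) \<otimes>\<^bsub>S1\<^esub> pr (cs (iV w))) \<ominus>\<^bsub>S1\<^esub> (pr (cs (iV w)) \<otimes>\<^bsub>S1\<^esub> pr (cs (iV v))) =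
      pr ((cs (iV v) \<otimes>\<^bsub>Bt\<^esub> cs (iV w)) \<ominus>\<^bsub>Btk\<^esub> (cs (iV w) \<otimes>\<^bsub>Bt\<^esub> cs (iV v)))"
    using klinear_diff[OF Bt.K.kvs S1.kvs pr(1), of "cs (iV v) \<otimes>\<^bsub>Bt\<^esub> cs (iV w)" "cs (iV w) \<otimes>\<^bsub>Bt\<^esub> cs (iV v)"]
      pr(6)[OF c(1,2)] pr(6)[OF c(2,1)] c by simp
  also have "\<dots> = pr (cs (iV (kapV v w))) \<oplus>\<^bsub>S1\<^esub> pr (cs (iA (kapA v w)))"
    unfolding comm_relation[OF v w]
    using pr(4)[of "t \<odot>\<^bsub>Bt\<^esub> cs (iV (kapV v w))" "t \<odot>\<^bsub>Bt\<^esub> (t \<odot>\<^bsub>Bt\<^esub> cs (iA (kapA v w)))"] c by (simp add: pr_t)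
  finally show "(pr (cs (iV v)) \<otimes>\<^bsub>S1\<^esub> pr (cs (iV w))) \<ominus>\<^bsub>S1\<^esub> (pr (cs (iV w)) \<otimes>\<^bsub>S1\<^esub> pr (cs (iV v))) =
      pr (cs (iV (kapV v w))) \<oplus>\<^bsub>S1\<^esub> pr (cs (iA (kapA v w)))" .
qed

end

context smash_deformation
begin

definition "phi = (SOME h. h \<in> alg_hom HH S1 \<and> (\<forall>v \<in> carrier V. h (hV v) = pr (cs (iV v))) \<and>
  (\<forall>a \<in> carrier A. h (hA a) = pr (cs (iA a))))"

lemma phi_hom: "phi \<in> alg_hom HH S1"
  and phi_hV: "v \<in> carrier V \<Longrightarrow> phi (hV v) = pr (cs (iV v))"
  and phi_hA: "a \<in> carrier A \<Longrightarrow> phi (hA a) = pr (cs (iA a))"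
proof -
  have "\<exists>h. h \<in> alg_hom HH S1 \<and> (\<forall>v \<in> carrier V. h (hV v) = pr (cs (iV v))) \<and>
      (\<forall>a \<in> carrier A. h (hA a) = pr (cs (iA a)))"
    using spec_hom by blast
  from someI_ex[OF this] show "phi \<in> alg_hom HH S1"
    "v \<in> carrier V \<Longrightarrow> phi (hV v) = pr (cs (iV v))" "a \<in> carrier A \<Longrightarrow> phi (hA a) = pr (cs (iA a))"
    unfolding phi_def by blast+
qed

lemmas phi = alg_homD[OF phi_hom]

lemma phi_hword: "gs \<in> lists gens \<Longrightarrow> phi (hword gs) = pr (bword gs)"
proof (induction gs)
  case Nil
  show ?case using phi(7) pr(7) by simp
next
  case (Cons g gs)
  then have g: "g \<in> gens" and gs: "gs \<in> lists gens" by auto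
  have pg: "phi (Hg g) = pr (cs (bgen g))" using g phi_hV phi_hA by auto
  have "phi (hword (g # gs)) = phi (Hg g) \<otimes>\<^bsub>S1\<^esub> phi (hword gs)"
    using phi(6)[OF Hg_closed[OF g] hword_closed[OF gs]] by simp
  also have "\<dots> = pr (cs (bgen g)) \<otimes>\<^bsub>S1\<^esub> pr (bword gs)" using pg Cons.IH[OF gs] by simp
  also have "\<dots> = pr (bword (g # gs))"
    using pr(6)[of "cs (bgen g)" "bword gs"] bgen_closed[OF g] bword_Bt[OF gs] by simp
  finally show ?case .
qed

text \<open>Evaluation at \<open>t = 1\<close>. It is only linear, since the product of the deformation need not be the
  one of \<open>B[t]\<close>.\<close>

definition eps :: "(nat \<Rightarrow> (('v list \<Rightarrow>\<^sub>0 'k) set set \<times> 'a \<Rightarrow>\<^sub>0 'k) set) \<Rightarrow> (('v list \<Rightarrow>\<^sub>0 'k) set set \<times> 'a \<Rightarrow>\<^sub>0 'k) set" where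
  "eps p = (\<Oplus>\<^bsub>SymA\<^esub>n\<in>{n. p n \<noteq> \<zero>\<^bsub>SymA\<^esub>}. p n)"

lemma eps_eq:
  assumes "p \<in> carrier Bt" "\<And>n. n > N \<Longrightarrow> p n = \<zero>\<^bsub>SymA\<^esub>" shows "eps p = (\<Oplus>\<^bsub>SymA\<^esub>n\<in>{..N}. p n)"
  unfolding eps_def
proof (rule SA.T.add.finprod_mono_neutral_cong_left)
  show "{n. p n \<noteq> \<zero>\<^bsub>SymA\<^esub>} \<subseteq> {..N}" using assms(2) by (auto simp: not_less[symmetric])
qed (use Bt_closed[OF assms(1)] in auto)

lemma klinear_eps: "klinear Btk SymA eps"
proof (rule klinearI)
  fix p q assume "p \<in> carrier Btk" "q \<in> carrier Btk"
  then have p: "p \<in> carrier Bt" and q: "q \<in> carrier Bt" by auto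
  obtain M where M: "\<forall>n>M. p n = \<zero>\<^bsub>SymA\<^esub>" using Bt_bound[OF p] by blast
  obtain N where N: "\<forall>n>N. q n = \<zero>\<^bsub>SymA\<^esub>" using Bt_bound[OF q] by blast
  note MN = M N
  note c = Bt_closed[OF p] Bt_closed[OF q]
  let ?K = "max M N"
  have "eps (p \<oplus>\<^bsub>Bt\<^esub> q) = (\<Oplus>\<^bsub>SymA\<^esub>n\<in>{..?K}. (p \<oplus>\<^bsub>Bt\<^esub> q) n)"
    by (rule eps_eq[OF Bt.a_closed[OF p q]]) (use p q MN in \<open>auto simp: Bt_add\<close>)
  also have "\<dots> = (\<Oplus>\<^bsub>SymA\<^esub>n\<in>{..?K}. p n \<oplus>\<^bsub>SymA\<^esub> q n)" by (simp only: Bt_add[OF p q])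
  also have "\<dots> = (\<Oplus>\<^bsub>SymA\<^esub>n\<in>{..?K}. p n) \<oplus>\<^bsub>SymA\<^esub> (\<Oplus>\<^bsub>SymA\<^esub>n\<in>{..?K}. q n)"
    by (rule SA.T.finsum_addf) (use c in auto)
  also have "\<dots> = eps p \<oplus>\<^bsub>SymA\<^esub> eps q"
    using eps_eq[OF p, of ?K] eps_eq[OF q, of ?K] MN by simp
  finally show "eps (p \<oplus>\<^bsub>Btk\<^esub> q) = eps p \<oplus>\<^bsub>SymA\<^esub> eps q" by simp
next
  fix p c assume "p \<in> carrier Btk"
  then have p: "p \<in> carrier Bt" by simp
  obtain N where N: "\<forall>n>N. p n = \<zero>\<^bsub>SymA\<^esub>" using Bt_bound[OF p] by blast
  have "eps ([:c:] \<odot>\<^bsub>Bt\<^esub> p) = (\<Oplus>\<^bsub>SymA\<^esub>n\<in>{..N}. ([:c:] \<odot>\<^bsub>Bt\<^esub> p) n)"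
    by (rule eps_eq[OF Bt.kt_smult_closed[OF p]]) (use p N in \<open>auto simp: Bt_smult_const\<close>)
  also have "\<dots> = (\<Oplus>\<^bsub>SymA\<^esub>n\<in>{..N}. c \<odot>\<^bsub>SymA\<^esub> p n)" by (simp only: Bt_smult_const[OF p])
  also have "\<dots> = c \<odot>\<^bsub>SymA\<^esub> (\<Oplus>\<^bsub>SymA\<^esub>n\<in>{..N}. p n)"
    using module.finsum_smult_ldistr[OF SA.kvs_tensor, of "{..N}" c p] Bt_closed[OF p] by auto
  finally show "eps (c \<odot>\<^bsub>Btk\<^esub> p) = c \<odot>\<^bsub>SymA\<^esub> eps p" using eps_eq[OF p, of N] N by simp
  show "eps p \<in> carrier SymA"
    unfolding eps_def by (rule SA.T.finsum_closed) (use Bt_closed[OF p] in auto)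
qed

lemma eps_t: "p \<in> carrier Bt \<Longrightarrow> eps (t \<odot>\<^bsub>Bt\<^esub> p) = eps p"
proof -
  assume p: "p \<in> carrier Bt"
  obtain N where N: "\<forall>n>N. p n = \<zero>\<^bsub>SymA\<^esub>" using Bt_bound[OF p] by blast
  note c = Bt_closed[OF p]
  let ?q = "\<lambda>n. case n of 0 \<Rightarrow> \<zero>\<^bsub>SymA\<^esub> | Suc m \<Rightarrow> p m"
  have "eps (t \<odot>\<^bsub>Bt\<^esub> p) = (\<Oplus>\<^bsub>SymA\<^esub>n\<in>{..Suc N}. (t \<odot>\<^bsub>Bt\<^esub> p) n)"
    by (rule eps_eq[OF Bt.kt_smult_closed[OF p]]) (use p N in \<open>auto simp: Bt_t split: nat.split\<close>)
  also have "\<dots> = (\<Oplus>\<^bsub>SymA\<^esub>n\<in>{..Suc N}. ?q n)" by (simp only: Bt_t[OF p])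
  also have "\<dots> = (\<Oplus>\<^bsub>SymA\<^esub>n\<in>{..N}. ?q (Suc n)) \<oplus>\<^bsub>SymA\<^esub> ?q 0"
    by (rule SA.T.finsum_Suc2) (use c in \<open>auto split: nat.split\<close>)
  also have "\<dots> = eps p"
    using eps_eq[OF p, of N] N c by (simp add: SA.T.finsum_closed)
  finally show ?thesis .
qed

lemma eps_ideal: "x \<in> Bt.spec_ideal 1 \<Longrightarrow> eps x = \<zero>\<^bsub>SymA\<^esub>"
proof -
  assume "x \<in> Bt.spec_ideal 1"
  then obtain u where u: "u \<in> carrier Bt" "x = [:- 1, 1:] \<odot>\<^bsub>Bt\<^esub> u" by blast
  have "x = (t + [:- 1:]) \<odot>\<^bsub>Bt\<^esub> u" using u(2) by simp
  also have "\<dots> = t \<odot>\<^bsub>Bt\<^esub> u \<oplus>\<^bsub>Btk\<^esub> (-1) \<odot>\<^bsub>Btk\<^esub> u"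
    using u(1) by (simp only: Bt.kt_add_left restrict_scalars_sel)
  finally have "eps x = eps u \<oplus>\<^bsub>SymA\<^esub> (-1) \<odot>\<^bsub>SymA\<^esub> eps u"
    using klinear_add[OF klinear_eps, of "t \<odot>\<^bsub>Bt\<^esub> u" "(-1) \<odot>\<^bsub>Btk\<^esub> u"]
      klinear_smult[OF klinear_eps, of u "-1"] u(1) eps_t[OF u(1)] by simp
  then show ?thesis
    using klinear_closed[OF klinear_eps, of u] u(1) SA.T.minus_eq_smult[of "eps u" "eps u"]
      SA.T.diff_eq_zero_iff[of "eps u" "eps u"] by simp
qed

text \<open>The composition of \<open>phi\<close> with the map \<open>B\<^sub>t / (t - 1) B\<^sub>t \<rightarrow> B\<close> that \<open>eps\<close> induces, described by
  the properties that are used.\<close>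

definition "psi = (SOME g. klinear HH SymA g \<and> (\<forall>gs \<in> lists gens. g (hword gs) = eps (bword gs)) \<and>
  (\<forall>x \<in> carrier HH. phi x = \<zero>\<^bsub>S1\<^esub> \<longrightarrow> g x = \<zero>\<^bsub>SymA\<^esub>))"

lemma klinear_psi: "klinear HH SymA psi"
  and psi_hword: "gs \<in> lists gens \<Longrightarrow> psi (hword gs) = eps (bword gs)"
  and psi_kernel: "x \<in> carrier HH \<Longrightarrow> phi x = \<zero>\<^bsub>S1\<^esub> \<Longrightarrow> psi x = \<zero>\<^bsub>SymA\<^esub>"
proof -
  obtain g where g: "klinear S1 SymA g" "\<And>x. x \<in> carrier Bt \<Longrightarrow> g (pr x) = eps x"
    using Bt.K.quot_factor_linear(1)[OF Bt.K.ideal_subspace[OF Bt.ideal_spec[of 1]] SA.kvs_tensor klinear_eps eps_ideal]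
    unfolding specialize_quot[symmetric] Bt.sproj_def[symmetric] by auto
  have "klinear HH SymA (\<lambda>x. g (phi x)) \<and> (\<forall>gs \<in> lists gens. g (phi (hword gs)) = eps (bword gs)) \<and>
      (\<forall>x \<in> carrier HH. phi x = \<zero>\<^bsub>S1\<^esub> \<longrightarrow> g (phi x) = \<zero>\<^bsub>SymA\<^esub>)"
    using klinear_comp[OF phi(1) g(1)] klinear_zero[OF S1.kvs SA.kvs_tensor g(1)]
    by (simp add: phi_hword g(2) bword_Bt del: in_lists_conv_set)
  then have "\<exists>g. klinear HH SymA g \<and> (\<forall>gs \<in> lists gens. g (hword gs) = eps (bword gs)) \<and>
      (\<forall>x \<in> carrier HH. phi x = \<zero>\<^bsub>S1\<^esub> \<longrightarrow> g x = \<zero>\<^bsub>SymA\<^esub>)"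
    by (rule exI[of _ "\<lambda>x. g (phi x)"])
  note s = someI_ex[OF this, folded psi_def]
  show "klinear HH SymA psi"
    "gs \<in> lists gens \<Longrightarrow> psi (hword gs) = eps (bword gs)"
    "x \<in> carrier HH \<Longrightarrow> phi x = \<zero>\<^bsub>S1\<^esub> \<Longrightarrow> psi x = \<zero>\<^bsub>SymA\<^esub>"
    using s by simp_all
qed

text \<open>The coefficient of \<open>t\<^sup>j\<close> in a homogeneous element of degree \<open>N\<close> has degree \<open>N - j\<close>, so only the
  constant coefficient contributes to degree \<open>N\<close> after evaluation.\<close>

lemma part_eps:
  assumes x: "x \<in> hom N" and n: "N \<le> n"
  shows "part n (eps x) = (if n = N then x 0 else \<zero>\<^bsub>SymA\<^esub>)"
proof -
  have j: "x j \<in> (if j \<le> N then Bdeg (N - j) else {\<zero>\<^bsub>SymA\<^esub>})" for j using x by (simp add: hom_def)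
  note c = Bt_closed[OF hom_Bt[OF x]]
  have x0: "x k = \<zero>\<^bsub>SymA\<^esub>" if "N < k" for k using j[of k] that by (simp split: if_splits)
  have "eps x = (\<Oplus>\<^bsub>SymA\<^esub>j\<in>{..N}. x j)"
    by (rule eps_eq[OF hom_Bt[OF x] x0])
  then have "part n (eps x) = (\<Oplus>\<^bsub>SymA\<^esub>j\<in>{..N}. part n (x j))"
    using klinear_finsum[OF SA.kvs_tensor SA.kvs_tensor klinear_part, of "{..N}" x n] c by simp
  also have "\<dots> = (\<Oplus>\<^bsub>SymA\<^esub>j\<in>{..N}. if 0 = j then (if n = N then x 0 else \<zero>\<^bsub>SymA\<^esub>) else \<zero>\<^bsub>SymA\<^esub>)"
  proof (rule SA.T.finsum_cong')
    fix i assume i: "i \<in> {..N}"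
    then have "x i \<in> Bdeg (N - i)" using j[of i] by simp
    from part_Bdeg[OF this, of n] show "part n (x i) = (if 0 = i then (if n = N then x 0 else \<zero>\<^bsub>SymA\<^esub>) else \<zero>\<^bsub>SymA\<^esub>)"
      using i n by (cases "i = 0") auto
  qed (use c in auto)
  also have "\<dots> = (if n = N then x 0 else \<zero>\<^bsub>SymA\<^esub>)"
    by (rule SA.T.finsum_singleton) (use c in auto)
  finally show ?thesis .
qed

lemma psi_high:
  assumes "x \<in> HF n" "n < m" shows "part m (psi x) = \<zero>\<^bsub>SymA\<^esub>"
proof -
  have lin: "klinear HH SymA (\<lambda>x. part m (psi x))" by (rule klinear_comp[OF klinear_psi klinear_part])
  have "{hword gs | gs. gs \<in> lists gens \<and> nV gs \<le> n} \<subseteq> {x \<in> carrier HH. part m (psi x) \<in> {\<zero>\<^bsub>SymA\<^esub>}}"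
  proof
    fix x assume "x \<in> {hword gs | gs. gs \<in> lists gens \<and> nV gs \<le> n}"
    then obtain gs where gs: "x = hword gs" "gs \<in> lists gens" "nV gs \<le> n" by blast
    have "part m (psi x) = \<zero>\<^bsub>SymA\<^esub>"
      using part_eps[OF bword_hom[OF gs(2)], of m] gs assms(2) psi_hword[OF gs(2)] by simp
    then show "x \<in> {x \<in> carrier HH. part m (psi x) \<in> {\<zero>\<^bsub>SymA\<^esub>}}" using gs hword_closed by simp
  qed
  from H.kspan_least[OF subspace_kernel[OF H.kvs SA.kvs_tensor lin SA.T.subspace_zero] this]
  show ?thesis using assms(1) unfolding HF_def by auto
qed

lemma psi_below: "x \<in> HF.below n \<Longrightarrow> part n (psi x) = \<zero>\<^bsub>SymA\<^esub>"
proof (cases n)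
  case 0
  assume "x \<in> HF.below n"
  then have "x = \<zero>\<^bsub>HH\<^esub>" using 0 by (simp add: HF.below_simps)
  then show ?thesis
    using klinear_zero[OF H.kvs SA.kvs_tensor klinear_psi] klinear_zero[OF SA.kvs_tensor SA.kvs_tensor klinear_part] by simp
next
  case (Suc m)
  assume "x \<in> HF.below n"
  then show ?thesis using psi_high[of x m n] Suc by (simp add: HF.below_simps)
qed

lemma psi_vword:
  "vs \<in> lists (carrier V) \<Longrightarrow> a \<in> carrier A \<Longrightarrow> part (length vs) (psi (vword vs a)) = tn (sym_word vs) a"
  using part_eps[OF bword_hom[OF vgs_gens], of vs a "length vs"] psi_hword[OF vgs_gens, of vs a]
  by (simp add: hword_vgs nV_vgs bword_vgs_0 del: in_lists_conv_set)

text \<open>The symbol map: the top component of \<open>psi\<close> only depends on the class in the associated graded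
  algebra. It is a left inverse of the natural map.\<close>

definition symb :: "nat \<Rightarrow> (nat \<Rightarrow> (('v \<times> 'a) list \<Rightarrow>\<^sub>0 'k) set set set) \<Rightarrow> (('v list \<Rightarrow>\<^sub>0 'k) set set \<times> 'a \<Rightarrow>\<^sub>0 'k) set" where
  "symb n P = part n (psi (SOME x. x \<in> P n))"

lemma symb_cls:
  assumes "x \<in> carrier HF.rees" shows "symb n (HF.cls x) = part n (psi (x n))"
proof -
  have x: "x n \<in> HF n" using assms by simp
  let ?y = "SOME y. y \<in> HF.below n +>\<^bsub>HH\<^esub> x n"
  note y = HF.some_coset[OF x]
  have c: "?y \<in> carrier HH" "x n \<in> carrier HH" using HF.Fl_carrier[OF y(1)] HF.Fl_carrier[OF x] by auto
  have lin: "klinear HH SymA (\<lambda>x. part n (psi x))" by (rule klinear_comp[OF klinear_psi klinear_part])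
  have "part n (psi ?y) \<ominus>\<^bsub>SymA\<^esub> part n (psi (x n)) = \<zero>\<^bsub>SymA\<^esub>"
    using psi_below[OF y(2)] klinear_diff[OF H.kvs SA.kvs_tensor lin c] by simp
  then have "part n (psi ?y) = part n (psi (x n))"
    using SA.T.diff_eq_zero_iff[OF klinear_closed[OF lin c(1)] klinear_closed[OF lin c(2)]] by simp
  then show ?thesis by (simp add: symb_def HF.cls_def)
qed

lemma klinear_symb: "klinear Gr SymA (symb n)"
proof (rule klinearI)
  have lin: "klinear HH SymA (\<lambda>x. part n (psi x))" by (rule klinear_comp[OF klinear_psi klinear_part])
  fix P assume "P \<in> carrier Gr"
  then obtain x where x: "x \<in> carrier HF.rees" "P = HF.cls x" unfolding HF.carrier_gr by blast
  have xn: "x n \<in> carrier HH" using x(1) HF.Fl_carrier[of "x n" n] by simp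
  show "symb n P \<in> carrier SymA" unfolding x(2) symb_cls[OF x(1)] by (rule klinear_closed[OF lin xn])
  show "symb n (c \<odot>\<^bsub>Gr\<^esub> P) = c \<odot>\<^bsub>SymA\<^esub> symb n P" for c
    unfolding x(2) HF.cls_smult[OF x(1), symmetric] symb_cls[OF x(1)] symb_cls[OF HF.R.smult_closed[OF x(1)]]
    using klinear_smult[OF lin xn] by simp
  fix Q assume "Q \<in> carrier Gr"
  then obtain y where y: "y \<in> carrier HF.rees" "Q = HF.cls y" unfolding HF.carrier_gr by blast
  have yn: "y n \<in> carrier HH" using y(1) HF.Fl_carrier[of "y n" n] by simp
  show "symb n (P \<oplus>\<^bsub>Gr\<^esub> Q) = symb n P \<oplus>\<^bsub>SymA\<^esub> symb n Q"
    unfolding x(2) y(2) HF.cls_add[OF x(1) y(1), symmetric] symb_cls[OF x(1)] symb_cls[OF y(1)]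
      symb_cls[OF HF.R.a_closed[OF x(1) y(1)]]
    using klinear_add[OF lin xn yn] by simp
qed

lemma symb_gin:
  assumes "x \<in> HF m" shows "symb n (gin m x) = (if m = n then part n (psi x) else \<zero>\<^bsub>SymA\<^esub>)"
proof -
  have lin: "klinear HH SymA (\<lambda>x. part n (psi x))" by (rule klinear_comp[OF klinear_psi klinear_part])
  show ?thesis
    unfolding HF.cls_homog[OF assms, symmetric] symb_cls[OF HF.homog_closed[OF assms]]
    using klinear_zero[OF H.kvs SA.kvs_tensor lin] by (simp add: HF.homog_def)
qed

lemma symb_natural:
  assumes "natural n" "b \<in> carrier SymA" shows "symb m (n b) = part m b"
proof -
  have n: "klinear SymA Gr n" using alg_homD(1)[OF naturalD(1)[OF assms(1)]] by simp
  show ?thesis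
  proof (rule smash_eqI[OF SA.kvs_tensor klinear_comp[OF n klinear_symb] klinear_part _ assms(2)])
    fix vs a assume va: "vs \<in> lists (carrier V)" "a \<in> carrier A"
    show "symb m (n (tn (sym_word vs) a)) = part m (tn (sym_word vs) a)"
      unfolding natural_word[OF assms(1) va] symb_gin[OF vword_HF[OF va]] part_word[OF va]
      using psi_vword[OF va] by auto
  qed
qed

lemma natural_inj:
  assumes "natural n" shows "inj_on n (carrier B)"
proof (rule inj_onI)
  fix b c assume bc: "b \<in> carrier B" "c \<in> carrier B" "n b = n c"
  then have c: "b \<in> carrier SymA" "c \<in> carrier SymA" by auto
  have "part m (b \<ominus>\<^bsub>SymA\<^esub> c) = \<zero>\<^bsub>SymA\<^esub>" for m
  proof -
    have "part m b = part m c" using symb_natural[OF assms c(1), of m] symb_natural[OF assms c(2), of m] bc(3) by simp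
    then show ?thesis
      using klinear_diff[OF SA.kvs_tensor SA.kvs_tensor klinear_part c] SA.T.diff_eq_zero_iff[of "part m b" "part m c"] c by simp
  qed
  then have "b \<ominus>\<^bsub>SymA\<^esub> c = \<zero>\<^bsub>SymA\<^esub>" using part_eq_zeroD[of "b \<ominus>\<^bsub>SymA\<^esub> c"] c by simp
  then show "b = c" using SA.T.diff_eq_zero_iff c by blast
qed

theorem PBW_of_deformation: "PBW A \<Delta> V act lam kap"
  unfolding PBW_def bij_betw_def
  using natural_nu natural_inj[OF natural_nu] natural_surj[OF natural_nu] by blast

subsection \<open>The specialization at \<open>t = 1\<close>\<close>

text \<open>The class of \<open>x\<close> in degree \<open>n\<close> is the image of some \<open>b\<close> under the natural map, and the symbol
  map recovers all components of \<open>b\<close> from \<open>psi x\<close>.\<close>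

lemma psi_zero_below:
  assumes x: "x \<in> HF n" "psi x = \<zero>\<^bsub>SymA\<^esub>" shows "x \<in> HF.below n"
  proof -
    have "gin n x \<in> carrier Gr" by (rule HF.gr_in_closed[OF x(1)])
    then obtain b where b: "b \<in> carrier SymA" "gin n x = nu b" using natural_surj[OF natural_nu] by auto
    have z: "part m \<zero>\<^bsub>SymA\<^esub> = \<zero>\<^bsub>SymA\<^esub>" for m by (rule klinear_zero[OF SA.kvs_tensor SA.kvs_tensor klinear_part])
    have "part m b = \<zero>\<^bsub>SymA\<^esub>" for m
      unfolding symb_natural[OF natural_nu b(1), symmetric] b(2)[symmetric] symb_gin[OF x(1)] x(2) by (simp add: z)
    then have "b = \<zero>\<^bsub>SymA\<^esub>" using part_eq_zeroD[OF b(1)] by blast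
    then have "gin n x = \<zero>\<^bsub>Gr\<^esub>" using b(2) klinear_zero[OF SA.kvs_tensor HF.G.kvs klinear_nu] by simp
    then have "gin n x n = \<zero>\<^bsub>Gr\<^esub> n" by simp
    then have "HF.below n +>\<^bsub>HH\<^esub> x = HF.below n" by (simp add: gr_in_def gr_def)
    then show ?thesis using H.coset_eq_zero_iff[OF HF.below_subspace HF.Fl_carrier[OF x(1)]] by simp
  qed

lemma psi_inj: "x \<in> HF n \<Longrightarrow> psi x = \<zero>\<^bsub>SymA\<^esub> \<Longrightarrow> x = \<zero>\<^bsub>HH\<^esub>"
proof (induction n)
  case 0
  then show ?case using psi_zero_below[of x 0] by (simp add: HF.below_simps)
next
  case (Suc n)
  then show ?case using psi_zero_below[of x "Suc n"] by (simp add: HF.below_simps)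
qed

lemma phi_range_subspace: "submodule (phi ` carrier HH) ring_of_type_algebra S1"
proof (rule S1.subspaceI)
  show "phi ` carrier HH \<subseteq> carrier S1" using phi(3) by blast
  show "\<zero>\<^bsub>S1\<^esub> \<in> phi ` carrier HH"
    using klinear_zero[OF H.kvs S1.kvs phi(1)] H.zero_closed by (metis image_eqI)
  fix x y assume "x \<in> phi ` carrier HH" "y \<in> phi ` carrier HH"
  then obtain u w where u: "u \<in> carrier HH" "x = phi u" "w \<in> carrier HH" "y = phi w" by blast
  show "x \<oplus>\<^bsub>S1\<^esub> y \<in> phi ` carrier HH"
    unfolding u(2,4) phi(4)[OF u(1,3), symmetric] using u(1,3) by (intro imageI H.a_closed)
next
  fix c x assume "x \<in> phi ` carrier HH"
  then obtain u where u: "u \<in> carrier HH" "x = phi u" by blast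
  show "c \<odot>\<^bsub>S1\<^esub> x \<in> phi ` carrier HH"
    unfolding u(2) phi(5)[OF u(1), symmetric] using u(1) by (intro imageI H.smult_closed)
qed

lemma pr_split:
  assumes "p \<in> carrier Bt" shows "pr p = pr (cs (p 0)) \<oplus>\<^bsub>S1\<^esub> pr (\<lambda>n. p (Suc n))"
proof -
  note q = Bt_split(2)[OF assms]
  have c: "cs (p 0) \<in> carrier Btk" "t \<odot>\<^bsub>Bt\<^esub> (\<lambda>n. p (Suc n)) \<in> carrier Btk"
    using Bt_closed[OF assms] q by auto
  have "pr p = pr (cs (p 0) \<oplus>\<^bsub>Btk\<^esub> t \<odot>\<^bsub>Bt\<^esub> (\<lambda>n. p (Suc n)))"
    by (rule arg_cong[of _ _ pr]) (simp only: restrict_scalars_sel Bt_split(1)[OF assms, symmetric])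
  also have "\<dots> = pr (cs (p 0)) \<oplus>\<^bsub>S1\<^esub> pr (\<lambda>n. p (Suc n))"
    unfolding pr(4)[OF c] pr_t[OF q] ..
  finally show ?thesis .
qed

text \<open>By induction on the degree, the image of \<open>phi\<close> contains all homogeneous elements: a product of
  generators has the prescribed constant term, and the other terms have smaller degree.\<close>

lemma phi_surj_hom: "x \<in> hom n \<Longrightarrow> pr x \<in> phi ` carrier HH"
proof (induction n arbitrary: x rule: less_induct)
  case (less n)
  note U = phi_range_subspace
  have rest: "pr (\<lambda>i. y (Suc i)) \<in> phi ` carrier HH" if y: "y \<in> hom n" for y
  proof (cases n)
    case 0
    have "y (Suc i) = cs (y 0) (Suc i)" for i by (rule fun_cong[OF hom_split(2)[OF y 0]])
    then have "(\<lambda>i. y (Suc i)) = \<zero>\<^bsub>Btk\<^esub>" by (simp add: cs_apply Bt_zero)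
    then show ?thesis
      using klinear_zero[OF Bt.K.kvs S1.kvs pr(1)] S1.subspaceD(2)[OF U] by simp
  next
    case (Suc m)
    then show ?thesis using less.IH[of m "\<lambda>i. y (Suc i)"] hom_split(3)[OF y Suc] by simp
  qed
  have word_ok: "pr (cs (tn (sym_word vs) a)) \<in> phi ` carrier HH"
    if vs: "vs \<in> lists (carrier V)" and a: "a \<in> carrier A" and n: "length vs = n" for vs a
  proof -
    let ?y = "bword (vgs vs a)"
    have y: "?y \<in> hom n" using bword_hom[OF vgs_gens[OF vs a]] n by (simp add: nV_vgs)
    have e: "pr ?y = pr (cs (tn (sym_word vs) a)) \<oplus>\<^bsub>S1\<^esub> pr (\<lambda>i. ?y (Suc i))"
      using pr_split[OF hom_Bt[OF y]] bword_vgs_0[OF vs a] by simp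
    have c: "pr (cs (tn (sym_word vs) a)) \<in> carrier S1" "pr (\<lambda>i. ?y (Suc i)) \<in> carrier S1"
      using klinear_closed[OF klinear_pr_cs, of "tn (sym_word vs) a"] vs a pr(3) Bt_split(2)[OF hom_Bt[OF y]] by auto
    have "pr ?y \<in> phi ` carrier HH"
      unfolding phi_hword[OF vgs_gens[OF vs a], symmetric] by (rule imageI[OF hword_closed[OF vgs_gens[OF vs a]]])
    from S1.subspaceD(5)[OF U this rest[OF y]] show ?thesis
      unfolding e by (simp only: S1.add_diff_cancel[OF c])
  qed
  have deg: "pr (cs (part n b)) \<in> phi ` carrier HH" if "b \<in> carrier SymA" for b
    using that
  proof (induction rule: smash_induct)
    case (word vs a)
    then show ?case
      using word_ok[OF word]
        klinear_zero[OF SA.kvs_tensor S1.kvs klinear_pr_cs] S1.subspaceD(2)[OF U]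
      by (auto simp: part_word simp del: in_lists_conv_set)
  next
    case (add s t)
    note l = klinear_comp[OF klinear_part[of n] klinear_pr_cs]
    show ?case unfolding klinear_add[OF l add(1,2)] by (rule S1.subspaceD(3)[OF U add(3,4)])
  next
    case (smult c t)
    note l = klinear_comp[OF klinear_part[of n] klinear_pr_cs]
    show ?case unfolding klinear_smult[OF l smult(1)] by (rule S1.subspaceD(4)[OF U smult(2)])
  qed
  note x = less.prems
  have "pr (cs (x 0)) \<in> phi ` carrier HH"
    using deg[OF Bdeg_carrier[OF hom_split(1)[OF x]]] Bdeg_eqI[OF hom_split(1)[OF x]] by simp
  from S1.subspaceD(3)[OF U this rest[OF x]] show ?case
    unfolding pr_split[OF hom_Bt[OF x], symmetric] .
qed

lemma phi_surj: "phi ` carrier HH = carrier S1"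
proof
  show "phi ` carrier HH \<subseteq> carrier S1" using phi(3) by blast
  note U = phi_range_subspace
  have cs: "pr (cs b) \<in> phi ` carrier HH" if "b \<in> carrier SymA" for b
    using that
  proof (induction rule: smash_induct)
    case (word vs a)
    show ?case by (rule phi_surj_hom[OF hom_cs[OF tn_word_Bdeg[OF word]]])
  next
    case (add s t)
    show ?case unfolding klinear_add[OF klinear_pr_cs add(1,2)] by (rule S1.subspaceD(3)[OF U add(3,4)])
  next
    case (smult c t)
    show ?case unfolding klinear_smult[OF klinear_pr_cs smult(1)] by (rule S1.subspaceD(4)[OF U smult(2)])
  qed
  have all: "p \<in> carrier Bt \<Longrightarrow> (\<forall>n\<ge>N. p n = \<zero>\<^bsub>SymA\<^esub>) \<Longrightarrow> pr p \<in> phi ` carrier HH" for p N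
  proof (induction N arbitrary: p)
    case 0
    then have "p = \<zero>\<^bsub>Btk\<^esub>" by (simp add: Bt_zero fun_eq_iff)
    then show ?case using klinear_zero[OF Bt.K.kvs S1.kvs pr(1)] S1.subspaceD(2)[OF U] by simp
  next
    case (Suc N)
    have "pr (\<lambda>n. p (Suc n)) \<in> phi ` carrier HH"
      by (rule Suc.IH) (use Bt_split(2)[OF Suc.prems(1)] Suc.prems(2) in auto)
    from S1.subspaceD(3)[OF U cs[OF Bt_closed[OF Suc.prems(1), of 0]] this]
    show ?case unfolding pr_split[OF Suc.prems(1), symmetric] .
  qed
  show "carrier S1 \<subseteq> phi ` carrier HH"
  proof
    fix z assume "z \<in> carrier S1"
    then obtain p where p: "p \<in> carrier Bt" "z = pr p" unfolding Bt.carrier_specialize by blast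
    obtain N where "\<forall>n>N. p n = \<zero>\<^bsub>SymA\<^esub>" using Bt_bound[OF p(1)] by blast
    then show "z \<in> phi ` carrier HH" using all[OF p(1), of "Suc N"] p(2) by auto
  qed
qed

text \<open>Injectivity holds because \<open>psi\<close> factors through \<open>phi\<close> and is itself injective, by descent along
  the filtration.\<close>

theorem specialization_iso: "phi \<in> alg_iso HH S1"
proof -
  have "inj_on phi (carrier HH)"
  proof (rule inj_onI)
    fix x y assume xy: "x \<in> carrier HH" "y \<in> carrier HH" "phi x = phi y"
    have d: "x \<ominus>\<^bsub>HH\<^esub> y \<in> carrier HH" using xy by simp
    have "phi (x \<ominus>\<^bsub>HH\<^esub> y) = \<zero>\<^bsub>S1\<^esub>"
      using klinear_diff[OF H.kvs S1.kvs phi(1) xy(1,2)] xy S1.diff_eq_zero_iff[of "phi x" "phi y"] phi(3) by simp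
    then have "psi (x \<ominus>\<^bsub>HH\<^esub> y) = \<zero>\<^bsub>SymA\<^esub>" by (rule psi_kernel[OF d])
    moreover obtain n where "x \<ominus>\<^bsub>HH\<^esub> y \<in> HF n" using HF_exhaust[OF d] by blast
    ultimately have "x \<ominus>\<^bsub>HH\<^esub> y = \<zero>\<^bsub>HH\<^esub>" using psi_inj by blast
    then show "x = y" using H.diff_eq_zero_iff xy by blast
  qed
  with phi_hom phi_surj show ?thesis by (simp add: alg_iso_def bij_betw_def)
qed

end

section \<open>From the PBW property to a graded deformation\<close>

text \<open>A linear map has a linear section over its image, and the section may be prescribed on any
  subspace \<open>C\<close> on which the map is injective: the image of the section is a maximal subspace that
  contains \<open>C\<close> and meets the kernel trivially.\<close>

lemma linear_section:
  assumes M: "kvs M" and N: "kvs N" and f: "klinear M N f"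
    and C: "submodule C ring_of_type_algebra M" and inj: "\<And>c. c \<in> C \<Longrightarrow> f c = \<zero>\<^bsub>N\<^esub> \<Longrightarrow> c = \<zero>\<^bsub>M\<^esub>"
  shows "\<exists>s. klinear (N\<lparr>carrier := f ` carrier M\<rparr>) M s \<and> (\<forall>x \<in> carrier M. f (s (f x)) = f x) \<and>
    (\<forall>c \<in> C. s (f c) = c)"
proof -
  interpret M: vspace M by (rule vspace.intro[OF M])
  interpret N: vspace N by (rule vspace.intro[OF N])
  define P where "P D \<longleftrightarrow> submodule D ring_of_type_algebra M \<and> C \<subseteq> D \<and> (\<forall>d \<in> D. f d = \<zero>\<^bsub>N\<^esub> \<longrightarrow> d = \<zero>\<^bsub>M\<^esub>)" for D
  have "\<exists>D \<in> {D. P D}. \<forall>E \<in> {D. P D}. D \<subseteq> E \<longrightarrow> E = D"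
  proof (rule subset_Zorn_nonempty)
    show "{D. P D} \<noteq> {}" using C inj by (auto simp: P_def)
    fix \<C> assume ne: "\<C> \<noteq> {}" and ch: "subset.chain {D. P D} \<C>"
    then have P: "\<And>D. D \<in> \<C> \<Longrightarrow> P D" by (auto simp: subset.chain_def)
    obtain D0 where D0: "D0 \<in> \<C>" using ne by blast
    have "submodule (\<Union>\<C>) ring_of_type_algebra M"
    proof (rule M.subspaceI)
      show "\<Union>\<C> \<subseteq> carrier M" using P M.subspaceD(1) unfolding P_def by blast
      show "\<zero>\<^bsub>M\<^esub> \<in> \<Union>\<C>" using P[OF D0] D0 M.subspaceD(2) unfolding P_def by blast
      show "c \<odot>\<^bsub>M\<^esub> x \<in> \<Union>\<C>" if "x \<in> \<Union>\<C>" for c x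
        using that P M.subspaceD(4) unfolding P_def by blast
      fix x y assume "x \<in> \<Union>\<C>" "y \<in> \<Union>\<C>"
      then obtain D E where "D \<in> \<C>" "E \<in> \<C>" "x \<in> D" "y \<in> E" by blast
      moreover have "D \<subseteq> E \<or> E \<subseteq> D" using ch calculation(1,2) by (auto simp: subset_chain_def)
      ultimately obtain E' where E': "E' \<in> \<C>" "x \<in> E'" "y \<in> E'" by blast
      then have "x \<oplus>\<^bsub>M\<^esub> y \<in> E'" using P M.subspaceD(3) unfolding P_def by blast
      then show "x \<oplus>\<^bsub>M\<^esub> y \<in> \<Union>\<C>" using E'(1) by blast
    qed
    moreover have "C \<subseteq> \<Union>\<C>" using P[OF D0] D0 unfolding P_def by blast
    moreover have "\<forall>d \<in> \<Union>\<C>. f d = \<zero>\<^bsub>N\<^esub> \<longrightarrow> d = \<zero>\<^bsub>M\<^esub>" using P unfolding P_def by blast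
    ultimately show "\<Union>\<C> \<in> {D. P D}" by (simp add: P_def)
  qed
  then obtain D where PD: "P D" and max: "\<And>E. P E \<Longrightarrow> D \<subseteq> E \<Longrightarrow> E = D" by blast
  have D: "submodule D ring_of_type_algebra M" and CD: "C \<subseteq> D"
    and ker: "\<And>d. d \<in> D \<Longrightarrow> f d = \<zero>\<^bsub>N\<^esub> \<Longrightarrow> d = \<zero>\<^bsub>M\<^esub>" using PD by (auto simp: P_def)
  note D' = M.subspaceD[OF D]
  have Dc: "d \<in> carrier M" if "d \<in> D" for d using that D'(1) by blast
  note fc = klinear_closed[OF f]
  have diff: "f (x \<ominus>\<^bsub>M\<^esub> y) = f x \<ominus>\<^bsub>N\<^esub> f y" if "x \<in> carrier M" "y \<in> carrier M" for x y
    by (rule klinear_diff[OF M N f that])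
  have injD: "inj_on f D"
  proof (rule inj_onI)
    fix x y assume xy: "x \<in> D" "y \<in> D" "f x = f y"
    have "f (x \<ominus>\<^bsub>M\<^esub> y) = \<zero>\<^bsub>N\<^esub>" using xy Dc fc by (simp add: diff N.diff_eq_zero_iff)
    then have "x \<ominus>\<^bsub>M\<^esub> y = \<zero>\<^bsub>M\<^esub>" using ker D'(5) xy by blast
    then show "x = y" using xy Dc by (simp add: M.diff_eq_zero_iff)
  qed
  have sur: "f x \<in> f ` D" if x: "x \<in> carrier M" for x
  proof (rule ccontr)
    assume nx: "f x \<notin> f ` D"
    define E where "E = {d \<oplus>\<^bsub>M\<^esub> c \<odot>\<^bsub>M\<^esub> x | d c. d \<in> D}"
    have DE: "D \<subseteq> E"
    proof
      fix d assume "d \<in> D"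
      then have "d = d \<oplus>\<^bsub>M\<^esub> 0 \<odot>\<^bsub>M\<^esub> x" using Dc x by simp
      then show "d \<in> E" using \<open>d \<in> D\<close> unfolding E_def by blast
    qed
    have "x = \<zero>\<^bsub>M\<^esub> \<oplus>\<^bsub>M\<^esub> 1 \<odot>\<^bsub>M\<^esub> x" using x by simp
    then have xE: "x \<in> E" using D'(2) unfolding E_def by blast
    have "submodule E ring_of_type_algebra M"
    proof (rule M.subspaceI)
      show "E \<subseteq> carrier M" using Dc x by (auto simp: E_def)
      show "\<zero>\<^bsub>M\<^esub> \<in> E" using DE D'(2) by blast
    next
      fix y z assume "y \<in> E" "z \<in> E"
      then obtain d c d' c' where 1: "d \<in> D" "d' \<in> D" "y = d \<oplus>\<^bsub>M\<^esub> c \<odot>\<^bsub>M\<^esub> x" "z = d' \<oplus>\<^bsub>M\<^esub> c' \<odot>\<^bsub>M\<^esub> x"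
        unfolding E_def by blast
      then have "y \<oplus>\<^bsub>M\<^esub> z = (d \<oplus>\<^bsub>M\<^esub> d') \<oplus>\<^bsub>M\<^esub> (c + c') \<odot>\<^bsub>M\<^esub> x"
        using Dc x by (simp add: M.smult_add_left M.a_ac)
      then show "y \<oplus>\<^bsub>M\<^esub> z \<in> E" using D'(3)[OF 1(1,2)] unfolding E_def by blast
    next
      fix b y assume "y \<in> E"
      then obtain d c where 1: "d \<in> D" "y = d \<oplus>\<^bsub>M\<^esub> c \<odot>\<^bsub>M\<^esub> x" unfolding E_def by blast
      then have "b \<odot>\<^bsub>M\<^esub> y = b \<odot>\<^bsub>M\<^esub> d \<oplus>\<^bsub>M\<^esub> (b * c) \<odot>\<^bsub>M\<^esub> x"
        using Dc x by (simp add: M.smult_add_right M.smult_smult)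
      then show "b \<odot>\<^bsub>M\<^esub> y \<in> E" using D'(4)[OF 1(1), of b] unfolding E_def by blast
    qed
    moreover have "y = \<zero>\<^bsub>M\<^esub>" if "y \<in> E" "f y = \<zero>\<^bsub>N\<^esub>" for y
    proof -
      obtain d c where 1: "d \<in> D" "y = d \<oplus>\<^bsub>M\<^esub> c \<odot>\<^bsub>M\<^esub> x" using \<open>y \<in> E\<close> unfolding E_def by blast
      \<comment> \<open>Otherwise \<open>x\<close> differs from \<open>- d / c\<close> by an element of the kernel, so its image lies in \<open>f ` D\<close>.\<close>
      have c: "c = 0"
      proof (rule ccontr)
        assume c: "c \<noteq> 0"
        define e where "e = (- inverse c) \<odot>\<^bsub>M\<^esub> d"
        have eD: "e \<in> D" using D'(4)[OF 1(1)] by (simp add: e_def)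
        have "inverse c \<odot>\<^bsub>M\<^esub> y = inverse c \<odot>\<^bsub>M\<^esub> d \<oplus>\<^bsub>M\<^esub> x"
          using Dc[OF 1(1)] x c by (simp add: 1(2) M.smult_add_right M.smult_smult)
        moreover have "x \<ominus>\<^bsub>M\<^esub> e = inverse c \<odot>\<^bsub>M\<^esub> d \<oplus>\<^bsub>M\<^esub> x"
          using Dc[OF 1(1)] x by (simp add: e_def M.minus_eq_smult M.smult_smult M.a_comm)
        ultimately have "x \<ominus>\<^bsub>M\<^esub> e = inverse c \<odot>\<^bsub>M\<^esub> y" by simp
        moreover have "f (inverse c \<odot>\<^bsub>M\<^esub> y) = \<zero>\<^bsub>N\<^esub>"
          using klinear_smult[OF f, of y "inverse c"] 1 Dc x that(2) by simp
        ultimately have "f x \<ominus>\<^bsub>N\<^esub> f e = \<zero>\<^bsub>N\<^esub>" using diff[OF x Dc[OF eD]] by simp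
        then have "f x = f e" using fc x Dc[OF eD] by (simp add: N.diff_eq_zero_iff)
        then show False using nx eD by blast
      qed
      then have "y = d" using 1 Dc x by simp
      then show ?thesis using ker 1(1) that(2) by simp
    qed
    ultimately have "P E" using CD DE by (auto simp: P_def)
    then have "E = D" using max DE by blast
    then show False using nx xE by blast
  qed
  define s where "s = the_inv_into D f"
  have s: "s (f d) = d" if "d \<in> D" for d unfolding s_def by (rule the_inv_into_f_f[OF injD that])
  have ex: "\<exists>d \<in> D. f x = f d" if "x \<in> carrier M" for x using sur[OF that] by blast
  have "klinear (N\<lparr>carrier := f ` carrier M\<rparr>) M s"
  proof (rule klinearI; simp)
    fix y assume "y \<in> f ` carrier M"
    then obtain d where "d \<in> D" "y = f d" using ex by blast
    then show "s y \<in> carrier M" using s Dc by simp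
    show "s (c \<odot>\<^bsub>N\<^esub> y) = c \<odot>\<^bsub>M\<^esub> s y" for c
      using \<open>d \<in> D\<close> \<open>y = f d\<close> s D'(4)[OF \<open>d \<in> D\<close>] Dc by (simp add: klinear_smult[OF f, symmetric])
    fix z assume "z \<in> f ` carrier M"
    then obtain e where "e \<in> D" "z = f e" using ex by blast
    then show "s (y \<oplus>\<^bsub>N\<^esub> z) = s y \<oplus>\<^bsub>M\<^esub> s z"
      using \<open>d \<in> D\<close> \<open>y = f d\<close> s D'(3)[OF \<open>d \<in> D\<close> \<open>e \<in> D\<close>] Dc by (simp add: klinear_add[OF f, symmetric])
  qed
  moreover have "f (s (f x)) = f x" if "x \<in> carrier M" for x using ex[OF that] s by auto
  moreover have "s (f c) = c" if "c \<in> C" for c using s that CD by blast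
  ultimately show ?thesis by blast
qed

locale pbw_algebra = deformed_smash A \<Delta> V act lam kap
  for A :: "('k::field, 'a) module"
    and \<Delta> :: "'a \<Rightarrow> ('a \<times> 'a \<Rightarrow>\<^sub>0 'k) set"
    and V :: "('k, 'v) module"
    and act :: "'a \<Rightarrow> 'v \<Rightarrow> 'v"
    and lam :: "('a \<times> 'v \<Rightarrow>\<^sub>0 'k) set \<Rightarrow> 'a"
    and kap :: "('v \<times> 'v \<Rightarrow>\<^sub>0 'k) set \<Rightarrow> 'v \<times> 'a" +
  fixes \<nu> :: "(('v list \<Rightarrow>\<^sub>0 'k) set set \<times> 'a \<Rightarrow>\<^sub>0 'k) set \<Rightarrow> nat \<Rightarrow> (('v \<times> 'a) list \<Rightarrow>\<^sub>0 'k) set set set"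
  assumes natural: "natural_gr_map A \<Delta> V act lam kap \<nu>"
    and inj: "inj_on \<nu> (carrier (smash A \<Delta> V act))"
begin

lemmas \<nu>_hom = alg_homD[OF naturalD(1)[OF natural]]

lemma klinear_\<nu>: "klinear SymA Gr \<nu>"
  using \<nu>_hom(1) by simp

lemma \<nu>_zero: "\<nu> \<zero>\<^bsub>SymA\<^esub> = \<zero>\<^bsub>Gr\<^esub>"
  by (rule klinear_zero[OF SA.kvs_tensor HF.G.kvs klinear_\<nu>])

lemma \<nu>_eq_zeroD: "b \<in> carrier SymA \<Longrightarrow> \<nu> b = \<zero>\<^bsub>Gr\<^esub> \<Longrightarrow> b = \<zero>\<^bsub>SymA\<^esub>"
  using inj_onD[OF inj, of b "\<zero>\<^bsub>SymA\<^esub>"] \<nu>_zero by simp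

lemma Gr_add_smult:
  "P k = P' k \<Longrightarrow> Q k = Q' k \<Longrightarrow> (P \<oplus>\<^bsub>Gr\<^esub> Q) k = (P' \<oplus>\<^bsub>Gr\<^esub> Q') k"
  "P k = P' k \<Longrightarrow> (c \<odot>\<^bsub>Gr\<^esub> P) k = (c \<odot>\<^bsub>Gr\<^esub> P') k"
  by (simp_all add: gr_def)

lemma Gr_zero: "\<zero>\<^bsub>Gr\<^esub> = filt_below HH HF"
  by (simp add: gr_def)

text \<open>The natural map is graded: it suffices to look at words, whose images are homogeneous.\<close>

lemma \<nu>_part: "b \<in> carrier SymA \<Longrightarrow> \<nu> (part k b) k = \<nu> b k"
proof (induction b rule: smash_induct)
  case (word vs a)
  show ?case
    using natural_word[OF natural word] by (simp add: part_word[OF word] \<nu>_zero Gr_zero gr_in_def)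
next
  case (add s t)
  have "\<nu> (part k (s \<oplus>\<^bsub>SymA\<^esub> t)) = \<nu> (part k s) \<oplus>\<^bsub>Gr\<^esub> \<nu> (part k t)"
    using add.hyps by (simp add: klinear_add[OF klinear_part] klinear_add[OF klinear_\<nu>])
  then show ?case using add.hyps
      Gr_add_smult(1)[of "\<nu> (part k s)" k "\<nu> s" "\<nu> (part k t)" "\<nu> t", OF add.IH] by (simp add: klinear_add[OF klinear_\<nu>])
next
  case (smult c s)
  have "\<nu> (part k (c \<odot>\<^bsub>SymA\<^esub> s)) = c \<odot>\<^bsub>Gr\<^esub> \<nu> (part k s)"
    using smult.hyps by (simp add: klinear_smult[OF klinear_part] klinear_smult[OF klinear_\<nu>])
  then show ?case using smult.hyps
      Gr_add_smult(2)[of "\<nu> (part k s)" k "\<nu> s" c, OF smult.IH] by (simp add: klinear_smult[OF klinear_\<nu>])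
qed

lemma \<nu>_part_gin: "b \<in> carrier SymA \<Longrightarrow> \<exists>h \<in> HF k. \<nu> (part k b) = gin k h"
proof (induction b rule: smash_induct)
  case (word vs a)
  show ?case
  proof (cases "length vs = k")
    case True
    then show ?thesis
      using natural_word[OF natural word] vword_HF[OF word] by (auto simp: part_word[OF word])
  next
    case False
    have "gin k \<zero>\<^bsub>HH\<^esub> = \<zero>\<^bsub>Gr\<^esub>"
      by (rule HF.gr_in_below) (rule H.subspaceD(2)[OF HF.below_subspace])
    with False show ?thesis
      by (intro bexI[of _ "\<zero>\<^bsub>HH\<^esub>"]) (simp_all add: part_word[OF word] \<nu>_zero HF.Fl_zero)
  qed
next
  case (add s t)
  then obtain g h where "g \<in> HF k" "h \<in> HF k" "\<nu> (part k s) = gin k g" "\<nu> (part k t) = gin k h" by blast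
  moreover from this have "g \<oplus>\<^bsub>HH\<^esub> h \<in> HF k" by (simp add: H.subspaceD(3)[OF HF_subspace])
  ultimately show ?case using add.hyps
    by (intro bexI[of _ "g \<oplus>\<^bsub>HH\<^esub> h"])
      (simp_all add: klinear_add[OF klinear_part] klinear_add[OF klinear_\<nu>] HF.gr_in_add)
next
  case (smult c s)
  then obtain g where "g \<in> HF k" "\<nu> (part k s) = gin k g" by blast
  moreover from this have "c \<odot>\<^bsub>HH\<^esub> g \<in> HF k" by (simp add: H.subspaceD(4)[OF HF_subspace])
  ultimately show ?case using smult.hyps
    by (intro bexI[of _ "c \<odot>\<^bsub>HH\<^esub> g"])
      (simp_all add: klinear_smult[OF klinear_part] klinear_smult[OF klinear_\<nu>] HF.gr_in_smult)
qed

lemma \<nu>_part_eq: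
  assumes b: "b \<in> carrier SymA" and h: "h \<in> HF k" and e: "\<nu> b k = HF.below k +>\<^bsub>HH\<^esub> h"
  shows "\<nu> (part k b) = gin k h"
proof -
  obtain g where g: "g \<in> HF k" "\<nu> (part k b) = gin k g" using \<nu>_part_gin[OF b] by blast
  have "HF.below k +>\<^bsub>HH\<^esub> g = HF.below k +>\<^bsub>HH\<^esub> h" using \<nu>_part[OF b, of k] g(2) e by (simp add: gr_in_def)
  then show ?thesis unfolding g(2) gr_in_def by (simp only:)
qed

text \<open>Since the natural map is graded and injective, each component of \<open>b\<close> outside degree \<open>N\<close> is zero
  because its image is.\<close>

lemma Bdeg_of_gin:
  assumes b: "b \<in> carrier SymA" and h: "h \<in> HF N" and e: "\<nu> b = gin N h"
  shows "b \<in> Bdeg N"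
proof -
  have z: "part j b = \<zero>\<^bsub>SymA\<^esub>" if "j \<noteq> N" for j
  proof -
    have "\<nu> b j = HF.below j +>\<^bsub>HH\<^esub> \<zero>\<^bsub>HH\<^esub>"
      using that by (simp add: e gr_in_def H.coset_zero[OF HF.below_subspace])
    from \<nu>_part_eq[OF b HF.Fl_zero this] have "\<nu> (part j b) = \<zero>\<^bsub>Gr\<^esub>"
      by (simp add: HF.gr_in_below H.subspaceD(2)[OF HF.below_subspace])
    then show ?thesis using \<nu>_eq_zeroD b part_closed by blast
  qed
  have "\<nu> (part N b) = \<nu> b" using \<nu>_part_eq[OF b h] by (simp add: e gr_in_def)
  then have "part N b = b" using inj_onD[OF inj] b part_closed by simp
  then show ?thesis using part_in_Bdeg[OF b, of N] by simp
qed

text \<open>The products \<open>v a\<close> span a copy of \<open>V \<otimes> A\<close> in the deformed algebra; the map below sends \<open>v \<otimes> a\<close>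
  to \<open>v a\<close> and all components of degree other than one to zero.\<close>

definition linS :: "('v list \<Rightarrow>\<^sub>0 'k) set set \<Rightarrow> (('v \<times> 'a) list \<Rightarrow>\<^sub>0 'k) set set" where
  "linS = sym_ext HH (\<lambda>vs. if length vs = 1 then hV (hd vs) else \<zero>\<^bsub>HH\<^esub>)"

definition lin where "lin = tens_ext HH (\<lambda>f a. linS f \<otimes>\<^bsub>HH\<^esub> hA a)"

lemma sym_multilinear_linS:
  "sym_multilinear V HH (\<lambda>vs. if length vs = 1 then hV (hd vs) else \<zero>\<^bsub>HH\<^esub>)"
  unfolding sym_multilinear_def
proof (intro conjI ballI)
  fix u w assume "u \<in> lists (carrier V)" "w \<in> lists (carrier V)"
  show "klinear V HH (\<lambda>x. if length (u @ x # w) = 1 then hV (hd (u @ x # w)) else \<zero>\<^bsub>HH\<^esub>)"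
  proof (cases "u = [] \<and> w = []")
    case True
    then show ?thesis using klinear_hV by simp
  next
    case False
    then show ?thesis by (auto simp: H.kvs klinear_zero_fun)
  qed
qed (auto simp: length_Suc_conv)

lemma klinear_linS: "klinear Sym HH linS"
  unfolding linS_def by (rule klinear_sym_ext[OF H.kvs sym_multilinear_linS])

lemma linS_word: "vs \<in> lists (carrier V) \<Longrightarrow> linS (sym_word vs) = (if length vs = 1 then hV (hd vs) else \<zero>\<^bsub>HH\<^esub>)"
  unfolding linS_def by (rule sym_ext_word[OF H.kvs sym_multilinear_linS])

lemma kbilinear_lin: "kbilinear Sym A HH (\<lambda>f a. linS f \<otimes>\<^bsub>HH\<^esub> hA a)"
  by (intro kbilinearI klinear_comp[OF klinear_linS klinear_H_mult_right]
      klinear_comp[OF klinear_hA klinear_H_mult_left] hA_closed klinear_closed[OF klinear_linS])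

lemma klinear_lin: "klinear SymA HH lin"
  unfolding lin_def by (rule SA.klinear_tens_ext[OF H.kvs kbilinear_lin])

lemma lin_word:
  assumes "vs \<in> lists (carrier V)" "a \<in> carrier A"
  shows "lin (tn (sym_word vs) a) = (if length vs = 1 then hV (hd vs) \<otimes>\<^bsub>HH\<^esub> hA a else \<zero>\<^bsub>HH\<^esub>)"
  using SA.tens_ext_tens[OF H.kvs kbilinear_lin sym_word_closed[OF assms(1)] assms(2)]
  by (simp add: lin_def linS_word[OF assms(1)] assms(2))

lemma lin_sym_in: "v \<in> carrier V \<Longrightarrow> a \<in> carrier A \<Longrightarrow> lin (tn (sym_in V v) a) = hV v \<otimes>\<^bsub>HH\<^esub> hA a"
  using lin_word[of "[v]" a] by simp

lemma lin_part: "b \<in> carrier SymA \<Longrightarrow> lin b = lin (part 1 b)"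
  by (rule smash_eqI[OF H.kvs klinear_lin klinear_comp[OF klinear_part klinear_lin]])
    (simp_all add: lin_word part_word klinear_zero[OF SA.kvs_tensor H.kvs klinear_lin] del: in_lists_conv_set)

lemma lin_HF: "b \<in> carrier SymA \<Longrightarrow> lin b \<in> HF 1 \<and> gin 1 (lin b) = \<nu> (part 1 b)"
proof (induction b rule: smash_induct)
  case (word vs a)
  show ?case
  proof (cases "length vs = 1")
    case True
    then have "vword vs a = hV (hd vs) \<otimes>\<^bsub>HH\<^esub> hA a" by (auto simp: length_Suc_conv)
    with True show ?thesis
      using natural_word[OF natural word] vword_HF[OF word] by (simp add: part_word[OF word] lin_word[OF word])
  next
    case False
    then show ?thesis
      by (simp add: part_word[OF word] lin_word[OF word] HF.Fl_zero \<nu>_zero HF.gr_in_below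
          H.subspaceD(2)[OF HF.below_subspace])
  qed
next
  case (add s t)
  then show ?case
    by (simp add: klinear_add[OF klinear_lin] klinear_add[OF klinear_part] klinear_add[OF klinear_\<nu>]
        HF.gr_in_add H.subspaceD(3)[OF HF_subspace])
next
  case (smult c s)
  then show ?case
    by (simp add: klinear_smult[OF klinear_lin] klinear_smult[OF klinear_part] klinear_smult[OF klinear_\<nu>]
        HF.gr_in_smult H.subspaceD(4)[OF HF_subspace])
qed

text \<open>Consequently the copy of \<open>V \<otimes> A\<close> meets \<open>F\<^sub>0\<close> trivially: \<open>lin b\<close> and the component of \<open>b\<close> in
  degree one have the same class, and the natural map is injective.\<close>

lemma lin_zero:
  assumes "b \<in> carrier SymA" "gin 1 (lin b) = \<zero>\<^bsub>Gr\<^esub>" shows "lin b = \<zero>\<^bsub>HH\<^esub>"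
proof -
  have "part 1 b = \<zero>\<^bsub>SymA\<^esub>" using lin_HF[OF assms(1)] assms \<nu>_eq_zeroD part_closed by simp
  then show ?thesis using lin_part[OF assms(1)] klinear_zero[OF SA.kvs_tensor H.kvs klinear_lin] by simp
qed


lemma kvs_HF: "kvs (HH\<lparr>carrier := HF k\<rparr>)"
  by (rule submodule.submodule_is_module[OF HF_subspace H.kvs])

text \<open>The maps \<open>F\<^sub>k \<rightarrow> F\<^sub>k / F\<^sub>k\<^sub>-\<^sub>1\<close> have sections that are prescribed on \<open>C\<close>; composed with the
  natural map they lift the component of degree \<open>k\<close>.\<close>

lemma gin_section:
  assumes C: "submodule C ring_of_type_algebra HH" "C \<subseteq> HF k"
    and inj: "\<And>c. c \<in> C \<Longrightarrow> gin k c = \<zero>\<^bsub>Gr\<^esub> \<Longrightarrow> c = \<zero>\<^bsub>HH\<^esub>"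
  shows "\<exists>s. klinear SymA HH (\<lambda>b. s (part k b)) \<and>
    (\<forall>b \<in> carrier SymA. s (part k b) \<in> HF k \<and> gin k (s (part k b)) = \<nu> (part k b)) \<and>
    (\<forall>b \<in> carrier SymA. \<forall>c \<in> C. \<nu> b = gin k c \<longrightarrow> s b = c)"
proof -
  let ?M = "HH\<lparr>carrier := HF k\<rparr>"
  have g: "klinear ?M Gr (gin k)"
    by (rule klinearI) (simp_all add: HF.gr_in_closed HF.gr_in_add HF.gr_in_smult)
  have "submodule C ring_of_type_algebra ?M"
    by (rule vspace.subspaceI[OF vspace.intro[OF kvs_HF]]) (use C H.subspaceD[OF C(1)] in simp_all)
  from linear_section[OF kvs_HF HF.G.kvs g this] inj obtain s where
    s: "klinear (Gr\<lparr>carrier := gin k ` HF k\<rparr>) ?M s" and sec: "\<And>x. x \<in> HF k \<Longrightarrow> gin k (s (gin k x)) = gin k x"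
    and sC: "\<And>c. c \<in> C \<Longrightarrow> s (gin k c) = c" by auto
  have im: "\<nu> (part k b) \<in> gin k ` HF k" if "b \<in> carrier SymA" for b using \<nu>_part_gin[OF that] by blast
  have "klinear SymA (Gr\<lparr>carrier := gin k ` HF k\<rparr>) (\<lambda>b. \<nu> (part k b))"
    by (rule klinearI)
      (simp_all add: im klinear_add[OF klinear_part] klinear_add[OF klinear_\<nu>]
        klinear_smult[OF klinear_part] klinear_smult[OF klinear_\<nu>])
  from klinear_comp[OF this s] have l: "klinear SymA ?M (\<lambda>b. s (\<nu> (part k b)))" .
  have "klinear SymA HH (\<lambda>b. s (\<nu> (part k b)))"
    using klinear_closed[OF l] klinear_add[OF l] klinear_smult[OF l] HF.Fl_carrier[of _ k]
    by (intro klinearI) auto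
  moreover have "s (\<nu> (part k b)) \<in> HF k \<and> gin k (s (\<nu> (part k b))) = \<nu> (part k b)" if "b \<in> carrier SymA" for b
    
  proof -
    obtain h where "h \<in> HF k" "\<nu> (part k b) = gin k h"
      using \<nu>_part_gin[OF \<open>b \<in> carrier SymA\<close>, of k] by blast
    then show ?thesis using klinear_closed[OF l \<open>b \<in> carrier SymA\<close>] sec by simp
  qed
  moreover have "s (\<nu> b) = c" if "c \<in> C" "\<nu> b = gin k c" for b c using sC[OF that(1)] that(2) by simp
  ultimately show ?thesis by (intro exI[of _ "\<lambda>b. s (\<nu> b)"]) blast
qed

text \<open>A homogeneous linear lift of the natural isomorphism to the Rees algebra, normalized on \<open>A\<close> and
  \<open>V \<otimes> A\<close> so that the products \<open>v a\<close> are lifted to \<open>v a\<close>.\<close>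

lemma rees_lift_exists:
  "\<exists>\<sigma>. klinear SymA HF.rees \<sigma> \<and> (\<forall>b \<in> carrier SymA. HF.cls (\<sigma> b) = \<nu> b) \<and>
    (\<forall>N. \<forall>b \<in> Bdeg N. \<exists>h \<in> HF N. \<sigma> b = HF.homog N h) \<and>
    (\<forall>b \<in> carrier SymA. \<forall>k. part k b = \<zero>\<^bsub>SymA\<^esub> \<longrightarrow> \<sigma> b k = \<zero>\<^bsub>HH\<^esub>) \<and>
    (\<forall>a \<in> carrier A. \<sigma> (iA a) = HF.homog 0 (hA a)) \<and>
    (\<forall>v \<in> carrier V. \<forall>a \<in> carrier A. \<sigma> (tn (sym_in V v) a) = HF.homog 1 (hV v \<otimes>\<^bsub>HH\<^esub> hA a))"
proof -
  \<comment> \<open>The subspaces on which the sections are prescribed: \<open>F\<^sub>0\<close> is its own quotient, and in degree one it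
    is the span of the products \<open>v a\<close>.\<close>
  define C where "C k = (if k = 0 then HF 0 else if k = 1 then lin ` carrier SymA else {\<zero>\<^bsub>HH\<^esub>})" for k :: nat
  have Csub: "submodule (C k) ring_of_type_algebra HH" for k
  proof -
    have "submodule (lin ` carrier SymA) ring_of_type_algebra HH"
    proof (rule H.subspaceI)
      show "lin ` carrier SymA \<subseteq> carrier HH" using klinear_closed[OF klinear_lin] by blast
      show "\<zero>\<^bsub>HH\<^esub> \<in> lin ` carrier SymA"
        using klinear_zero[OF SA.kvs_tensor H.kvs klinear_lin, symmetric] by (rule image_eqI) simp
    next
      fix x y assume "x \<in> lin ` carrier SymA" "y \<in> lin ` carrier SymA"
      then obtain b d where b: "b \<in> carrier SymA" "d \<in> carrier SymA" "x = lin b" "y = lin d" by blast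
      then have "x \<oplus>\<^bsub>HH\<^esub> y = lin (b \<oplus>\<^bsub>SymA\<^esub> d)" by (simp add: klinear_add[OF klinear_lin])
      then show "x \<oplus>\<^bsub>HH\<^esub> y \<in> lin ` carrier SymA" by (rule image_eqI) (simp add: b)
    next
      fix c x assume "x \<in> lin ` carrier SymA"
      then obtain b where b: "b \<in> carrier SymA" "x = lin b" by blast
      then have "c \<odot>\<^bsub>HH\<^esub> x = lin (c \<odot>\<^bsub>SymA\<^esub> b)" by (simp add: klinear_smult[OF klinear_lin])
      then show "c \<odot>\<^bsub>HH\<^esub> x \<in> lin ` carrier SymA" by (rule image_eqI) (simp add: b)
    qed
    then show ?thesis by (simp add: C_def HF_subspace H.subspace_zero)
  qed
  have CF: "C k \<subseteq> HF k" for k using lin_HF by (auto simp: C_def HF.Fl_zero)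
  have Cinj: "c = \<zero>\<^bsub>HH\<^esub>" if "c \<in> C k" "gin k c = \<zero>\<^bsub>Gr\<^esub>" for c k
  proof -
    have "HF.below k +>\<^bsub>HH\<^esub> c = HF.below k" using fun_cong[OF that(2), of k] by (simp add: gr_in_def Gr_zero)
    moreover have cc: "c \<in> carrier HH" using that(1) CF HF.Fl_carrier by blast
    ultimately have "c \<in> HF.below k" by (simp add: H.coset_eq_zero_iff[OF HF.below_subspace])
    then show ?thesis using that lin_zero by (auto simp: C_def HF.below_simps split: if_splits)
  qed
  have "\<forall>k. \<exists>s. klinear SymA HH (\<lambda>b. s (part k b)) \<and>
    (\<forall>b \<in> carrier SymA. s (part k b) \<in> HF k \<and> gin k (s (part k b)) = \<nu> (part k b)) \<and>
    (\<forall>b \<in> carrier SymA. \<forall>c \<in> C k. \<nu> b = gin k c \<longrightarrow> s b = c)"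
    by (intro allI gin_section Csub CF) (rule Cinj)
  then obtain s where s: "\<And>k. klinear SymA HH (\<lambda>b. s k (part k b)) \<and>
    (\<forall>b \<in> carrier SymA. s k (part k b) \<in> HF k \<and> gin k (s k (part k b)) = \<nu> (part k b)) \<and>
    (\<forall>b \<in> carrier SymA. \<forall>c \<in> C k. \<nu> b = gin k c \<longrightarrow> s k b = c)" by metis
  have lin: "klinear SymA HH (\<lambda>b. s k (part k b))" for k using s by blast
  have sF: "s k (part k b) \<in> HF k" and sn: "gin k (s k (part k b)) = \<nu> (part k b)"
    if "b \<in> carrier SymA" for k b using s that by blast+
  have sC: "s k b = c" if "b \<in> carrier SymA" "c \<in> C k" "\<nu> b = gin k c" for k b c using s that by blast
  have s0: "s k \<zero>\<^bsub>SymA\<^esub> = \<zero>\<^bsub>HH\<^esub>" for k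
    by (rule sC) (simp_all add: \<nu>_zero HF.gr_in_below H.subspaceD(2)[OF HF.below_subspace] H.subspaceD(2)[OF Csub])
  define \<sigma> where "\<sigma> b = (\<lambda>k. s k (part k b))" for b
  have hom: "\<sigma> b = HF.homog N (s N b)" if "b \<in> Bdeg N" for b N
    unfolding \<sigma>_def HF.homog_def by (rule ext) (simp add: part_Bdeg[OF that] s0)
  have closed: "\<sigma> b \<in> carrier HF.rees" if b: "b \<in> carrier SymA" for b
  proof -
    obtain N where N: "\<forall>k>N. part k b = \<zero>\<^bsub>SymA\<^esub>" using part_bounded[OF b] by blast
    then have "bound \<zero>\<^bsub>HH\<^esub> N (\<sigma> b)" by (auto simp: \<sigma>_def s0)
    then show ?thesis by (rule HF.reesI[rotated]) (simp add: \<sigma>_def sF b)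
  qed
  have "klinear SymA HF.rees \<sigma>"
    by (rule klinearI) (simp_all only: closed[unfolded \<sigma>_def] HF.rees_sel(5,6) \<sigma>_def klinear_add[OF lin] klinear_smult[OF lin])
  moreover have "HF.cls (\<sigma> b) = \<nu> b" if b: "b \<in> carrier SymA" for b
  proof
    fix k
    have "HF.cls (\<sigma> b) k = gin k (s k (part k b)) k" by (simp add: HF.cls_def \<sigma>_def gr_in_def)
    also have "\<dots> = \<nu> b k" by (simp only: sn[OF b] \<nu>_part[OF b])
    finally show "HF.cls (\<sigma> b) k = \<nu> b k" .
  qed
  moreover have "\<exists>h \<in> HF N. \<sigma> b = HF.homog N h" if "b \<in> Bdeg N" for N b
    using hom[OF that] sF[OF Bdeg_carrier[OF that], of N] by (auto simp: part_Bdeg[OF that])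
  moreover have "\<sigma> b k = \<zero>\<^bsub>HH\<^esub>" if "part k b = \<zero>\<^bsub>SymA\<^esub>" for b k
    by (simp add: \<sigma>_def that s0)
  moreover have "\<sigma> (iA a) = HF.homog 0 (hA a)" if a: "a \<in> carrier A" for a
  proof -
    have "s 0 (iA a) = hA a" by (rule sC) (simp_all add: a C_def hA_HF naturalD(3)[OF natural])
    then show ?thesis using hom[OF iA_Bdeg[OF a]] by simp
  qed
  moreover have "\<sigma> (tn (sym_in V v) a) = HF.homog 1 (hV v \<otimes>\<^bsub>HH\<^esub> hA a)" if v: "v \<in> carrier V" and a: "a \<in> carrier A" for v a
  proof -
    have w: "[v] \<in> lists (carrier V)" using v by simp
    have e: "tn (sym_in V v) a = tn (sym_word [v]) a" using v by simp
    have b: "tn (sym_in V v) a \<in> Bdeg 1" using tn_word_Bdeg[OF w a] v by simp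
    have "\<nu> (tn (sym_in V v) a) = gin 1 (hV v \<otimes>\<^bsub>HH\<^esub> hA a)" using natural_word[OF natural w a] v by simp
    moreover have "hV v \<otimes>\<^bsub>HH\<^esub> hA a \<in> C 1"
      unfolding C_def using lin_sym_in[OF v a, symmetric] Bdeg_carrier[OF b] by simp
    ultimately have "s 1 (tn (sym_in V v) a) = hV v \<otimes>\<^bsub>HH\<^esub> hA a" using sC Bdeg_carrier[OF b] by blast
    then show ?thesis using hom[OF b] by simp
  qed
  ultimately show ?thesis by blast
qed

end

subsection \<open>Sequences as modules over \<open>k[t]\<close>\<close>

text \<open>Multiplication by \<open>t\<close> of a polynomial that is given by its coefficients.\<close>

definition tshift :: "('m, 'r) ring_scheme \<Rightarrow> (nat \<Rightarrow> 'm) \<Rightarrow> nat \<Rightarrow> 'm" where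
  "tshift M x = (\<lambda>n. case n of 0 \<Rightarrow> \<zero>\<^bsub>M\<^esub> | Suc m \<Rightarrow> x m)"

lemma tshift_simps [simp]: "tshift M x 0 = \<zero>\<^bsub>M\<^esub>" "tshift M x (Suc m) = x m"
  by (simp_all add: tshift_def)

definition poly_act :: "('k::field, 'm) module \<Rightarrow> 'k poly \<Rightarrow> (nat \<Rightarrow> 'm) \<Rightarrow> nat \<Rightarrow> 'm" where
  "poly_act M f x = (\<lambda>n. \<Oplus>\<^bsub>M\<^esub>i\<in>{..n}. poly.coeff f i \<odot>\<^bsub>M\<^esub> x (n - i))"

context vspace
begin

lemma poly_act_0: "(\<And>n. x n \<in> carrier M) \<Longrightarrow> poly_act M 0 x = (\<lambda>n. \<zero>)"
  by (simp add: poly_act_def finsum_zero)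

lemma poly_act_pCons:
  assumes x: "\<And>n. x n \<in> carrier M"
  shows "poly_act M (pCons a f) x = (\<lambda>n. a \<odot> x n \<oplus> tshift M (poly_act M f x) n)"
proof
  fix n show "poly_act M (pCons a f) x n = a \<odot> x n \<oplus> tshift M (poly_act M f x) n"
  proof (cases n)
    case 0
    then show ?thesis using x by (simp add: poly_act_def)
  next
    case (Suc m)
    have "(\<Oplus>i\<in>{..Suc m}. poly.coeff (pCons a f) i \<odot> x (Suc m - i)) =
        (\<Oplus>i\<in>{..m}. poly.coeff f i \<odot> x (m - i)) \<oplus> a \<odot> x (Suc m)"
      using x by (subst finsum_Suc2) (auto simp del: finsum_Suc)
    then show ?thesis using x by (simp add: Suc poly_act_def a_comm del: finsum_Suc)
  qed
qed

end

text \<open>To check the axioms of a \<open>k[t]\<close>-algebra it suffices to embed it into a \<open>k\<close>-algebra in such a way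
  that polynomials act through central elements.\<close>

lemma (in kalgebra) assoc_algebra_poly_pullback:
  fixes N :: "('k poly, 'n) module"
  assumes inj: "inj_on \<Phi> (carrier N)"
    and c\<Phi>: "\<And>x. x \<in> carrier N \<Longrightarrow> \<Phi> x \<in> carrier M"
    and c: "\<And>x y. x \<in> carrier N \<Longrightarrow> y \<in> carrier N \<Longrightarrow> x \<oplus>\<^bsub>N\<^esub> y \<in> carrier N"
      "\<And>x y. x \<in> carrier N \<Longrightarrow> y \<in> carrier N \<Longrightarrow> x \<otimes>\<^bsub>N\<^esub> y \<in> carrier N"
      "\<And>f x. x \<in> carrier N \<Longrightarrow> f \<odot>\<^bsub>N\<^esub> x \<in> carrier N" "\<zero>\<^bsub>N\<^esub> \<in> carrier N" "\<one>\<^bsub>N\<^esub> \<in> carrier N"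
    and h: "\<And>x y. x \<in> carrier N \<Longrightarrow> y \<in> carrier N \<Longrightarrow> \<Phi> (x \<oplus>\<^bsub>N\<^esub> y) = \<Phi> x \<oplus> \<Phi> y"
      "\<And>x y. x \<in> carrier N \<Longrightarrow> y \<in> carrier N \<Longrightarrow> \<Phi> (x \<otimes>\<^bsub>N\<^esub> y) = \<Phi> x \<otimes> \<Phi> y"
      "\<And>f x. x \<in> carrier N \<Longrightarrow> \<Phi> (f \<odot>\<^bsub>N\<^esub> x) = \<iota> f \<otimes> \<Phi> x" "\<Phi> \<zero>\<^bsub>N\<^esub> = \<zero>" "\<Phi> \<one>\<^bsub>N\<^esub> = \<one>"
    and i: "\<And>f. \<iota> f \<in> carrier M" "\<And>f g. \<iota> (f + g) = \<iota> f \<oplus> \<iota> g" "\<And>f g. \<iota> (f * g) = \<iota> f \<otimes> \<iota> g" "\<iota> 1 = \<one>"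
      "\<And>f x. x \<in> carrier M \<Longrightarrow> x \<otimes> \<iota> f = \<iota> f \<otimes> x"
  shows "assoc_algebra ring_of_type_algebra N"
proof -
  have eqI: "x = y" if "\<Phi> x = \<Phi> y" "x \<in> carrier N" "y \<in> carrier N" for x y
    using inj_onD[OF inj that] .
  have neg: "\<iota> (- 1) \<oplus> \<one> = \<zero>"
  proof -
    have "\<iota> 0 \<oplus> \<iota> 0 = \<iota> 0" using i(2)[of 0 0] by simp
    then have "\<iota> 0 = \<zero>" using i(1)[of 0] add.l_cancel_one' by force
    then show ?thesis using i(2)[of "- 1" 1] by (simp add: i(4))
  qed
  have ab: "abelian_group N"
  proof (rule abelian_groupI)
    fix x assume x: "x \<in> carrier N"
    have "\<iota> (- 1) \<otimes> \<Phi> x \<oplus> \<Phi> x = (\<iota> (- 1) \<oplus> \<one>) \<otimes> \<Phi> x" using x c\<Phi> i(1) by (simp add: l_distr)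
    then have "(- 1) \<odot>\<^bsub>N\<^esub> x \<oplus>\<^bsub>N\<^esub> x = \<zero>\<^bsub>N\<^esub>" using x c\<Phi> by (intro eqI) (simp_all add: c h neg)
    then show "\<exists>y\<in>carrier N. y \<oplus>\<^bsub>N\<^esub> x = \<zero>\<^bsub>N\<^esub>" using c(3)[OF x] by blast
  qed (auto intro!: eqI simp: c h c\<Phi> a_ac)
  have "module ring_of_type_algebra N"
    by (intro moduleI cring_from_type_algebra ab)
      (auto intro!: eqI simp: c h c\<Phi> i(1-4) l_distr r_distr m_assoc)
  moreover have "ring N"
    by (intro ringI monoidI ab) (auto intro!: eqI simp: c h c\<Phi> l_distr r_distr m_assoc)
  moreover have "(f \<odot>\<^bsub>N\<^esub> x) \<otimes>\<^bsub>N\<^esub> y = f \<odot>\<^bsub>N\<^esub> (x \<otimes>\<^bsub>N\<^esub> y)" "x \<otimes>\<^bsub>N\<^esub> (f \<odot>\<^bsub>N\<^esub> y) = f \<odot>\<^bsub>N\<^esub> (x \<otimes>\<^bsub>N\<^esub> y)"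
    if "x \<in> carrier N" "y \<in> carrier N" for f x y
  proof -
    note xy = that c\<Phi>[OF that(1)] c\<Phi>[OF that(2)]
    show "(f \<odot>\<^bsub>N\<^esub> x) \<otimes>\<^bsub>N\<^esub> y = f \<odot>\<^bsub>N\<^esub> (x \<otimes>\<^bsub>N\<^esub> y)" using xy by (intro eqI) (simp_all add: c h i(1) m_assoc)
    have "\<Phi> x \<otimes> (\<iota> f \<otimes> \<Phi> y) = \<iota> f \<otimes> (\<Phi> x \<otimes> \<Phi> y)"
      using xy by (simp add: m_assoc[symmetric] i(1) i(5))
    then show "x \<otimes>\<^bsub>N\<^esub> (f \<odot>\<^bsub>N\<^esub> y) = f \<odot>\<^bsub>N\<^esub> (x \<otimes>\<^bsub>N\<^esub> y)" using xy by (intro eqI) (simp_all add: c h)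
  qed
  ultimately show ?thesis by (simp add: assoc_algebra_def)
qed

subsection \<open>The Rees algebra as an algebra over \<open>k[t]\<close>\<close>

context filtered_algebra
begin

declare rees_sel [simp del]

definition "rees_t = homog 1 \<one>"

lemma rees_t_closed [simp, intro]: "rees_t \<in> carrier rees"
  unfolding rees_t_def using Fl_one Fl_Suc[of 0] by (intro homog_closed) auto

lemma rees_coeff: "x \<in> carrier rees \<Longrightarrow> x n \<in> carrier H"
  and rees_Fl: "x \<in> carrier rees \<Longrightarrow> x n \<in> Fl n"
  and rees_bound: "x \<in> carrier rees \<Longrightarrow> \<exists>N. bound \<zero> N x"
  by (auto simp: rees_sel(1))

lemma rees_t_mult:
  assumes x: "x \<in> carrier rees"
  shows "rees_t \<otimes>\<^bsub>rees\<^esub> x = tshift H x" "x \<otimes>\<^bsub>rees\<^esub> rees_t = tshift H x"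
proof -
  note c = rees_coeff[OF x]
  have "(\<Oplus>i\<in>{..n}. rees_t i \<otimes> x (n - i)) = tshift H x n \<and> (\<Oplus>i\<in>{..n}. x i \<otimes> rees_t (n - i)) = tshift H x n" for n
  proof (cases n)
    case (Suc m)
    have "(\<Oplus>i\<in>{..n}. rees_t i \<otimes> x (n - i)) = (\<Oplus>i\<in>{..n}. if 1 = i then x m else \<zero>)"
      by (rule finsum_cong') (use c Suc in \<open>auto simp: rees_t_def homog_def\<close>)
    moreover have "(\<Oplus>i\<in>{..n}. x i \<otimes> rees_t (n - i)) = (\<Oplus>i\<in>{..n}. if m = i then x m else \<zero>)"
      by (rule finsum_cong') (use c Suc in \<open>auto simp: rees_t_def homog_def\<close>)
    moreover have "(\<Oplus>i\<in>{..n}. if j = i then x m else \<zero>) = x m" if "j \<le> n" for j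
      by (rule finsum_singleton) (use c that in auto)
    ultimately show ?thesis using Suc by (simp del: finsum_Suc)
  qed (use c in \<open>auto simp: rees_t_def homog_def\<close>)
  then show "rees_t \<otimes>\<^bsub>rees\<^esub> x = tshift H x" "x \<otimes>\<^bsub>rees\<^esub> rees_t = tshift H x"
    by (simp_all add: rees_sel fun_eq_iff)
qed

lemma tshift_closed: "x \<in> carrier rees \<Longrightarrow> tshift H x \<in> carrier rees"
  using rees_t_mult(1)[of x] R.m_closed[OF rees_t_closed, of x] by simp

lemma tshift_homog: "tshift H (homog n h) = homog (Suc n) h"
  by (auto simp: tshift_def homog_def fun_eq_iff split: nat.split)

text \<open>The central copy of \<open>k[t]\<close> in the Rees algebra, in which \<open>t\<close> is the unit of \<open>H\<close> placed in degree
  one.\<close>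

definition poly_rees :: "'k poly \<Rightarrow> nat \<Rightarrow> 'h" where
  "poly_rees f = poly_act H f \<one>\<^bsub>rees\<^esub>"

lemma poly_rees_0: "poly_rees 0 = \<zero>\<^bsub>rees\<^esub>"
  unfolding poly_rees_def by (subst poly_act_0) (auto simp: rees_coeff rees_sel)

lemma poly_rees_pCons:
  assumes "poly_rees f \<in> carrier rees"
  shows "poly_rees (pCons a f) = a \<odot>\<^bsub>rees\<^esub> \<one>\<^bsub>rees\<^esub> \<oplus>\<^bsub>rees\<^esub> rees_t \<otimes>\<^bsub>rees\<^esub> poly_rees f"
  using assms unfolding poly_rees_def
  by (subst poly_act_pCons) (auto simp: rees_coeff rees_t_mult rees_sel(5,6))

lemma poly_rees_closed [simp, intro]: "poly_rees f \<in> carrier rees"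
  by (induction f) (simp_all add: poly_rees_0 poly_rees_pCons)

lemmas poly_rees_pCons' = poly_rees_pCons[OF poly_rees_closed]

lemma poly_rees_add: "poly_rees (f + g) = poly_rees f \<oplus>\<^bsub>rees\<^esub> poly_rees g"
proof (induction f g rule: poly_induct2)
  case (pCons a f b g)
  then show ?case by (simp add: poly_rees_pCons' R.smult_add_left R.r_distr R.a_ac)
qed (simp add: poly_rees_0)

lemma poly_rees_smult: "poly_rees (smult c f) = c \<odot>\<^bsub>rees\<^esub> poly_rees f"
  by (induction f)
    (simp_all add: poly_rees_0 poly_rees_pCons' R.smult_add_right R.smult_smult R.mult_smult_right)

lemma poly_rees_mult: "poly_rees (f * g) = poly_rees f \<otimes>\<^bsub>rees\<^esub> poly_rees g"
proof (induction f)
  case (pCons a f)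
  then show ?case
    by (simp add: mult_pCons_left poly_rees_add poly_rees_smult poly_rees_pCons' R.l_distr R.mult_smult_left R.m_assoc)
qed (simp add: poly_rees_0)

lemma poly_rees_1: "poly_rees 1 = \<one>\<^bsub>rees\<^esub>"
  by (simp add: one_pCons poly_rees_pCons' poly_rees_0)

lemma poly_rees_central: "x \<in> carrier rees \<Longrightarrow> x \<otimes>\<^bsub>rees\<^esub> poly_rees f = poly_rees f \<otimes>\<^bsub>rees\<^esub> x"
proof (induction f)
  case (pCons a f)
  have "x \<otimes>\<^bsub>rees\<^esub> (rees_t \<otimes>\<^bsub>rees\<^esub> poly_rees f) = (x \<otimes>\<^bsub>rees\<^esub> rees_t) \<otimes>\<^bsub>rees\<^esub> poly_rees f"
    using pCons.prems by (simp add: R.m_assoc)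
  also have "\<dots> = rees_t \<otimes>\<^bsub>rees\<^esub> (poly_rees f \<otimes>\<^bsub>rees\<^esub> x)"
    using pCons by (simp add: rees_t_mult(2)[of x] rees_t_mult(1)[of x, symmetric] R.m_assoc)
  finally show ?case using pCons.prems
    by (simp add: poly_rees_pCons' R.l_distr R.r_distr R.mult_smult_left R.mult_smult_right R.m_assoc)
qed (simp add: poly_rees_0)

text \<open>The \<open>n\<close>-th coefficient of \<open>t x\<close> lies in the filtration step \<open>n - 1\<close>.\<close>

lemma cls_tshift:
  assumes x: "x \<in> carrier rees" shows "cls (tshift H x) = \<zero>\<^bsub>G\<^esub>"
proof -
  have "tshift H x n \<ominus> \<zero>\<^bsub>rees\<^esub> n \<in> below n" for n
  proof (cases n)
    case (Suc m)
    then show ?thesis using rees_Fl[OF x, of m] Fl_carrier by (simp add: below_simps rees_sel a_minus_def)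
  qed (simp add: below_simps rees_sel a_minus_def)
  then have "cls (tshift H x) = cls \<zero>\<^bsub>rees\<^esub>" using cls_eq_iff tshift_closed[OF x] R.zero_closed by blast
  then show ?thesis by (simp only: cls_zero)
qed

text \<open>The kernel of the projection to the associated graded algebra is generated by \<open>t\<close>.\<close>

lemma cls_eq_zeroD:
  assumes x: "x \<in> carrier rees" and 0: "cls x = \<zero>\<^bsub>G\<^esub>"
  shows "(\<lambda>n. x (Suc n)) \<in> carrier rees" "x = tshift H (\<lambda>n. x (Suc n))"
proof -
  have "cls x = cls \<zero>\<^bsub>rees\<^esub>" by (simp only: cls_zero 0)
  then have d: "x n \<ominus> \<zero>\<^bsub>rees\<^esub> n \<in> below n" for n using cls_eq_iff[OF x R.zero_closed] by blast
  then have b: "x n \<in> below n" for n using d[of n] rees_coeff[OF x, of n] by (simp add: rees_sel a_minus_def)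
  obtain N where "bound \<zero> N x" using rees_bound[OF x] by blast
  then have "bound \<zero> N (\<lambda>n. x (Suc n))" by (auto simp: bound_def)
  then show "(\<lambda>n. x (Suc n)) \<in> carrier rees"
    by (rule reesI[rotated]) (use b[of "Suc _"] in \<open>simp add: below_simps\<close>)
  show "x = tshift H (\<lambda>n. x (Suc n))"
    using b[of 0] by (auto simp: tshift_def fun_eq_iff below_simps split: nat.split)
qed

end

subsection \<open>The deformation carried by the Rees algebra\<close>

locale rees_lift = pbw_algebra A \<Delta> V act lam kap \<nu>
  for A :: "('k::field, 'a) module"
    and \<Delta> :: "'a \<Rightarrow> ('a \<times> 'a \<Rightarrow>\<^sub>0 'k) set"
    and V :: "('k, 'v) module"
    and act :: "'a \<Rightarrow> 'v \<Rightarrow> 'v"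
    and lam :: "('a \<times> 'v \<Rightarrow>\<^sub>0 'k) set \<Rightarrow> 'a"
    and kap :: "('v \<times> 'v \<Rightarrow>\<^sub>0 'k) set \<Rightarrow> 'v \<times> 'a"
    and \<nu> :: "(('v list \<Rightarrow>\<^sub>0 'k) set set \<times> 'a \<Rightarrow>\<^sub>0 'k) set \<Rightarrow> nat \<Rightarrow> (('v \<times> 'a) list \<Rightarrow>\<^sub>0 'k) set set set" +
  fixes \<sigma> :: "(('v list \<Rightarrow>\<^sub>0 'k) set set \<times> 'a \<Rightarrow>\<^sub>0 'k) set \<Rightarrow> nat \<Rightarrow> (('v \<times> 'a) list \<Rightarrow>\<^sub>0 'k) set set"
  assumes lift: "klinear SymA HF.rees \<sigma> \<and> (\<forall>b \<in> carrier SymA. HF.cls (\<sigma> b) = \<nu> b) \<and>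
    (\<forall>N. \<forall>b \<in> Bdeg N. \<exists>h \<in> HF N. \<sigma> b = HF.homog N h) \<and>
    (\<forall>b \<in> carrier SymA. \<forall>k. part k b = \<zero>\<^bsub>SymA\<^esub> \<longrightarrow> \<sigma> b k = \<zero>\<^bsub>HH\<^esub>) \<and>
    (\<forall>a \<in> carrier A. \<sigma> (iA a) = HF.homog 0 (hA a)) \<and>
    (\<forall>v \<in> carrier V. \<forall>a \<in> carrier A. \<sigma> (tn (sym_in V v) a) = HF.homog 1 (hV v \<otimes>\<^bsub>HH\<^esub> hA a))"
begin

abbreviation "R \<equiv> HF.rees"

declare HF.rees_sel [simp del]

lemma klinear_\<sigma>: "klinear SymA R \<sigma>"
  and cls_\<sigma>: "b \<in> carrier SymA \<Longrightarrow> HF.cls (\<sigma> b) = \<nu> b"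
  and \<sigma>_homog: "b \<in> Bdeg N \<Longrightarrow> \<exists>h \<in> HF N. \<sigma> b = HF.homog N h"
  and \<sigma>_part: "b \<in> carrier SymA \<Longrightarrow> part k b = \<zero>\<^bsub>SymA\<^esub> \<Longrightarrow> \<sigma> b k = \<zero>\<^bsub>HH\<^esub>"
  and \<sigma>_A: "a \<in> carrier A \<Longrightarrow> \<sigma> (iA a) = HF.homog 0 (hA a)"
  and \<sigma>_VA: "v \<in> carrier V \<Longrightarrow> a \<in> carrier A \<Longrightarrow> \<sigma> (tn (sym_in V v) a) = HF.homog 1 (hV v \<otimes>\<^bsub>HH\<^esub> hA a)"
  using lift by blast+

lemma \<sigma>_V: "v \<in> carrier V \<Longrightarrow> \<sigma> (iV v) = HF.homog 1 (hV v)"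
  using \<sigma>_VA[of v "\<one>\<^bsub>A\<^esub>"] by (simp add: smashV_def hA_one)

lemma \<sigma>_closed [simp, intro]: "b \<in> carrier SymA \<Longrightarrow> \<sigma> b \<in> carrier R"
  by (rule klinear_closed[OF klinear_\<sigma>])

lemma \<sigma>_zero: "\<sigma> \<zero>\<^bsub>SymA\<^esub> = \<zero>\<^bsub>R\<^esub>"
  by (rule klinear_zero[OF SA.kvs_tensor HF.R.kvs klinear_\<sigma>])

lemma \<sigma>_coeff: "b \<in> carrier SymA \<Longrightarrow> \<sigma> b k \<in> carrier HH"
  by (rule HF.rees_coeff[OF \<sigma>_closed])

lemma up_B_iff: "p \<in> up B \<longleftrightarrow> (\<forall>n. p n \<in> carrier SymA) \<and> (\<exists>N. \<forall>n>N. p n = \<zero>\<^bsub>SymA\<^esub>)"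
proof
  assume p: "p \<in> up B"
  then obtain N where "bound \<zero>\<^bsub>B\<^esub> N p" unfolding up_def by blast
  then have "\<forall>n>N. p n = \<zero>\<^bsub>SymA\<^esub>" by (simp add: bound_def)
  moreover have "p n \<in> carrier SymA" for n using mem_upD[OF p] by simp
  ultimately show "(\<forall>n. p n \<in> carrier SymA) \<and> (\<exists>N. \<forall>n>N. p n = \<zero>\<^bsub>SymA\<^esub>)" by blast
next
  assume "(\<forall>n. p n \<in> carrier SymA) \<and> (\<exists>N. \<forall>n>N. p n = \<zero>\<^bsub>SymA\<^esub>)"
  then obtain N where "\<And>n. p n \<in> carrier SymA" "\<forall>n>N. p n = \<zero>\<^bsub>SymA\<^esub>" by blast
  then show "p \<in> up B" by (intro mem_upI exI[of _ N]) (auto simp: bound_def)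
qed

lemma up_B_coeff: "p \<in> up B \<Longrightarrow> p n \<in> carrier SymA"
  by (simp add: up_B_iff)

lemma up_B_zero: "(\<lambda>_. \<zero>\<^bsub>SymA\<^esub>) \<in> up B"
  by (simp add: up_B_iff)

lemma up_BI: "(\<And>n. p n \<in> carrier SymA) \<Longrightarrow> \<forall>n>N. p n = \<zero>\<^bsub>SymA\<^esub> \<Longrightarrow> p \<in> up B"
  unfolding up_B_iff by blast

lemma up_B_add: 
  assumes p: "p \<in> up B" and q: "q \<in> up B" shows "(\<lambda>n. p n \<oplus>\<^bsub>SymA\<^esub> q n) \<in> up B"
proof -
  obtain N where N: "\<forall>n>N. p n = \<zero>\<^bsub>SymA\<^esub>" using p up_B_iff by blast
  obtain M where M: "\<forall>n>M. q n = \<zero>\<^bsub>SymA\<^esub>" using q up_B_iff by blast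
  have "\<forall>n>max N M. p n \<oplus>\<^bsub>SymA\<^esub> q n = \<zero>\<^bsub>SymA\<^esub>" using N M by simp
  then show ?thesis by (rule up_BI[rotated]) (simp add: p q up_B_coeff)
qed

lemma up_B_smult:
  assumes p: "p \<in> up B" shows "(\<lambda>n. c \<odot>\<^bsub>SymA\<^esub> p n) \<in> up B"
proof -
  obtain N where "\<forall>n>N. p n = \<zero>\<^bsub>SymA\<^esub>" using p up_B_iff by blast
  then have "\<forall>n>N. c \<odot>\<^bsub>SymA\<^esub> p n = \<zero>\<^bsub>SymA\<^esub>" by simp
  then show ?thesis by (rule up_BI[rotated]) (simp add: p up_B_coeff)
qed

lemma up_B_Cons:
  assumes b: "b \<in> carrier SymA" and p: "p \<in> up B" shows "(\<lambda>n. case n of 0 \<Rightarrow> b | Suc m \<Rightarrow> p m) \<in> up B"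
proof -
  obtain N where N: "\<forall>n>N. p n = \<zero>\<^bsub>SymA\<^esub>" using p up_B_iff by blast
  have "\<forall>n>Suc N. (case n of 0 \<Rightarrow> b | Suc m \<Rightarrow> p m) = \<zero>\<^bsub>SymA\<^esub>"
    using N by (auto split: nat.split)
  then show ?thesis by (rule up_BI[rotated]) (auto simp: b p up_B_coeff split: nat.split)
qed

lemma up_B_tshift: "p \<in> up B \<Longrightarrow> tshift B p \<in> up B"
  unfolding tshift_def by (simp add: up_B_Cons)

lemma up_B_tl:
  assumes p: "p \<in> up B" shows "(\<lambda>n. p (Suc n)) \<in> up B"
proof -
  obtain N where "\<forall>n>N. p n = \<zero>\<^bsub>SymA\<^esub>" using p up_B_iff by blast
  then have "\<forall>n>N. p (Suc n) = \<zero>\<^bsub>SymA\<^esub>" by simp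
  then show ?thesis by (rule up_BI[rotated]) (simp add: p up_B_coeff)
qed

text \<open>The isomorphism \<open>B[t] \<rightarrow> R\<close> of \<open>k[t]\<close>-modules that extends the lift.\<close>

definition Phi where
  "Phi p = (\<lambda>k. \<Oplus>\<^bsub>HH\<^esub>j\<in>{..k}. \<sigma> (p j) (k - j))"

text \<open>The formula \<open>p = p\<^sub>0 + t p'\<close>, carried over to the Rees algebra; all inductions below use it.\<close>

lemma Phi_rec:
  assumes p: "\<And>n. p n \<in> carrier SymA"
  shows "Phi p = \<sigma> (p 0) \<oplus>\<^bsub>R\<^esub> tshift HH (Phi (\<lambda>n. p (Suc n)))"
proof
  fix k show "Phi p k = (\<sigma> (p 0) \<oplus>\<^bsub>R\<^esub> tshift HH (Phi (\<lambda>n. p (Suc n)))) k"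
  proof (cases k)
    case 0
    then show ?thesis using \<sigma>_coeff[OF p] by (simp add: Phi_def HF.rees_sel(5))
  next
    case (Suc m)
    have "(\<Oplus>\<^bsub>HH\<^esub>j\<in>{..Suc m}. \<sigma> (p j) (Suc m - j)) =
        (\<Oplus>\<^bsub>HH\<^esub>j\<in>{..m}. \<sigma> (p (Suc j)) (m - j)) \<oplus>\<^bsub>HH\<^esub> \<sigma> (p 0) (Suc m)"
      using \<sigma>_coeff[OF p] by (subst H.finsum_Suc2) (auto simp del: H.finsum_Suc)
    then show ?thesis using \<sigma>_coeff[OF p] by (simp add: Suc Phi_def HF.rees_sel(5) H.a_comm del: H.finsum_Suc)
  qed
qed

lemma Phi_zero: "Phi (\<lambda>_. \<zero>\<^bsub>SymA\<^esub>) = \<zero>\<^bsub>R\<^esub>"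
  by (simp add: Phi_def \<sigma>_zero HF.rees_sel H.finsum_zero)

lemma Phi_closed [simp, intro]: "p \<in> up B \<Longrightarrow> Phi p \<in> carrier R"
proof -
  have "Phi p \<in> carrier R" if "\<And>n. p n \<in> carrier SymA" "\<And>n. n \<ge> N \<Longrightarrow> p n = \<zero>\<^bsub>SymA\<^esub>" for p N
    using that
  proof (induction N arbitrary: p)
    case 0
    then have "p = (\<lambda>_. \<zero>\<^bsub>SymA\<^esub>)" by auto
    then show ?case by (simp add: Phi_zero)
  next
    case (Suc N)
    have "Phi (\<lambda>n. p (Suc n)) \<in> carrier R" by (rule Suc.IH) (simp_all add: Suc.prems)
    then show ?case using Suc.prems by (subst Phi_rec) (auto intro: HF.tshift_closed)
  qed
  moreover assume p: "p \<in> up B"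
  moreover obtain N where "\<forall>n>N. p n = \<zero>\<^bsub>SymA\<^esub>" using p up_B_iff by blast
  ultimately show ?thesis using up_B_coeff[OF p] by (metis Suc_le_eq)
qed

lemma Phi_Cons:
  assumes "b \<in> carrier SymA" "p \<in> up B"
  shows "Phi (\<lambda>n. case n of 0 \<Rightarrow> b | Suc m \<Rightarrow> p m) = \<sigma> b \<oplus>\<^bsub>R\<^esub> tshift HH (Phi p)"
  using Phi_rec[of "case_nat b p", OF up_B_coeff[OF up_B_Cons[OF assms]]] by simp

lemma Phi_tshift: "p \<in> up B \<Longrightarrow> Phi (tshift B p) = tshift HH (Phi p)"
  unfolding tshift_def[of B] using Phi_Cons[of "\<zero>\<^bsub>SymA\<^esub>" p] by (simp add: \<sigma>_zero HF.tshift_closed)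

lemma Phi_add:
  assumes "p \<in> up B" "q \<in> up B" shows "Phi (\<lambda>n. p n \<oplus>\<^bsub>SymA\<^esub> q n) = Phi p \<oplus>\<^bsub>R\<^esub> Phi q"
  using \<sigma>_coeff[OF up_B_coeff[OF assms(1)]] \<sigma>_coeff[OF up_B_coeff[OF assms(2)]]
  by (simp add: Phi_def klinear_add[OF klinear_\<sigma>] up_B_coeff assms HF.rees_sel(5) H.finsum_addf)

lemma Phi_smult:
  assumes "p \<in> up B" shows "Phi (\<lambda>n. c \<odot>\<^bsub>SymA\<^esub> p n) = c \<odot>\<^bsub>R\<^esub> Phi p"
  using \<sigma>_coeff[OF up_B_coeff[OF assms]]
  by (simp add: Phi_def klinear_smult[OF klinear_\<sigma>] up_B_coeff assms HF.rees_sel(6) module.finsum_smult_ldistr[OF H.kvs])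

lemma poly_act_up_B: "p \<in> up B \<Longrightarrow> poly_act B f p \<in> up B"
  and Phi_poly_act: "p \<in> up B \<Longrightarrow> Phi (poly_act B f p) = HF.poly_rees f \<otimes>\<^bsub>R\<^esub> Phi p"
proof -
  assume p: "p \<in> up B"
  have c: "p n \<in> carrier B" for n using up_B_coeff[OF p] by simp
  have "poly_act B f p \<in> up B \<and> Phi (poly_act B f p) = HF.poly_rees f \<otimes>\<^bsub>R\<^esub> Phi p"
  proof (induction f)
    case 0
    then show ?case using p by (simp add: B.poly_act_0[OF c] up_B_zero Phi_zero HF.poly_rees_0)
  next
    case (pCons a f)
    have "poly_act B (pCons a f) p = (\<lambda>n. a \<odot>\<^bsub>SymA\<^esub> p n \<oplus>\<^bsub>SymA\<^esub> tshift B (poly_act B f p) n)"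
      by (simp add: B.poly_act_pCons[OF c])
    moreover have "HF.rees_t \<otimes>\<^bsub>R\<^esub> (HF.poly_rees f \<otimes>\<^bsub>R\<^esub> Phi p) = tshift HH (HF.poly_rees f \<otimes>\<^bsub>R\<^esub> Phi p)"
      by (rule HF.rees_t_mult) (simp add: p)
    ultimately show ?case using pCons.IH p
      by (simp add: up_B_add up_B_smult up_B_tshift Phi_add Phi_smult Phi_tshift HF.poly_rees_pCons'
          HF.R.l_distr HF.R.mult_smult_left HF.R.m_assoc)
  qed
  then show "poly_act B f p \<in> up B" "Phi (poly_act B f p) = HF.poly_rees f \<otimes>\<^bsub>R\<^esub> Phi p" by blast+
qed

lemma cls_Phi:
  assumes p: "p \<in> up B" shows "HF.cls (Phi p) = \<nu> (p 0)"
proof -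
  note c = up_B_coeff[OF p] and t = HF.tshift_closed[OF Phi_closed[OF up_B_tl[OF p]]]
  have "HF.cls (Phi p) = HF.cls (\<sigma> (p 0)) \<oplus>\<^bsub>Gr\<^esub> HF.cls (tshift HH (Phi (\<lambda>n. p (Suc n))))"
    by (subst Phi_rec[OF c]) (rule HF.cls_add[OF \<sigma>_closed[OF c] t])
  then show ?thesis
    using c \<nu>_hom(3)[of "p 0"] by (simp add: cls_\<sigma> HF.cls_tshift Phi_closed[OF up_B_tl[OF p]])
qed

text \<open>Modulo \<open>t\<close> the value of \<open>Phi\<close> determines the constant coefficient, and \<open>t\<close> can be cancelled in
  the Rees algebra.\<close>

lemma Phi_inj: "inj_on Phi (up B)"
proof (rule inj_onI, rule ext)
  fix p q j assume "p \<in> up B" "q \<in> up B" "Phi p = Phi q"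
  then show "p j = q j"
  proof (induction j arbitrary: p q)
    case (0 p q)
    then have "\<nu> (p 0) = \<nu> (q 0)" using cls_Phi by metis
    then show ?case using inj_onD[OF inj] up_B_coeff 0 by simp
  next
    case (Suc j p q)
    have 0: "p 0 = q 0"
      using inj_onD[OF inj, of "p 0" "q 0"] cls_Phi[OF Suc.prems(1)] cls_Phi[OF Suc.prems(2)] up_B_coeff Suc.prems
      by simp
    have "\<sigma> (p 0) \<oplus>\<^bsub>R\<^esub> tshift HH (Phi (\<lambda>n. p (Suc n))) = \<sigma> (p 0) \<oplus>\<^bsub>R\<^esub> tshift HH (Phi (\<lambda>n. q (Suc n)))"
      using Phi_rec[of p, OF up_B_coeff[OF Suc.prems(1)]] Phi_rec[of q, OF up_B_coeff[OF Suc.prems(2)]] Suc.prems(3)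
      by (simp only: 0)
    then have e: "tshift HH (Phi (\<lambda>n. p (Suc n))) = tshift HH (Phi (\<lambda>n. q (Suc n)))"
      by (rule HF.R.add.l_cancel)
        (simp_all add: up_B_coeff[OF Suc.prems(1)] HF.tshift_closed Phi_closed up_B_tl Suc.prems(1,2))
    have "Phi (\<lambda>n. p (Suc n)) = Phi (\<lambda>n. q (Suc n))"
    proof
      fix k show "Phi (\<lambda>n. p (Suc n)) k = Phi (\<lambda>n. q (Suc n)) k" using fun_cong[OF e, of "Suc k"] by simp
    qed
    then show ?case using Suc.IH[of "\<lambda>n. p (Suc n)" "\<lambda>n. q (Suc n)"] up_B_tl Suc.prems by simp
  qed
qed

text \<open>Subtracting the lift of its class from an element of the Rees algebra leaves a multiple of \<open>t\<close>.
  The lift does not reach beyond the last coefficient of the element, so the quotient by \<open>t\<close> is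
  shorter.\<close>

lemma Phi_surj: "x \<in> carrier R \<Longrightarrow> x \<in> Phi ` up B"
proof -
  have "\<exists>p \<in> up B. Phi p = x" if "x \<in> carrier R" "\<And>k. k \<ge> N \<Longrightarrow> x k = \<zero>\<^bsub>HH\<^esub>" for x N
    using that
  proof (induction N arbitrary: x)
    case 0
    then have "x = \<zero>\<^bsub>R\<^esub>" by (auto simp: HF.rees_sel)
    then show ?case using up_B_zero Phi_zero by blast
  next
    case (Suc N)
    note x = Suc.prems(1)
    have "HF.cls x \<in> \<nu> ` carrier B" unfolding natural_surj[OF natural] by (rule alg_homD(3)[OF HF.alg_hom_cls x])
    then obtain b where b: "b \<in> carrier SymA" "\<nu> b = HF.cls x" by auto
    define y where "y = x \<ominus>\<^bsub>R\<^esub> \<sigma> b"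
    have y: "y \<in> carrier R" using x b by (simp add: y_def)
    have "HF.cls y = HF.cls x \<ominus>\<^bsub>Gr\<^esub> HF.cls (\<sigma> b)"
      unfolding y_def by (rule klinear_diff[OF HF.R.kvs HF.G.kvs alg_homD(1)[OF HF.alg_hom_cls] x \<sigma>_closed[OF b(1)]])
    also have "\<dots> = \<zero>\<^bsub>Gr\<^esub>"
      using b \<nu>_hom(3)[of b] by (simp add: cls_\<sigma> HF.G.r_neg a_minus_def)
    finally have y0: "HF.cls y = \<zero>\<^bsub>Gr\<^esub>" .
    note y' = HF.cls_eq_zeroD[OF y y0]
    have yz: "y k = \<zero>\<^bsub>HH\<^esub>" if k: "k \<ge> Suc N" for k
    proof -
      have "\<nu> b k = HF.below k +>\<^bsub>HH\<^esub> \<zero>\<^bsub>HH\<^esub>" by (simp add: b(2) HF.cls_def Suc.prems(2)[OF k])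
      from \<nu>_part_eq[OF b(1) HF.Fl_zero this] have "\<nu> (part k b) = \<zero>\<^bsub>Gr\<^esub>"
        by (simp add: HF.gr_in_below H.subspaceD(2)[OF HF.below_subspace])
      then have "part k b = \<zero>\<^bsub>SymA\<^esub>" using \<nu>_eq_zeroD b(1) part_closed by blast
      then have "\<sigma> b k = \<zero>\<^bsub>HH\<^esub>" by (rule \<sigma>_part[OF b(1)])
      moreover have "y \<oplus>\<^bsub>R\<^esub> \<sigma> b = x" unfolding y_def by (rule HF.R.diff_add_cancel[OF x \<sigma>_closed[OF b(1)]])
      then have "x k = y k \<oplus>\<^bsub>HH\<^esub> \<sigma> b k" by (auto simp: HF.rees_sel(5))
      ultimately show ?thesis using HF.rees_coeff[OF y, of k] Suc.prems(2)[OF k] by simp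
    qed
    obtain p where p: "p \<in> up B" "Phi p = (\<lambda>n. y (Suc n))"
      using Suc.IH[OF y'(1)] yz by auto
    have "Phi (\<lambda>n. case n of 0 \<Rightarrow> b | Suc m \<Rightarrow> p m) = \<sigma> b \<oplus>\<^bsub>R\<^esub> y"
      by (simp only: Phi_Cons[OF b(1) p(1)] p(2) y'(2)[symmetric])
    also have "\<dots> = x"
      unfolding y_def using x b by (metis HF.R.a_comm HF.R.diff_add_cancel HF.R.minus_closed \<sigma>_closed)
    finally show ?case using up_B_Cons[OF b(1) p(1)] by blast
  qed
  moreover assume x: "x \<in> carrier R"
  moreover obtain N where "bound \<zero>\<^bsub>HH\<^esub> N x" using HF.rees_bound[OF x] by blast
  then have "x k = \<zero>\<^bsub>HH\<^esub>" if "k \<ge> Suc N" for k using that by (simp add: bound_def)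
  ultimately show ?thesis by blast
qed

definition "Psi = inv_into (up B) Phi"

lemma Psi: "x \<in> carrier R \<Longrightarrow> Psi x \<in> up B" "x \<in> carrier R \<Longrightarrow> Phi (Psi x) = x"
  unfolding Psi_def by (simp_all add: inv_into_into f_inv_into_f Phi_surj)

text \<open>The multiplication of the Rees algebra, transported to \<open>B[t]\<close>.\<close>

definition deformed_product ::
  "('k poly, nat \<Rightarrow> (('v list \<Rightarrow>\<^sub>0 'k) set set \<times> 'a \<Rightarrow>\<^sub>0 'k) set) module" where
  "deformed_product = \<lparr>carrier = up B, monoid.mult = (\<lambda>p q. Psi (Phi p \<otimes>\<^bsub>R\<^esub> Phi q)), one = Psi \<one>\<^bsub>R\<^esub>,
     ring.zero = (\<lambda>_. \<zero>\<^bsub>SymA\<^esub>), ring.add = (\<lambda>p q n. p n \<oplus>\<^bsub>SymA\<^esub> q n), module.smult = poly_act B\<rparr>"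

lemma deformed_product_sel:
  "carrier deformed_product = up B" "p \<otimes>\<^bsub>deformed_product\<^esub> q = Psi (Phi p \<otimes>\<^bsub>R\<^esub> Phi q)"
  "\<one>\<^bsub>deformed_product\<^esub> = Psi \<one>\<^bsub>R\<^esub>" "\<zero>\<^bsub>deformed_product\<^esub> = (\<lambda>_. \<zero>\<^bsub>SymA\<^esub>)"
  "p \<oplus>\<^bsub>deformed_product\<^esub> q = (\<lambda>n. p n \<oplus>\<^bsub>SymA\<^esub> q n)" "f \<odot>\<^bsub>deformed_product\<^esub> p = poly_act B f p"
  by (simp_all add: deformed_product_def)

lemma assoc_deformed_product: "assoc_algebra ring_of_type_algebra deformed_product"
proof (rule HF.R.assoc_algebra_poly_pullback[of Phi _ HF.poly_rees])
  show "x \<otimes>\<^bsub>R\<^esub> HF.poly_rees f = HF.poly_rees f \<otimes>\<^bsub>R\<^esub> x" if "x \<in> carrier R" for f x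
    by (rule HF.poly_rees_central[OF that])
qed (simp_all add: deformed_product_sel Phi_inj Psi up_B_zero up_B_add poly_act_up_B Phi_add Phi_poly_act Phi_zero
    HF.poly_rees_add HF.poly_rees_mult HF.poly_rees_1)

sublocale smash_seq A \<Delta> V act deformed_product
  by unfold_locales
    (simp_all add: assoc_deformed_product deformed_product_sel(1,5,6) poly_act_def)

end

context rees_lift
begin

abbreviation "Bt \<equiv> deformed_product"

lemma Phi_mult: "p \<in> up B \<Longrightarrow> q \<in> up B \<Longrightarrow> Phi (p \<otimes>\<^bsub>Bt\<^esub> q) = Phi p \<otimes>\<^bsub>R\<^esub> Phi q"
  and Phi_one: "Phi \<one>\<^bsub>Bt\<^esub> = \<one>\<^bsub>R\<^esub>"
  by (simp_all add: deformed_product_sel Psi)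

lemma Bt_mult_closed: "p \<in> up B \<Longrightarrow> q \<in> up B \<Longrightarrow> p \<otimes>\<^bsub>Bt\<^esub> q \<in> up B"
  using Bt.m_closed unfolding carrier_Bt .

lemma cs_up: "b \<in> carrier SymA \<Longrightarrow> cs b \<in> up B"
  using cs_closed unfolding carrier_Bt .

lemma Phi_eqD: "p \<in> up B \<Longrightarrow> q \<in> up B \<Longrightarrow> Phi p = Phi q \<Longrightarrow> p = q"
  using inj_onD[OF Phi_inj] .

lemma Phi_cs: 
  assumes b: "b \<in> carrier SymA" shows "Phi (cs b) = \<sigma> b"
proof -
  have "cs b = (\<lambda>n. case n of 0 \<Rightarrow> b | Suc m \<Rightarrow> \<zero>\<^bsub>SymA\<^esub>)"
    by (auto simp: cs_apply fun_eq_iff split: nat.split)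
  then have "Phi (cs b) = \<sigma> b \<oplus>\<^bsub>R\<^esub> tshift HH \<zero>\<^bsub>R\<^esub>" using Phi_Cons[OF b up_B_zero] by (simp add: Phi_zero)
  also have "tshift HH \<zero>\<^bsub>R\<^esub> = \<zero>\<^bsub>R\<^esub>" by (auto simp: tshift_def HF.rees_sel fun_eq_iff split: nat.split)
  finally show ?thesis using b by simp
qed

text \<open>Modulo \<open>t\<close> the product is the one of the associated graded algebra, that is, of \<open>B\<close>.\<close>

lemma mult_Bt_const:
  assumes p: "p \<in> up B" and q: "q \<in> up B" shows "(p \<otimes>\<^bsub>Bt\<^esub> q) 0 = p 0 \<otimes>\<^bsub>B\<^esub> q 0"
proof -
  have c: "p 0 \<in> carrier B" "q 0 \<in> carrier B" using up_B_coeff p q by simp_all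
  have "\<nu> ((p \<otimes>\<^bsub>Bt\<^esub> q) 0) = HF.cls (Phi p \<otimes>\<^bsub>R\<^esub> Phi q)"
    using cls_Phi[OF Bt_mult_closed[OF p q]] by (simp only: Phi_mult[OF p q])
  also have "\<dots> = \<nu> (p 0) \<otimes>\<^bsub>Gr\<^esub> \<nu> (q 0)"
    by (simp only: HF.cls_mult[OF Phi_closed[OF p] Phi_closed[OF q]] cls_Phi[OF p] cls_Phi[OF q])
  also have "\<dots> = \<nu> (p 0 \<otimes>\<^bsub>B\<^esub> q 0)" by (rule \<nu>_hom(6)[OF c, symmetric])
  finally show ?thesis
    by (rule inj_onD[OF inj])
      (use up_B_coeff[OF Bt_mult_closed[OF p q], of 0] c smash_mult_closed in simp_all)
qed

lemma one_Bt_const: "\<one>\<^bsub>Bt\<^esub> 0 = \<one>\<^bsub>B\<^esub>"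
proof -
  have o: "\<one>\<^bsub>Bt\<^esub> \<in> up B" using Bt.one_closed unfolding carrier_Bt .
  have "\<one>\<^bsub>B\<^esub> \<in> carrier SymA" unfolding smash_one by auto
  moreover have "\<nu> (\<one>\<^bsub>Bt\<^esub> 0) = \<nu> \<one>\<^bsub>B\<^esub>"
    using cls_Phi[OF o] by (simp only: Phi_one HF.cls_one \<nu>_hom(7))
  ultimately show ?thesis using inj_onD[OF inj, of "\<one>\<^bsub>Bt\<^esub> 0" "\<one>\<^bsub>B\<^esub>"] up_B_coeff[OF o, of 0] by simp
qed

lemma deformation_Bt: "deformation B Bt"
proof -
  let ?f = "\<lambda>P. the_elem ((\<lambda>p. p 0) ` P)"
  have f: "?f (Bt.sproj 0 p) = p 0" if "p \<in> carrier Bt" for p by (rule constant_coeff[OF that])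
  note pr0 = alg_homD[OF Bt.alg_hom_sproj[of 0]]
  have hom: "?f \<in> alg_hom (specialize Bt 0) B"
  proof (intro alg_homI klinearI)
    fix P Q assume "P \<in> carrier (specialize Bt 0)" "Q \<in> carrier (specialize Bt 0)"
    then obtain p q where pq: "p \<in> carrier Bt" "q \<in> carrier Bt" "P = Bt.sproj 0 p" "Q = Bt.sproj 0 q"
      unfolding Bt.carrier_specialize by blast
    show "?f (P \<oplus>\<^bsub>specialize Bt 0\<^esub> Q) = ?f P \<oplus>\<^bsub>B\<^esub> ?f Q"
      using pq pr0(4)[of p q] f[of "p \<oplus>\<^bsub>Bt\<^esub> q"] fun_cong[OF Bt_add[of p q], of 0] by (simp add: f del: smash_sel(6))
    show "?f (P \<otimes>\<^bsub>specialize Bt 0\<^esub> Q) = ?f P \<otimes>\<^bsub>B\<^esub> ?f Q"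
      using pq pr0(6)[of p q] f[of "p \<otimes>\<^bsub>Bt\<^esub> q"] mult_Bt_const[of p q] by (simp add: f carrier_Bt[symmetric])
  next
    fix c P assume "P \<in> carrier (specialize Bt 0)"
    then obtain p where p: "p \<in> carrier Bt" "P = Bt.sproj 0 p"
      unfolding Bt.carrier_specialize by blast
    show "?f P \<in> carrier B" using p Bt_closed by (simp add: f)
    show "?f (c \<odot>\<^bsub>specialize Bt 0\<^esub> P) = c \<odot>\<^bsub>B\<^esub> ?f P"
      using p pr0(5)[of p c] f[of "[:c:] \<odot>\<^bsub>Bt\<^esub> p"] fun_cong[OF Bt_smult_const[of p c], of 0] by (simp add: f)
  next
    show "?f \<one>\<^bsub>specialize Bt 0\<^esub> = \<one>\<^bsub>B\<^esub>"
      using pr0(7) f[of "\<one>\<^bsub>Bt\<^esub>"] by (simp add: one_Bt_const)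
  qed
  have inj0: "inj_on ?f (carrier (specialize Bt 0))"
  proof (rule inj_onI)
    fix P Q assume "P \<in> carrier (specialize Bt 0)" "Q \<in> carrier (specialize Bt 0)" and e: "?f P = ?f Q"
    then obtain p q where pq: "p \<in> carrier Bt" "q \<in> carrier Bt" "P = Bt.sproj 0 p" "Q = Bt.sproj 0 q"
      unfolding Bt.carrier_specialize by blast
    have "Bt.sproj 0 r = Bt.sproj 0 (cs (r 0))" if r: "r \<in> carrier Bt" for r
    proof -
      let ?r = "\<lambda>n. r (Suc n)"
      note s = Bt_split[OF r]
      have c: "cs (r 0) \<in> carrier Bt" by (rule cs_closed[OF Bt_closed[OF r]])
      have tr: "t \<odot>\<^bsub>Bt\<^esub> ?r \<in> carrier Bt" by (rule Bt.kt_smult_closed[OF s(2)])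
      have "r \<ominus>\<^bsub>Btk\<^esub> cs (r 0) = (t \<odot>\<^bsub>Bt\<^esub> ?r \<oplus>\<^bsub>Btk\<^esub> cs (r 0)) \<ominus>\<^bsub>Btk\<^esub> cs (r 0)"
        using s(1) Bt.a_comm[OF c tr] by simp
      also have "\<dots> = t \<odot>\<^bsub>Bt\<^esub> ?r" by (rule Bt.K.add_diff_cancel) (simp_all add: tr c)
      finally have "r \<ominus>\<^bsub>Btk\<^esub> cs (r 0) \<in> Bt.spec_ideal 0" using s(2) by simp
      then show ?thesis by (simp only: Bt.sproj_eq_iff[OF r c])
    qed
    then show "P = Q" using pq e f by metis
  qed
  have "b \<in> ?f ` carrier (specialize Bt 0)" if "b \<in> carrier B" for b
  proof (rule image_eqI)
    have c: "cs b \<in> carrier Bt" using that by simp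
    show "b = ?f (Bt.sproj 0 (cs b))" by (simp add: f[OF c] cs_apply)
    show "Bt.sproj 0 (cs b) \<in> carrier (specialize Bt 0)" using c unfolding Bt.carrier_specialize by blast
  qed
  then have "?f ` carrier (specialize Bt 0) = carrier B" using alg_homD(3)[OF hom] by blast
  then have "?f \<in> alg_iso (specialize Bt 0) B" using hom inj0 by (simp add: alg_iso_def bij_betw_def)
  then show ?thesis
    using assoc_deformed_product by (simp add: deformation_def deformed_product_sel(1,5,6) poly_act_def)
qed

text \<open>A sequence whose image is homogeneous of degree \<open>N\<close> has its \<open>j\<close>-th coefficient in degree \<open>N -
  j\<close>, because \<open>t\<close> has degree one in the Rees algebra.\<close>

lemma Phi_homog:
  "p \<in> up B \<Longrightarrow> h \<in> HF N \<Longrightarrow> Phi p = HF.homog N h \<Longrightarrow> p j \<in> (if j \<le> N then Bdeg (N - j) else {\<zero>\<^bsub>SymA\<^esub>})"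
proof (induction j arbitrary: p h N)
  case (0 p h N)
  have "\<nu> (p 0) = gin N h" using cls_Phi[OF 0(1)] HF.cls_homog[OF 0(2)] 0(3) by simp
  then show ?case using Bdeg_of_gin[OF up_B_coeff[OF 0(1)] 0(2)] by simp
next
  case (Suc j p h N)
  let ?p = "\<lambda>n. p (Suc n)"
  note p = Suc.prems(1) and p' = up_B_tl[OF Suc.prems(1)] and h = Suc.prems(2)
  note c = up_B_coeff[OF p]
  have "\<nu> (p 0) = gin N h" using cls_Phi[OF p] HF.cls_homog[OF h] Suc.prems(3) by simp
  then obtain g where g: "g \<in> HF N" "\<sigma> (p 0) = HF.homog N g" using \<sigma>_homog Bdeg_of_gin[OF c h] by blast
  have e: "HF.homog N h = HF.homog N g \<oplus>\<^bsub>R\<^esub> tshift HH (Phi ?p)"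
    using Phi_rec[of p, OF c] Suc.prems(3) g(2) by simp
  define d where "d = h \<ominus>\<^bsub>HH\<^esub> g"
  have d: "d \<in> HF N" unfolding d_def using H.subspaceD(5)[OF HF_subspace] h g(1) by blast
  note cH = HF.Fl_carrier[OF h] HF.Fl_carrier[OF g(1)] HF.rees_coeff[OF Phi_closed[OF p']]
  have e': "tshift HH (Phi ?p) = HF.homog N d"
  proof
    fix k
    have ct: "tshift HH (Phi ?p) k \<in> carrier HH" using cH by (cases k) simp_all
    have "HF.homog N h k = HF.homog N g k \<oplus>\<^bsub>HH\<^esub> tshift HH (Phi ?p) k" using fun_cong[OF e, of k] by (simp add: HF.rees_sel(5))
    then show "tshift HH (Phi ?p) k = HF.homog N d k"
      using ct cH H.add_diff_cancel[OF ct cH(2)] H.a_comm[OF cH(2) ct] by (auto simp: HF.homog_def d_def split: if_splits)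
  qed
  show ?case
  proof (cases N)
    case 0
    have "Phi ?p = \<zero>\<^bsub>R\<^esub>"
    proof
      fix k show "Phi ?p k = \<zero>\<^bsub>R\<^esub> k" using fun_cong[OF e', of "Suc k"] 0 by (simp add: HF.homog_def HF.rees_sel(4))
    qed
    then have "?p = (\<lambda>_. \<zero>\<^bsub>SymA\<^esub>)" using Phi_eqD[OF p' up_B_zero] Phi_zero by simp
    then show ?thesis using 0 fun_cong[of ?p _ j] by simp
  next
    case (Suc M)
    have "Phi ?p = HF.homog M d"
    proof
      fix k show "Phi ?p k = HF.homog M d k" using fun_cong[OF e', of "Suc k"] Suc by (simp add: HF.homog_def)
    qed
    moreover have "HF.homog M d \<in> carrier R" using calculation Phi_closed[OF p'] by simp
    then have "d \<in> HF M" using HF.rees_Fl[of "HF.homog M d" M] by (simp add: HF.homog_def)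
    ultimately show ?thesis using Suc.IH[OF p', of d M] Suc by (simp split: if_splits)
  qed
qed

lemma graded_Bt: "graded_deformation B Bdeg Bt"
proof -
  have "mu B Bt j b b' \<in> (if j \<le> m + n then Bdeg (m + n - j) else {\<zero>\<^bsub>B\<^esub>})"
    if b: "b \<in> Bdeg m" "b' \<in> Bdeg n" for j m n b b'
  proof -
    note c = cs_up[OF Bdeg_carrier[OF b(1)]] cs_up[OF Bdeg_carrier[OF b(2)]]
    obtain g where g: "g \<in> HF m" "\<sigma> b = HF.homog m g" using \<sigma>_homog[OF b(1)] by blast
    obtain h where h: "h \<in> HF n" "\<sigma> b' = HF.homog n h" using \<sigma>_homog[OF b(2)] by blast
    have "Phi (cs b \<otimes>\<^bsub>Bt\<^esub> cs b') = HF.homog (m + n) (g \<otimes>\<^bsub>HH\<^esub> h)"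
      by (simp only: Phi_mult[OF c] Phi_cs[OF Bdeg_carrier[OF b(1)]] Phi_cs[OF Bdeg_carrier[OF b(2)]] g(2) h(2)
          HF.homog_mult[OF g(1) h(1)])
    from Phi_homog[OF Bt_mult_closed[OF c] HF_mult[OF g(1) h(1)] this, of j]
    show ?thesis by (simp add: mu_def split: if_splits)
  qed
  then show ?thesis using deformation_Bt by (simp add: graded_deformation_def)
qed

lemma homog_add:
  "x \<in> carrier HH \<Longrightarrow> y \<in> carrier HH \<Longrightarrow> HF.homog n (x \<oplus>\<^bsub>HH\<^esub> y) = HF.homog n x \<oplus>\<^bsub>R\<^esub> HF.homog n y"
  by (simp add: HF.homog_def HF.rees_sel(5) fun_eq_iff)

text \<open>By the normalization of the lift these products carry no power of \<open>t\<close>, so they do not contribute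
  to the condition on \<open>\<lambda>\<close>.\<close>

lemma cs_V_A:
  assumes v: "v \<in> carrier V" and y: "y \<in> carrier A"
  shows "cs (iV v) \<otimes>\<^bsub>Bt\<^esub> cs (iA y) = cs (tn (sym_in V v) y)"
proof (rule Phi_eqD)
  note c = iV_closed[OF v] iA_closed[OF y]
  have d: "tn (sym_in V v) y \<in> carrier SymA" using v y by auto
  show "cs (iV v) \<otimes>\<^bsub>Bt\<^esub> cs (iA y) \<in> up B" by (intro Bt_mult_closed cs_up c)
  show "cs (tn (sym_in V v) y) \<in> up B" by (intro cs_up d)
  have "Phi (cs (iV v) \<otimes>\<^bsub>Bt\<^esub> cs (iA y)) = HF.homog (1 + 0) (hV v \<otimes>\<^bsub>HH\<^esub> hA y)"
    by (simp only: Phi_mult[OF cs_up[OF c(1)] cs_up[OF c(2)]] Phi_cs[OF c(1)] Phi_cs[OF c(2)] \<sigma>_V[OF v] \<sigma>_A[OF y]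
        HF.homog_mult[OF hV_HF[OF v] hA_HF[OF y]])
  then show "Phi (cs (iV v) \<otimes>\<^bsub>Bt\<^esub> cs (iA y)) = Phi (cs (tn (sym_in V v) y))"
    by (simp add: Phi_cs[OF d] \<sigma>_VA[OF v y])
qed

lemma \<sigma>_sweedler:
  assumes a: "a \<in> carrier A" and v: "v \<in> carrier V"
  defines "Z \<equiv> sweedler SymA (\<lambda>x y. tn (sym_in V (act x v)) y) a"
  shows "Z \<in> carrier SymA" "\<sigma> Z = HF.homog 1 (sweedler HH (\<lambda>x y. hV (act x v) \<otimes>\<^bsub>HH\<^esub> hA y) a)"
proof -
  have g: "tn (sym_in V (act x v)) y \<in> Bdeg 1" if "x \<in> carrier A" "y \<in> carrier A" for x y
    using tn_word_Bdeg[of "[act x v]" y] that v by simp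
  have Z: "Z \<in> Bdeg 1" unfolding Z_def
    by (rule AA.tens_ext_subspace[OF SA.kvs_tensor Bdeg_sub g \<Delta>_closed[OF a]])
  show Zc: "Z \<in> carrier SymA" by (rule Bdeg_carrier[OF Z])
  obtain h where h: "\<sigma> Z = HF.homog 1 h" using \<sigma>_homog[OF Z] by blast
  have "klinear R HH (\<lambda>x. x 1)" by (rule klinearI) (simp_all only: HF.rees_coeff HF.rees_sel(5,6))
  from klinear_comp[OF klinear_\<sigma> this] have l: "klinear SymA HH (\<lambda>b. \<sigma> b 1)" .
  have "h = \<sigma> Z 1" by (simp add: h HF.homog_def)
  also have "\<dots> = sweedler HH (\<lambda>x y. \<sigma> (tn (sym_in V (act x v)) y) 1) a"
    unfolding Z_def by (rule AA.klinear_tens_ext_comp[OF SA.kvs_tensor H.kvs l Bdeg_carrier[OF g] \<Delta>_closed[OF a]])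
  also have "\<dots> = sweedler HH (\<lambda>x y. hV (act x v) \<otimes>\<^bsub>HH\<^esub> hA y) a"
    by (rule AA.tens_ext_cong[OF H.kvs _ _ \<Delta>_closed[OF a]])
      (use v in \<open>simp_all add: \<sigma>_VA HF.homog_def act_closed hV_closed hA_closed\<close>)
  finally show "\<sigma> Z = HF.homog 1 (sweedler HH (\<lambda>x y. hV (act x v) \<otimes>\<^bsub>HH\<^esub> hA y) a)" using h by simp
qed

text \<open>In the Rees algebra the term \<open>\<lambda>(a, v)\<close> of the relation for \<open>a v\<close> is \<open>t\<close> times an element of
  degree zero.\<close>

lemma cs_A_V:
  assumes a: "a \<in> carrier A" and v: "v \<in> carrier V"
  shows "cs (iA a) \<otimes>\<^bsub>Bt\<^esub> cs (iV v) =
    (\<lambda>n. case n of 0 \<Rightarrow> sweedler SymA (\<lambda>x y. tn (sym_in V (act x v)) y) a | Suc m \<Rightarrow> cs (iA (lamf a v)) m)"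
    (is "_ = ?rhs")
proof (rule Phi_eqD)
  note c = iA_closed[OF a] iV_closed[OF v] and l = lamf_closed[OF a v]
  note Z = \<sigma>_sweedler[OF a v]
  let ?S = "sweedler HH (\<lambda>x y. hV (act x v) \<otimes>\<^bsub>HH\<^esub> hA y) a"
  have S: "?S \<in> carrier HH"
    by (rule AA.tens_ext_closed[OF H.kvs _ \<Delta>_closed[OF a]]) (use v in \<open>simp add: act_closed hV_closed hA_closed\<close>)
  show "cs (iA a) \<otimes>\<^bsub>Bt\<^esub> cs (iV v) \<in> up B" by (intro Bt_mult_closed cs_up c)
  show "?rhs \<in> up B" by (intro up_B_Cons Z(1) cs_up iA_closed l)
  have "Phi (cs (iA a) \<otimes>\<^bsub>Bt\<^esub> cs (iV v)) = HF.homog (0 + 1) (hA a \<otimes>\<^bsub>HH\<^esub> hV v)"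
    by (simp only: Phi_mult[OF cs_up[OF c(1)] cs_up[OF c(2)]] Phi_cs[OF c(1)] Phi_cs[OF c(2)] \<sigma>_V[OF v] \<sigma>_A[OF a]
        HF.homog_mult[OF hA_HF[OF a] hV_HF[OF v]])
  also have "\<dots> = HF.homog 1 ?S \<oplus>\<^bsub>R\<^esub> HF.homog 1 (hA (lamf a v))"
    by (simp only: hA_hV[OF a v] homog_add[OF S hA_closed[OF l]] add_0)
  also have "\<dots> = Phi ?rhs"
    by (simp only: Phi_Cons[OF Z(1) cs_up[OF iA_closed[OF l]]] Phi_cs[OF iA_closed[OF l]] Z(2) \<sigma>_A[OF l]
        HF.tshift_homog One_nat_def)
  finally show "Phi (cs (iA a) \<otimes>\<^bsub>Bt\<^esub> cs (iV v)) = Phi ?rhs" .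
qed

text \<open>In degree two of the Rees algebra the summand of \<open>\<kappa>(v, w)\<close> in \<open>V\<close> is divisible by \<open>t\<close>, and the
  one in \<open>A\<close> by \<open>t\<^sup>2\<close>.\<close>

lemma cs_V_V:
  assumes v: "v \<in> carrier V" and w: "w \<in> carrier V"
  shows "cs (iV v) \<otimes>\<^bsub>Bt\<^esub> cs (iV w) = (\<lambda>n. (cs (iV w) \<otimes>\<^bsub>Bt\<^esub> cs (iV v)) n \<oplus>\<^bsub>SymA\<^esub>
    (case n of 0 \<Rightarrow> \<zero>\<^bsub>SymA\<^esub> | Suc m \<Rightarrow> case m of 0 \<Rightarrow> iV (kapV v w) | Suc i \<Rightarrow> cs (iA (kapA v w)) i))"
    (is "_ = (\<lambda>n. ?q n \<oplus>\<^bsub>SymA\<^esub> ?r n)")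
proof (rule Phi_eqD)
  note c = iV_closed[OF v] iV_closed[OF w] and k = kap_closed[OF v w]
  note hc = hV_closed[OF v] hV_closed[OF w] hV_closed[OF k(1)] hA_closed[OF k(2)]
  have r: "(\<lambda>m. case m of 0 \<Rightarrow> iV (kapV v w) | Suc i \<Rightarrow> cs (iA (kapA v w)) i) \<in> up B"
    by (intro up_B_Cons cs_up iA_closed iV_closed k)
  show "cs (iV v) \<otimes>\<^bsub>Bt\<^esub> cs (iV w) \<in> up B" by (intro Bt_mult_closed cs_up c)
  have q: "?q \<in> up B" by (intro Bt_mult_closed cs_up c)
  have r': "?r \<in> up B" by (rule up_B_Cons[OF SA.T.zero_closed r])
  show "(\<lambda>n. ?q n \<oplus>\<^bsub>SymA\<^esub> ?r n) \<in> up B" by (rule up_B_add[OF q r'])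
  have hom: "Phi (cs (iV x) \<otimes>\<^bsub>Bt\<^esub> cs (iV y)) = HF.homog (1 + 1) (hV x \<otimes>\<^bsub>HH\<^esub> hV y)"
    if "x \<in> carrier V" "y \<in> carrier V" for x y
    by (simp only: Phi_mult[OF cs_up[OF iV_closed] cs_up[OF iV_closed]] Phi_cs[OF iV_closed] \<sigma>_V that
        HF.homog_mult[OF hV_HF hV_HF])
  have "hV v \<otimes>\<^bsub>HH\<^esub> hV w = ((hV v \<otimes>\<^bsub>HH\<^esub> hV w) \<ominus>\<^bsub>HH\<^esub> (hV w \<otimes>\<^bsub>HH\<^esub> hV v)) \<oplus>\<^bsub>HH\<^esub> (hV w \<otimes>\<^bsub>HH\<^esub> hV v)"
    using hc by (simp add: H.diff_add_cancel)
  also have "\<dots> = (hV w \<otimes>\<^bsub>HH\<^esub> hV v) \<oplus>\<^bsub>HH\<^esub> (hV (kapV v w) \<oplus>\<^bsub>HH\<^esub> hA (kapA v w))"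
    unfolding hV_hV[OF v w] using hc by (simp add: H.a_comm)
  finally have e: "hV v \<otimes>\<^bsub>HH\<^esub> hV w = (hV w \<otimes>\<^bsub>HH\<^esub> hV v) \<oplus>\<^bsub>HH\<^esub> (hV (kapV v w) \<oplus>\<^bsub>HH\<^esub> hA (kapA v w))" .
  have ts: "tshift HH (x \<oplus>\<^bsub>R\<^esub> y) = tshift HH x \<oplus>\<^bsub>R\<^esub> tshift HH y" for x y
    by (auto simp: tshift_def HF.rees_sel(5) fun_eq_iff split: nat.split)
  have "Phi (\<lambda>n. ?q n \<oplus>\<^bsub>SymA\<^esub> ?r n) = Phi ?q \<oplus>\<^bsub>R\<^esub> Phi ?r" by (rule Phi_add[OF q r'])
  also have "Phi ?r = \<zero>\<^bsub>R\<^esub> \<oplus>\<^bsub>R\<^esub> tshift HH (HF.homog 1 (hV (kapV v w)) \<oplus>\<^bsub>R\<^esub> tshift HH (HF.homog 0 (hA (kapA v w))))"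
    by (simp only: Phi_Cons[OF SA.T.zero_closed r] Phi_Cons[OF iV_closed[OF k(1)] cs_up[OF iA_closed[OF k(2)]]]
        \<sigma>_zero Phi_cs[OF iA_closed[OF k(2)]] \<sigma>_V[OF k(1)] \<sigma>_A[OF k(2)])
  also have "\<dots> = HF.homog (1 + 1) (hV (kapV v w) \<oplus>\<^bsub>HH\<^esub> hA (kapA v w))"
    using hc by (simp add: ts HF.tshift_homog homog_add) (auto simp: HF.rees_sel(4,5) HF.homog_def)
  also have "Phi ?q \<oplus>\<^bsub>R\<^esub> HF.homog (1 + 1) (hV (kapV v w) \<oplus>\<^bsub>HH\<^esub> hA (kapA v w)) = HF.homog (1 + 1) (hV v \<otimes>\<^bsub>HH\<^esub> hV w)"
    unfolding hom[OF w v] e using hc by (intro homog_add[symmetric]) auto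
  finally show "Phi (cs (iV v) \<otimes>\<^bsub>Bt\<^esub> cs (iV w)) = Phi (\<lambda>n. ?q n \<oplus>\<^bsub>SymA\<^esub> ?r n)" by (simp only: hom[OF v w])
qed

lemma compatible_Bt: "mu_compatible A \<Delta> V act lam kap Bt"
proof -
  have "iA (lamf a v) = mu B Bt 1 (iA a) (iV v) \<ominus>\<^bsub>B\<^esub> sweedler B (\<lambda>x y. mu B Bt 1 (iV (act x v)) (iA y)) a"
    if a: "a \<in> carrier A" and v: "v \<in> carrier V" for a v
  proof -
    have "sweedler B (\<lambda>x y. mu B Bt 1 (iV (act x v)) (iA y)) a = sweedler B (\<lambda>x y. \<zero>\<^bsub>B\<^esub>) a"
      by (rule AA.tens_ext_cong[OF kvs_smash _ _ \<Delta>_closed[OF a]])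
        (use v in \<open>simp_all add: mu_def cs_V_A act_closed cs_apply\<close>)
    also have "\<dots> = \<zero>\<^bsub>B\<^esub>" unfolding tens_ext_def free_ext_def by (simp add: case_prod_beta B.finsum_zero[unfolded smash_sel])
    finally have "sweedler B (\<lambda>x y. mu B Bt 1 (iV (act x v)) (iA y)) a = \<zero>\<^bsub>SymA\<^esub>" by simp
    moreover have "iA (lamf a v) \<ominus>\<^bsub>B\<^esub> \<zero>\<^bsub>SymA\<^esub> = iA (lamf a v)"
      using SA.T.add_diff_cancel[OF iA_closed[OF lamf_closed[OF a v]] SA.T.zero_closed] iA_closed[OF lamf_closed[OF a v]]
      by (simp add: B_diff)
    moreover have "mu B Bt 1 (iA a) (iV v) = iA (lamf a v)" by (simp add: mu_def cs_A_V[OF a v] cs_apply)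
    ultimately show ?thesis by (simp only:)
  qed
  moreover have "iV (kapV v w) = mu B Bt 1 (iV v) (iV w) \<ominus>\<^bsub>B\<^esub> mu B Bt 1 (iV w) (iV v) \<and>
      iA (kapA v w) = mu B Bt 2 (iV v) (iV w) \<ominus>\<^bsub>B\<^esub> mu B Bt 2 (iV w) (iV v)"
    if v: "v \<in> carrier V" and w: "w \<in> carrier V" for v w
  proof -
    note k = iV_closed[OF kap_closed(1)[OF v w]] iA_closed[OF kap_closed(2)[OF v w]]
    have q: "(cs (iV w) \<otimes>\<^bsub>Bt\<^esub> cs (iV v)) n \<in> carrier SymA" for n
      by (intro up_B_coeff Bt_mult_closed cs_up iV_closed v w)
    have d: "(x \<oplus>\<^bsub>SymA\<^esub> y) \<ominus>\<^bsub>B\<^esub> x = y" if "x \<in> carrier SymA" "y \<in> carrier SymA" for x y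
      using that SA.T.add_diff_cancel[of y x] by (simp add: B_diff SA.T.a_comm)
    show ?thesis using d[OF q[of 1] k(1)] d[OF q[of 2] k(2)]
      by (simp add: mu_def fun_cong[OF cs_V_V[OF v w]] cs_apply numeral_2_eq_2)
  qed
  ultimately show ?thesis by (simp add: mu_compatible_def Let_def)
qed

end

theorem (in pbw_algebra) deformation_exists:
  "\<exists>Bt. graded_deformation B Bdeg Bt \<and> mu_compatible A \<Delta> V act lam kap Bt"
proof -
  from rees_lift_exists have "\<exists>\<sigma>. rees_lift A \<Delta> V act lam kap \<nu> \<sigma>"
    by (elim exE) (rule exI, rule rees_lift.intro[OF pbw_algebra_axioms], rule rees_lift_axioms.intro)
  then obtain \<sigma> where "rees_lift A \<Delta> V act lam kap \<nu> \<sigma>" ..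
  then interpret rees_lift A \<Delta> V act lam kap \<nu> \<sigma> .
  show ?thesis using graded_Bt compatible_Bt by blast
qed

theorem theorem3p1:
  fixes A :: "('k::field, 'a) module"
    and \<Delta> :: "'a \<Rightarrow> ('a \<times> 'a \<Rightarrow>\<^sub>0 'k) set"
    and V :: "('k, 'v) module"
    and act :: "'a \<Rightarrow> 'v \<Rightarrow> 'v"
    and lam :: "('a \<times> 'v \<Rightarrow>\<^sub>0 'k) set \<Rightarrow> 'a"
    and kap :: "('v \<times> 'v \<Rightarrow>\<^sub>0 'k) set \<Rightarrow> 'v \<times> 'a"
  assumes "cocomm_algebra A \<Delta>"
    and "alg_module A V act"
    and "klinear (tensor A V) A lam"
    and "klinear (wedge_space V) (dirsum V A) kap"
  shows "(PBW A \<Delta> V act lam kap \<longrightarrow>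
            (\<exists>Bt. graded_deformation (smash A \<Delta> V act) (smash_deg A \<Delta> V act) Bt \<and>
                  mu_compatible A \<Delta> V act lam kap Bt)) \<and>
         (fin_dim A \<and> fin_dim V \<longrightarrow>
            (\<exists>Bt. graded_deformation (smash A \<Delta> V act) (smash_deg A \<Delta> V act) Bt \<and>
                  mu_compatible A \<Delta> V act lam kap Bt) \<longrightarrow>
            PBW A \<Delta> V act lam kap) \<and>
         (\<forall>Bt. PBW A \<Delta> V act lam kap \<and>
                  graded_deformation (smash A \<Delta> V act) (smash_deg A \<Delta> V act) Bt \<and>
                  mu_compatible A \<Delta> V act lam kap Bt \<longrightarrow>
            alg_iso (Hlk A \<Delta> V act lam kap) (specialize Bt 1) \<noteq> {})"
proof -
  interpret deformed_smash A \<Delta> V act lam kap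
    by (intro deformed_smash.intro deformed_smash_axioms.intro cocommutative_module.intro assms)
  have 1: "\<exists>Bt. graded_deformation B Bdeg Bt \<and> mu_compatible A \<Delta> V act lam kap Bt"
    if PBW: "PBW A \<Delta> V act lam kap"
  proof -
    obtain \<nu> where "natural \<nu>" "inj_on \<nu> (carrier B)"
      using PBW unfolding PBW_def bij_betw_def by blast
    then have "pbw_algebra A \<Delta> V act lam kap \<nu>"
      by (intro pbw_algebra.intro pbw_algebra_axioms.intro deformed_smash_axioms)
    then show ?thesis by (rule pbw_algebra.deformation_exists)
  qed
  have D: "smash_deformation A \<Delta> V act lam kap Bt"
    if "graded_deformation B Bdeg Bt \<and> mu_compatible A \<Delta> V act lam kap Bt" for Bt
    using that by (intro smash_deformation.intro smash_deformation_axioms.intro deformed_smash_axioms) auto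
  have 2: "PBW A \<Delta> V act lam kap"
    if "graded_deformation B Bdeg Bt \<and> mu_compatible A \<Delta> V act lam kap Bt" for Bt
    by (rule smash_deformation.PBW_of_deformation[OF D[OF that]])
  have 3: "alg_iso HH (specialize Bt 1) \<noteq> {}"
    if "graded_deformation B Bdeg Bt \<and> mu_compatible A \<Delta> V act lam kap Bt" for Bt
    using smash_deformation.specialization_iso[OF D[OF that]] by blast
  show ?thesis using 1 2 3 by blast
qed

end
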